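(* Let $e=\sqrt3$ and let $\mathcal{A}(31,3)$ be the arrangement of $31$ lines in $\mathbb{P}^2_{\mathbb{C}}$ with homogeneous coordinates $x,y,z$ given by the zero loci of the following linear forms: the $19$ forms $$z,\quad x,\quad y,\quad ex+y,\quad ex-y,\quad x+ey,\quad x-ey,\quad 2x-ez,\quad 2x+ez,\quad x-ez,\quad x+ez,$$ $$x+ey+ez,\quad x+ey-ez,\quad x-ey+ez,\quad x-ey-ez,$$ $$x+ey+2ez,\quad x+ey-2ez,\quad x-ey+2ez,\quad x-ey-2ez,$$ together with the $12$ forms $$ex+y+z,\quad ex+y-z,\quad ex-y+z,\quad ex-y-z,\quad 2y-z,\quad 2y+z,$$ $$4x+ez,\quad 4x-ez,\quad 2x-2ey+ez,\quad 2x-2ey-ez,\quad 2x+2ey-ez,\quad 2x+2ey+ez.$$ Then $\mathcal{A}(31,3)$ is inductively free, and $(J(\mathcal{A}(31,3)))^{(3)}\not\subseteq (J(\mathcal{A}(31,3)))^2$.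
   Context: A line in $\mathbb{P}^2_{\mathbb{C}}$ is identified with a plane through the origin in $\mathbb{C}^3$, so line arrangements are regarded as arrangements of hyperplanes in $\mathbb{C}^3$. Put $S=\mathbb{C}[x,y,z]$. **Free arrangements.** Let $V$ be a vector space of dimension $\ell$ over a field $\mathbb{K}$ of characteristic zero (here $\mathbb{K}=\mathbb{C}$), with coordinate ring $R=\mathbb{K}[x_1,\dots,x_\ell]$. Let $\mathcal{B}$ be a finite set of hyperplanes through the origin in $V$, and let $Q(\mathcal{B})=\prod_{H\in\mathcal{B}}l_H$, where $l_H$ is a linear form with kernel $H$; the empty product is $1$. Let $D(\mathcal{B})$ be the $R$-module of $\mathbb{K}$-derivations $\theta:R\to R$ with $\theta(Q(\mathcal{B}))\in Q(\mathcal{B})R$. The arrangement $\mathcal{B}$ is free if $D(\mathcal{B})$ is a free $R$-module. In that case $\exp(\mathcal{B})$ is the multiset of polynomial degrees of the elements of a homogeneous basis of $D(\mathcal{B})$, where $\theta=\sum g_i\,\partial/\partial x_i$ with all $g_i$ homogeneous of degree $d$ has polynomial degree $d$. **Inductively free arrangements.** For $H\in\mathcal{B}$ put $\mathcal{B}'=\mathcal{B}\setminus\{H\}$ and $\mathcal{B}''=\{H\cap K : K\in\mathcal{B}'\}$, where $\mathcal{B}''$ is regarded as an arrangement of hyperplanes in the vector space $H$. The class of inductively free arrangements is the smallest class such that: (1) the empty arrangement in an $\ell$-dimensional space belongs to it for every $\ell\ge 0$; (2) if there is $H\in\mathcal{B}$ such that $\mathcal{B}'$ and $\mathcal{B}''$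 belong to it and $\exp(\mathcal{B}'')\subset\exp(\mathcal{B}')$ as multisets, then $\mathcal{B}$ belongs to it. Every arrangement in this class is free, so the exponents are defined. **Ideals and symbolic powers.** $J(\mathcal{A})\subset S$ is the homogeneous radical ideal generated by all homogeneous polynomials vanishing at every point of $\mathbb{P}^2_{\mathbb{C}}$ that lies on at least two lines of $\mathcal{A}$. For a homogeneous ideal $I\subseteq S$ and an integer $m\ge1$, the $m$-th symbolic power is $I^{(m)}=S\cap\bigcap_{Q\in\mathrm{Ass}(I)}I_Q^m$, where $\mathrm{Ass}(I)$ is the set of primes associated with $I$ and $I_Q$ is the localization of $I$ at $Q$. For the radical ideal of a finite set of points this is the intersection of the $m$-th powers of the ideals of the points. $I^r$ denotes the ordinary power. *)

theory Defs
  imports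
    "HOL-Analysis.Analysis"
    "HOL-Library.Multiset"
    "HOL-Library.Poly_Mapping"
    "HOL-Computational_Algebra.Fraction_Field"
    "HOL-Algebra.Ideal_Product"
    "HOL-Algebra.Algebraic_Closure_Type"
begin

section \<open>Polynomials\<close>

text \<open>A polynomial maps each exponent vector to its coefficient; the type carries the
  convolution product.  Variables are indexed by \<^typ>\<open>'x\<close>.\<close>

type_synonym ('x, 'a) mpoly = "('x \<Rightarrow>\<^sub>0 nat) \<Rightarrow>\<^sub>0 'a"

definition mvar :: "'x \<Rightarrow> ('x, 'a::zero_neq_one) mpoly" where
  "mvar i = Poly_Mapping.single (Poly_Mapping.single i 1) 1"

definition mconst :: "'a::zero \<Rightarrow> ('x, 'a) mpoly" where
  "mconst c = Poly_Mapping.single 0 c"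

definition meval :: "('x, 'a::comm_ring_1) mpoly \<Rightarrow> ('x \<Rightarrow> 'a) \<Rightarrow> 'a" where
  "meval p v = (\<Sum>m\<in>Poly_Mapping.keys p. Poly_Mapping.lookup p m *
      (\<Prod>i\<in>Poly_Mapping.keys m. v i ^ Poly_Mapping.lookup m i))"

definition homogeneous :: "nat \<Rightarrow> ('x, 'a::zero) mpoly \<Rightarrow> bool" where
  "homogeneous d p \<longleftrightarrow>
     (\<forall>m\<in>Poly_Mapping.keys p. (\<Sum>i\<in>Poly_Mapping.keys m. Poly_Mapping.lookup m i) = d)"

text \<open>The polynomials in the variables with index below \<open>n\<close>.\<close>

definition poly_ring :: "nat \<Rightarrow> (nat, 'a::zero) mpoly set" where
  "poly_ring n = {p. \<forall>m\<in>Poly_Mapping.keys p. Poly_Mapping.keys m \<subseteq> {..<n}}"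


section \<open>Arrangements and their derivations\<close>

text \<open>The ambient vector space \<open>V\<close> is a linear subspace of some \<open>K\<^sup>n\<close>, so that
  restrictions of arrangements are again arrangements in such a space.\<close>

definition arrangement :: "('a::field_char_0 ^ 'n) set \<Rightarrow> ('a ^ 'n) set set \<Rightarrow> bool" where
  "arrangement V B \<longleftrightarrow> vec.subspace V \<and> finite B \<and>
     (\<forall>H\<in>B. vec.subspace H \<and> H \<subseteq> V \<and> vec.dim V = vec.dim H + 1)"

text \<open>A choice of linear coordinates on \<open>V\<close>, given by a basis.\<close>

definition coordinates :: "('a::field_char_0 ^ 'n) set \<Rightarrow> (nat \<Rightarrow> 'a ^ 'n) \<Rightarrow> bool" where
  "coordinates V b \<longleftrightarrow> inj_on b {..<vec.dim V} \<and> vec.independent (b ` {..<vec.dim V}) \<and>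
     vec.span (b ` {..<vec.dim V}) = V"

text \<open>\<open>l\<close> is a linear form in the coordinates of \<open>V\<close> whose kernel is \<open>H\<close>.\<close>

definition defining_form ::
  "('a::field_char_0 ^ 'n) set \<Rightarrow> (nat \<Rightarrow> 'a ^ 'n) \<Rightarrow> ('a ^ 'n) set \<Rightarrow> (nat, 'a) mpoly \<Rightarrow> bool" where
  "defining_form V b H l \<longleftrightarrow>
     (\<exists>c. l = (\<Sum>i<vec.dim V. mconst (c i) * mvar i) \<and>
          H = {\<Sum>i<vec.dim V. u i *s b i | u. (\<Sum>i<vec.dim V. c i * u i) = 0})"

text \<open>Derivations of \<open>K[x\<^sub>0,\<dots>,x\<^bsub>n-1\<^esub>]\<close>; only the values of \<open>\<theta>\<close> on
  \<^term>\<open>poly_ring n\<close> matter.\<close>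

definition derivation ::
  "nat \<Rightarrow> ((nat, 'a::field_char_0) mpoly \<Rightarrow> (nat, 'a) mpoly) \<Rightarrow> bool" where
  "derivation n \<theta> \<longleftrightarrow>
     (\<forall>f\<in>poly_ring n. \<theta> f \<in> poly_ring n) \<and>
     (\<forall>f\<in>poly_ring n. \<forall>g\<in>poly_ring n. \<theta> (f + g) = \<theta> f + \<theta> g) \<and>
     (\<forall>c. \<forall>f\<in>poly_ring n. \<theta> (mconst c * f) = mconst c * \<theta> f) \<and>
     (\<forall>f\<in>poly_ring n. \<forall>g\<in>poly_ring n. \<theta> (f * g) = f * \<theta> g + g * \<theta> f)"

definition log_derivations ::
  "nat \<Rightarrow> (nat, 'a::field_char_0) mpoly \<Rightarrow> ((nat, 'a) mpoly \<Rightarrow> (nat, 'a) mpoly) set" where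
  "log_derivations n Q = {\<theta>. derivation n \<theta> \<and> (\<exists>r\<in>poly_ring n. \<theta> Q = Q * r)}"

text \<open>The coefficient \<open>g\<^sub>i\<close> in \<open>\<theta> = \<Sum> g\<^sub>i \<partial>/\<partial>x\<^sub>i\<close> is \<open>\<theta> x\<^sub>i\<close>.\<close>

definition has_pdegree ::
  "nat \<Rightarrow> ((nat, 'a::field_char_0) mpoly \<Rightarrow> (nat, 'a) mpoly) \<Rightarrow> nat \<Rightarrow> bool" where
  "has_pdegree n \<theta> d \<longleftrightarrow> (\<forall>i<n. homogeneous d (\<theta> (mvar i)))"

definition module_basis ::
  "nat \<Rightarrow> ((nat, 'a::field_char_0) mpoly \<Rightarrow> (nat, 'a) mpoly) set
   \<Rightarrow> ((nat, 'a) mpoly \<Rightarrow> (nat, 'a) mpoly) list \<Rightarrow> bool" where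
  "module_basis n D \<theta>s \<longleftrightarrow>
     set \<theta>s \<subseteq> D \<and>
     (\<forall>\<theta>\<in>D. \<exists>p. (\<forall>j<length \<theta>s. p j \<in> poly_ring n) \<and>
        (\<forall>f\<in>poly_ring n. \<theta> f = (\<Sum>j<length \<theta>s. p j * (\<theta>s ! j) f))) \<and>
     (\<forall>p. (\<forall>j<length \<theta>s. p j \<in> poly_ring n) \<and>
        (\<forall>f\<in>poly_ring n. (\<Sum>j<length \<theta>s. p j * (\<theta>s ! j) f) = 0)
        \<longrightarrow> (\<forall>j<length \<theta>s. p j = 0))"

text \<open>\<open>has_exponents V B M\<close>: the arrangement \<open>B\<close> in \<open>V\<close> is free and \<open>exp(B) = M\<close>.
  Neither the coordinates, nor the scaling of the defining forms, nor the choice of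
  homogeneous basis affects \<open>M\<close>.\<close>

definition has_exponents ::
  "('a::field_char_0 ^ 'n) set \<Rightarrow> ('a ^ 'n) set set \<Rightarrow> nat multiset \<Rightarrow> bool" where
  "has_exponents V B M \<longleftrightarrow>
     (\<exists>b l \<theta>s ds. coordinates V b \<and> (\<forall>H\<in>B. defining_form V b H (l H)) \<and>
        module_basis (vec.dim V) (log_derivations (vec.dim V) (\<Prod>H\<in>B. l H)) \<theta>s \<and>
        length ds = length \<theta>s \<and>
        (\<forall>j<length \<theta>s. has_pdegree (vec.dim V) (\<theta>s ! j) (ds ! j)) \<and>
        M = mset ds)"

inductive inductively_free ::
  "('a::field_char_0 ^ 'n) set \<Rightarrow> ('a ^ 'n) set set \<Rightarrow> bool" where
  empty: "vec.subspace V \<Longrightarrow> inductively_free V {}"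
| add_hyperplane:
    "\<lbrakk> arrangement V B; H \<in> B; B' = B - {H}; B'' = (\<lambda>K. H \<inter> K) ` B';
       inductively_free V B'; inductively_free H B'';
       has_exponents V B' M'; has_exponents H B'' M''; M'' \<subseteq># M' \<rbrakk>
     \<Longrightarrow> inductively_free V B"


section \<open>Symbolic powers\<close>

definition ideal_power :: "('r, 'b) ring_scheme \<Rightarrow> 'r set \<Rightarrow> nat \<Rightarrow> 'r set" where
  "ideal_power R I m = I [^]\<^bsub>ideals_set R\<^esub> m"

definition associated_primes :: "'r::idom set \<Rightarrow> 'r set set" where
  "associated_primes I =
     {Q. primeideal Q ring_of_type_algebra \<and> (\<exists>s. Q = {r. r * s \<in> I})}"

text \<open>For a prime \<open>Q\<close> and an ideal \<open>I\<close> of the domain \<open>'r\<close>, the localization \<open>I\<^sub>Q\<close> inside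
  the field of fractions.\<close>

definition localize :: "'r::idom set \<Rightarrow> 'r set \<Rightarrow> 'r fract set" where
  "localize Q I = {Fract a s | a s. a \<in> I \<and> s \<notin> Q}"

definition localization_ring :: "'r::idom set \<Rightarrow> 'r fract ring" where
  "localization_ring Q = ring_of_type_algebra\<lparr>carrier := localize Q UNIV\<rparr>"

definition symbolic_power :: "'r::idom set \<Rightarrow> nat \<Rightarrow> 'r set" where
  "symbolic_power I m =
     {f. \<forall>Q\<in>associated_primes I. Fract f 1 \<in> ideal_power (localization_ring Q) (localize Q I) m}"


section \<open>Line arrangements in the projective plane\<close>

text \<open>Lines are planes through the origin of \<open>\<complex>\<^sup>3\<close>, and points of the projective plane are
  represented by nonzero vectors.\<close>

definition J :: "(complex ^ 3) set set \<Rightarrow> (3, complex) mpoly set" where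
  "J A = genideal ring_of_type_algebra
     {p. (\<exists>d. homogeneous d p) \<and>
         (\<forall>v. v \<noteq> 0 \<and> (\<exists>H\<in>A. \<exists>K\<in>A. H \<noteq> K \<and> v \<in> H \<and> v \<in> K) \<longrightarrow> meval p (\<lambda>i. v $ i) = 0)}"

definition forms_31_3 :: "complex \<Rightarrow> complex \<Rightarrow> complex \<Rightarrow> complex list" where
  "forms_31_3 x y z = (let e = complex_of_real (sqrt 3) in
     [z, x, y, e*x + y, e*x - y, x + e*y, x - e*y, 2*x - e*z, 2*x + e*z, x - e*z, x + e*z,
      x + e*y + e*z, x + e*y - e*z, x - e*y + e*z, x - e*y - e*z,
      x + e*y + 2*e*z, x + e*y - 2*e*z, x - e*y + 2*e*z, x - e*y - 2*e*z,
      e*x + y + z, e*x + y - z, e*x - y + z, e*x - y - z, 2*y - z, 2*y + z,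
      4*x + e*z, 4*x - e*z,
      2*x - 2*e*y + e*z, 2*x - 2*e*y - e*z, 2*x + 2*e*y - e*z, 2*x + 2*e*y + e*z])"

definition A_31_3 :: "(complex ^ 3) set set" where
  "A_31_3 = {{v. forms_31_3 (v $ 1) (v $ 2) (v $ 3) ! i = 0} | i. i < 31}"

end

theory Submission
  imports Defs
begin

text \<open>Inductive freeness. The lines are added one at a time to the single line \<open>z = 0\<close>. After the
  substitution \<open>x = \<surd>3 X\<close> every line has an equation with integer coefficients, so the number of
  points in which a new line meets the previous ones is found by integer arithmetic. At each step
  the module of logarithmic vector fields has a basis consisting of the Euler field and of two
  homogeneous fields of degrees \<open>a\<close> and \<open>b\<close>, and the new line meets the previous ones in \<open>a + 1\<close> or
  \<open>b + 1\<close> points. The addition theorem (\<open>addition\<close>) then produces a basis of the same kind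
  with \<open>b\<close>, or \<open>a\<close>, raised by one. The restriction to the new line is an arrangement of \<open>a + 1\<close>
  or \<open>b + 1\<close> lines through the origin of a plane; its exponents are \<open>{1, a}\<close> or \<open>{1, b}\<close>, and it is
  inductively free.

  The containment. Write \<open>J\<close> for the ideal of the 127 intersection points. Let \<open>F\<close> be the product of
  21 of the lines and of a form \<open>C\<close> of degree 12. At every intersection point \<open>F\<close> vanishes to order
  three: at least three of the 21 lines pass through it, or two of them and the curve \<open>C\<close>, or
  one of them, and \<open>C\<close> is singular there. Hence \<open>F\<close> lies in the third symbolic power of \<open>J\<close>
  (\<open>F33_in_cube\<close>, \<open>F33_in_symbolic_power\<close>).

  That \<open>F\<close>, of degree 33, is not in \<open>J\<^sup>2\<close> is detected by a linear functional on forms of degree 33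
  that vanishes on \<open>J\<^sup>2\<close> and not on \<open>F\<close>. If \<open>f\<close> and \<open>g\<close> are forms in \<open>J\<close> with degrees adding up to 33,
  then one of them, say \<open>f\<close>, has degree at most 16. In these degrees \<open>J\<close> is known completely: it
  contains no form of degree at most 13, and in degrees 14, 15 and 16 it is spanned by the
  multiples of three explicit forms of degree 14 and four of degree 15. The upper bounds for
  the dimensions come from removing lines: a form of degree \<open>d\<close> that vanishes at more than \<open>d\<close> points of a
  line is divisible by the equation of that line (\<open>peel_zero\<close>, \<open>span_by_dimension\<close>). So the functional has
  to be tested on products \<open>G h\<close> only, with \<open>G\<close> one of the seven generators and \<open>h\<close> in \<open>J\<close>. For
  \<open>G\<close> of degree 14 it vanishes for every form \<open>h\<close> of degree 19. For \<open>G\<close> of degree 15 it equals, as a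
  functional of \<open>h\<close>, a weighted sum of the values of \<open>h\<close> at the intersection points, so it vanishes
  for \<open>h\<close> in \<open>J\<close> (\<open>Lam33_product\<close>).

  The points, the lines and the set of generators are invariant under the sign changes of the
  coordinates, each generator being an eigenvector. The functional is supported on the monomials
  \<open>X\<^sup>a Y\<^sup>b Z\<^sup>c\<close> with \<open>a\<close> and \<open>c\<close> even and \<open>b\<close> odd, which is the parity of \<open>F\<close>; forms are accordingly stored
  as triangular tables of the coefficients of one parity class.\<close>

section \<open>Evaluation of polynomials\<close>

abbreviation lk where "lk \<equiv> Poly_Mapping.lookup"
abbreviation mkeys where "mkeys \<equiv> Poly_Mapping.keys"

text \<open>The monomial \<open>m\<close> evaluated at \<open>v\<close>.\<close>

definition mono_eval :: "('x \<Rightarrow>\<^sub>0 nat) \<Rightarrow> ('x \<Rightarrow> 'a::comm_ring_1) \<Rightarrow> 'a" where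
  "mono_eval m v = (\<Prod>i\<in>mkeys m. v i ^ lk m i)"

lemma meval_alt: "meval p v = (\<Sum>m\<in>mkeys p. lk p m * mono_eval m v)"
  by (simp add: meval_def mono_eval_def)

lemma mono_eval_superset:
  assumes "finite I" "mkeys m \<subseteq> I"
  shows "mono_eval m v = (\<Prod>i\<in>I. v i ^ lk m i)"
  unfolding mono_eval_def
  by (rule prod.mono_neutral_left) (use assms in \<open>auto simp: in_keys_iff\<close>)

lemma mono_eval_add: "mono_eval (m + n) v = mono_eval m v * mono_eval n v"
proof -
  let ?I = "mkeys m \<union> mkeys n"
  have "mkeys (m + n) \<subseteq> ?I" by (rule keys_add)
  thus ?thesis
    by (simp add: mono_eval_superset[of ?I] lookup_add power_add prod.distrib)
qed

lemma mono_eval_zero [simp]: "mono_eval 0 v = 1"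
  by (simp add: mono_eval_def)

lemma mono_eval_single [simp]: "mono_eval (Poly_Mapping.single i k) v = v i ^ k"
  by (cases "k = 0") (simp_all add: mono_eval_def lookup_single)

lemma meval_superset:
  assumes "finite K" "mkeys p \<subseteq> K"
  shows "meval p v = (\<Sum>m\<in>K. lk p m * mono_eval m v)"
  unfolding meval_alt
  by (rule sum.mono_neutral_left) (use assms in \<open>auto simp: in_keys_iff\<close>)

lemma meval_zero [simp]: "meval 0 v = 0"
  by (simp add: meval_def)

lemma meval_add: "meval (p + q) v = meval p v + meval q v"
proof -
  let ?K = "mkeys p \<union> mkeys q"
  have "mkeys (p + q) \<subseteq> ?K" by (rule keys_add)
  thus ?thesis
    by (simp add: meval_superset[of ?K] lookup_add ring_distribs sum.distrib)
qed

lemma meval_single [simp]: "meval (Poly_Mapping.single m c) v = c * mono_eval m v"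
  by (cases "c = 0") (simp_all add: meval_alt)

lemma meval_sum: "meval (sum f T) v = (\<Sum>x\<in>T. meval (f x) v)"
  by (induction T rule: infinite_finite_induct) (simp_all add: meval_add)

lemma mpoly_expand:
  fixes p :: "('x, 'a::comm_monoid_add) mpoly"
  shows "p = (\<Sum>m\<in>mkeys p. Poly_Mapping.single m (lk p m))"
proof (rule poly_mapping_eqI)
  fix k
  have "lk (\<Sum>m\<in>mkeys p. Poly_Mapping.single m (lk p m)) k = (\<Sum>m\<in>mkeys p. lk p m when m = k)"
    by (simp add: lookup_sum lookup_single)
  also have "\<dots> = lk p k"
    by (cases "k \<in> mkeys p") (auto simp: when_def in_keys_iff sum.delta)
  finally show "lk p k = lk (\<Sum>m\<in>mkeys p. Poly_Mapping.single m (lk p m)) k" ..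
qed

lemma mpoly_induct [case_names single add]:
  fixes p :: "('x, 'a::comm_monoid_add) mpoly"
  assumes "\<And>m c. P (Poly_Mapping.single m c)" "\<And>p q. P p \<Longrightarrow> P q \<Longrightarrow> P (p + q)"
  shows "P p"
proof -
  have "P (\<Sum>m\<in>T. Poly_Mapping.single m (lk p m))" if "finite T" for T
    using that
  proof induction
    case empty
    show ?case using assms(1)[of 0 0] by simp
  next
    case (insert x F)
    thus ?case using assms by simp
  qed
  from this[of "mkeys p"] show ?thesis by (subst mpoly_expand) simp
qed

lemma meval_mult: "meval (p * q) v = meval p v * meval q v"
proof (induction p rule: mpoly_induct)
  case (single m c)
  show ?case
    by (induction q rule: mpoly_induct)
      (simp_all add: mult_single mono_eval_add algebra_simps meval_add)
qed (simp add: ring_distribs meval_add)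

lemma meval_const [simp]: "meval (mconst c) v = c"
  by (simp add: mconst_def)

lemma meval_var [simp]: "meval (mvar i) v = v i"
  by (simp add: mvar_def)

lemma meval_one [simp]: "meval 1 v = 1"
  by (metis meval_single mono_eval_zero mult_1 single_one)

lemma meval_uminus: "meval (- p) v = - meval p v"
  using meval_add[of p "-p" v] by (simp add: eq_neg_iff_add_eq_0 add.commute)

lemma meval_diff: "meval (p - q) v = meval p v - meval q v"
  using meval_add[of p "-q" v] by (simp add: meval_uminus)

lemma meval_prod: "meval (prod f T) v = (\<Prod>x\<in>T. meval (f x) v)"
  by (induction T rule: infinite_finite_induct) (simp_all add: meval_mult)

lemma meval_power: "meval (p ^ k) v = meval p v ^ k"
  by (induction k) (simp_all add: meval_mult)

lemmas meval_simps = meval_add meval_diff meval_uminus meval_mult meval_sum meval_prod meval_power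

section \<open>Polynomials are determined by their values\<close>

definition polys_in :: "'x set \<Rightarrow> ('x, 'a::zero) mpoly set" where
  "polys_in I = {p. \<forall>m\<in>mkeys p. mkeys m \<subseteq> I}"

lemma poly_ring_eq: "poly_ring n = polys_in {..<n}"
  by (simp add: poly_ring_def polys_in_def)

lemma polys_in_zero [simp, intro]: "0 \<in> polys_in I"
  by (simp add: polys_in_def)

lemma polys_in_add [intro]: "p \<in> polys_in I \<Longrightarrow> q \<in> polys_in I \<Longrightarrow> p + q \<in> polys_in I"
  using keys_add[of p q] by (auto simp: polys_in_def)

lemma polys_in_single [intro]: "mkeys m \<subseteq> I \<Longrightarrow> Poly_Mapping.single m c \<in> polys_in I"
  by (auto simp: polys_in_def)

lemma polys_in_const [intro, simp]: "mconst c \<in> polys_in I"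
  by (auto simp: mconst_def)

lemma polys_in_one [intro, simp]: "1 \<in> polys_in I"
  by (auto simp: polys_in_def)

lemma polys_in_var [intro]: "i \<in> I \<Longrightarrow> mvar i \<in> polys_in I"
  by (auto simp: mvar_def)

lemma polys_in_sum [intro]: "(\<And>x. x \<in> T \<Longrightarrow> f x \<in> polys_in I) \<Longrightarrow> sum f T \<in> polys_in I"
  by (induction T rule: infinite_finite_induct) auto

lemma polys_in_mult [intro]:
  assumes "p \<in> polys_in I" "q \<in> polys_in I"
  shows "p * q \<in> polys_in I"
proof -
  have "mkeys m \<subseteq> I" if "m \<in> mkeys (p * q)" for m
  proof -
    from that keys_mult[of p q] obtain a b where ab: "m = a + b" "a \<in> mkeys p" "b \<in> mkeys q"
      by blast
    have "mkeys m \<subseteq> mkeys a \<union> mkeys b"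
      unfolding ab(1) by (rule keys_add)
    thus ?thesis using ab assms by (auto simp: polys_in_def)
  qed
  thus ?thesis by (auto simp: polys_in_def)
qed

lemma polys_in_uminus [intro]: "(p :: ('x, 'a::comm_ring_1) mpoly) \<in> polys_in I \<Longrightarrow> - p \<in> polys_in I"
  by (auto simp: polys_in_def in_keys_iff)

lemma polys_in_diff [intro]:
  "(p :: ('x, 'a::comm_ring_1) mpoly) \<in> polys_in I \<Longrightarrow> q \<in> polys_in I \<Longrightarrow> p - q \<in> polys_in I"
  using polys_in_add[of p I "- q"] by auto

lemma polys_in_prod [intro]: "(\<And>x. x \<in> T \<Longrightarrow> f x \<in> polys_in I) \<Longrightarrow> prod f T \<in> polys_in I"
  by (induction T rule: infinite_finite_induct) auto

lemma polys_in_power [intro]: "p \<in> polys_in I \<Longrightarrow> p ^ k \<in> polys_in I"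
  by (induction k) auto

lemma meval_cong:
  assumes "p \<in> polys_in I" "\<And>i. i \<in> I \<Longrightarrow> v i = w i"
  shows "meval p v = meval p w"
  unfolding meval_alt mono_eval_def
  by (intro sum.cong prod.cong arg_cong2[where f="(*)"] refl)
     (use assms in \<open>auto simp: polys_in_def subset_iff\<close>)

text \<open>A weight under which finitely many monomials have different weighted degrees. Substituting
  powers of one variable then sends a nonzero polynomial to a nonzero univariate one.\<close>

lemma separating_weight:
  fixes K :: "('x \<Rightarrow>\<^sub>0 nat) set"
  assumes "finite K"
  obtains w :: "'x \<Rightarrow> nat" where "inj_on (\<lambda>m. \<Sum>i\<in>mkeys m. w i * lk m i) K"
proof -
  define I where "I = (\<Union>m\<in>K. mkeys m)"
  have finI: "finite I" using assms by (auto simp: I_def)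
  obtain idx :: "'x \<Rightarrow> nat" where idx: "inj_on idx I"
    using finI finite_imp_inj_to_nat_seg by metis
  define d :: "('x \<Rightarrow>\<^sub>0 nat) \<Rightarrow> ('x \<Rightarrow>\<^sub>0 nat) \<Rightarrow> real poly"
    where "d m m' = (\<Sum>i\<in>I. Polynomial.monom (real (lk m i) - real (lk m' i)) (idx i))" for m m'
  have nz: "d m m' \<noteq> 0" if mm: "m \<in> K" "m' \<in> K" "m \<noteq> m'" for m m'
  proof -
    obtain j where j: "lk m j \<noteq> lk m' j" using mm(3) by (metis poly_mapping_eqI)
    hence "j \<in> mkeys m \<or> j \<in> mkeys m'" by (metis in_keys_iff)
    hence "j \<in> I" using mm by (auto simp: I_def)
    have "poly.coeff (d m m') (idx j) = (\<Sum>i\<in>I. if idx i = idx j then real (lk m i) - real (lk m' i) else 0)"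
      by (simp add: d_def coeff_sum)
    also have "\<dots> = (\<Sum>i\<in>I. if i = j then real (lk m i) - real (lk m' i) else 0)"
      using idx \<open>j \<in> I\<close> by (intro sum.cong) (auto dest: inj_onD)
    also have "\<dots> = real (lk m j) - real (lk m' j)" using \<open>j \<in> I\<close> finI by simp
    finally show ?thesis using j by auto
  qed
  define B where "B = (\<Union>m\<in>K. \<Union>m'\<in>K-{m}. {x. poly (d m m') x = 0})"
  have "finite B"
    unfolding B_def using assms nz by (intro finite_UN_I finite_Diff poly_roots_finite) auto
  hence "infinite (range real - B)"
    by (intro Diff_infinite_finite) (auto simp: infinite_UNIV_nat finite_image_iff)
  then obtain D :: nat where D: "real D \<notin> B"
    by (metis DiffD2 Diff_eq_empty_iff finite.emptyI image_subset_iff)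
  have "inj_on (\<lambda>m. \<Sum>i\<in>mkeys m. D ^ idx i * lk m i) K"
  proof (rule inj_onI, rule ccontr)
    fix m m' assume H: "m \<in> K" "m' \<in> K" "(\<Sum>i\<in>mkeys m. D ^ idx i * lk m i) = (\<Sum>i\<in>mkeys m'. D ^ idx i * lk m' i)" "m \<noteq> m'"
    have sup: "(\<Sum>i\<in>mkeys m. D ^ idx i * lk m i) = (\<Sum>i\<in>I. D ^ idx i * lk m i)" if "m \<in> K" for m
      using that finI by (intro sum.mono_neutral_left) (auto simp: I_def in_keys_iff)
    have "poly (d m m') (real D) = real (\<Sum>i\<in>I. D ^ idx i * lk m i) - real (\<Sum>i\<in>I. D ^ idx i * lk m' i)"
      by (simp add: d_def poly_sum poly_monom algebra_simps sum_subtractf)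
    also have "\<dots> = 0" using H(3) sup[OF H(1)] sup[OF H(2)] by simp
    finally have "real D \<in> B" using H by (auto simp: B_def)
    with D show False ..
  qed
  thus ?thesis by (rule that)
qed

lemma mpoly_zero_if_eval_zero:
  fixes p :: "('x, 'a::field_char_0) mpoly"
  assumes "\<And>v. meval p v = 0"
  shows "p = 0"
proof (rule ccontr)
  assume "p \<noteq> 0"
  obtain w :: "'x \<Rightarrow> nat" where w: "inj_on (\<lambda>m. \<Sum>i\<in>mkeys m. w i * lk m i) (mkeys p)"
    using separating_weight[of "mkeys p"] by auto
  let ?w = "\<lambda>m. \<Sum>i\<in>mkeys m. w i * lk m i"
  define q where "q = (\<Sum>m\<in>mkeys p. Polynomial.monom (lk p m) (?w m))"
  have "poly q t = meval p (\<lambda>i. t ^ w i)" for t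
    by (simp add: q_def poly_sum poly_monom meval_alt mono_eval_def power_sum power_mult)
  hence "\<forall>t. poly q t = 0" using assms by simp
  hence "q = 0" by (simp only: poly_all_0_iff_0)
  obtain m where m: "m \<in> mkeys p" using \<open>p \<noteq> 0\<close> by (meson keys_eq_empty equals0I)
  have "poly.coeff q (?w m) = (\<Sum>m'\<in>mkeys p. if ?w m' = ?w m then lk p m' else 0)"
    by (simp add: q_def coeff_sum)
  also have "\<dots> = (\<Sum>m'\<in>mkeys p. if m' = m then lk p m' else 0)"
    using w m by (intro sum.cong) (auto dest: inj_onD)
  also have "\<dots> = lk p m" using m by simp
  finally show False using \<open>q = 0\<close> m by (simp add: in_keys_iff)
qed

text \<open>Over a field of characteristic zero polynomial identities may be checked on values. Most
  identities between polynomials below are proved in this way.\<close>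

lemma mpoly_eqI:
  fixes p q :: "('x, 'a::field_char_0) mpoly"
  assumes "\<And>v. meval p v = meval q v"
  shows "p = q"
  using mpoly_zero_if_eval_zero[of "p - q"] assms by (simp add: meval_diff)

section \<open>Homogeneous polynomials\<close>

definition mdeg :: "('x \<Rightarrow>\<^sub>0 nat) \<Rightarrow> nat" where
  "mdeg m = (\<Sum>i\<in>mkeys m. lk m i)"

lemma homogeneous_alt: "homogeneous d p \<longleftrightarrow> (\<forall>m\<in>mkeys p. mdeg m = d)"
  by (simp add: homogeneous_def mdeg_def)

lemma mdeg_superset: "finite I \<Longrightarrow> mkeys m \<subseteq> I \<Longrightarrow> mdeg m = (\<Sum>i\<in>I. lk m i)"
  unfolding mdeg_def by (rule sum.mono_neutral_left) (auto simp: in_keys_iff)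

lemma mdeg_add [simp]: "mdeg (m + n) = mdeg m + mdeg n"
  using keys_add[of m n]
  by (simp add: mdeg_superset[of "mkeys m \<union> mkeys n"] lookup_add sum.distrib)

lemma mdeg_zero [simp]: "mdeg 0 = 0"
  by (simp add: mdeg_def)

lemma mdeg_single [simp]: "mdeg (Poly_Mapping.single i k) = k"
  by (cases "k = 0") (simp_all add: mdeg_def lookup_single)

lemma homogeneous_zero [simp]: "homogeneous d 0"
  by (simp add: homogeneous_alt)

lemma homogeneous_single: "mdeg m = d \<Longrightarrow> homogeneous d (Poly_Mapping.single m c)"
  by (simp add: homogeneous_alt)

lemma homogeneous_const [simp]: "homogeneous 0 (mconst c)"
  by (simp add: mconst_def homogeneous_single)

lemma homogeneous_one [simp]: "homogeneous 0 (1 :: ('x, 'a::zero_neq_one) mpoly)"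
  by (simp add: homogeneous_alt)

lemma homogeneous_var [simp]: "homogeneous 1 (mvar i)" "homogeneous (Suc 0) (mvar i)"
  by (simp_all add: mvar_def homogeneous_single)

lemma homogeneous_add: "homogeneous d p \<Longrightarrow> homogeneous d q \<Longrightarrow> homogeneous d (p + q)"
  using keys_add[of p q] by (auto simp: homogeneous_alt)

lemma homogeneous_uminus: "homogeneous d (p :: ('x, 'a::comm_ring_1) mpoly) \<Longrightarrow> homogeneous d (- p)"
  by (auto simp: homogeneous_alt in_keys_iff)

lemma homogeneous_diff:
  "homogeneous d (p :: ('x, 'a::comm_ring_1) mpoly) \<Longrightarrow> homogeneous d q \<Longrightarrow> homogeneous d (p - q)"
  using homogeneous_add[of d p "- q"] homogeneous_uminus[of d q] by simp

lemma homogeneous_mult: "homogeneous d p \<Longrightarrow> homogeneous e q \<Longrightarrow> homogeneous (d + e) (p * q)"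
  using keys_mult[of p q] by (fastforce simp: homogeneous_alt)

lemma homogeneous_sum: "(\<And>x. x \<in> T \<Longrightarrow> homogeneous d (f x)) \<Longrightarrow> homogeneous d (sum f T)"
  by (induction T rule: infinite_finite_induct) (auto intro: homogeneous_add)

lemma homogeneous_smult: "homogeneous d p \<Longrightarrow> homogeneous d (mconst c * p)"
  using homogeneous_mult[of 0 "mconst c" d p] by simp

lemma homogeneous_power: "homogeneous d p \<Longrightarrow> homogeneous (k * d) (p ^ k)"
  by (induction k) (auto dest: homogeneous_mult)

lemma homogeneous_prod:
  "(\<And>x. x \<in> T \<Longrightarrow> homogeneous (d x) (f x)) \<Longrightarrow> homogeneous (sum d T) (prod f T)"
  by (induction T rule: infinite_finite_induct) (auto intro: homogeneous_mult)

lemma mono_eval_scale: "mono_eval m (\<lambda>i. t * v i) = t ^ mdeg m * mono_eval m v"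
  by (simp add: mono_eval_def mdeg_def power_mult_distrib prod.distrib power_sum)

lemma homogeneous_eval_scale:
  "homogeneous d p \<Longrightarrow> meval p (\<lambda>i. t * v i) = t ^ d * meval p v"
  by (simp add: meval_alt homogeneous_alt mono_eval_scale sum_distrib_left algebra_simps)

text \<open>The homogeneous component of degree \<open>d\<close>.\<close>

definition hcomp :: "nat \<Rightarrow> ('x, 'a::comm_monoid_add) mpoly \<Rightarrow> ('x, 'a) mpoly" where
  "hcomp d p = (\<Sum>m\<in>{m\<in>mkeys p. mdeg m = d}. Poly_Mapping.single m (lk p m))"

lemma lookup_hcomp: "lk (hcomp d p) m = (if mdeg m = d then lk p m else 0)"
proof -
  have "lk (hcomp d p) m = (\<Sum>m'\<in>{m\<in>mkeys p. mdeg m = d}. if m' = m then lk p m else 0)"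
    unfolding hcomp_def lookup_sum lookup_single when_def by (intro sum.cong) auto
  also have "\<dots> = (if mdeg m = d then lk p m else 0)"
    by (simp add: in_keys_iff)
  finally show ?thesis .
qed

lemma homogeneous_hcomp [simp]: "homogeneous d (hcomp d p)"
  by (auto simp: homogeneous_alt in_keys_iff lookup_hcomp split: if_splits)

lemma hcomp_zero [simp]: "hcomp d 0 = 0"
  by (rule poly_mapping_eqI) (simp add: lookup_hcomp)

lemma hcomp_add: "hcomp d (p + q) = hcomp d p + hcomp d q"
  by (rule poly_mapping_eqI) (simp add: lookup_hcomp lookup_add)

lemma hcomp_sum: "hcomp d (sum f T) = (\<Sum>x\<in>T. hcomp d (f x))"
  by (induction T rule: infinite_finite_induct) (simp_all add: hcomp_add)

lemma hcomp_homogeneous: "homogeneous e p \<Longrightarrow> hcomp d p = (if d = e then p else 0)"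
  by (rule poly_mapping_eqI) (auto simp: lookup_hcomp homogeneous_alt in_keys_iff)

lemma hcomp_polys_in: "p \<in> polys_in I \<Longrightarrow> hcomp d p \<in> polys_in I"
  by (auto simp: polys_in_def in_keys_iff lookup_hcomp split: if_splits)

lemma hcomp_expand:
  obtains N where "p = (\<Sum>d\<le>N. hcomp d p)"
proof
  let ?N = "Max (insert 0 (mdeg ` mkeys p))"
  show "p = (\<Sum>d\<le>?N. hcomp d p)"
  proof (rule poly_mapping_eqI)
    fix m
    have "lk (\<Sum>d\<le>?N. hcomp d p) m = (if mdeg m \<le> ?N then lk p m else 0)"
      by (simp add: lookup_sum lookup_hcomp)
    also have "\<dots> = lk p m"
      by (auto simp: in_keys_iff intro!: Max_ge)
    finally show "lk p m = lk (\<Sum>d\<le>?N. hcomp d p) m" ..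
  qed
qed

lemma hcomp_mult_homogeneous:
  fixes l q :: "('x, 'a::comm_ring_1) mpoly"
  assumes "homogeneous e l"
  shows "hcomp (e + d) (l * q) = l * hcomp d q"
proof -
  obtain N where N: "q = (\<Sum>j\<le>N. hcomp j q)" by (rule hcomp_expand)
  have "hcomp (e + d) (l * (\<Sum>j\<le>N. hcomp j q)) = (\<Sum>j\<le>N. hcomp (e + d) (l * hcomp j q))"
    by (simp add: sum_distrib_left hcomp_sum)
  also have "\<dots> = (\<Sum>j\<le>N. if d = j then l * hcomp j q else 0)"
    by (intro sum.cong refl, subst hcomp_homogeneous[OF homogeneous_mult[OF assms homogeneous_hcomp]]) auto
  also have "\<dots> = (if d \<le> N then l * hcomp d q else 0)" by simp
  also have "\<dots> = l * hcomp d (\<Sum>j\<le>N. hcomp j q)"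
    by (auto simp: hcomp_sum hcomp_homogeneous[OF homogeneous_hcomp])
  finally show ?thesis by (simp add: N[symmetric])
qed

text \<open>Multiplication by a nonzero form shifts the homogeneous components, so a quotient of forms is
  a form.\<close>

lemma homogeneous_cancel:
  fixes l q :: "('x::linorder, 'a::idom) mpoly"
  assumes "homogeneous e l" "l \<noteq> 0" "homogeneous (e + d) (l * q)"
  shows "homogeneous d q"
proof -
  have "l * hcomp d q = l * q"
    using hcomp_mult_homogeneous[OF assms(1), of d q] hcomp_homogeneous[OF assms(3), of "e + d"] by auto
  thus ?thesis using assms(2) by (metis homogeneous_hcomp mult_left_cancel)
qed

lemma homogeneous_cancel_zero:
  fixes l q :: "('x::linorder, 'a::idom) mpoly"
  assumes "homogeneous e l" "l \<noteq> 0" "homogeneous d (l * q)" "d < e"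
  shows "q = 0"
proof (rule ccontr)
  assume "q \<noteq> 0"
  obtain N where N: "q = (\<Sum>j\<le>N. hcomp j q)" by (rule hcomp_expand)
  with \<open>q \<noteq> 0\<close> obtain j where j: "hcomp j q \<noteq> 0"
    by (metis sum.neutral)
  have "l * hcomp j q = hcomp (e + j) (l * q)" by (simp add: hcomp_mult_homogeneous[OF assms(1)])
  also have "\<dots> = 0" using assms(4) by (simp add: hcomp_homogeneous[OF assms(3)])
  finally show False using j assms(2) by simp
qed

section \<open>Linear forms\<close>

lemma mono_single_prod: 
  "Poly_Mapping.single m c = mconst c * (\<Prod>i\<in>mkeys m. mvar i ^ lk m i)"
  for c :: "'a::field_char_0"
  by (rule mpoly_eqI) (simp add: meval_simps mono_eval_def)

lemma polys_in_induct [consumes 1, case_names const var add mult]: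
  fixes p :: "('x, 'a::field_char_0) mpoly"
  assumes "p \<in> polys_in I"
    and "\<And>c. P (mconst c)" "\<And>i. i \<in> I \<Longrightarrow> P (mvar i)"
    and add: "\<And>p q. p \<in> polys_in I \<Longrightarrow> q \<in> polys_in I \<Longrightarrow> P p \<Longrightarrow> P q \<Longrightarrow> P (p + q)"
    and mult: "\<And>p q. p \<in> polys_in I \<Longrightarrow> q \<in> polys_in I \<Longrightarrow> P p \<Longrightarrow> P q \<Longrightarrow> P (p * q)"
  shows "P p"
proof -
  have one: "P 1" using assms(2)[of 1] by (simp add: mconst_def)
  have zero: "P 0" using assms(2)[of 0] by (simp add: mconst_def)
  have pow: "P (mvar i ^ k)" if "i \<in> I" for i k
    by (induction k) (use one assms(3) that in \<open>auto intro!: mult\<close>)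
  have prd: "P (\<Prod>i\<in>T. mvar i ^ k i)" if "finite T" "T \<subseteq> I" for T k
    using that by (induction T) (use one pow in \<open>auto intro!: mult polys_in_prod polys_in_power polys_in_var\<close>)
  have "P (\<Sum>m\<in>T. Poly_Mapping.single m (lk p m))" if "finite T" "T \<subseteq> mkeys p" for T
    using that
  proof (induction T)
    case (insert m T)
    hence mI: "mkeys m \<subseteq> I" using assms(1) by (auto simp: polys_in_def)
    have "P (Poly_Mapping.single m (lk p m))"
      unfolding mono_single_prod using mI assms(2) prd by (auto intro!: mult)
    moreover have "(\<Sum>m\<in>T. Poly_Mapping.single m (lk p m)) \<in> polys_in I"
      using insert.prems assms(1) by (intro polys_in_sum polys_in_single) (auto simp: polys_in_def)
    ultimately show ?case using insert mI by (simp add: add polys_in_single)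
  qed (use zero in simp)
  from this[of "mkeys p"] show ?thesis by (subst mpoly_expand) simp
qed

definition lform :: "'x set \<Rightarrow> ('x \<Rightarrow> 'a::field_char_0) \<Rightarrow> ('x, 'a) mpoly" where
  "lform I c = (\<Sum>i\<in>I. mconst (c i) * mvar i)"

lemma meval_lform [simp]: "meval (lform I c) v = (\<Sum>i\<in>I. c i * v i)"
  by (simp add: lform_def meval_simps)

lemma lform_polys_in [simp, intro]: "lform I c \<in> polys_in I"
  by (auto simp: lform_def)

lemma homogeneous_lform [simp]: "homogeneous (Suc 0) (lform I c)"
  unfolding lform_def by (intro homogeneous_sum homogeneous_smult) simp

lemma lform_nonzero:
  assumes "finite I" "k \<in> I" "c k \<noteq> 0"
  shows "lform I c \<noteq> 0"
proof
  assume "lform I c = 0"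
  hence "(\<Sum>i\<in>I. c i * (if i = k then 1 else 0)) = 0"
    by (metis meval_lform meval_zero)
  thus False using assms by (simp add: if_distrib cong: if_cong)
qed

text \<open>The projection onto the hyperplane \<open>c \<bullet> v = 0\<close> along the coordinate axis \<open>k\<close>.\<close>

definition elim :: "'x set \<Rightarrow> ('x \<Rightarrow> 'a::field_char_0) \<Rightarrow> 'x \<Rightarrow> ('x \<Rightarrow> 'a) \<Rightarrow> 'x \<Rightarrow> 'a" where
  "elim I c k v = v(k := v k - (\<Sum>i\<in>I. c i * v i) / c k)"

lemma elim_on:
  assumes "finite I" "k \<in> I" "c k \<noteq> 0"
  shows "(\<Sum>i\<in>I. c i * elim I c k v i) = 0"
proof -
  have "(\<Sum>i\<in>I. c i * elim I c k v i) = c k * elim I c k v k + (\<Sum>i\<in>I-{k}. c i * elim I c k v i)"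
    using assms by (simp add: sum.remove)
  also have "(\<Sum>i\<in>I-{k}. c i * elim I c k v i) = (\<Sum>i\<in>I-{k}. c i * v i)"
    by (intro sum.cong) (auto simp: elim_def)
  also have "c k * elim I c k v k = c k * v k - (\<Sum>i\<in>I. c i * v i)"
    using assms by (simp add: elim_def field_simps)
  finally show ?thesis using assms by (simp add: sum.remove)
qed

lemma elim_fix: "(\<Sum>i\<in>I. c i * v i) = 0 \<Longrightarrow> elim I c k v = v"
  by (simp add: elim_def)

text \<open>Division with remainder by a linear form: eliminating the variable \<open>k\<close> changes a polynomial by a
  multiple of the form. This is proved on generators and extended to sums and products.\<close>

lemma elim_poly:
  assumes "finite I" "k \<in> I" "c k \<noteq> 0" "p \<in> polys_in I"
  shows "\<exists>q\<in>polys_in I. \<exists>r\<in>polys_in I. p = lform I c * q + r \<and> (\<forall>v. meval r v = meval p (elim I c k v))"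
  using assms(4)
proof (induction p rule: polys_in_induct)
  case (const a)
  show ?case by (rule bexI[of _ 0], rule bexI[of _ "mconst a"]) auto
next
  case (var i)
  show ?case
  proof (cases "i = k")
    case True
    let ?r = "mvar k - mconst (1 / c k) * lform I c"
    show ?thesis
      by (rule bexI[of _ "mconst (1 / c k)"], rule bexI[of _ ?r])
         (use assms True in \<open>auto simp: elim_def meval_simps\<close>)
  next
    case False
    show ?thesis
      by (rule bexI[of _ 0], rule bexI[of _ "mvar i"]) (use False var in \<open>auto simp: elim_def\<close>)
  qed
next
  case (add p p')
  then obtain q r q' r' where H: "q \<in> polys_in I" "r \<in> polys_in I" "q' \<in> polys_in I" "r' \<in> polys_in I"
    "p = lform I c * q + r" "p' = lform I c * q' + r'"
    "\<forall>v. meval r v = meval p (elim I c k v)" "\<forall>v. meval r' v = meval p' (elim I c k v)"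
    by blast
  have "p + p' = lform I c * (q + q') + (r + r')" using H(5,6) by (simp add: algebra_simps)
  moreover have "\<forall>v. meval (r + r') v = meval (p + p') (elim I c k v)"
    using H(7,8) by (simp only: meval_add) simp
  ultimately show ?case using H(1-4) by blast
next
  case (mult p p')
  then obtain q r q' r' where H: "q \<in> polys_in I" "r \<in> polys_in I" "q' \<in> polys_in I" "r' \<in> polys_in I"
    "p = lform I c * q + r" "p' = lform I c * q' + r'"
    "\<forall>v. meval r v = meval p (elim I c k v)" "\<forall>v. meval r' v = meval p' (elim I c k v)"
    by blast
  have "p * p' = lform I c * (q * (lform I c * q' + r') + r * q') + (r * r')" using H(5,6) by (simp add: algebra_simps)
  moreover have "\<forall>v. meval (r * r') v = meval (p * p') (elim I c k v)"
    using H(7,8) by (simp only: meval_mult) simp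
  moreover have "q * (lform I c * q' + r') + r * q' \<in> polys_in I"
    using H(1-4) by (intro polys_in_add polys_in_mult lform_polys_in)
  ultimately show ?case using H(1-4) by blast
qed

definition vanishes_on :: "'x set \<Rightarrow> ('x \<Rightarrow> 'a::field_char_0) \<Rightarrow> ('x, 'a) mpoly \<Rightarrow> bool" where
  "vanishes_on I c p \<longleftrightarrow> (\<forall>v. (\<Sum>i\<in>I. c i * v i) = 0 \<longrightarrow> meval p v = 0)"

lemma vanishes_on_dvd:
  assumes "finite I" "k \<in> I" "c k \<noteq> 0" "p \<in> polys_in I" "vanishes_on I c p"
  obtains q where "q \<in> polys_in I" "p = lform I c * q"
proof -
  from elim_poly[where c=c, OF assms(1-4)] obtain q r where H: "q \<in> polys_in I" "p = lform I c * q + r"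
    "\<forall>v. meval r v = meval p (elim I c k v)" by blast
  have "r = 0"
    using H(3) assms(5) elim_on[where c=c, OF assms(1-3)] by (intro mpoly_zero_if_eval_zero) (auto simp: vanishes_on_def)
  with H that show ?thesis by simp
qed

text \<open>Restriction to a hyperplane is a homomorphism to a domain.\<close>

lemma vanishes_on_prime:
  fixes p q :: "('x::linorder, 'a::field_char_0) mpoly"
  assumes "finite I" "k \<in> I" "c k \<noteq> 0" "p \<in> polys_in I" "q \<in> polys_in I" "vanishes_on I c (p * q)"
  shows "vanishes_on I c p \<or> vanishes_on I c q"
proof -
  from elim_poly[where c=c, OF assms(1-4)] obtain r where r: "\<forall>v. meval r v = meval p (elim I c k v)" by blast
  from elim_poly[where c=c, OF assms(1-3) assms(5)] obtain s where s: "\<forall>v. meval s v = meval q (elim I c k v)" by blast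
  have "r * s = 0"
    using r s assms(6) elim_on[where c=c, OF assms(1-3)]
    by (intro mpoly_zero_if_eval_zero) (auto simp: vanishes_on_def meval_mult)
  hence "r = 0 \<or> s = 0" by simp
  thus ?thesis using r s elim_fix unfolding vanishes_on_def by (metis meval_zero)
qed

lemma vanishes_on_prod:
  fixes f :: "'b \<Rightarrow> ('x::linorder, 'a::field_char_0) mpoly"
  assumes "finite I" "k \<in> I" "c k \<noteq> 0" "finite T" "\<And>x. x \<in> T \<Longrightarrow> f x \<in> polys_in I" "vanishes_on I c (prod f T)"
  shows "\<exists>x\<in>T. vanishes_on I c (f x)"
  using assms(4-6)
proof (induction T)
  case empty
  have "meval (prod f {}) (\<lambda>_. 0) = 0" using empty by (simp add: vanishes_on_def del: prod.empty)
  thus ?case by simp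
next
  case (insert x T)
  hence "vanishes_on I c (f x * prod f T)" by simp
  hence "vanishes_on I c (f x) \<or> vanishes_on I c (prod f T)"
    using vanishes_on_prime[where c=c, OF assms(1-3)] insert.prems by (metis insert_iff polys_in_prod)
  thus ?case using insert by auto
qed

text \<open>Distinct linear forms are coprime primes: after division by one of them the quotient still
  vanishes on the other hyperplanes.\<close>

lemma prod_lform_dvd:
  fixes p :: "('x::linorder, 'a::field_char_0) mpoly"
  assumes "finite I" "finite B" "p \<in> polys_in I"
    and nz: "\<And>H. H \<in> B \<Longrightarrow> \<exists>k\<in>I. c H k \<noteq> 0"
    and distinct: "\<And>H K. H \<in> B \<Longrightarrow> K \<in> B \<Longrightarrow> H \<noteq> K \<Longrightarrow> \<not> vanishes_on I (c H) (lform I (c K))"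
    and van: "\<And>H. H \<in> B \<Longrightarrow> vanishes_on I (c H) p"
  obtains q where "q \<in> polys_in I" "p = (\<Prod>H\<in>B. lform I (c H)) * q"
proof -
  have "\<exists>q\<in>polys_in I. p = (\<Prod>H\<in>B. lform I (c H)) * q"
    using assms(2) nz distinct van
  proof (induction B)
    case empty
    show ?case using assms(3) by auto
  next
    case (insert H B)
    then obtain q where q: "q \<in> polys_in I" "p = (\<Prod>H\<in>B. lform I (c H)) * q" by auto
    obtain k where k: "k \<in> I" "c H k \<noteq> 0" using insert.prems(1)[of H] by blast
    have "vanishes_on I (c H) ((\<Prod>H\<in>B. lform I (c H)) * q)" using insert.prems(3) q by auto
    hence "vanishes_on I (c H) (\<Prod>H\<in>B. lform I (c H)) \<or> vanishes_on I (c H) q"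
      by (rule vanishes_on_prime[where c="c H", OF assms(1) k _ q(1), rotated])
         (intro polys_in_prod lform_polys_in)
    moreover have "\<not> vanishes_on I (c H) (\<Prod>H\<in>B. lform I (c H))"
      using vanishes_on_prod[where c="c H", OF assms(1) k insert.hyps(1), of "\<lambda>H. lform I (c H)"]
        insert.prems(2) insert.hyps(2) by blast
    ultimately have "vanishes_on I (c H) q" by blast
    then obtain r where "r \<in> polys_in I" "q = lform I (c H) * r"
      using vanishes_on_dvd[where c="c H", OF assms(1) k q(1)] by blast
    thus ?case using insert.hyps q(2) by (auto simp: mult.assoc mult.left_commute)
  qed
  thus ?thesis using that by blast
qed

section \<open>Restriction to lines\<close>

text \<open>The restriction of a polynomial to the line through \<open>u\<close> with direction \<open>w\<close>, as a polynomial in the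
  parameter.\<close>

definition lrestr :: "('x \<Rightarrow> 'a::comm_ring_1) \<Rightarrow> ('x \<Rightarrow> 'a) \<Rightarrow> ('x, 'a) mpoly \<Rightarrow> 'a poly" where
  "lrestr u w p = (\<Sum>m\<in>mkeys p. Polynomial.smult (lk p m) (\<Prod>i\<in>mkeys m. [:u i, w i:] ^ lk m i))"

lemma poly_lrestr: "poly (lrestr u w p) t = meval p (\<lambda>i. u i + t * w i)"
  by (simp add: lrestr_def poly_sum poly_prod meval_def)

lemma degree_lrestr:
  assumes "homogeneous d (p :: ('x, 'a::idom) mpoly)"
  shows "Polynomial.degree (lrestr u w p) \<le> d"
  unfolding lrestr_def
proof (rule degree_sum_le)
  fix m assume m: "m \<in> mkeys p"
  have "Polynomial.degree (\<Prod>i\<in>mkeys m. [:u i, w i:] ^ lk m i) \<le> (\<Sum>i\<in>mkeys m. Polynomial.degree ([:u i, w i:] ^ lk m i))"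
    by (rule degree_prod_sum_le[unfolded o_def]) simp
  also have "\<dots> \<le> (\<Sum>i\<in>mkeys m. lk m i)"
    by (intro sum_mono order_trans[OF degree_power_le]) auto
  also have "\<dots> = d" using assms m by (simp add: homogeneous_alt mdeg_def)
  finally show "Polynomial.degree (Polynomial.smult (lk p m) (\<Prod>i\<in>mkeys m. [:u i, w i:] ^ lk m i)) \<le> d"
    by (metis degree_smult_le le_trans)
qed simp

section \<open>Partial derivatives\<close>

definition mpd :: "'x \<Rightarrow> ('x, 'a::comm_ring_1) mpoly \<Rightarrow> ('x, 'a) mpoly" where
  "mpd i p = (\<Sum>m\<in>mkeys p. Poly_Mapping.single (m - Poly_Mapping.single i 1) (lk p m * of_nat (lk m i)))"

lemma mpd_superset:
  "finite K \<Longrightarrow> mkeys p \<subseteq> K \<Longrightarrow>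
    mpd i p = (\<Sum>m\<in>K. Poly_Mapping.single (m - Poly_Mapping.single i 1) (lk p m * of_nat (lk m i)))"
  unfolding mpd_def by (rule sum.mono_neutral_left) (auto simp: in_keys_iff)

lemma mpd_single: "mpd i (Poly_Mapping.single m c) = Poly_Mapping.single (m - Poly_Mapping.single i 1) (c * of_nat (lk m i))"
  by (cases "c = 0") (simp_all add: mpd_def)

lemma mpd_zero [simp]: "mpd i 0 = 0" by (simp add: mpd_def)

lemma mpd_add: "mpd i (p + q) = mpd i p + mpd i q"
proof -
  let ?K = "mkeys p \<union> mkeys q"
  have "mkeys (p + q) \<subseteq> ?K" by (rule keys_add)
  thus ?thesis
    by (simp add: mpd_superset[of ?K] lookup_add ring_distribs single_add sum.distrib)
qed

lemma mpd_mult: "mpd i (p * q) = p * mpd i q + q * mpd i p"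
proof (induction p rule: mpoly_induct)
  case (single m c)
  show ?case
  proof (induction q rule: mpoly_induct)
    case (single n d)
    let ?e = "Poly_Mapping.single i (1::nat)"
    have *: "Poly_Mapping.single (m + n - ?e) (c * d * of_nat (lk m i)) = Poly_Mapping.single (n + (m - ?e)) (c * d * of_nat (lk m i))" for m n c d
    proof (cases "lk m i = 0")
      case False
      hence "m + n - ?e = n + (m - ?e)"
        by (intro poly_mapping_eqI) (auto simp: lookup_minus lookup_add lookup_single when_def)
      thus ?thesis by simp
    qed simp
    show ?case
      using *[of m n c d] *[of n m c d]
      by (simp add: mult_single mpd_single lookup_add algebra_simps single_add)
  qed (simp add: mpd_add ring_distribs)
qed (simp add: mpd_add ring_distribs)

lemma mpd_const [simp]: "mpd i (mconst c) = 0"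
  by (simp add: mconst_def mpd_single)

lemma mpd_var [simp]: "mpd i (mvar j) = (if i = j then 1 else 0)"
  by (auto simp: mvar_def mpd_single lookup_single)

lemma mpd_sum: "mpd i (sum f T) = (\<Sum>x\<in>T. mpd i (f x))"
  by (induction T rule: infinite_finite_induct) (simp_all add: mpd_add)

lemma mpd_smult: "mpd i (mconst c * p) = mconst c * mpd i p"
  by (simp add: mpd_mult)

lemma mpd_polys_in: "p \<in> polys_in I \<Longrightarrow> mpd i p \<in> polys_in I"
  unfolding mpd_def
  by (intro polys_in_sum polys_in_single) (force simp: polys_in_def in_keys_iff lookup_minus lookup_single)

lemma homogeneous_mpd:
  assumes "homogeneous d p"
  shows "homogeneous (d - 1) (mpd i p)"
  unfolding mpd_def
proof (rule homogeneous_sum)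
  fix m assume m: "m \<in> mkeys p"
  show "homogeneous (d - 1) (Poly_Mapping.single (m - Poly_Mapping.single i 1) (lk p m * of_nat (lk m i)))"
  proof (cases "lk m i = 0")
    case False
    hence "(m - Poly_Mapping.single i 1) + Poly_Mapping.single i 1 = m"
      by (intro poly_mapping_eqI) (auto simp: lookup_minus lookup_add lookup_single when_def)
    hence "mdeg (m - Poly_Mapping.single i 1) + 1 = mdeg m" by (metis mdeg_add mdeg_single)
    thus ?thesis using assms m by (intro homogeneous_single) (auto simp: homogeneous_alt)
  qed simp
qed

section \<open>Polynomial vector fields and logarithmic derivations\<close>

text \<open>A polynomial vector field is given by its coefficients \<open>g 0, \<dots>, g (n - 1)\<close>.\<close>

definition vfields :: "nat \<Rightarrow> (nat \<Rightarrow> (nat, 'a::field_char_0) mpoly) set" where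
  "vfields n = {g. \<forall>i<n. g i \<in> poly_ring n}"

definition lin :: "nat \<Rightarrow> (nat \<Rightarrow> 'a) \<Rightarrow> (nat \<Rightarrow> (nat, 'a::field_char_0) mpoly) \<Rightarrow> (nat, 'a) mpoly" where
  "lin n c g = (\<Sum>i<n. mconst (c i) * g i)"

definition tangent :: "nat \<Rightarrow> (nat \<Rightarrow> 'a) \<Rightarrow> (nat \<Rightarrow> (nat, 'a::field_char_0) mpoly) \<Rightarrow> bool" where
  "tangent n c g \<longleftrightarrow> vanishes_on {..<n} c (lin n c g)"

text \<open>Linear forms are given by their coefficient vectors \<open>c \<in> C\<close>; the list \<open>G\<close> is to be a basis of the
  module of vector fields tangent to all hyperplanes \<open>c = 0\<close>.\<close>

definition vbasis ::
  "nat \<Rightarrow> (nat \<Rightarrow> 'a) set \<Rightarrow> (nat \<Rightarrow> (nat, 'a::field_char_0) mpoly) list \<Rightarrow> bool" where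
  "vbasis n C G \<longleftrightarrow>
     (\<forall>g\<in>set G. g \<in> vfields n \<and> (\<forall>c\<in>C. tangent n c g)) \<and>
     (\<forall>g\<in>vfields n. (\<forall>c\<in>C. tangent n c g) \<longrightarrow>
        (\<exists>p. (\<forall>j<length G. p j \<in> poly_ring n) \<and> (\<forall>i<n. g i = (\<Sum>j<length G. p j * (G ! j) i)))) \<and>
     (\<forall>p. (\<forall>j<length G. p j \<in> poly_ring n) \<and> (\<forall>i<n. (\<Sum>j<length G. p j * (G ! j) i) = 0)
        \<longrightarrow> (\<forall>j<length G. p j = 0))"

lemma meval_lin: "meval (lin n c g) v = (\<Sum>i<n. c i * meval (g i) v)"
  by (simp add: lin_def meval_simps)

lemma lin_poly_ring: "g \<in> vfields n \<Longrightarrow> lin n c g \<in> polys_in {..<n}"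
  by (auto simp: lin_def vfields_def poly_ring_eq intro!: polys_in_sum polys_in_mult)

definition der :: "nat \<Rightarrow> (nat \<Rightarrow> (nat, 'a::field_char_0) mpoly) \<Rightarrow> (nat, 'a) mpoly \<Rightarrow> (nat, 'a) mpoly" where
  "der n g f = (\<Sum>i<n. g i * mpd i f)"

lemma derivation_der:
  assumes "g \<in> vfields n"
  shows "derivation n (der n g)"
  unfolding derivation_def
proof (intro conjI ballI allI)
  fix f :: "(nat, 'a) mpoly" assume "f \<in> poly_ring n"
  thus "der n g f \<in> poly_ring n"
    using assms by (auto simp: der_def vfields_def poly_ring_eq intro!: polys_in_sum polys_in_mult mpd_polys_in)
qed (simp_all add: der_def mpd_add mpd_mult sum.distrib algebra_simps sum_distrib_left)

lemma der_var: "i < n \<Longrightarrow> der n g (mvar i) = g i"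
  by (simp add: der_def if_distrib cong: if_cong)

text \<open>A derivation is determined by its values on the variables.\<close>

lemma derivation_eq_der:
  assumes "derivation n \<theta>" "f \<in> poly_ring n"
  shows "\<theta> f = der n (\<lambda>i. \<theta> (mvar i)) f"
  using assms(2) unfolding poly_ring_eq
proof (induction f rule: polys_in_induct)
  case (const c)
  have one: "1 \<in> poly_ring n" by (simp add: poly_ring_eq)
  have "\<theta> (1 * 1) = 1 * \<theta> 1 + 1 * \<theta> 1" using assms(1) one unfolding derivation_def by blast
  hence "\<theta> 1 = 0" by simp
  moreover have "\<theta> (mconst c * 1) = mconst c * \<theta> 1" using assms(1) one unfolding derivation_def by blast
  ultimately show ?case by (simp add: der_def)
next
  case (var i)
  thus ?case by (simp add: der_var)
next
  case (add p q)
  have "\<theta> (p + q) = \<theta> p + \<theta> q" using assms(1) add(1,2) unfolding derivation_def poly_ring_eq by blast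
  thus ?case using add by (simp add: der_def mpd_add sum.distrib algebra_simps)
next
  case (mult p q)
  have "\<theta> (p * q) = p * \<theta> q + q * \<theta> p" using assms(1) mult(1,2) unfolding derivation_def poly_ring_eq by blast
  thus ?case using mult by (simp add: der_def mpd_mult sum.distrib algebra_simps sum_distrib_left)
qed

lemma der_lform: "der n g (lform {..<n} c) = lin n c g"
  by (simp add: der_def lform_def mpd_sum mpd_smult lin_def if_distrib sum_distrib_left cong: if_cong)
     (simp add: mult.commute)

lemma der_mult: "der n g (p * q) = p * der n g q + q * der n g p"
  by (simp add: der_def mpd_mult sum.distrib algebra_simps sum_distrib_left)

lemma der_one [simp]: "der n g 1 = 0"
proof -
  have "der n g (mconst 1) = 0" unfolding der_def mpd_const by simp
  thus ?thesis by (simp add: mconst_def)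
qed

lemma der_prod:
  "finite B \<Longrightarrow> der n g (\<Prod>H\<in>B. l H) = (\<Sum>H\<in>B. der n g (l H) * (\<Prod>K\<in>B-{H}. l K))"
proof (induction B rule: finite_induct)
  case (insert H B)
  have *: "(\<Prod>L\<in>insert H B - {K}. l L) = l H * (\<Prod>L\<in>B-{K}. l L)" if "K \<in> B" for K
  proof -
    have "insert H B - {K} = insert H (B - {K})" using insert that by auto
    thus ?thesis using insert by simp
  qed
  have **: "insert H B - {H} = B" using insert by auto
  have "(\<Sum>K\<in>B. der n g (l K) * (\<Prod>L\<in>insert H B - {K}. l L)) = l H * (\<Sum>K\<in>B. der n g (l K) * (\<Prod>L\<in>B-{K}. l L))"
    unfolding sum_distrib_left by (intro sum.cong) (auto simp: * algebra_simps)
  thus ?case using insert by (simp add: der_mult ** algebra_simps)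
qed simp

text \<open>The reason for working with tangency: by the product rule, \<open>\<theta>\<close> preserves the ideal of the product
  of pairwise non-proportional linear forms if and only if \<open>\<theta>\<close> maps each of them to a multiple of itself.\<close>

lemma der_prod_dvd_iff:
  fixes c :: "'b \<Rightarrow> nat \<Rightarrow> 'a::field_char_0"
  assumes "finite B" "g \<in> vfields n"
    and nz: "\<And>H. H \<in> B \<Longrightarrow> \<exists>k<n. c H k \<noteq> 0"
    and distinct: "\<And>H K. H \<in> B \<Longrightarrow> K \<in> B \<Longrightarrow> H \<noteq> K \<Longrightarrow> \<not> vanishes_on {..<n} (c H) (lform {..<n} (c K))"
  shows "(\<exists>r\<in>poly_ring n. der n g (\<Prod>H\<in>B. lform {..<n} (c H)) = (\<Prod>H\<in>B. lform {..<n} (c H)) * r)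
     \<longleftrightarrow> (\<forall>H\<in>B. tangent n (c H) g)" (is "?L = ?R")
proof
  assume ?L
  then obtain r where r: "der n g (\<Prod>H\<in>B. lform {..<n} (c H)) = (\<Prod>H\<in>B. lform {..<n} (c H)) * r" by blast
  show ?R
  proof
    fix H assume H: "H \<in> B"
    obtain k where k: "k \<in> {..<n}" "c H k \<noteq> 0" using nz[OF H] by auto
    let ?P = "\<Prod>K\<in>B-{H}. lform {..<n} (c K)"
    have "vanishes_on {..<n} (c H) (lin n (c H) g * ?P)"
      unfolding vanishes_on_def
    proof (intro allI impI)
      fix v assume v: "(\<Sum>i<n. c H i * v i) = 0"
      have "0 = meval (der n g (\<Prod>H\<in>B. lform {..<n} (c H))) v"
        unfolding r using assms(1) H v by (simp add: meval_simps prod.remove[of B H])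
      also have "\<dots> = (\<Sum>K\<in>B. meval (lin n (c K) g) v * meval (\<Prod>L\<in>B-{K}. lform {..<n} (c L)) v)"
        by (subst der_prod[OF assms(1)]) (simp add: meval_sum meval_mult der_lform)
      also have "\<dots> = (\<Sum>K\<in>B. if K = H then meval (lin n (c H) g) v * meval ?P v else 0)"
      proof (intro sum.cong refl)
        fix K assume K: "K \<in> B"
        show "meval (lin n (c K) g) v * meval (\<Prod>L\<in>B-{K}. lform {..<n} (c L)) v
           = (if K = H then meval (lin n (c H) g) v * meval ?P v else 0)"
        proof (cases "K = H")
          case False
          hence "meval (\<Prod>L\<in>B-{K}. lform {..<n} (c L)) v = 0"
            using assms(1) H v by (simp add: meval_simps prod.remove[of "B-{K}" H])
          thus ?thesis using False by simp
        qed simp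
      qed
      also have "\<dots> = meval (lin n (c H) g * ?P) v" using assms(1) H by (simp add: meval_mult)
      finally show "meval (lin n (c H) g * ?P) v = 0" ..
    qed
    hence "vanishes_on {..<n} (c H) (lin n (c H) g) \<or> vanishes_on {..<n} (c H) ?P"
      using k assms(2) by (intro vanishes_on_prime[where c="c H" and k=k]) (auto intro!: lin_poly_ring polys_in_prod)
    moreover have "\<not> vanishes_on {..<n} (c H) ?P"
      using vanishes_on_prod[where c="c H" and T="B-{H}" and f="\<lambda>H. lform {..<n} (c H)" and I="{..<n}", OF _ k] distinct H assms(1)
      by auto
    ultimately show "tangent n (c H) g" by (simp add: tangent_def)
  qed
next
  assume R: ?R
  have "\<exists>r\<in>poly_ring n. lin n (c H) g = lform {..<n} (c H) * r" if H: "H \<in> B" for H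
  proof -
    obtain k where k: "k \<in> {..<n}" "c H k \<noteq> 0" using nz[OF H] by auto
    have "vanishes_on {..<n} (c H) (lin n (c H) g)" using R H by (auto simp: tangent_def)
    from vanishes_on_dvd[where c="c H", OF finite_lessThan k lin_poly_ring[OF assms(2)] this]
    show ?thesis by (metis poly_ring_eq)
  qed
  then obtain r where r: "\<And>H. H \<in> B \<Longrightarrow> r H \<in> poly_ring n" "\<And>H. H \<in> B \<Longrightarrow> lin n (c H) g = lform {..<n} (c H) * r H"
    by metis
  have "der n g (\<Prod>H\<in>B. lform {..<n} (c H)) = (\<Sum>H\<in>B. lform {..<n} (c H) * r H * (\<Prod>K\<in>B-{H}. lform {..<n} (c K)))"
    by (subst der_prod[OF assms(1)]) (auto simp: der_lform r intro!: sum.cong)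
  also have "\<dots> = (\<Sum>H\<in>B. (\<Prod>K\<in>B. lform {..<n} (c K)) * r H)"
    using assms(1) by (intro sum.cong) (auto simp: prod.remove algebra_simps)
  also have "\<dots> = (\<Prod>K\<in>B. lform {..<n} (c K)) * (\<Sum>H\<in>B. r H)" by (simp add: sum_distrib_left)
  finally show ?L using r(1) by (auto simp: poly_ring_eq intro!: bexI[of _ "\<Sum>H\<in>B. r H"])
qed

lemma parallel_if_vanishes:
  fixes a b :: "'x \<Rightarrow> 'a::field_char_0"
  assumes "finite I" "k \<in> I" "a k \<noteq> 0" "vanishes_on I a (lform I b)"
  shows "\<forall>i\<in>I. b i = (b k / a k) * a i"
proof
  fix i assume i: "i \<in> I"
  show "b i = (b k / a k) * a i"
  proof (cases "i = k")
    case False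
    let ?v = "\<lambda>j. if j = i then 1 else if j = k then - (a i / a k) else 0"
    have *: "(\<Sum>j\<in>I. f j * ?v j) = f i - f k * (a i / a k)" for f :: "'x \<Rightarrow> 'a"
    proof -
      have "(\<Sum>j\<in>I. f j * ?v j) = (\<Sum>j\<in>I. (if j = i then f i else 0) + (if j = k then - (f k * (a i / a k)) else 0))"
        using False by (intro sum.cong) auto
      thus ?thesis using i assms by (simp add: sum.distrib)
    qed
    have "(\<Sum>j\<in>I. a j * ?v j) = 0" unfolding * using assms by simp
    hence "(\<Sum>j\<in>I. b j * ?v j) = 0" using assms(4)[unfolded vanishes_on_def, rule_format, of ?v] by simp
    thus ?thesis unfolding * by simp
  qed (use assms in simp)
qed

text \<open>Passage from vector fields in coordinates, with linear equations chosen by hand, to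
  exponents in the sense of log derivations.\<close>

lemma has_exponentsI:
  fixes V :: "('a::field_char_0 ^ 'n) set"
  assumes co: "coordinates V b" and "finite B" and n: "n = vec.dim V"
    and H: "\<And>H. H \<in> B \<Longrightarrow> H = {\<Sum>i<n. u i *s b i | u. (\<Sum>i<n. c H i * u i) = 0}"
    and nz: "\<And>H. H \<in> B \<Longrightarrow> \<exists>k<n. c H k \<noteq> 0"
    and bas: "vbasis n (c ` B) G"
    and len: "length ds = length G"
    and deg: "\<And>j i. j < length G \<Longrightarrow> i < n \<Longrightarrow> homogeneous (ds ! j) ((G ! j) i)"
  shows "has_exponents V B (mset ds)"
proof -
  have distinct: "\<not> vanishes_on {..<n} (c H) (lform {..<n} (c K))" if HK: "H \<in> B" "K \<in> B" "H \<noteq> K" for H K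
  proof
    assume van: "vanishes_on {..<n} (c H) (lform {..<n} (c K))"
    obtain k where k: "k < n" "c H k \<noteq> 0" using nz HK by blast
    define t where "t = c K k / c H k"
    have t: "\<forall>i<n. c K i = t * c H i"
      using parallel_if_vanishes[where a="c H" and b="c K" and k=k and I="{..<n}", OF _ _ k(2) van] k(1)
      unfolding t_def by blast
    have "t \<noteq> 0" using nz[OF HK(2)] t by auto
    have "(\<Sum>i<n. c K i * u i) = t * (\<Sum>i<n. c H i * u i)" for u
      using t by (simp add: sum_distrib_left mult.assoc)
    hence eq: "{\<Sum>i<n. u i *s b i | u. (\<Sum>i<n. c H i * u i) = 0} = {\<Sum>i<n. u i *s b i | u. (\<Sum>i<n. c K i * u i) = 0}"
      using \<open>t \<noteq> 0\<close> by simp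
    have "H = K" by (rule trans[OF H[OF HK(1)] trans[OF eq H[OF HK(2), symmetric]]])
    with HK show False by simp
  qed
  let ?l = "\<lambda>H. lform {..<n} (c H)"
  let ?Q = "\<Prod>H\<in>B. ?l H"
  have logd: "\<theta> \<in> log_derivations n ?Q \<longleftrightarrow> derivation n \<theta> \<and> (\<forall>c\<in>c`B. tangent n c (\<lambda>i. \<theta> (mvar i)))" for \<theta>
  proof (cases "derivation n \<theta>")
    case True
    have Q: "?Q \<in> poly_ring n" by (auto simp: poly_ring_eq intro!: polys_in_prod)
    have vf: "(\<lambda>i. \<theta> (mvar i)) \<in> vfields n"
      using True by (auto simp: derivation_def vfields_def poly_ring_eq polys_in_var)
    have "(\<exists>r\<in>poly_ring n. \<theta> ?Q = ?Q * r) \<longleftrightarrow> (\<forall>H\<in>B. tangent n (c H) (\<lambda>i. \<theta> (mvar i)))"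
      unfolding derivation_eq_der[OF True Q] 
      by (rule der_prod_dvd_iff[OF assms(2) vf nz distinct])
    thus ?thesis using True by (simp add: log_derivations_def)
  qed (simp add: log_derivations_def)
  define \<theta>s where "\<theta>s = map (der n) G"
  have vfG: "g \<in> vfields n" if "g \<in> set G" for g using bas that by (auto simp: vbasis_def)
  have tanvar: "tangent n c' (\<lambda>i. der n g (mvar i)) \<longleftrightarrow> tangent n c' g" for c' g
    unfolding tangent_def lin_def by (simp add: der_var)
  have mb: "module_basis n (log_derivations n ?Q) \<theta>s"
    unfolding module_basis_def
  proof (intro conjI ballI allI impI)
    show "set \<theta>s \<subseteq> log_derivations n ?Q"
    proof
      fix \<theta> assume "\<theta> \<in> set \<theta>s"
      then obtain g where g: "g \<in> set G" "\<theta> = der n g" by (auto simp: \<theta>s_def)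
      thus "\<theta> \<in> log_derivations n ?Q"
        unfolding logd using derivation_der[OF vfG] bas by (auto simp: tanvar vbasis_def)
    qed
  next
    fix \<theta> assume "\<theta> \<in> log_derivations n ?Q"
    hence \<theta>: "derivation n \<theta>" "\<forall>c\<in>c`B. tangent n c (\<lambda>i. \<theta> (mvar i))" unfolding logd by auto
    have vf: "(\<lambda>i. \<theta> (mvar i)) \<in> vfields n"
      using \<theta>(1) by (auto simp: derivation_def vfields_def poly_ring_eq polys_in_var)
    have "\<exists>p. (\<forall>j<length G. p j \<in> poly_ring n) \<and> (\<forall>i<n. \<theta> (mvar i) = (\<Sum>j<length G. p j * (G ! j) i))"
      using bas vf \<theta>(2) unfolding vbasis_def by blast
    then obtain p where p: "\<forall>j<length G. p j \<in> poly_ring n" "\<forall>i<n. \<theta> (mvar i) = (\<Sum>j<length G. p j * (G ! j) i)"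
      by blast
    have "\<theta> f = (\<Sum>j<length \<theta>s. p j * (\<theta>s ! j) f)" if f: "f \<in> poly_ring n" for f
    proof -
      have "\<theta> f = (\<Sum>i<n. \<Sum>j<length G. p j * (G ! j) i * mpd i f)"
        unfolding derivation_eq_der[OF \<theta>(1) f] using p(2) by (simp add: der_def sum_distrib_right)
      also have "\<dots> = (\<Sum>j<length G. \<Sum>i<n. p j * (G ! j) i * mpd i f)" by (rule sum.swap)
      finally show ?thesis by (simp add: \<theta>s_def der_def sum_distrib_left mult.assoc)
    qed
    thus "\<exists>p. (\<forall>j<length \<theta>s. p j \<in> poly_ring n) \<and> (\<forall>f\<in>poly_ring n. \<theta> f = (\<Sum>j<length \<theta>s. p j * (\<theta>s ! j) f))"
      using p(1) by (auto simp: \<theta>s_def)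
  next
    fix p j assume p: "(\<forall>j<length \<theta>s. p j \<in> poly_ring n) \<and> (\<forall>f\<in>poly_ring n. (\<Sum>j<length \<theta>s. p j * (\<theta>s ! j) f) = 0)"
      and j: "j < length \<theta>s"
    have "(\<Sum>j<length G. p j * (G ! j) i) = 0" if "i < n" for i
    proof -
      have "mvar i \<in> poly_ring n" using that by (auto simp: poly_ring_eq)
      thus ?thesis using p that by (force simp: \<theta>s_def der_var)
    qed
    thus "p j = 0" using bas p j unfolding vbasis_def by (simp add: \<theta>s_def)
  qed
  have df: "\<forall>H\<in>B. defining_form V b H (?l H)"
    unfolding defining_form_def n[symmetric] using H by (auto simp: lform_def)
  have pd: "\<forall>j<length \<theta>s. has_pdegree n (\<theta>s ! j) (ds ! j)"
    using deg by (auto simp: has_pdegree_def \<theta>s_def der_var)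
  show ?thesis
    unfolding has_exponents_def n[symmetric]
    using co df mb pd len by (intro exI[of _ b] exI[of _ ?l] exI[of _ \<theta>s] exI[of _ ds]) (simp add: \<theta>s_def)
qed

section \<open>Coordinates\<close>

lemma coordinates_exist:
  fixes V :: "('a::field_char_0 ^ 'n) set"
  assumes "vec.subspace V"
  obtains b where "coordinates V b"
proof -
  obtain B where B: "B \<subseteq> V" "vec.independent B" "V \<subseteq> vec.span B" "card B = vec.dim V"
    using vec.basis_exists by blast
  have "finite B" using B(2) by (rule vec.finiteI_independent)
  then obtain b where b: "bij_betw b {..<vec.dim V} B"
    using B(4) by (metis ex_bij_betw_nat_finite lessThan_atLeast0)
  have "vec.span B = V" using B assms by (metis vec.span_eq_iff vec.span_mono subset_antisym)
  hence "coordinates V b" using b B by (auto simp: coordinates_def bij_betw_def)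
  thus ?thesis by (rule that)
qed

lemma coordinates_rep:
  assumes "coordinates V b"
  shows "V = {\<Sum>i<vec.dim V. u i *s b i | u. True}"
proof -
  let ?n = "vec.dim V"
  have inj: "inj_on b {..<?n}" using assms by (simp add: coordinates_def)
  have "V = vec.span (b ` {..<?n})" using assms by (simp add: coordinates_def)
  also have "\<dots> = range (\<lambda>u. \<Sum>v\<in>b ` {..<?n}. u v *s v)" by (rule vec.span_finite) simp
  also have "\<dots> = {\<Sum>i<?n. u i *s b i | u. True}"
  proof (intro equalityI subsetI)
    fix x assume "x \<in> range (\<lambda>u. \<Sum>v\<in>b ` {..<?n}. u v *s v)"
    then obtain u where "x = (\<Sum>v\<in>b ` {..<?n}. u v *s v)" by auto
    hence "x = (\<Sum>i<?n. (u (b i)) *s b i)" using inj by (simp add: sum.reindex)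
    thus "x \<in> {\<Sum>i<?n. u i *s b i | u. True}"
      by (intro CollectI exI[of _ "\<lambda>i. u (b i)"]) simp
  next
    fix x assume "x \<in> {\<Sum>i<?n. u i *s b i | u. True}"
    then obtain u where u: "x = (\<Sum>i<?n. u i *s b i)" by auto
    have "x = (\<Sum>v\<in>b ` {..<?n}. u (the_inv_into {..<?n} b v) *s v)"
      unfolding u using inj by (simp add: sum.reindex the_inv_into_f_f)
    thus "x \<in> range (\<lambda>u. \<Sum>v\<in>b ` {..<?n}. u v *s v)"
      by (intro image_eqI[of _ _ "\<lambda>v. u (the_inv_into {..<?n} b v)"]) auto
  qed
  finally show ?thesis .
qed

text \<open>Extend a basis of \<open>H\<close> by one vector \<open>w\<close>; the linear map that kills the basis of \<open>H\<close> and fixes \<open>w\<close>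
  yields the equation.\<close>

lemma hyperplane_equation:
  fixes V :: "('a::field_char_0 ^ 'n) set"
  assumes co: "coordinates V b" and H: "vec.subspace H" "H \<subseteq> V" "vec.dim V = vec.dim H + 1"
  obtains c where "H = {\<Sum>i<vec.dim V. u i *s b i | u. (\<Sum>i<vec.dim V. c i * u i) = 0}" "\<exists>k<vec.dim V. c k \<noteq> 0"
proof -
  let ?n = "vec.dim V"
  have Vsub: "vec.subspace V" using co by (metis coordinates_def vec.subspace_span)
  obtain B where B: "B \<subseteq> H" "vec.independent B" "H \<subseteq> vec.span B" "card B = vec.dim H"
    using vec.basis_exists by blast
  have spanB: "vec.span B = H" using B H(1) by (metis vec.span_eq_iff vec.span_mono subset_antisym)
  have "\<not> V \<subseteq> H" using H by (metis Suc_eq_plus1 n_not_Suc_n subset_antisym)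
  then obtain w where w: "w \<in> V" "w \<notin> H" by blast
  have ind: "vec.independent (insert w B)" using B(2) w(2) spanB by (simp add: vec.independent_insert)
  have wB: "w \<notin> B" using w(2) B(1) by blast
  have fB: "finite B" using B(2) by (rule vec.finiteI_independent)
  have spanV: "vec.span (insert w B) = V"
  proof -
    have "insert w B \<subseteq> V" using w B H by auto
    moreover have "card (insert w B) = ?n" using fB wB B(4) H(3) by simp
    ultimately have "V \<subseteq> vec.span (insert w B)"
      using vec.card_eq_dim[of "insert w B" V] ind fB by auto
    thus ?thesis using \<open>insert w B \<subseteq> V\<close> Vsub by (metis vec.span_eq_iff vec.span_mono subset_antisym)
  qed
  obtain f :: "'a^'n \<Rightarrow> 'a^'n" where f: "Vector_Spaces.linear (*s) (*s) f" "\<forall>x\<in>insert w B. f x = (if x = w then w else 0)"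
    using vec.linear_independent_extend[OF ind, of "\<lambda>x. if x = w then w else 0"] by blast
  interpret f: Vector_Spaces.linear "(*s)" "(*s)" f by (rule f(1))
  have f0: "f h = 0" if "h \<in> H" for h
  proof -
    have "h \<in> vec.span B" using that spanB by simp
    have fB: "f x = 0" if "x \<in> B" for x using f(2) wB that by auto
    show ?thesis by (rule f.eq_0_on_span[OF fB \<open>h \<in> vec.span B\<close>])
  qed
  have fw: "f w = w" using f(2) by simp
  have dec: "\<exists>k. v - k *s w \<in> H" if "v \<in> V" for v
    using that spanV spanB by (metis vec.span_breakdown_eq)
  have fdec: "\<exists>k. f v = k *s w \<and> (v \<in> H \<longleftrightarrow> k = 0)" if v: "v \<in> V" for v
  proof -
    obtain k where k: "v - k *s w \<in> H" using dec[OF v] by blast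
    have "f (v - k *s w) = f v - k *s f w" by (simp add: f.diff f.scale)
    hence "f v = k *s w" using f0[OF k] fw by simp
    moreover have "v \<in> H \<longleftrightarrow> k = 0"
    proof
      assume "v \<in> H"
      hence "f v = 0" by (rule f0)
      hence "k *s w = 0" using \<open>f v = k *s w\<close> by simp
      moreover have "w \<noteq> 0" using w(2) H(1) vec.subspace_0 by auto
      ultimately show "k = 0" by simp
    next
      assume "k = 0" thus "v \<in> H" using k by simp
    qed
    ultimately show ?thesis by blast
  qed
  have "b i \<in> V" if "i < ?n" for i
    using co that unfolding coordinates_def by (metis imageI lessThan_iff vec.span_base)
  hence "\<forall>i. \<exists>k. i < ?n \<longrightarrow> f (b i) = k *s w" using fdec by blast
  then obtain c where c: "\<And>i. i < ?n \<Longrightarrow> f (b i) = c i *s w" by metis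
  have w0: "w \<noteq> 0" using w(2) H(1) vec.subspace_0 by auto
  have fs: "f (\<Sum>i<?n. u i *s b i) = (\<Sum>i<?n. c i * u i) *s w" for u
    by (simp add: f.sum f.scale c vec.scale_sum_left mult.commute)
  have VV: "v \<in> V \<longleftrightarrow> (\<exists>u. v = (\<Sum>i<?n. u i *s b i))" for v using coordinates_rep[OF co] by auto
  have iff: "(\<Sum>i<?n. u i *s b i) \<in> H \<longleftrightarrow> (\<Sum>i<?n. c i * u i) = 0" for u
  proof -
    have "(\<Sum>i<?n. u i *s b i) \<in> V" using VV by blast
    then obtain k where "f (\<Sum>i<?n. u i *s b i) = k *s w" "(\<Sum>i<?n. u i *s b i) \<in> H \<longleftrightarrow> k = 0" using fdec by blast
    thus ?thesis using fs[of u] w0 by simp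
  qed
  have "H = {\<Sum>i<?n. u i *s b i | u. (\<Sum>i<?n. c i * u i) = 0}"
  proof (intro equalityI subsetI)
    fix x assume x: "x \<in> H"
    then obtain u where u: "x = (\<Sum>i<?n. u i *s b i)" using VV H(2) by blast
    hence "(\<Sum>i<?n. c i * u i) = 0" using x iff by simp
    thus "x \<in> {\<Sum>i<?n. u i *s b i | u. (\<Sum>i<?n. c i * u i) = 0}" using u by blast
  next
    fix x assume "x \<in> {\<Sum>i<?n. u i *s b i | u. (\<Sum>i<?n. c i * u i) = 0}"
    thus "x \<in> H" using iff by auto
  qed
  moreover have "\<exists>k<?n. c k \<noteq> 0"
  proof (rule ccontr)
    assume "\<not> ?thesis"
    hence "(\<Sum>i<?n. c i * u i) = 0" for u by simp
    moreover obtain u where "w = (\<Sum>i<?n. u i *s b i)" using w(1) VV by blast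
    ultimately have "w \<in> H" using iff by simp
    with w(2) show False ..
  qed
  ultimately show ?thesis by (rule that)
qed

section \<open>Arrangements of rank at most two\<close>

lemma has_exponents_empty:
  fixes V :: "('a::field_char_0 ^ 'n) set"
  assumes "vec.subspace V"
  shows "has_exponents V {} (replicate_mset (vec.dim V) 0)"
proof -
  obtain b where b: "coordinates V b" using assms by (rule coordinates_exist)
  let ?n = "vec.dim V"
  let ?G = "map (\<lambda>j i. if i = j then 1 else 0 :: (nat, 'a) mpoly) [0..<?n]"
  have bas: "vbasis ?n {} ?G"
    unfolding vbasis_def
  proof (intro conjI ballI impI allI)
    fix g assume "g \<in> set ?G"
    thus "g \<in> vfields ?n" by (auto simp: vfields_def poly_ring_eq)
  next
    fix g :: "nat \<Rightarrow> (nat, 'a) mpoly" assume "g \<in> vfields ?n"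
    thus "\<exists>p. (\<forall>j<length ?G. p j \<in> poly_ring ?n) \<and> (\<forall>i<?n. g i = (\<Sum>j<length ?G. p j * (?G ! j) i))"
      by (intro exI[of _ g]) (auto simp: vfields_def if_distrib cong: if_cong)
  next
    fix p j assume p: "(\<forall>j<length ?G. p j \<in> poly_ring ?n) \<and> (\<forall>i<?n. (\<Sum>j<length ?G. p j * (?G ! j) i) = 0)"
      and j: "j < length ?G"
    hence "(\<Sum>k<?n. p k * (if j = k then 1 else 0)) = 0" by auto
    thus "p j = 0" using j by (simp add: if_distrib cong: if_cong)
  qed simp
  have "has_exponents V {} (mset (replicate ?n 0))"
    by (rule has_exponentsI[OF b _ refl _ _ _ , where c="\<lambda>_ _. 0" and G="?G"])
       (use bas in \<open>auto simp: homogeneous_alt\<close>)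
  thus ?thesis by simp
qed

lemma mvar_nonzero [simp]: "mvar i \<noteq> (0 :: ('x, 'a::field_char_0) mpoly)"
proof
  assume "mvar i = (0 :: ('x, 'a) mpoly)"
  hence "meval (mvar i) (\<lambda>_. 1 :: 'a) = 0" by simp
  thus False by simp
qed

lemma vbasis_dim1:
  fixes c :: "nat \<Rightarrow> 'a::field_char_0"
  assumes "c 0 \<noteq> 0"
  shows "vbasis 1 {c} [mvar]"
proof -
  have van: "vanishes_on {..<1} c p \<longleftrightarrow> (\<exists>q\<in>poly_ring 1. p = q * mvar 0)" if "p \<in> poly_ring 1" for p :: "(nat, 'a) mpoly"
  proof
    assume v: "vanishes_on {..<1} c p"
    have z: "(0::nat) \<in> {..<1}" and pR: "p \<in> polys_in {..<1}" using that by (simp_all add: poly_ring_eq)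
    obtain q where q: "q \<in> polys_in {..<1}" "p = lform {..<1} c * q"
      using vanishes_on_dvd[where c=c, OF finite_lessThan z assms pR v] by blast
    have "p = (mconst (c 0) * q) * mvar 0" using q(2) by (simp add: lform_def mult.commute mult.left_commute)
    thus "\<exists>q\<in>poly_ring 1. p = q * mvar 0" using q(1) by (auto simp: poly_ring_eq)
  next
    assume "\<exists>q\<in>poly_ring 1. p = q * mvar 0"
    thus "vanishes_on {..<1} c p" using assms by (auto simp: vanishes_on_def meval_simps)
  qed
  show ?thesis
    unfolding vbasis_def
  proof (intro conjI ballI impI allI)
    fix g :: "nat \<Rightarrow> (nat, 'a) mpoly" assume g: "g \<in> set [mvar]"
    show "g \<in> vfields 1" using g by (auto simp: vfields_def poly_ring_eq)
    fix d assume "d \<in> {c}"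
    thus "tangent 1 d g" using g by (auto simp: tangent_def lin_def vanishes_on_def meval_simps)
  next
    fix g :: "nat \<Rightarrow> (nat, 'a) mpoly" assume g: "g \<in> vfields 1" "\<forall>d\<in>{c}. tangent 1 d g"
    have "vanishes_on {..<1} c (g 0)"
      using g(2) assms by (auto simp: tangent_def lin_def vanishes_on_def meval_simps)
    then obtain q where "q \<in> poly_ring 1" "g 0 = q * mvar 0" using van[of "g 0"] g(1) by (auto simp: vfields_def)
    thus "\<exists>p. (\<forall>j<length [mvar]. p j \<in> poly_ring 1) \<and> (\<forall>i<1. g i = (\<Sum>j<length [mvar]. p j * ([mvar] ! j) i))"
      by (intro exI[of _ "\<lambda>_. q"]) auto
  next
    fix p :: "nat \<Rightarrow> (nat, 'a) mpoly" and j :: nat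
    assume p: "(\<forall>j<length [mvar]. p j \<in> poly_ring 1) \<and> (\<forall>i<1. (\<Sum>j<length [mvar]. p j * ([mvar] ! j) i) = 0)"
      and j: "j < length [mvar :: nat \<Rightarrow> (nat, 'a) mpoly]"
    hence "p 0 * mvar 0 = 0" by auto
    thus "p j = 0" using j by simp
  qed
qed

lemma meval_of_nat [simp]: "meval (of_nat k) v = of_nat k"
  by (induction k) (simp_all add: meval_add)

lemma lessThan_two: "{..<2} = {0, 1::nat}" by auto

lemma sum_two: "(\<Sum>i<2. f i) = f 0 + f (1::nat)"
  by (simp add: lessThan_two)

lemma orthogonal_det2:
  fixes a b :: "'a::field"
  assumes "a * x + b * y = 0" "a * p + b * q = 0" "a \<noteq> 0 \<or> b \<noteq> 0"
  shows "y * p - x * q = 0"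
proof -
  have *: "a * x = - (b * y)" "a * p = - (b * q)"
    using assms(1,2) by (simp_all add: eq_neg_iff_add_eq_0)
  have "a * (y * p - x * q) = y * (a * p) - (a * x) * q" by (simp add: algebra_simps)
  also have "\<dots> = 0" unfolding * by (simp add: algebra_simps)
  finally have 1: "a = 0 \<or> y * p - x * q = 0" by simp
  have **: "b * y = - (a * x)" "b * q = - (a * p)"
    using assms(1,2) by (simp_all add: eq_neg_iff_add_eq_0 add.commute)
  have "b * (y * p - x * q) = (b * y) * p - x * (b * q)" by (simp add: algebra_simps)
  also have "\<dots> = 0" unfolding ** by (simp add: algebra_simps)
  finally show ?thesis using 1 assms(3) by auto
qed

text \<open>The second basis field is the Hamiltonian field of the product \<open>Q\<close> of the forms. It annihilates \<open>Q\<close>, and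
  by Euler's relation its determinant with the Euler field is a nonzero multiple of \<open>Q\<close>.\<close>

lemma vbasis_dim2:
  fixes c :: "'b \<Rightarrow> nat \<Rightarrow> 'a::field_char_0"
  assumes "finite B" "B \<noteq> {}"
    and nz: "\<And>H. H \<in> B \<Longrightarrow> \<exists>k<2. c H k \<noteq> 0"
    and distinct: "\<And>H K. H \<in> B \<Longrightarrow> K \<in> B \<Longrightarrow> H \<noteq> K \<Longrightarrow> \<not> vanishes_on {..<2} (c H) (lform {..<2} (c K))"
  defines "Q \<equiv> \<Prod>H\<in>B. lform {..<2} (c H)"
  defines "\<theta> \<equiv> (\<lambda>i::nat. if i = 0 then mpd 1 Q else - mpd 0 Q)"
  shows "vbasis 2 (c ` B) [mvar, \<theta>]"
proof -
  have QR: "Q \<in> polys_in {..<2}" by (auto simp: Q_def intro!: polys_in_prod)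
  have dR: "mpd i Q \<in> polys_in {..<2}" for i by (rule mpd_polys_in[OF QR])
  have Q0: "Q \<noteq> 0"
  proof -
    have "lform {..<2} (c H) \<noteq> 0" if "H \<in> B" for H
      using nz[OF that] lform_nonzero[of "{..<2}" _ "c H"] by auto
    thus ?thesis unfolding Q_def using assms(1) by (simp add: prod_zero_iff)
  qed
  have vE: "(mvar :: nat \<Rightarrow> (nat, 'a) mpoly) \<in> vfields 2" by (auto simp: vfields_def poly_ring_eq)
  have v\<theta>: "\<theta> \<in> vfields 2" using dR by (auto simp: vfields_def poly_ring_eq \<theta>_def)
  have linE: "lin 2 d mvar = lform {..<2} d" for d :: "nat \<Rightarrow> 'a" by (simp add: lin_def lform_def)
  let ?k = "of_nat (card B) :: (nat, 'a) mpoly"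
  have euler: "mvar 0 * mpd 0 Q + mvar 1 * mpd 1 Q = ?k * Q"
  proof -
    have "der 2 mvar Q = (\<Sum>H\<in>B. lform {..<2} (c H) * (\<Prod>K\<in>B-{H}. lform {..<2} (c K)))"
      unfolding Q_def by (subst der_prod[OF assms(1)]) (simp add: der_lform linE)
    also have "\<dots> = (\<Sum>H\<in>B. Q)" unfolding Q_def using assms(1) by (intro sum.cong) (simp_all add: prod.remove)
    finally show ?thesis by (simp add: der_def sum_two)
  qed
  have kc: "?k = mconst (of_nat (card B))" by (rule mpoly_eqI) (simp add: meval_of_nat)
  have k0: "of_nat (card B) \<noteq> (0::'a)" using assms(1,2) by simp
  have tE: "tangent 2 d mvar" for d :: "nat \<Rightarrow> 'a" by (simp add: tangent_def linE vanishes_on_def)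
  have t\<theta>: "\<forall>H\<in>B. tangent 2 (c H) \<theta>"
  proof -
    have "der 2 \<theta> Q = Q * 0" by (simp add: der_def sum_two \<theta>_def)
    hence "\<exists>r\<in>poly_ring 2. der 2 \<theta> Q = Q * r" by (auto simp: poly_ring_eq)
    thus ?thesis using der_prod_dvd_iff[OF assms(1) v\<theta> nz distinct] by (simp add: Q_def)
  qed
  have w\<theta>: "mvar 1 * \<theta> 0 - mvar 0 * \<theta> 1 = ?k * Q"
    using euler by (simp add: \<theta>_def algebra_simps)
  have cancel: "\<exists>p\<in>polys_in {..<2}. h 0 = p * mvar 0 \<and> h 1 = p * mvar 1"
    if h: "h \<in> vfields 2" "mvar 1 * h 0 = mvar 0 * h 1" for h :: "nat \<Rightarrow> (nat, 'a) mpoly"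
  proof -
    let ?e = "\<lambda>i::nat. if i = 0 then 1 else 0 :: 'a"
    have le: "lform {..<2} ?e = mvar 0" by (rule mpoly_eqI) (simp add: sum_two)
    have h0: "h 0 \<in> polys_in {..<2}" using h(1) by (auto simp: vfields_def poly_ring_eq)
    have "vanishes_on {..<2} ?e (mvar 1 * h 0)"
      unfolding h(2) by (simp add: vanishes_on_def meval_simps sum_two)
    hence "vanishes_on {..<2} ?e (mvar 1) \<or> vanishes_on {..<2} ?e (h 0)"
      using h0 by (intro vanishes_on_prime[where k=0]) auto
    moreover have "\<not> vanishes_on {..<2} ?e (mvar 1)"
      by (auto simp: vanishes_on_def sum_two intro!: exI[of _ "\<lambda>i. if i = 1 then 1 else 0"])
    ultimately obtain p where p: "p \<in> polys_in {..<2}" "h 0 = mvar 0 * p"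
      using vanishes_on_dvd[of "{..<2}" 0 ?e "h 0"] h0 le by auto
    have "mvar 0 * h 1 = mvar 0 * (p * mvar 1)" unfolding h(2)[symmetric] p(2) by (simp add: algebra_simps)
    hence "h 1 = p * mvar 1" using mult_left_cancel[OF mvar_nonzero] by blast
    thus ?thesis using p by (auto simp: mult.commute)
  qed
  show ?thesis
    unfolding vbasis_def
  proof (intro conjI ballI impI allI)
    fix g :: "nat \<Rightarrow> (nat, 'a) mpoly" assume g: "g \<in> set [mvar, \<theta>]"
    show "g \<in> vfields 2" using g vE v\<theta> by auto
    fix d assume "d \<in> c ` B"
    thus "tangent 2 d g" using g tE t\<theta> by auto
  next
    fix g :: "nat \<Rightarrow> (nat, 'a) mpoly" assume g: "g \<in> vfields 2" "\<forall>d\<in>c ` B. tangent 2 d g"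
    let ?w = "mvar 1 * g 0 - mvar 0 * g 1"
    have gR: "g 0 \<in> polys_in {..<2}" "g 1 \<in> polys_in {..<2}" using g(1) by (auto simp: vfields_def poly_ring_eq)
    have "vanishes_on {..<2} (c H) ?w" if H: "H \<in> B" for H
      unfolding vanishes_on_def
    proof (intro allI impI)
      fix v assume "(\<Sum>i<2. c H i * v i) = 0"
      hence v: "c H 0 * v 0 + c H 1 * v 1 = 0" by (simp add: sum_two)
      have gv: "c H 0 * meval (g 0) v + c H 1 * meval (g 1) v = 0"
        using g(2) H \<open>(\<Sum>i<2. c H i * v i) = 0\<close>
        by (auto simp: tangent_def vanishes_on_def meval_lin sum_two)
      have "c H 0 \<noteq> 0 \<or> c H 1 \<noteq> 0" using nz[OF H] by (auto simp: less_2_cases_iff)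
      from orthogonal_det2[OF v gv this] show "meval ?w v = 0" by (simp add: meval_simps)
    qed
    note van = this
    have wR: "?w \<in> polys_in {..<2}" using gR by (intro polys_in_diff polys_in_mult polys_in_var) auto
    have nz': "\<And>H. H \<in> B \<Longrightarrow> \<exists>k\<in>{..<2}. c H k \<noteq> 0" using nz by blast
    obtain q where q: "q \<in> polys_in {..<2}" "?w = Q * q"
      using prod_lform_dvd[where c=c, OF finite_lessThan assms(1) wR nz' distinct van] unfolding Q_def by blast
    let ?a = "mconst (1 / of_nat (card B)) * q"
    have ka: "?k * ?a = q" unfolding kc using k0
      by (intro mpoly_eqI) (simp add: meval_simps)
    have aR: "?a \<in> polys_in {..<2}" using q by auto
    let ?h = "\<lambda>i. g i - ?a * \<theta> i"
    have "?h \<in> vfields 2" using g(1) v\<theta> aR by (auto simp: vfields_def poly_ring_eq)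
    moreover have "mvar 1 * ?h 0 = mvar 0 * ?h 1"
    proof -
      have "mvar 1 * ?h 0 - mvar 0 * ?h 1 = ?w - ?a * (mvar 1 * \<theta> 0 - mvar 0 * \<theta> 1)" by (simp add: algebra_simps)
      also have "\<dots> = Q * q - (?k * ?a) * Q" unfolding q(2) w\<theta> by (simp add: algebra_simps)
      also have "\<dots> = 0" unfolding ka by simp
      finally show ?thesis by simp
    qed
    ultimately obtain p where p: "p \<in> polys_in {..<2}" "?h 0 = p * mvar 0" "?h 1 = p * mvar 1" using cancel by blast
    have "g i = p * mvar i + ?a * \<theta> i" if "i < 2" for i
      using that p(2,3) by (auto simp: less_2_cases_iff algebra_simps)
    thus "\<exists>p. (\<forall>j<length [mvar, \<theta>]. p j \<in> poly_ring 2) \<and> (\<forall>i<2. g i = (\<Sum>j<length [mvar, \<theta>]. p j * ([mvar, \<theta>] ! j) i))"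
      using p(1) aR by (intro exI[of _ "\<lambda>j. if j = 0 then p else ?a"]) (auto simp: poly_ring_eq less_2_cases_iff)
  next
    fix p :: "nat \<Rightarrow> (nat, 'a) mpoly" and j :: nat
    assume p: "(\<forall>j<length [mvar, \<theta>]. p j \<in> poly_ring 2) \<and> (\<forall>i<2. (\<Sum>j<length [mvar, \<theta>]. p j * ([mvar, \<theta>] ! j) i) = 0)"
      and j: "j < length [mvar, \<theta>]"
    have p0: "p 0 * mvar 0 + p 1 * \<theta> 0 = 0" and p1: "p 0 * mvar 1 + p 1 * \<theta> 1 = 0" using p by auto
    have "p 1 * (?k * Q) = mvar 1 * (p 0 * mvar 0 + p 1 * \<theta> 0) - mvar 0 * (p 0 * mvar 1 + p 1 * \<theta> 1)"
      unfolding w\<theta>[symmetric] by (simp add: algebra_simps)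
    also have "\<dots> = 0" unfolding p0 p1 by simp
    finally have "p 1 = 0" using Q0 assms(1,2) by simp
    moreover have "p 0 = 0" using p0 \<open>p 1 = 0\<close> by simp
    ultimately show "p j = 0" using j by (auto simp: less_Suc_eq)
  qed
qed

lemma arrangement_equations:
  fixes V :: "('a::field_char_0 ^ 'n) set"
  assumes "arrangement V B" "coordinates V b"
  shows "\<exists>c. \<forall>H\<in>B. H = {\<Sum>i<vec.dim V. u i *s b i | u. (\<Sum>i<vec.dim V. c H i * u i) = 0}
    \<and> (\<exists>k<vec.dim V. c H k \<noteq> 0)"
proof -
  have "\<exists>c. H = {\<Sum>i<vec.dim V. u i *s b i | u. (\<Sum>i<vec.dim V. c i * u i) = 0} \<and> (\<exists>k<vec.dim V. c k \<noteq> 0)"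
    if H: "H \<in> B" for H
  proof -
    have "vec.subspace H" "H \<subseteq> V" "vec.dim V = vec.dim H + 1" using assms(1) H by (auto simp: arrangement_def)
    then obtain c where "H = {\<Sum>i<vec.dim V. u i *s b i | u. (\<Sum>i<vec.dim V. c i * u i) = 0}" "\<exists>k<vec.dim V. c k \<noteq> 0"
      by (rule hyperplane_equation[OF assms(2)])
    thus ?thesis by blast
  qed
  hence "\<forall>H\<in>B. \<exists>c. H = {\<Sum>i<vec.dim V. u i *s b i | u. (\<Sum>i<vec.dim V. c i * u i) = 0} \<and> (\<exists>k<vec.dim V. c k \<noteq> 0)"
    by blast
  from bchoice[OF this] show ?thesis .
qed

lemma same_kernel_if_vanishes:
  fixes b :: "nat \<Rightarrow> 'a::field_char_0 ^ 'n"
  assumes van: "vanishes_on {..<n} c (lform {..<n} d)" and k: "k < n" "c k \<noteq> 0" and d: "\<exists>k<n. d k \<noteq> 0"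
  shows "{\<Sum>i<n. u i *s b i | u. (\<Sum>i<n. c i * u i) = 0} = {\<Sum>i<n. u i *s b i | u. (\<Sum>i<n. d i * u i) = 0}"
proof -
  define t where "t = d k / c k"
  have t: "\<forall>i<n. d i = t * c i"
    using parallel_if_vanishes[where a="c" and b="d" and k=k and I="{..<n}", OF _ _ k(2) van] k(1)
    unfolding t_def by blast
  have "t \<noteq> 0" using d t by auto
  have "(\<Sum>i<n. d i * u i) = t * (\<Sum>i<n. c i * u i)" for u
    using t by (simp add: sum_distrib_left mult.assoc)
  thus ?thesis using \<open>t \<noteq> 0\<close> by simp
qed

lemma has_exponents_dim1:
  fixes V :: "('a::field_char_0 ^ 'n) set"
  assumes "vec.subspace V" "vec.dim V = 1"
  shows "has_exponents V {{0}} {#1#}"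
proof -
  obtain b where b: "coordinates V b" using assms(1) by (rule coordinates_exist)
  have H: "vec.subspace {0 :: 'a^'n}" "{0} \<subseteq> V" "vec.dim V = vec.dim {0 :: 'a^'n} + 1"
    using assms by (auto simp: vec.subspace_0 vec.subspace_single_0)
  obtain c where c: "{0} = {\<Sum>i<vec.dim V. u i *s b i | u. (\<Sum>i<vec.dim V. c i * u i) = 0}" "\<exists>k<vec.dim V. c k \<noteq> 0"
    by (rule hyperplane_equation[OF b H])
  have c': "\<exists>k<1. c k \<noteq> 0" using c(2) assms(2) by simp
  have bas: "vbasis 1 ((\<lambda>_. c) ` {{0}}) [mvar]" using c' vbasis_dim1[of c] by simp
  have "has_exponents V {{0}} (mset [1])"
  proof (rule has_exponentsI[OF b _ assms(2)[symmetric], where c="\<lambda>_. c" and G="[mvar]"])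
    fix H assume "H \<in> {{0 :: 'a^'n}}"
    thus "H = {\<Sum>i<1. u i *s b i | u. (\<Sum>i<1. c i * u i) = 0}"
      using c(1)[unfolded assms(2)] by (simp only: singleton_iff)
  qed (use c' bas in auto)
  thus ?thesis by simp
qed

lemma has_exponents_dim2:
  fixes V :: "('a::field_char_0 ^ 'n) set"
  assumes V: "vec.subspace V" "vec.dim V = 2" and B: "arrangement V B" "B \<noteq> {}"
  shows "has_exponents V B {#1, card B - 1#}"
proof -
  obtain b where b: "coordinates V b" using V(1) by (rule coordinates_exist)
  obtain c where "\<forall>H\<in>B. H = {\<Sum>i<2. u i *s b i | u. (\<Sum>i<2. c H i * u i) = 0} \<and> (\<exists>k<2. c H k \<noteq> 0)"
    using arrangement_equations[OF B(1) b] unfolding V(2) ..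
  hence c: "H \<in> B \<Longrightarrow> H = {\<Sum>i<2. u i *s b i | u. (\<Sum>i<2. c H i * u i) = 0}"
    "H \<in> B \<Longrightarrow> \<exists>k<2. c H k \<noteq> 0" for H by blast+
  have fB: "finite B" using B(1) by (simp add: arrangement_def)
  have distinct: "\<not> vanishes_on {..<2} (c H) (lform {..<2} (c K))" if HK: "H \<in> B" "K \<in> B" "H \<noteq> K" for H K
  proof
    assume van: "vanishes_on {..<2} (c H) (lform {..<2} (c K))"
    obtain k where k: "k < 2" "c H k \<noteq> 0" using c(2)[OF HK(1)] by blast
    have "H = K"
      by (rule trans[OF c(1)[OF HK(1)] trans[OF same_kernel_if_vanishes[OF van k c(2)[OF HK(2)]] c(1)[OF HK(2), symmetric]]])
    thus False using HK(3) by simp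
  qed
  let ?Q = "\<Prod>H\<in>B. lform {..<2} (c H)"
  let ?t = "\<lambda>i::nat. if i = 0 then mpd 1 ?Q else - mpd 0 ?Q"
  have hQ: "homogeneous (card B) ?Q"
    using homogeneous_prod[of B "\<lambda>_. Suc 0" "\<lambda>H. lform {..<2} (c H)"] by simp
  have ht: "homogeneous (card B - 1) (?t i)" for i
    using homogeneous_mpd[OF hQ] homogeneous_uminus[OF homogeneous_mpd[OF hQ]] by simp
  have "has_exponents V B (mset [1, card B - 1])"
  proof (rule has_exponentsI[OF b fB V(2)[symmetric] c(1) c(2), where G="[mvar, ?t]"])
    show "vbasis 2 (c ` B) [mvar, ?t]" by (rule vbasis_dim2[OF fB B(2) c(2) distinct])
    fix j i :: nat assume "j < length [mvar, ?t]"
    thus "homogeneous ([1, card B - 1] ! j) (([mvar, ?t] ! j) i)"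
      using ht[of i] by (cases j) auto
  qed auto
  thus ?thesis by simp
qed

lemma inductively_free_dim1:
  fixes V :: "('a::field_char_0 ^ 'n) set"
  assumes V: "vec.subspace V" "vec.dim V = 1"
  shows "inductively_free V {{0}}"
proof (rule inductively_free.add_hyperplane[where H="{0}"])
  show "arrangement V {{0}}" using V by (auto simp: arrangement_def vec.subspace_0 vec.subspace_single_0)
  show "has_exponents V {} (replicate_mset (vec.dim V) 0)" by (rule has_exponents_empty[OF V(1)])
  show "has_exponents {0 :: 'a^'n} {} (replicate_mset (vec.dim {0 :: 'a^'n}) 0)"
    by (rule has_exponents_empty[OF vec.subspace_single_0])
  show "inductively_free V {}" by (rule inductively_free.empty[OF V(1)])
  show "inductively_free {0 :: 'a^'n} {}" by (rule inductively_free.empty[OF vec.subspace_single_0])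
qed auto

text \<open>Lines in a plane can be added in any order: the restriction to each of them is \<open>{{0}}\<close> or empty.\<close>

lemma inductively_free_dim2:
  fixes V :: "('a::field_char_0 ^ 'n) set"
  assumes V: "vec.subspace V" "vec.dim V = 2" and "arrangement V B"
  shows "inductively_free V B"
proof -
  have "finite B" using assms(3) by (simp add: arrangement_def)
  thus ?thesis using assms(3)
  proof (induction B rule: finite_induct)
    case empty
    show ?case by (rule inductively_free.empty[OF V(1)])
  next
    case (insert H B)
    have H: "vec.subspace H" "H \<subseteq> V" "vec.dim H = 1" using insert.prems V(2) by (auto simp: arrangement_def)
    have arrB: "arrangement V B" using insert.prems by (auto simp: arrangement_def)
    have meet: "H \<inter> K = {0}" if K: "K \<in> B" for K
    proof -
      have K': "vec.subspace K" "vec.dim K = 1" using arrB K V(2) by (auto simp: arrangement_def)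
      have sub: "vec.subspace (H \<inter> K)" by (rule vec.subspace_inter[OF H(1) K'(1)])
      have "vec.dim (H \<inter> K) \<noteq> 1"
      proof
        assume d: "vec.dim (H \<inter> K) = 1"
        have "H \<inter> K = H" using vec.subspace_dim_equal[OF sub H(1)] d H(3) by auto
        moreover have "H \<inter> K = K" using vec.subspace_dim_equal[OF sub K'(1)] d K'(2) by auto
        ultimately show False using insert.hyps K by auto
      qed
      moreover have "vec.dim (H \<inter> K) \<le> vec.dim H" by (rule vec.dim_subset) auto
      ultimately have "vec.dim (H \<inter> K) = 0" using H(3) by linarith
      hence "H \<inter> K \<subseteq> {0}" by (simp only: vec.dim_eq_0)
      thus ?thesis using vec.subspace_0[OF sub] by auto
    qed
    have BH: "insert H B - {H} = B" using insert.hyps by auto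
    have im: "(\<lambda>K. H \<inter> K) ` B = (if B = {} then {} else {{0}})" using meet by auto
    have ifH: "inductively_free H ((\<lambda>K. H \<inter> K) ` B)"
      unfolding im using inductively_free.empty[OF H(1)] inductively_free_dim1[OF H(1,3)] by simp
    show ?case
    proof (cases "B = {}")
      case True
      show ?thesis
      proof (rule inductively_free.add_hyperplane[OF insert.prems _ BH[symmetric] refl insert.IH[OF arrB] ifH])
        show "has_exponents V B {#0, 0#}"
          using has_exponents_empty[OF V(1)] True V(2) by (simp add: numeral_2_eq_2)
        show "has_exponents H ((\<lambda>K. H \<inter> K) ` B) {#0#}"
          using has_exponents_empty[OF H(1)] True H(3) by simp
      qed auto
    next
      case False
      show ?thesis
      proof (rule inductively_free.add_hyperplane[OF insert.prems _ BH[symmetric] refl insert.IH[OF arrB] ifH])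
        show "has_exponents V B {#1, card B - 1#}" by (rule has_exponents_dim2[OF V arrB False])
        show "has_exponents H ((\<lambda>K. H \<inter> K) ` B) {#1#}"
          unfolding im using has_exponents_dim1[OF H(1,3)] False by simp
      qed auto
    qed
  qed
qed

section \<open>The addition theorem in dimension three\<close>

lemma vbasis3_iff:
  "vbasis 3 C [e, f, g] \<longleftrightarrow>
     (e \<in> vfields 3 \<and> f \<in> vfields 3 \<and> g \<in> vfields 3 \<and> (\<forall>c\<in>C. tangent 3 c e \<and> tangent 3 c f \<and> tangent 3 c g)) \<and>
     (\<forall>h\<in>vfields 3. (\<forall>c\<in>C. tangent 3 c h) \<longrightarrow>
        (\<exists>p\<in>poly_ring 3. \<exists>q\<in>poly_ring 3. \<exists>r\<in>poly_ring 3. \<forall>i<3. h i = p * e i + q * f i + r * g i)) \<and>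
     (\<forall>p\<in>poly_ring 3. \<forall>q\<in>poly_ring 3. \<forall>r\<in>poly_ring 3.
        (\<forall>i<3. p * e i + q * f i + r * g i = 0) \<longrightarrow> p = 0 \<and> q = 0 \<and> r = 0)"
  (is "?L \<longleftrightarrow> ?A \<and> ?B \<and> ?C")
proof -
  have len: "{..<length [e, f, g]} = {0, 1, 2}" by auto
  have all: "(\<forall>j<length [e, f, g]. P j) \<longleftrightarrow> P 0 \<and> P 1 \<and> P 2" for P :: "nat \<Rightarrow> bool"
    by (auto simp: less_Suc_eq numeral_2_eq_2)
  have sum: "(\<Sum>j<length [e, f, g]. p j * ([e, f, g] ! j) i) = p 0 * e i + p 1 * f i + p 2 * g i"
    for p :: "nat \<Rightarrow> (nat, 'a) mpoly" and i
    unfolding len by (simp add: add.assoc)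
  have ex: "(\<exists>p. (\<forall>j<length [e, f, g]. p j \<in> poly_ring 3) \<and> (\<forall>i<3. h i = (\<Sum>j<length [e, f, g]. p j * ([e, f, g] ! j) i)))
     \<longleftrightarrow> (\<exists>p\<in>poly_ring 3. \<exists>q\<in>poly_ring 3. \<exists>r\<in>poly_ring 3. \<forall>i<3. h i = p * e i + q * f i + r * g i)" for h
    unfolding all sum
  proof
    assume "\<exists>p\<in>poly_ring 3. \<exists>q\<in>poly_ring 3. \<exists>r\<in>poly_ring 3. \<forall>i<3. h i = p * e i + q * f i + r * g i"
    then obtain p q r where "p \<in> poly_ring 3" "q \<in> poly_ring 3" "r \<in> poly_ring 3" "\<forall>i<3. h i = p * e i + q * f i + r * g i"
      by blast
    thus "\<exists>p::nat \<Rightarrow> (nat, 'a) mpoly. (p 0 \<in> poly_ring 3 \<and> p 1 \<in> poly_ring 3 \<and> p 2 \<in> poly_ring 3) \<and> (\<forall>i<3. h i = p 0 * e i + p 1 * f i + p 2 * g i)"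
      by (intro exI[of _ "\<lambda>j::nat. if j = 0 then p else if j = 1 then q else r"]) simp
  qed blast
  have indep: "(\<forall>p. (\<forall>j<length [e, f, g]. p j \<in> poly_ring 3) \<and> (\<forall>i<3. (\<Sum>j<length [e, f, g]. p j * ([e, f, g] ! j) i) = 0)
        \<longrightarrow> (\<forall>j<length [e, f, g]. p j = 0)) \<longleftrightarrow> ?C"
    unfolding all sum
  proof
    assume H: "\<forall>p::nat \<Rightarrow> (nat, 'a) mpoly. (p 0 \<in> poly_ring 3 \<and> p 1 \<in> poly_ring 3 \<and> p 2 \<in> poly_ring 3) \<and>
        (\<forall>i<3. p 0 * e i + p 1 * f i + p 2 * g i = 0) \<longrightarrow> p 0 = 0 \<and> p 1 = 0 \<and> p 2 = 0"
    show ?C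
    proof (intro ballI impI)
      fix p q r assume "p \<in> poly_ring 3" "q \<in> poly_ring 3" "r \<in> poly_ring 3" "\<forall>i<3. p * e i + q * f i + r * g i = 0"
      thus "p = 0 \<and> q = 0 \<and> r = 0"
        using H[rule_format, of "\<lambda>j::nat. if j = 0 then p else if j = 1 then q else r"] by simp
    qed
  qed blast
  show ?thesis
    unfolding vbasis_def ex indep by (rule conj_cong, auto)
qed

lemma vbasis3I:
  assumes v: "e \<in> vfields 3" "f \<in> vfields 3" "g \<in> vfields 3"
    and t: "\<And>c. c \<in> C \<Longrightarrow> tangent 3 c e" "\<And>c. c \<in> C \<Longrightarrow> tangent 3 c f" "\<And>c. c \<in> C \<Longrightarrow> tangent 3 c g"
    and sp: "\<And>h. h \<in> vfields 3 \<Longrightarrow> \<forall>c\<in>C. tangent 3 c h \<Longrightarrow>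
        \<exists>p\<in>poly_ring 3. \<exists>q\<in>poly_ring 3. \<exists>r\<in>poly_ring 3. \<forall>i<3. h i = p * e i + q * f i + r * g i"
    and ind: "\<And>p q r. p \<in> poly_ring 3 \<Longrightarrow> q \<in> poly_ring 3 \<Longrightarrow> r \<in> poly_ring 3 \<Longrightarrow>
        \<forall>i<3. p * e i + q * f i + r * g i = 0 \<Longrightarrow> p = 0 \<and> q = 0 \<and> r = 0"
  shows "vbasis 3 C [e, f, g]"
  unfolding vbasis3_iff
proof (intro conjI ballI impI)
  fix h assume "h \<in> vfields 3" "\<forall>c\<in>C. tangent 3 c h"
  thus "\<exists>p\<in>poly_ring 3. \<exists>q\<in>poly_ring 3. \<exists>r\<in>poly_ring 3. \<forall>i<3. h i = p * e i + q * f i + r * g i"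
    by (rule sp)
qed (use v t ind in blast)+

definition dot3 :: "(nat \<Rightarrow> 'a::field_char_0) \<Rightarrow> (nat \<Rightarrow> 'a) \<Rightarrow> 'a" where
  "dot3 c u = (\<Sum>i<3. c i * u i)"

lemma lessThan_three: "{..<3} = {0, 1, 2::nat}" by auto

lemma dot3_alt: "dot3 c u = c 0 * u 0 + c 1 * u 1 + c 2 * u 2"
  by (simp add: dot3_def lessThan_three add.assoc)

abbreviation form3 :: "(nat \<Rightarrow> 'a::field_char_0) \<Rightarrow> (nat, 'a) mpoly" where
  "form3 c \<equiv> lform {..<3} c"

abbreviation van3 :: "(nat \<Rightarrow> 'a::field_char_0) \<Rightarrow> (nat, 'a) mpoly \<Rightarrow> bool" where
  "van3 c p \<equiv> vanishes_on {..<3} c p"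

lemma meval_form3: "meval (form3 c) v = dot3 c v"
  by (simp add: dot3_def)

lemma van3_alt: "van3 c p \<longleftrightarrow> (\<forall>v. dot3 c v = 0 \<longrightarrow> meval p v = 0)"
  by (simp add: vanishes_on_def dot3_def)

definition nonzero3 :: "(nat \<Rightarrow> 'a::field_char_0) \<Rightarrow> bool" where
  "nonzero3 c \<longleftrightarrow> (\<exists>k<3. c k \<noteq> 0)"

lemma van3_prime:
  assumes "nonzero3 c" "p \<in> poly_ring 3" "q \<in> poly_ring 3" "van3 c (p * q)"
  shows "van3 c p \<or> van3 c q"
  using assms vanishes_on_prime[of "{..<3}" _ c p q] by (auto simp: nonzero3_def poly_ring_eq)

lemma van3_dvd:
  assumes "nonzero3 c" "p \<in> poly_ring 3" "van3 c p"
  obtains q where "q \<in> poly_ring 3" "p = form3 c * q"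
  using assms vanishes_on_dvd[of "{..<3}" _ c p] by (auto simp: nonzero3_def poly_ring_eq)

lemma van3_prod:
  assumes "nonzero3 c" "finite T" "\<And>x. x \<in> T \<Longrightarrow> f x \<in> poly_ring 3" "van3 c (prod f T)"
  shows "\<exists>x\<in>T. van3 c (f x)"
  using assms vanishes_on_prod[of "{..<3}" _ c T f] by (auto simp: nonzero3_def poly_ring_eq)

lemma poly_ring_rules:
  "p \<in> poly_ring n \<Longrightarrow> q \<in> poly_ring n \<Longrightarrow> p + q \<in> poly_ring n"
  "p \<in> poly_ring n \<Longrightarrow> q \<in> poly_ring n \<Longrightarrow> p - q \<in> poly_ring n"
  "p \<in> poly_ring n \<Longrightarrow> q \<in> poly_ring n \<Longrightarrow> p * q \<in> poly_ring n"
  "p \<in> poly_ring n \<Longrightarrow> - p \<in> poly_ring n"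
  "p \<in> poly_ring n \<Longrightarrow> p ^ k \<in> poly_ring n"
  "mconst a \<in> poly_ring n" "0 \<in> poly_ring n" "1 \<in> poly_ring n" "lform {..<n} c \<in> poly_ring n"
  "(\<And>x. x \<in> T \<Longrightarrow> f x \<in> poly_ring n) \<Longrightarrow> sum f T \<in> poly_ring n"
  "(\<And>x. x \<in> T \<Longrightarrow> f x \<in> poly_ring n) \<Longrightarrow> prod f T \<in> poly_ring n"
  "i < n \<Longrightarrow> mvar i \<in> poly_ring n"
  "g \<in> vfields n \<Longrightarrow> lin n c g \<in> poly_ring n"
  for p q :: "(nat, 'a::field_char_0) mpoly"
  by (auto simp: poly_ring_eq lin_poly_ring)

lemma lin_comb:
  "(\<And>i. i < n \<Longrightarrow> h i = p * e i + q * f i + r * g i) \<Longrightarrow> lin n c h = p * lin n c e + q * lin n c f + r * lin n c g"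
  by (simp add: lin_def sum_distrib_left algebra_simps sum.distrib)

lemma lin_scale: "lin n c (\<lambda>i. p * g i) = p * lin n c g"
  by (simp add: lin_def sum_distrib_left algebra_simps)

lemma lin_euler: "lin n c mvar = lform {..<n} c"
  by (simp add: lin_def lform_def)

lemma tangent_euler: "tangent n c mvar"
  by (simp add: tangent_def lin_euler vanishes_on_def)

lemma homogeneous_lin:
  "(\<And>i. i < n \<Longrightarrow> homogeneous d (g i)) \<Longrightarrow> homogeneous d (lin n c g)"
  unfolding lin_def by (intro homogeneous_sum homogeneous_smult) auto

lemma vbasis_change:
  assumes "vbasis 3 C [e, f, g]" "q \<in> poly_ring 3"
  shows "vbasis 3 C [e, \<lambda>i. f i - q * g i, g]"
proof -
  note H = assms(1)[unfolded vbasis3_iff]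
  note H1 = H[THEN conjunct1] and H2 = H[THEN conjunct2, THEN conjunct1] and H3 = H[THEN conjunct2, THEN conjunct2]
  let ?f = "\<lambda>i. f i - q * g i"
  have l: "lin 3 c ?f = lin 3 c f - q * lin 3 c g" for c
    by (simp add: lin_def sum_distrib_left algebra_simps sum_subtractf)
  have t: "\<forall>c\<in>C. tangent 3 c ?f"
    using H1 by (auto simp: tangent_def l van3_alt meval_simps)
  have v: "?f \<in> vfields 3" using H1 assms(2) by (auto simp: vfields_def intro!: poly_ring_rules)
  have sp: "\<exists>p\<in>poly_ring 3. \<exists>q'\<in>poly_ring 3. \<exists>r\<in>poly_ring 3. \<forall>i<3. h i = p * e i + q' * ?f i + r * g i"
    if h: "h \<in> vfields 3" "\<forall>c\<in>C. tangent 3 c h" for h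
  proof -
    obtain p q' r where *: "p \<in> poly_ring 3" "q' \<in> poly_ring 3" "r \<in> poly_ring 3" "\<forall>i<3. h i = p * e i + q' * f i + r * g i"
      using mp[OF bspec[OF H2 h(1)] h(2)] by blast
    have "r + q' * q \<in> poly_ring 3" using * assms(2) by (intro poly_ring_rules)
    moreover have "\<forall>i<3. h i = p * e i + q' * ?f i + (r + q' * q) * g i" using *(4) by (simp add: algebra_simps)
    ultimately show ?thesis using *(1,2) by blast
  qed
  have ind: "p = 0 \<and> q' = 0 \<and> r = 0" if "p \<in> poly_ring 3" "q' \<in> poly_ring 3" "r \<in> poly_ring 3"
    "\<forall>i<3. p * e i + q' * ?f i + r * g i = 0" for p q' r
  proof -
    have "r - q' * q \<in> poly_ring 3" using that assms(2) by (intro poly_ring_rules)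
    moreover have "\<forall>i<3. p * e i + q' * f i + (r - q' * q) * g i = 0" using that(4) by (simp add: algebra_simps)
    ultimately have "p = 0 \<and> q' = 0 \<and> r - q' * q = 0" using H3 that(1,2) by blast
    thus ?thesis by auto
  qed
  show ?thesis
    by (rule vbasis3I[OF _ v _ _ _ _ sp ind]) (use H1 t in auto)
qed

lemma vbasis_swap:
  assumes "vbasis 3 C [e, f, g]"
  shows "vbasis 3 C [e, g, f]"
proof -
  note H = assms[unfolded vbasis3_iff]
  note H1 = H[THEN conjunct1] and H2 = H[THEN conjunct2, THEN conjunct1] and H3 = H[THEN conjunct2, THEN conjunct2]
  have sp: "\<exists>p\<in>poly_ring 3. \<exists>q'\<in>poly_ring 3. \<exists>r\<in>poly_ring 3. \<forall>i<3. h i = p * e i + q' * g i + r * f i"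
    if h: "h \<in> vfields 3" "\<forall>c\<in>C. tangent 3 c h" for h
  proof -
    obtain p q' r where *: "p \<in> poly_ring 3" "q' \<in> poly_ring 3" "r \<in> poly_ring 3" "\<forall>i<3. h i = p * e i + q' * f i + r * g i"
      using mp[OF bspec[OF H2 h(1)] h(2)] by blast
    have "\<forall>i<3. h i = p * e i + r * g i + q' * f i" using *(4) by (simp add: algebra_simps)
    thus ?thesis using *(1-3) by blast
  qed
  have ind: "p = 0 \<and> q' = 0 \<and> r = 0" if "p \<in> poly_ring 3" "q' \<in> poly_ring 3" "r \<in> poly_ring 3"
    "\<forall>i<3. p * e i + q' * g i + r * f i = 0" for p q' r
  proof -
    have "\<forall>i<3. p * e i + r * f i + q' * g i = 0" using that(4) by (simp add: algebra_simps)
    hence "p = 0 \<and> r = 0 \<and> q' = 0" using H3 that(1-3) by blast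
    thus ?thesis by auto
  qed
  show ?thesis
    by (rule vbasis3I[OF _ _ _ _ _ _ sp ind]) (use H1 in auto)
qed

text \<open>If the first two fields are tangent to the new plane, then only the third has to be multiplied
  by its equation. That no smaller multiple suffices follows from primality of the form.\<close>

lemma vbasis_insert:
  assumes bas: "vbasis 3 C [e, f, g]" and \<alpha>: "nonzero3 \<alpha>" and t: "tangent 3 \<alpha> e" "tangent 3 \<alpha> f" "\<not> tangent 3 \<alpha> g"
  shows "vbasis 3 (insert \<alpha> C) [e, f, \<lambda>i. form3 \<alpha> * g i]"
proof -
  note H = bas[unfolded vbasis3_iff]
  note H1 = H[THEN conjunct1] and H2 = H[THEN conjunct2, THEN conjunct1] and H3 = H[THEN conjunct2, THEN conjunct2]
  let ?g = "\<lambda>i. form3 \<alpha> * g i"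
  have tg: "\<forall>c\<in>insert \<alpha> C. tangent 3 c ?g"
    using H1 by (auto simp: tangent_def lin_scale van3_alt meval_mult meval_form3 simp del: meval_lform)
  have v: "?g \<in> vfields 3" using H1 by (auto simp: vfields_def intro!: poly_ring_rules)
  have sp: "\<exists>p\<in>poly_ring 3. \<exists>q'\<in>poly_ring 3. \<exists>r\<in>poly_ring 3. \<forall>i<3. h i = p * e i + q' * f i + r * ?g i"
    if h: "h \<in> vfields 3" "\<forall>c\<in>insert \<alpha> C. tangent 3 c h" for h
  proof -
    obtain p q r where *: "p \<in> poly_ring 3" "q \<in> poly_ring 3" "r \<in> poly_ring 3" "\<forall>i<3. h i = p * e i + q * f i + r * g i"
      using mp[OF bspec[OF H2 h(1)]] h(2) by blast
    have "lin 3 \<alpha> h = p * lin 3 \<alpha> e + q * lin 3 \<alpha> f + r * lin 3 \<alpha> g" by (rule lin_comb) (use *(4) in auto)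
    moreover have "van3 \<alpha> (lin 3 \<alpha> h)" using h(2) by (auto simp: tangent_def)
    ultimately have "van3 \<alpha> (r * lin 3 \<alpha> g)"
      using t(1,2) by (auto simp: tangent_def van3_alt meval_simps)
    hence "van3 \<alpha> r" using van3_prime[OF \<alpha> *(3)] H1 t(3) by (auto simp: tangent_def intro!: poly_ring_rules)
    then obtain s where s: "s \<in> poly_ring 3" "r = form3 \<alpha> * s" using van3_dvd[OF \<alpha> *(3)] by blast
    have "\<forall>i<3. h i = p * e i + q * f i + s * ?g i" using *(4) s(2) by (simp add: algebra_simps)
    thus ?thesis using *(1,2) s(1) by blast
  qed
  have fz: "form3 \<alpha> \<noteq> 0" using \<alpha> lform_nonzero[of "{..<3}" _ \<alpha>] by (auto simp: nonzero3_def)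
  have ind: "p = 0 \<and> q' = 0 \<and> r = 0" if "p \<in> poly_ring 3" "q' \<in> poly_ring 3" "r \<in> poly_ring 3"
    "\<forall>i<3. p * e i + q' * f i + r * ?g i = 0" for p q' r
  proof -
    have "r * form3 \<alpha> \<in> poly_ring 3" using that by (intro poly_ring_rules)
    moreover have "\<forall>i<3. p * e i + q' * f i + (r * form3 \<alpha>) * g i = 0" using that(4) by (simp add: algebra_simps)
    ultimately have "p = 0 \<and> q' = 0 \<and> r * form3 \<alpha> = 0" using H3 that(1,2) by blast
    thus ?thesis using fz by auto
  qed
  show ?thesis
    by (rule vbasis3I[OF _ _ v _ _ _ sp ind]) (use H1 tg t(1,2) in auto)
qed

text \<open>Two vectors \<open>p\<close>, \<open>q\<close> span the plane, and \<open>\<sigma>\<close>, \<open>\<rho>\<close> are the dual coordinates. The vector \<open>q\<close> is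
  chosen off the finitely many other planes, so that each of them meets the affine line \<open>p + t q\<close>
  in exactly one point.\<close>

lemma plane_parametrisation:
  fixes \<alpha> :: "nat \<Rightarrow> 'a::field_char_0"
  assumes "nonzero3 \<alpha>" "finite C" "\<And>c. c \<in> C \<Longrightarrow> \<not> van3 \<alpha> (form3 c)"
  obtains p q \<sigma> \<rho> where "dot3 \<alpha> p = 0" "dot3 \<alpha> q = 0"
    "\<And>u i. dot3 \<alpha> u = 0 \<Longrightarrow> i < 3 \<Longrightarrow> u i = dot3 \<sigma> u * p i + dot3 \<rho> u * q i"
    "dot3 \<sigma> p = 1" "dot3 \<sigma> q = 0" "dot3 \<rho> p = 0" "dot3 \<rho> q = 1"
    "\<And>c. c \<in> C \<Longrightarrow> dot3 c q \<noteq> 0"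
proof -
  obtain k where k: "k < 3" "\<alpha> k \<noteq> 0" using assms(1) by (auto simp: nonzero3_def)
  obtain l m where lm: "l < 3" "m < 3" "{..<3} = {k, l, m}" "k \<noteq> l" "k \<noteq> m" "l \<noteq> m"
  proof -
    consider "k = 0" | "k = 1" | "k = 2" using k(1) by linarith
    thus ?thesis
    proof cases
      case 1 show ?thesis by (rule that[of 1 2]) (use 1 in auto)
    next
      case 2 show ?thesis by (rule that[of 0 2]) (use 2 in auto)
    next
      case 3 show ?thesis by (rule that[of 0 1]) (use 3 in auto)
    qed
  qed
  have d3: "dot3 c u = c k * u k + c l * u l + c m * u m" for c u :: "nat \<Rightarrow> 'a"
    unfolding dot3_def lm(3) using lm by (simp add: add.assoc)
  define e1 where "e1 = (\<lambda>i. if i = l then 1 else if i = k then - (\<alpha> l / \<alpha> k) else 0)"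
  define e2 where "e2 = (\<lambda>i. if i = m then 1 else if i = k then - (\<alpha> m / \<alpha> k) else 0)"
  have e: "e1 k = - (\<alpha> l / \<alpha> k)" "e1 l = 1" "e1 m = 0" "e2 k = - (\<alpha> m / \<alpha> k)" "e2 l = 0" "e2 m = 1"
    using lm by (auto simp: e1_def e2_def)
  have on: "dot3 \<alpha> e1 = 0" "dot3 \<alpha> e2 = 0" using k(2) by (simp_all add: d3 e)
  have rep: "u i = u l * e1 i + u m * e2 i" if u: "dot3 \<alpha> u = 0" and i: "i < 3" for u i
  proof -
    have "\<alpha> k * u k = - (\<alpha> l * u l) - \<alpha> m * u m" using u by (simp add: d3 algebra_simps eq_neg_iff_add_eq_0)
    hence "u k = - (\<alpha> l / \<alpha> k) * u l - (\<alpha> m / \<alpha> k) * u m" using k(2) by (simp add: field_simps)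
    moreover have "i = k \<or> i = l \<or> i = m" using i lm(3) by auto
    ultimately show ?thesis by (auto simp: e algebra_simps)
  qed
  have "finite ((\<lambda>c. - (dot3 c e2 / dot3 c e1)) ` C)" using assms(2) by simp
  then obtain s where s: "s \<notin> (\<lambda>c. - (dot3 c e2 / dot3 c e1)) ` C"
    using ex_new_if_finite infinite_UNIV_char_0 by blast
  define q where "q = (\<lambda>i. e2 i + s * e1 i)"
  have dq: "dot3 c q = dot3 c e2 + s * dot3 c e1" for c by (simp add: d3 q_def algebra_simps)
  have cq: "dot3 c q \<noteq> 0" if c: "c \<in> C" for c
  proof (cases "dot3 c e1 = 0")
    case True
    have "dot3 c e2 \<noteq> 0"
    proof
      assume "dot3 c e2 = 0"
      have "meval (form3 c) v = 0" if "dot3 \<alpha> v = 0" for v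
      proof -
        have "dot3 c v = (\<Sum>i<3. c i * (v l * e1 i + v m * e2 i))"
          unfolding dot3_def by (intro sum.cong refl) (use rep[OF that] in auto)
        also have "\<dots> = v l * dot3 c e1 + v m * dot3 c e2"
          by (simp add: dot3_def sum_distrib_left algebra_simps sum.distrib)
        finally show ?thesis using True \<open>dot3 c e2 = 0\<close> by (simp add: meval_form3 del: meval_lform)
      qed
      thus False using assms(3)[OF c] by (auto simp: van3_alt)
    qed
    thus ?thesis using True by (simp add: dq)
  next
    case False
    have "s \<noteq> - (dot3 c e2 / dot3 c e1)" using s c by blast
    thus ?thesis using False by (auto simp: dq field_simps eq_neg_iff_add_eq_0)
  qed
  define \<sigma> where "\<sigma> = (\<lambda>i. if i = l then 1 else if i = m then - s else 0)"
  define \<rho> where "\<rho> = (\<lambda>i. if i = m then 1 else 0 :: 'a)"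
  have sr: "dot3 \<sigma> u = u l - s * u m" "dot3 \<rho> u = u m" for u
    using lm by (auto simp: d3 \<sigma>_def \<rho>_def)
  show ?thesis
  proof (rule that[of e1 q \<sigma> \<rho>])
    show "dot3 \<alpha> e1 = 0" "dot3 \<alpha> q = 0" using on by (simp_all add: dq)
    show "u i = dot3 \<sigma> u * e1 i + dot3 \<rho> u * q i" if "dot3 \<alpha> u = 0" "i < 3" for u i
      using rep[OF that] by (simp add: sr q_def algebra_simps)
    show "dot3 \<sigma> e1 = 1" "dot3 \<sigma> q = 0" "dot3 \<rho> e1 = 0" "dot3 \<rho> q = 1" by (simp_all add: sr e q_def)
  qed (rule cq)
qed

lemma prod_smult_const:
  fixes r :: "'a::comm_ring_1 poly"
  shows "finite T \<Longrightarrow> (\<Prod>x\<in>T. Polynomial.smult (a x) r) = Polynomial.smult (\<Prod>x\<in>T. a x) (r ^ card T)"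
  by (induction T rule: finite_induct) (simp_all add: mult.commute)

lemma prod_linear_powers_dvd:
  fixes f :: "'a::field_char_0 poly"
  assumes "finite T" "\<And>t. t \<in> T \<Longrightarrow> [:-t, 1:] ^ k t dvd f"
  shows "(\<Prod>t\<in>T. [:-t, 1:] ^ k t) dvd f"
  using assms
proof (induction T arbitrary: f rule: finite_induct)
  case (insert t T)
  show ?case
  proof (cases "f = 0")
    case False
    obtain g where g: "f = [:-t, 1:] ^ k t * g" using insert.prems[of t] by (auto elim: dvdE)
    have "[:-s, 1:] ^ k s dvd g" if s: "s \<in> T" for s
    proof -
      have "k s \<le> Polynomial.order s f" using insert.prems[of s] s False by (simp add: order_divides)
      also have "Polynomial.order s f = Polynomial.order s ([:-t, 1:] ^ k t) + Polynomial.order s g"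
        using False g by (simp add: order_mult)
      also have "Polynomial.order s ([:-t, 1:] ^ k t) = 0"
        using s insert.hyps by (intro order_0I) (auto simp: poly_power)
      finally show ?thesis by (simp add: order_divides)
    qed
    hence "(\<Prod>t\<in>T. [:-t, 1:] ^ k t) dvd g" by (rule insert.IH)
    thus ?thesis unfolding g using insert.hyps by simp
  qed simp
qed simp

text \<open>A form restricted to the plane is determined by its values on the affine line \<open>p + t q\<close>; this
  replaces binary forms by univariate polynomials of bounded degree.\<close>

locale plane_param =
  fixes \<alpha> p q \<sigma> \<rho> :: "nat \<Rightarrow> 'a::field_char_0"
  assumes nz\<alpha>: "nonzero3 \<alpha>" and \<alpha>p: "dot3 \<alpha> p = 0" and \<alpha>q: "dot3 \<alpha> q = 0"
    and rep: "\<And>u i. dot3 \<alpha> u = 0 \<Longrightarrow> i < 3 \<Longrightarrow> u i = dot3 \<sigma> u * p i + dot3 \<rho> u * q i"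
    and dual: "dot3 \<sigma> p = 1" "dot3 \<sigma> q = 0" "dot3 \<rho> p = 0" "dot3 \<rho> q = 1"
begin

definition pt :: "'a \<Rightarrow> nat \<Rightarrow> 'a" where "pt t = (\<lambda>i. p i + t * q i)"

lemma dot_pt: "dot3 c (pt t) = dot3 c p + t * dot3 c q"
  by (simp add: dot3_alt pt_def algebra_simps)

lemma dot_on_plane:
  assumes "dot3 \<alpha> u = 0"
  shows "dot3 c u = dot3 \<sigma> u * dot3 c p + dot3 \<rho> u * dot3 c q"
proof -
  have "dot3 c u = (\<Sum>i<3. c i * (dot3 \<sigma> u * p i + dot3 \<rho> u * q i))"
    unfolding dot3_def[of c] by (intro sum.cong refl) (use rep[OF assms] in auto)
  also have "\<dots> = dot3 \<sigma> u * dot3 c p + dot3 \<rho> u * dot3 c q"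
    by (simp add: dot3_alt[of c] lessThan_three algebra_simps)
  finally show ?thesis .
qed

abbreviation restr where "restr f \<equiv> lrestr p q f"

lemma poly_restr: "poly (restr f) t = meval f (pt t)"
  by (simp add: poly_lrestr pt_def)

lemma restr_eqI: "(\<And>t. meval f (pt t) = poly g t) \<Longrightarrow> restr f = g"
  by (simp add: poly_eq_poly_eq_iff[symmetric] poly_restr fun_eq_iff)

lemma restr_mult: "restr (f * g) = restr f * restr g"
  by (rule restr_eqI) (simp add: meval_mult poly_restr)

lemma restr_diff: "restr (f - g) = restr f - restr g"
  by (rule restr_eqI) (simp add: meval_diff poly_restr)

lemma van_if_restr_zero:
  assumes f: "f \<in> poly_ring 3" "homogeneous d f" "restr f = 0"
  shows "van3 \<alpha> f"
proof -
  have "van3 \<alpha> (form3 \<sigma> * f)"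
    unfolding van3_alt
  proof (intro allI impI)
    fix u assume u: "dot3 \<alpha> u = 0"
    show "meval (form3 \<sigma> * f) u = 0"
    proof (cases "dot3 \<sigma> u = 0")
      case False
      let ?s = "dot3 \<sigma> u" and ?t = "dot3 \<rho> u / dot3 \<sigma> u"
      have "meval f u = meval f (\<lambda>i. ?s * pt ?t i)"
        by (rule meval_cong[of f "{..<3}"]) (use f(1) False rep[OF u] in \<open>auto simp: poly_ring_eq pt_def field_simps\<close>)
      also have "\<dots> = ?s ^ d * poly (restr f) ?t" by (simp add: homogeneous_eval_scale[OF f(2)] poly_restr)
      finally show ?thesis using f(3) by (simp add: meval_mult)
    qed (simp add: meval_mult meval_form3 del: meval_lform)
  qed
  hence "van3 \<alpha> (form3 \<sigma>) \<or> van3 \<alpha> f" by (intro van3_prime[OF nz\<alpha>] poly_ring_rules f(1))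
  moreover have "\<not> van3 \<alpha> (form3 \<sigma>)" using \<alpha>p dual(1) by (auto simp: van3_alt meval_form3 simp del: meval_lform)
  ultimately show ?thesis by blast
qed

text \<open>Homogenisation: \<open>t\<^sup>j\<close> lifts to \<open>\<sigma>\<^bsup>d-j\<^esup> \<rho>\<^sup>j\<close>.\<close>

lemma lift_restr:
  assumes "Polynomial.degree g \<le> d"
  obtains f where "f \<in> poly_ring 3" "homogeneous d f" "restr f = g"
proof -
  let ?f = "\<Sum>i\<le>d. mconst (poly.coeff g i) * (form3 \<rho> ^ i * form3 \<sigma> ^ (d - i))"
  have h1: "homogeneous i (form3 c ^ i)" for c :: "nat \<Rightarrow> 'a" and i
    using homogeneous_power[OF homogeneous_lform, of i "{..<3}" c] by simp
  have "homogeneous d ?f"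
    by (intro homogeneous_sum homogeneous_smult) (use homogeneous_mult[OF h1 h1] in \<open>metis le_add_diff_inverse atMost_iff\<close>)
  moreover have "?f \<in> poly_ring 3" by (intro poly_ring_rules)
  moreover have "restr ?f = g"
  proof (rule restr_eqI)
    fix t
    have "meval ?f (pt t) = (\<Sum>i\<le>d. poly.coeff g i * t ^ i)"
      by (simp add: meval_simps meval_form3 dot_pt dual del: meval_lform)
    also have "\<dots> = poly g t"
      unfolding poly_altdef using assms
      by (intro sum.mono_neutral_right) (auto simp: coeff_eq_0)
    finally show "meval ?f (pt t) = poly g t" .
  qed
  ultimately show ?thesis using that by blast
qed

end

text \<open>The plane \<open>\<alpha> = 0\<close> is added to the arrangement of the planes \<open>c = 0\<close> with \<open>c \<in> C\<close>. The parameter of the point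
  in which \<open>c = 0\<close> meets the affine line is \<open>\<tau> c\<close>, so the intersections with the new
  plane correspond to the elements of \<open>\<tau> ` C\<close>.\<close>

locale addition_step = plane_param \<alpha> p q \<sigma> \<rho>
  for \<alpha> p q \<sigma> \<rho> :: "nat \<Rightarrow> 'a::field_char_0" +
  fixes C :: "(nat \<Rightarrow> 'a) set"
  assumes finC: "finite C" and nzC: "\<And>c. c \<in> C \<Longrightarrow> nonzero3 c"
    and distinctC: "\<And>c d. c \<in> C \<Longrightarrow> d \<in> C \<Longrightarrow> c \<noteq> d \<Longrightarrow> \<not> van3 c (form3 d)"
    and indep1: "\<And>c. c \<in> C \<Longrightarrow> \<not> van3 \<alpha> (form3 c)"
    and indep2: "\<And>c. c \<in> C \<Longrightarrow> \<not> van3 c (form3 \<alpha>)"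
    and cq: "\<And>c. c \<in> C \<Longrightarrow> dot3 c q \<noteq> 0"
begin

definition \<tau> :: "(nat \<Rightarrow> 'a) \<Rightarrow> 'a" where "\<tau> c = - (dot3 c p / dot3 c q)"

lemma dot_p: "c \<in> C \<Longrightarrow> dot3 c p = - \<tau> c * dot3 c q"
  using cq[of c] by (simp add: \<tau>_def)

lemma dot_pt_C: "c \<in> C \<Longrightarrow> dot3 c (pt t) = dot3 c q * (t - \<tau> c)"
  using cq[of c] by (simp add: dot_pt \<tau>_def field_simps)

lemma dot_on_plane_C:
  assumes "dot3 \<alpha> u = 0" "c \<in> C"
  shows "dot3 c u = dot3 c q * (dot3 \<rho> u - \<tau> c * dot3 \<sigma> u)"
  using dot_on_plane[OF assms(1), of c] dot_p[OF assms(2)] by (simp add: algebra_simps)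

definition mult :: "'a \<Rightarrow> nat" where "mult t = card {c \<in> C. \<tau> c = t}"

text \<open>For a point on \<open>k\<close> of the old planes the factor occurs \<open>k - 1\<close> times; the degree of \<open>Pi\<close> is the number
  of old planes minus the number of their intersections with the new plane.\<close>

definition Pi :: "'a poly" where "Pi = (\<Prod>t\<in>\<tau> ` C. [:-t, 1:] ^ (mult t - 1))"

lemma degree_Pi: "Polynomial.degree Pi + card (\<tau> ` C) = card C"
proof -
  have "Polynomial.degree Pi = (\<Sum>t\<in>\<tau> ` C. mult t - 1)"
    unfolding Pi_def by (subst degree_prod_eq_sum_degree) (auto simp: degree_power_eq)
  moreover have "(\<Sum>t\<in>\<tau> ` C. mult t - 1) + card (\<tau> ` C) = (\<Sum>t\<in>\<tau> ` C. mult t)"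
  proof -
    have ge: "mult t \<ge> 1" if "t \<in> \<tau> ` C" for t
      using that finC by (auto simp: mult_def Suc_le_eq card_gt_0_iff)
    have "(\<Sum>t\<in>\<tau> ` C. mult t - 1) + card (\<tau> ` C) = (\<Sum>t\<in>\<tau> ` C. (mult t - 1) + 1)"
      by (simp only: sum.distrib card_eq_sum)
    also have "\<dots> = (\<Sum>t\<in>\<tau> ` C. mult t)" by (intro sum.cong refl) (use ge in fastforce)
    finally show ?thesis .
  qed
  moreover have "(\<Sum>t\<in>\<tau> ` C. mult t) = card C"
    unfolding mult_def using finC sum.image_gen[of C "\<lambda>_. 1::nat" \<tau>] by simp
  ultimately show ?thesis by simp
qed

lemma Pi_nonzero: "Pi \<noteq> 0"
  unfolding Pi_def using finC by auto

text \<open>Let \<open>\<beta>\<close> be an old plane through an intersection point with parameter \<open>t\<close>. Every old plane \<open>\<gamma>\<close> through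
  this point is a combination \<open>r \<alpha> + s \<beta>\<close>, and so \<open>\<alpha> g(\<beta>) - \<beta> g(\<alpha>)\<close>, with the same combination relating
  the values of \<open>g\<close>, vanishes on \<open>\<gamma>\<close>. It is therefore divisible by the product of the planes through the
  point. On the plane \<open>\<alpha> = 0\<close> only \<open>\<beta> g(\<alpha>)\<close> remains, which contains one factor less after cancelling \<open>\<beta>\<close>.\<close>

lemma Pi_dvd:
  assumes g: "g \<in> vfields 3" "\<And>c. c \<in> C \<Longrightarrow> tangent 3 c g"
  shows "Pi dvd restr (lin 3 \<alpha> g)"
  unfolding Pi_def
proof (rule prod_linear_powers_dvd)
  fix t assume "t \<in> \<tau> ` C"
  then obtain \<beta> where \<beta>: "\<beta> \<in> C" "\<tau> \<beta> = t" by blast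
  let ?Ct = "{c \<in> C. \<tau> c = t}"
  let ?w = "form3 \<alpha> * lin 3 \<beta> g - form3 \<beta> * lin 3 \<alpha> g"
  have wR: "?w \<in> polys_in {..<3}"
    using g(1) unfolding poly_ring_eq[symmetric] by (intro poly_ring_rules)
  have van: "van3 \<gamma> ?w" if \<gamma>: "\<gamma> \<in> ?Ct" for \<gamma>
  proof -
    define s where "s = dot3 \<gamma> q / dot3 \<beta> q"
    have s0: "s \<noteq> 0" using cq[of \<gamma>] cq[of \<beta>] \<gamma> \<beta> by (simp add: s_def)
    let ?d = "\<lambda>i. \<gamma> i - s * \<beta> i"
    have dd: "dot3 ?d u = dot3 \<gamma> u - s * dot3 \<beta> u" for u by (simp add: dot3_alt algebra_simps)
    have \<gamma>p: "dot3 \<gamma> p = - t * dot3 \<gamma> q" "dot3 \<beta> p = - t * dot3 \<beta> q"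
      using \<gamma> \<beta> dot_p[of \<gamma>] dot_p[of \<beta>] by auto
    have dpq: "dot3 ?d q = 0" "dot3 ?d p = 0"
      using cq[OF \<beta>(1)] unfolding dd \<gamma>p by (simp_all add: s_def)
    have "van3 \<alpha> (form3 ?d)"
      unfolding van3_alt
    proof (intro allI impI)
      fix u assume u: "dot3 \<alpha> u = 0"
      have "dot3 ?d u = (\<Sum>i<3. ?d i * (dot3 \<sigma> u * p i + dot3 \<rho> u * q i))"
        unfolding dot3_def[of ?d] by (intro sum.cong refl) (use rep[OF u] in auto)
      also have "\<dots> = dot3 \<sigma> u * dot3 ?d p + dot3 \<rho> u * dot3 ?d q"
        unfolding dot3_def[of ?d] by (simp only: sum_distrib_left distrib_left sum.distrib) (simp add: algebra_simps)
      finally show "meval (form3 ?d) u = 0" using dpq by (simp add: meval_form3 del: meval_lform)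
    qed
    moreover obtain k where k: "k < 3" "\<alpha> k \<noteq> 0" using nz\<alpha> by (auto simp: nonzero3_def)
    ultimately have "\<forall>i\<in>{..<3}. ?d i = (?d k / \<alpha> k) * \<alpha> i"
      by (intro parallel_if_vanishes) auto
    then obtain r where r: "\<And>i. i < 3 \<Longrightarrow> \<gamma> i = r * \<alpha> i + s * \<beta> i"
      by (metis (no_types, lifting) add.commute diff_add_cancel lessThan_iff)
    have dg: "(\<Sum>i<3. \<gamma> i * x i) = r * (\<Sum>i<3. \<alpha> i * x i) + s * (\<Sum>i<3. \<beta> i * x i)" for x
    proof -
      have "(\<Sum>i<3. \<gamma> i * x i) = (\<Sum>i<3. (r * \<alpha> i + s * \<beta> i) * x i)" by (intro sum.cong) (auto simp: r)
      thus ?thesis by (simp add: sum_distrib_left algebra_simps sum.distrib)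
    qed
    show ?thesis
      unfolding van3_alt
    proof (intro allI impI)
      fix v assume v: "dot3 \<gamma> v = 0"
      hence 1: "r * dot3 \<alpha> v + s * dot3 \<beta> v = 0" using dg[of v] by (simp add: dot3_def)
      have "meval (lin 3 \<gamma> g) v = 0" using g(2)[of \<gamma>] \<gamma> v by (auto simp: tangent_def van3_alt)
      hence 2: "r * meval (lin 3 \<alpha> g) v + s * meval (lin 3 \<beta> g) v = 0"
        using dg[of "\<lambda>i. meval (g i) v"] by (simp add: meval_lin)
      have "dot3 \<beta> v * meval (lin 3 \<alpha> g) v - dot3 \<alpha> v * meval (lin 3 \<beta> g) v = 0"
        by (rule orthogonal_det2[OF 1 2]) (use s0 in simp)
      thus "meval ?w v = 0" by (simp add: meval_simps meval_form3 algebra_simps del: meval_lform)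
    qed
  qed
  have fin: "finite ?Ct" using finC by simp
  have nz': "\<And>H. H \<in> ?Ct \<Longrightarrow> \<exists>k\<in>{..<3}. H k \<noteq> 0" using nzC by (auto simp: nonzero3_def)
  have dis: "\<And>H K. H \<in> ?Ct \<Longrightarrow> K \<in> ?Ct \<Longrightarrow> H \<noteq> K \<Longrightarrow> \<not> van3 H (form3 K)" using distinctC by blast
  obtain w' where w': "?w = (\<Prod>c\<in>?Ct. form3 c) * w'"
    using prod_lform_dvd[where c="\<lambda>c. c" and B="?Ct", OF finite_lessThan fin wR nz' dis van] by blast
  have rf: "restr (form3 c) = Polynomial.smult (dot3 c q) [:-t, 1:]" if "c \<in> ?Ct" for c
    by (rule restr_eqI) (use that in \<open>simp add: meval_form3 dot_pt_C algebra_simps del: meval_lform\<close>)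
  have rprod: "restr (\<Prod>c\<in>T. form3 c) = (\<Prod>c\<in>T. restr (form3 c))" for T
    by (rule restr_eqI) (simp add: meval_simps poly_prod poly_restr)
  have r\<alpha>: "restr (form3 \<alpha>) = 0"
    by (rule restr_eqI) (simp add: meval_form3 dot_pt \<alpha>p \<alpha>q del: meval_lform)
  have "- (restr (form3 \<beta>) * restr (lin 3 \<alpha> g)) = restr ?w"
    unfolding restr_diff restr_mult r\<alpha> by simp
  also have "\<dots> = (\<Prod>c\<in>?Ct. restr (form3 c)) * restr w'" unfolding w' restr_mult rprod ..
  also have "(\<Prod>c\<in>?Ct. restr (form3 c)) = (\<Prod>c\<in>?Ct. Polynomial.smult (dot3 c q) [:-t, 1:])"
    by (intro prod.cong) (auto simp: rf)
  also have "\<dots> = Polynomial.smult (\<Prod>c\<in>?Ct. dot3 c q) ([:-t, 1:] ^ mult t)"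
    unfolding mult_def by (rule prod_smult_const[OF fin])
  finally have eq: "- (restr (form3 \<beta>) * restr (lin 3 \<alpha> g)) = Polynomial.smult (\<Prod>c\<in>?Ct. dot3 c q) ([:-t, 1:] ^ mult t) * restr w'" .
  have "mult t > 0" using \<beta> fin by (auto simp: mult_def card_gt_0_iff)
  then obtain m where m: "mult t = Suc m" by (cases "mult t") auto
  let ?b = "dot3 \<beta> q" and ?P = "\<Prod>c\<in>?Ct. dot3 c q"
  have cancel: "L * Polynomial.smult (- b) R = L * (L ^ m * Polynomial.smult P W)"
    if "- (Polynomial.smult b L * R) = Polynomial.smult P (L ^ Suc m) * W" for L R W :: "'a poly" and b P
    using that by (simp add: mult.assoc mult.left_commute)
  have "\<beta> \<in> ?Ct" using \<beta> by simp
  have "[:-t, 1:] * Polynomial.smult (- ?b) (restr (lin 3 \<alpha> g)) = [:-t, 1:] * ([:-t, 1:] ^ m * Polynomial.smult ?P (restr w'))"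
    by (rule cancel) (rule eq[unfolded m rf[OF \<open>\<beta> \<in> ?Ct\<close>]])
  hence "Polynomial.smult (- ?b) (restr (lin 3 \<alpha> g)) = [:-t, 1:] ^ m * Polynomial.smult ?P (restr w')"
    by (subst (asm) mult_left_cancel) simp_all
  hence "[:-t, 1:] ^ m dvd Polynomial.smult (- ?b) (restr (lin 3 \<alpha> g))" by (rule dvdI)
  thus "[:-t, 1:] ^ (mult t - 1) dvd restr (lin 3 \<alpha> g)"
    unfolding m diff_Suc_1 by (rule dvd_smult_cancel) (use cq[OF \<beta>(1)] in simp)
qed (use finC in simp)

text \<open>If all basis fields were tangent to the new plane, then so would be every field tangent to
  the old planes, in particular \<open>Q \<partial>/\<partial>x\<^sub>k\<close>, where \<open>Q\<close> is the product of the old forms.\<close>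

lemma no_common_tangent:
  assumes bas: "vbasis 3 C [mvar, f, g]" and t: "tangent 3 \<alpha> f" "tangent 3 \<alpha> g"
  shows False
proof -
  note H = bas[unfolded vbasis3_iff]
  obtain k where k: "k < 3" "\<alpha> k \<noteq> 0" using nz\<alpha> by (auto simp: nonzero3_def)
  let ?Q = "\<Prod>c\<in>C. form3 c"
  let ?h = "\<lambda>i. if i = k then ?Q else 0"
  have QR: "?Q \<in> poly_ring 3" by (intro poly_ring_rules)
  have l: "lin 3 c ?h = mconst (c k) * ?Q" for c
    using k(1) by (simp add: lin_def if_distrib cong: if_cong)
  have th: "\<forall>c\<in>C. tangent 3 c ?h"
  proof
    fix c assume c: "c \<in> C"
    show "tangent 3 c ?h"
      unfolding tangent_def l van3_alt
    proof (intro allI impI)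
      fix v assume v: "dot3 c v = 0"
      have "(\<Prod>d\<in>C. dot3 d v) = 0" using finC c v by (auto simp: prod_zero_iff)
      thus "meval (mconst (c k) * ?Q) v = 0" by (simp add: meval_simps meval_form3 del: meval_lform)
    qed
  qed
  have vh: "?h \<in> vfields 3" using QR by (auto simp: vfields_def intro: poly_ring_rules)
  obtain r s u where r: "\<forall>i<3. ?h i = r * mvar i + s * f i + u * g i"
    using mp[OF bspec[OF H[THEN conjunct2, THEN conjunct1] vh] th] by blast
  have "lin 3 \<alpha> ?h = r * lin 3 \<alpha> mvar + s * lin 3 \<alpha> f + u * lin 3 \<alpha> g"
    by (rule lin_comb) (use r in blast)
  hence eq: "mconst (\<alpha> k) * ?Q = r * lin 3 \<alpha> mvar + s * lin 3 \<alpha> f + u * lin 3 \<alpha> g" unfolding l .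
  have "van3 \<alpha> ?Q"
    unfolding van3_alt
  proof (intro allI impI)
    fix v assume v: "dot3 \<alpha> v = 0"
    have "meval (mconst (\<alpha> k) * ?Q) v = 0"
      unfolding eq using t v tangent_euler[of 3 \<alpha>] by (auto simp: tangent_def van3_alt meval_add meval_mult)
    thus "meval ?Q v = 0" using k(2) by (simp add: meval_mult)
  qed
  hence "\<exists>c\<in>C. van3 \<alpha> (form3 c)" by (intro van3_prod[OF nz\<alpha> finC] poly_ring_rules)
  thus False using indep1 by blast
qed

text \<open>If \<open>g\<close> is tangent to the new plane, it induces a field on this plane tangent to more lines through the
  origin than its degree plus one, so it is a multiple \<open>h\<close> of the Euler field there. Then \<open>g - h E\<close> is
  divisible by \<open>\<alpha>\<close>, and the quotient is again tangent to the old planes, which contradicts that \<open>g\<close> is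
  part of a basis.\<close>

lemma no_small_tangent:
  assumes bas: "vbasis 3 C [mvar, f, g]" and hg: "\<And>i. i < 3 \<Longrightarrow> homogeneous b (g i)"
    and t: "tangent 3 \<alpha> g" and b: "b + 1 < card (\<tau> ` C)"
  shows False
proof -
  note H = bas[unfolded vbasis3_iff]
  have vg: "g \<in> vfields 3" and tgC: "\<And>c. c \<in> C \<Longrightarrow> tangent 3 c g" using H by auto
  let ?S = "lin 3 \<sigma> g" and ?R = "lin 3 \<rho> g"
  let ?\<psi> = "restr ?S" and ?\<chi> = "restr ?R"
  have deg: "Polynomial.degree ?\<psi> \<le> b" "Polynomial.degree ?\<chi> \<le> b"
    by (auto intro!: degree_lrestr homogeneous_lin hg)
  have gpt: "meval (g i) (pt x) = poly ?\<psi> x * p i + poly ?\<chi> x * q i" if i: "i < 3" for i x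
  proof -
    have "dot3 \<alpha> (pt x) = 0" by (simp add: dot_pt \<alpha>p \<alpha>q)
    hence "meval (lin 3 \<alpha> g) (pt x) = 0" using t by (auto simp: tangent_def van3_alt)
    hence "dot3 \<alpha> (\<lambda>i. meval (g i) (pt x)) = 0" by (simp add: meval_lin dot3_def)
    from rep[OF this i] show ?thesis by (simp add: poly_restr meval_lin dot3_def)
  qed
  have zero: "poly (?\<chi> - [:0, 1:] * ?\<psi>) x = 0" if x: "x \<in> \<tau> ` C" for x
  proof -
    obtain c where c: "c \<in> C" "x = \<tau> c" using x by blast
    have "dot3 c (pt x) = 0" using c by (simp add: dot_pt_C)
    hence "meval (lin 3 c g) (pt x) = 0" using tgC[OF c(1)] by (auto simp: tangent_def van3_alt)
    hence "0 = (\<Sum>i<3. c i * meval (g i) (pt x))" by (simp add: meval_lin)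
    also have "\<dots> = (\<Sum>i<3. c i * (poly ?\<psi> x * p i + poly ?\<chi> x * q i))"
      by (intro sum.cong refl) (use gpt in auto)
    also have "\<dots> = poly ?\<psi> x * dot3 c p + poly ?\<chi> x * dot3 c q"
      by (simp add: dot3_alt lessThan_three algebra_simps)
    also have "dot3 c p = - x * dot3 c q" using cq[OF c(1)] c(2) by (simp add: \<tau>_def)
    finally have "dot3 c q * (poly ?\<chi> x - x * poly ?\<psi> x) = 0" by (auto simp: algebra_simps)
    thus ?thesis using cq[OF c(1)] by simp
  qed
  have chi: "?\<chi> = [:0, 1:] * ?\<psi>"
  proof (rule ccontr)
    assume "?\<chi> \<noteq> [:0, 1:] * ?\<psi>"
    hence nz: "?\<chi> - [:0, 1:] * ?\<psi> \<noteq> 0" by simp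
    have "card (\<tau> ` C) \<le> card {x. poly (?\<chi> - [:0, 1:] * ?\<psi>) x = 0}"
      using zero by (intro card_mono poly_roots_finite nz) blast
    also have "\<dots> \<le> Polynomial.degree (?\<chi> - [:0, 1:] * ?\<psi>)" by (rule card_poly_roots_bound[OF nz])
    also have "\<dots> \<le> b + 1"
    proof (rule degree_diff_le)
      show "Polynomial.degree ?\<chi> \<le> b + 1" using deg by simp
      have "Polynomial.degree ([:0, 1:] * ?\<psi>) \<le> Polynomial.degree [:0, 1 :: 'a:] + Polynomial.degree ?\<psi>"
        by (rule degree_mult_le)
      thus "Polynomial.degree ([:0, 1:] * ?\<psi>) \<le> b + 1" using deg by simp
    qed
    finally show False using b by simp
  qed
  obtain h where h: "h \<in> poly_ring 3" "restr h = ?\<psi>" "\<And>i. homogeneous b (h * mvar i)"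
  proof (cases "?\<psi> = 0")
    case True
    show ?thesis
      by (rule that[of 0]) (use True in \<open>auto intro: poly_ring_rules simp: lrestr_def\<close>)
  next
    case False
    have "Polynomial.degree ?\<chi> = Suc (Polynomial.degree ?\<psi>)"
      unfolding chi using False by (subst degree_mult_eq) auto
    hence "Suc (Polynomial.degree ?\<psi>) \<le> b" using deg(2) by simp
    then obtain b' where b': "b = Suc b'" "Polynomial.degree ?\<psi> \<le> b'" by (cases b) auto
    obtain h where h: "h \<in> poly_ring 3" "homogeneous b' h" "restr h = ?\<psi>"
      using b'(2) by (rule lift_restr)
    have "homogeneous b (h * mvar i)" for i
      using homogeneous_mult[OF h(2) homogeneous_var(1)[of i]] b' by simp
    thus ?thesis using h that by blast
  qed
  have "van3 \<alpha> (g i - h * mvar i)" if i: "i < 3" for i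
  proof (rule van_if_restr_zero)
    show "g i - h * mvar i \<in> poly_ring 3" using vg h(1) i by (auto simp: vfields_def intro!: poly_ring_rules)
    show "homogeneous b (g i - h * mvar i)" by (intro homogeneous_diff hg i h(3))
    show "restr (g i - h * mvar i) = 0"
    proof (rule restr_eqI)
      fix x
      have "meval h (pt x) = poly ?\<psi> x" unfolding h(2)[symmetric] poly_restr ..
      moreover have "poly ?\<chi> x = x * poly ?\<psi> x" unfolding chi by simp
      ultimately show "meval (g i - h * mvar i) (pt x) = poly 0 x"
        using gpt[OF i, of x] by (simp add: meval_diff meval_mult pt_def algebra_simps)
    qed
  qed
  hence "\<forall>i. \<exists>e. i < 3 \<longrightarrow> e \<in> poly_ring 3 \<and> g i - h * mvar i = form3 \<alpha> * e"
    using van3_dvd[OF nz\<alpha>] vg h(1) by (metis (no_types, lifting) poly_ring_rules(2,3,12) vfields_def mem_Collect_eq)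
  then obtain \<eta> where \<eta>: "\<And>i. i < 3 \<Longrightarrow> \<eta> i \<in> poly_ring 3" "\<And>i. i < 3 \<Longrightarrow> g i - h * mvar i = form3 \<alpha> * \<eta> i" by metis
  have v\<eta>: "\<eta> \<in> vfields 3" using \<eta>(1) by (auto simp: vfields_def)
  have t\<eta>: "\<forall>c\<in>C. tangent 3 c \<eta>"
  proof
    fix c assume c: "c \<in> C"
    have "lin 3 c (\<lambda>i. form3 \<alpha> * \<eta> i) = lin 3 c (\<lambda>i. g i - h * mvar i)"
      unfolding lin_def by (intro sum.cong refl) (use \<eta>(2) in simp)
    also have "\<dots> = lin 3 c g - h * form3 c"
      unfolding lin_euler[symmetric] by (simp add: lin_def sum_distrib_left algebra_simps sum_subtractf)
    finally have "lin 3 c (\<lambda>i. form3 \<alpha> * \<eta> i) = lin 3 c g - h * form3 c" .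
    moreover have "van3 c (lin 3 c g - h * form3 c)"
      using tgC[OF c] by (auto simp: tangent_def van3_alt meval_simps meval_form3 simp del: meval_lform)
    ultimately have "van3 c (form3 \<alpha> * lin 3 c \<eta>)" by (simp add: lin_scale)
    hence "van3 c (form3 \<alpha>) \<or> van3 c (lin 3 c \<eta>)"
      using v\<eta> by (intro van3_prime[OF nzC[OF c]] poly_ring_rules)
    thus "tangent 3 c \<eta>" using indep2[OF c] by (auto simp: tangent_def)
  qed
  obtain r s u where r: "r \<in> poly_ring 3" "s \<in> poly_ring 3" "u \<in> poly_ring 3" "\<forall>i<3. \<eta> i = r * mvar i + s * f i + u * g i"
    using mp[OF bspec[OF H[THEN conjunct2, THEN conjunct1] v\<eta>] t\<eta>] by blast
  have "\<forall>i<3. (h + form3 \<alpha> * r) * mvar i + (form3 \<alpha> * s) * f i + (form3 \<alpha> * u - 1) * g i = 0"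
  proof (intro allI impI)
    fix i :: nat assume i: "i < 3"
    have "g i = h * mvar i + form3 \<alpha> * \<eta> i" using \<eta>(2)[OF i] by (simp add: algebra_simps)
    also have "\<dots> = h * mvar i + form3 \<alpha> * (r * mvar i + s * f i + u * g i)" using r(4) i by simp
    finally have "g i = h * mvar i + form3 \<alpha> * (r * mvar i + s * f i + u * g i)" .
    thus "(h + form3 \<alpha> * r) * mvar i + (form3 \<alpha> * s) * f i + (form3 \<alpha> * u - 1) * g i = 0"
      by (simp add: algebra_simps)
  qed
  note eq = this
  have R: "h + form3 \<alpha> * r \<in> poly_ring 3" "form3 \<alpha> * s \<in> poly_ring 3" "form3 \<alpha> * u - 1 \<in> poly_ring 3"
    using h(1) r(1-3) by (auto intro!: poly_ring_rules(1-3,8,9))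
  have "form3 \<alpha> * u - 1 = 0"
    using mp[OF bspec[OF bspec[OF bspec[OF H[THEN conjunct2, THEN conjunct2] R(1)] R(2)] R(3)] eq] by blast
  hence "meval (form3 \<alpha> * u - 1) (\<lambda>_. 0) = 0" by simp
  thus False by (simp add: meval_diff meval_mult)
qed

text \<open>The addition theorem. By \<open>Pi_dvd\<close> both \<open>f(\<alpha>)\<close> and \<open>g(\<alpha>)\<close> restrict to multiples of \<open>Pi\<close>, which
  has degree \<open>b\<close>. If the restriction of \<open>g(\<alpha>)\<close> is not zero, it is a constant times \<open>Pi\<close> for degree reasons, so
  \<open>f\<close> can be made tangent by subtracting a multiple of \<open>g\<close>, and \<open>g\<close> is multiplied by \<open>\<alpha>\<close>. If it is zero, then \<open>g\<close>
  is tangent and \<open>f\<close> is not; comparing degrees gives \<open>a = b\<close>, and \<open>f\<close> and \<open>g\<close> exchange their roles.\<close>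

lemma addition:
  assumes bas: "vbasis 3 C [mvar, f, g]"
    and hf: "\<And>i. i < 3 \<Longrightarrow> homogeneous a (f i)" and hg: "\<And>i. i < 3 \<Longrightarrow> homogeneous b (g i)"
    and cardC: "card C = a + b + 1" and cardT: "card (\<tau> ` C) = a + 1"
  shows "\<exists>f' g'. vbasis 3 (insert \<alpha> C) [mvar, f', g'] \<and> (\<forall>i<3. homogeneous a (f' i)) \<and> (\<forall>i<3. homogeneous (b + 1) (g' i))"
proof -
  note H = bas[unfolded vbasis3_iff]
  let ?F = "restr (lin 3 \<alpha> f)" and ?G = "restr (lin 3 \<alpha> g)"
  have v: "f \<in> vfields 3" "g \<in> vfields 3" and t: "\<And>c. c \<in> C \<Longrightarrow> tangent 3 c f" "\<And>c. c \<in> C \<Longrightarrow> tangent 3 c g"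
    using H by auto
  have degPi: "Polynomial.degree Pi = b" using degree_Pi cardC cardT by simp
  have dvd: "Pi dvd ?F" "Pi dvd ?G" by (rule Pi_dvd; use v t in auto)+
  have deg: "Polynomial.degree ?F \<le> a" "Polynomial.degree ?G \<le> b"
    by (auto intro!: degree_lrestr homogeneous_lin hf hg)
  have tan: "tangent 3 \<alpha> h" if "h \<in> vfields 3" "\<And>i. i < 3 \<Longrightarrow> homogeneous d (h i)" "restr (lin 3 \<alpha> h) = 0" for h d
    unfolding tangent_def
    by (rule van_if_restr_zero[where d=d]) (use that in \<open>auto intro!: poly_ring_rules homogeneous_lin\<close>)
  have ntan: "\<not> tangent 3 \<alpha> h" if "restr (lin 3 \<alpha> h) \<noteq> 0" for h
  proof
    assume "tangent 3 \<alpha> h"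
    hence "restr (lin 3 \<alpha> h) = 0"
      by (intro restr_eqI) (auto simp: tangent_def van3_alt dot_pt \<alpha>p \<alpha>q)
    with that show False ..
  qed
  have hmul: "homogeneous (d + 1) (form3 \<alpha> * h)" if "homogeneous d h" for h d
    using homogeneous_mult[OF homogeneous_lform that, of "{..<3}" \<alpha>] by simp
  show ?thesis
  proof (cases "?G = 0")
    case False
    obtain \<kappa> where \<kappa>: "?F = ?G * \<kappa>"
    proof -
      obtain k where k: "?G = Pi * k" using dvd(2) by (auto elim: dvdE)
      hence "k \<noteq> 0" using False by auto
      hence "Polynomial.degree k = 0" using deg(2) degPi Pi_nonzero k by (simp add: degree_mult_eq)
      then obtain e where e: "k = [:e:]" by (rule degree_eq_zeroE)
      hence "e \<noteq> 0" using \<open>k \<noteq> 0\<close> by auto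
      obtain l where l: "?F = Pi * l" using dvd(1) by (auto elim: dvdE)
      have "?F = ?G * ([:1 / e:] * l)" unfolding k l e using \<open>e \<noteq> 0\<close> by simp
      thus ?thesis by (rule that)
    qed
    obtain h where h: "h \<in> poly_ring 3" "restr h = \<kappa>" "\<And>i. i < 3 \<Longrightarrow> homogeneous a (h * g i)"
    proof (cases "\<kappa> = 0")
      case True
      show ?thesis
        by (rule that[of 0]) (use True in \<open>auto intro: poly_ring_rules simp: lrestr_def\<close>)
    next
      case k0: False
      have "b \<le> Polynomial.degree ?G" using dvd(2) False dvd_imp_degree_le degPi by metis
      hence "Polynomial.degree \<kappa> + b \<le> a" using deg(1) k0 False unfolding \<kappa> by (simp add: degree_mult_eq)
      hence ab: "b \<le> a" "Polynomial.degree \<kappa> \<le> a - b" by simp_all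
      obtain h where h: "h \<in> poly_ring 3" "homogeneous (a - b) h" "restr h = \<kappa>"
        using ab(2) by (rule lift_restr)
      have "homogeneous a (h * g i)" if "i < 3" for i
        using homogeneous_mult[OF h(2) hg[OF that]] ab(1) by simp
      thus ?thesis using h that by blast
    qed
    let ?f = "\<lambda>i. f i - h * g i"
    have bas': "vbasis 3 C [mvar, ?f, g]" by (rule vbasis_change[OF bas h(1)])
    have hf': "\<And>i. i < 3 \<Longrightarrow> homogeneous a (?f i)" using hf h(3) by (intro homogeneous_diff)
    have "lin 3 \<alpha> ?f = lin 3 \<alpha> f - h * lin 3 \<alpha> g"
      by (simp add: lin_def sum_distrib_left algebra_simps sum_subtractf)
    hence "restr (lin 3 \<alpha> ?f) = 0" by (simp add: restr_diff restr_mult h(2) \<kappa> mult.commute)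
    moreover have "?f \<in> vfields 3" using bas' by (simp add: vbasis3_iff)
    ultimately have "tangent 3 \<alpha> ?f" using hf' by (intro tan)
    hence "vbasis 3 (insert \<alpha> C) [mvar, ?f, \<lambda>i. form3 \<alpha> * g i]"
      by (intro vbasis_insert[OF bas' nz\<alpha> tangent_euler] ntan False)
    thus ?thesis using hf' hmul[OF hg] by blast
  next
    case True
    hence tg: "tangent 3 \<alpha> g" using v(2) hg by (intro tan)
    have "?F \<noteq> 0"
    proof
      assume "?F = 0"
      hence "tangent 3 \<alpha> f" using v(1) hf by (intro tan)
      thus False using no_common_tangent[OF bas] tg by blast
    qed
    hence "b \<le> Polynomial.degree ?F" using dvd(1) dvd_imp_degree_le degPi by metis
    hence "b \<le> a" using deg(1) by simp
    moreover have "\<not> b < a" using no_small_tangent[OF bas hg tg] cardT by auto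
    ultimately have ab: "a = b" by simp
    have "vbasis 3 (insert \<alpha> C) [mvar, g, \<lambda>i. form3 \<alpha> * f i]"
      by (intro vbasis_insert[OF vbasis_swap[OF bas] nz\<alpha> tangent_euler tg] ntan \<open>?F \<noteq> 0\<close>)
    thus ?thesis using hg hmul[OF hf] unfolding ab by blast
  qed
qed

end

section \<open>Planes with rational equations\<close>

type_synonym triple = "int \<times> int \<times> int"

definition s3 :: complex where "s3 = complex_of_real (sqrt 3)"

lemma s3_sq: "s3 * s3 = 3"
  by (simp add: s3_def flip: of_real_mult)

lemma s3_nonzero [simp]: "s3 \<noteq> 0" by (simp add: s3_def)

text \<open>Coefficients of a linear form, or coordinates of a point, in the coordinates
  \<open>X = x / \<surd>3, y, z\<close> in which all lines and points are rational.\<close>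

definition cf :: "triple \<Rightarrow> nat \<Rightarrow> complex" where
  "cf t i = (case t of (a, b, c) \<Rightarrow> of_int (if i = 0 then a else if i = 1 then b else c))"

definition co :: "complex ^ 3 \<Rightarrow> nat \<Rightarrow> complex" where
  "co v i = (if i = 0 then v $ 1 / s3 else if i = 1 then v $ 2 else v $ 3)"

definition vecof :: "(nat \<Rightarrow> complex) \<Rightarrow> complex ^ 3" where
  "vecof u = (\<chi> j. if j = 1 then s3 * u 0 else if j = 2 then u 1 else u 2)"

definition plane :: "triple \<Rightarrow> (complex ^ 3) set" where
  "plane t = {v. dot3 (cf t) (co v) = 0}"

lemma vec3_eqI: "v $ 1 = w $ 1 \<Longrightarrow> v $ 2 = w $ 2 \<Longrightarrow> v $ 3 = w $ 3 \<Longrightarrow> v = (w :: 'a ^ 3)"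
  by (simp add: vec_eq_iff forall_3)

lemma vecof_nth [simp]: "vecof u $ 1 = s3 * u 0" "vecof u $ 2 = u 1" "vecof u $ 3 = u 2"
  by (simp_all add: vecof_def)

lemma vecof_co [simp]: "vecof (co v) = v"
  by (rule vec3_eqI) (simp_all add: co_def)

lemma co_vecof: "i < 3 \<Longrightarrow> co (vecof u) i = u i"
  by (auto simp: co_def less_Suc_eq numeral_3_eq_3 numeral_2_eq_2)

lemma vecof_cong: "(\<And>i. i < 3 \<Longrightarrow> u i = w i) \<Longrightarrow> vecof u = vecof w"
  by (rule vec3_eqI) simp_all

lemma co_add: "co (v + w) i = co v i + co w i" and co_scale: "co (k *s v) i = k * co v i" and co_zero: "co 0 i = 0"
  by (simp_all add: co_def add_divide_distrib)

lemma dot3_co_add: "dot3 c (co (v + w)) = dot3 c (co v) + dot3 c (co w)"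
  and dot3_co_scale: "dot3 c (co (k *s v)) = k * dot3 c (co v)"
  and dot3_co_zero: "dot3 c (co 0) = 0"
  by (simp_all add: dot3_alt co_add co_scale co_zero algebra_simps)

lemma dot3_co_vecof: "dot3 c (co (vecof u)) = dot3 c u"
  by (simp add: dot3_alt co_vecof)

lemma vecof_comb: "vecof (\<lambda>i. a * u i + b * w i) = a *s vecof u + b *s vecof w"
  by (rule vec3_eqI) (simp_all add: algebra_simps)

lemma subspace_plane: "vec.subspace (plane t)"
  by (auto simp: vec.subspace_def plane_def dot3_co_add dot3_co_scale dot3_co_zero)

text \<open>The basis of \<open>\<complex>\<^sup>3\<close> dual to the coordinates \<open>X, y, z\<close>.\<close>

definition bb :: "nat \<Rightarrow> complex ^ 3" where
  "bb i = vecof (\<lambda>j. if j = i then 1 else 0)"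

lemma sum_bb: "(\<Sum>i<3. u i *s bb i) = vecof u"
  by (rule vec3_eqI) (simp_all add: bb_def lessThan_three)

lemma coordinates_bb: "coordinates UNIV bb"
proof -
  have d: "vec.dim (UNIV :: (complex^3) set) = 3"
    by (simp add: vec.dim_UNIV vec.dimension_def card_cart_basis)
  have sp: "vec.span (bb ` {..<3}) = UNIV"
  proof -
    have "v \<in> vec.span (bb ` {..<3})" for v
    proof -
      have "v = (\<Sum>i<3. co v i *s bb i)" by (simp add: sum_bb)
      also have "\<dots> \<in> vec.span (bb ` {..<3})"
        by (intro vec.span_sum vec.span_scale vec.span_base) auto
      finally show ?thesis .
    qed
    thus ?thesis by blast
  qed
  have "3 \<le> card (bb ` {..<3})"
    using vec.dim_le_card[of UNIV "bb ` {..<3}"] sp d by auto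
  hence c: "card (bb ` {..<3}) = 3" using card_image_le[of "{..<3::nat}" bb] by simp
  hence inj: "inj_on bb {..<3}" by (intro eq_card_imp_inj_on) auto
  have "vec.independent (bb ` {..<3})"
    by (rule vec.card_le_dim_spanning[of _ UNIV]) (use sp d c in auto)
  thus ?thesis using inj sp d by (simp add: coordinates_def)
qed

lemma dim_UNIV3: "vec.dim (UNIV :: (complex^3) set) = 3"
    by (simp add: vec.dim_UNIV vec.dimension_def card_cart_basis)

lemma plane_eq: "plane t = {\<Sum>i<3. u i *s bb i | u. (\<Sum>i<3. cf t i * u i) = 0}"
proof (intro equalityI subsetI)
  fix v assume "v \<in> plane t"
  thus "v \<in> {\<Sum>i<3. u i *s bb i | u. (\<Sum>i<3. cf t i * u i) = 0}"
    unfolding sum_bb dot3_def[symmetric] plane_def by (auto intro!: exI[of _ "co v"])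
next
  fix v assume "v \<in> {\<Sum>i<3. u i *s bb i | u. (\<Sum>i<3. cf t i * u i) = 0}"
  thus "v \<in> plane t"
    unfolding sum_bb dot3_def[symmetric] plane_def by (auto simp: dot3_co_vecof)
qed

fun icross :: "triple \<Rightarrow> triple \<Rightarrow> triple" where
  "icross (a, b, c) (d, e, f) = (b * f - c * e, c * d - a * f, a * e - b * d)"

fun idot :: "triple \<Rightarrow> triple \<Rightarrow> int" where
  "idot (a, b, c) (d, e, f) = a * d + b * e + c * f"

lemma dot3_cf: "dot3 (cf s) (cf t) = of_int (idot s t)"
  by (cases s; cases t) (simp add: dot3_alt cf_def)

lemma idot_icross: "idot s (icross s t) = 0" "idot t (icross s t) = 0"
  by (cases s; cases t; simp add: algebra_simps)+

lemma nonzero3_cf: "nonzero3 (cf t) \<longleftrightarrow> t \<noteq> (0, 0, 0)"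
proof -
  obtain a b c where t: "t = (a, b, c)" by (cases t)
  have "nonzero3 (cf t) \<longleftrightarrow> cf t 0 \<noteq> 0 \<or> cf t 1 \<noteq> 0 \<or> cf t 2 \<noteq> 0"
    unfolding nonzero3_def by (auto simp: less_Suc_eq numeral_3_eq_3 numeral_2_eq_2)
  thus ?thesis by (simp add: t cf_def)
qed

lemma not_van3_cf:
  assumes "icross s t \<noteq> (0, 0, 0)"
  shows "\<not> van3 (cf s) (form3 (cf t))"
proof
  assume van: "van3 (cf s) (form3 (cf t))"
  obtain a b c where s: "s = (a, b, c)" by (cases s)
  obtain d e f where t: "t = (d, e, f)" by (cases t)
  have v: "dot3 (cf s) u = 0 \<Longrightarrow> dot3 (cf t) u = 0" for u
    using van by (auto simp: van3_alt meval_form3 simp del: meval_lform)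
  have w: "idot t r = 0" if "idot s r = 0" for r
    using v[of "cf r"] that by (simp add: dot3_cf)
  have "a * e - b * d = 0" using w[of "(-b, a, 0)"] by (simp add: s t algebra_simps)
  moreover have "c * d - a * f = 0" using w[of "(c, 0, -a)"] by (simp add: s t algebra_simps)
  moreover have "b * f - c * e = 0" using w[of "(0, -c, b)"] by (simp add: s t algebra_simps)
  ultimately show False using assms by (simp add: s t)
qed

lemma icross_commute_nz: "icross s t \<noteq> (0, 0, 0) \<Longrightarrow> icross t s \<noteq> (0, 0, 0)"
  by (cases s; cases t) (auto simp: algebra_simps)

text \<open>The distinct points in which the line \<open>t\<close> meets the lines of the list: a line contributes a new
  point if it passes through none of the points found before.\<close>

fun reps :: "triple \<Rightarrow> triple list \<Rightarrow> triple list" where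
  "reps t [] = []"
| "reps t (s # L) = (let R = reps t L in if list_ex (\<lambda>r. idot s r = 0) R then R else icross t s # R)"

lemma card_image_eq_if_same_kernel:
  assumes "\<And>x y. x \<in> A \<Longrightarrow> y \<in> A \<Longrightarrow> f x = f y \<longleftrightarrow> g x = g y"
  shows "card (f ` A) = card (g ` A)"
proof -
  have "bij_betw (\<lambda>z. g (inv_into A f z)) (f ` A) (g ` A)"
  proof (rule bij_betw_imageI)
    show "inj_on (\<lambda>z. g (inv_into A f z)) (f ` A)"
    proof (rule inj_onI)
      fix z w assume *: "z \<in> f ` A" "w \<in> f ` A" "g (inv_into A f z) = g (inv_into A f w)"
      have "f (inv_into A f z) = f (inv_into A f w)" using assms[of "inv_into A f z" "inv_into A f w"] * by (simp add: inv_into_into)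
      thus "z = w" using * by (simp add: f_inv_into_f)
    qed
    show "(\<lambda>z. g (inv_into A f z)) ` f ` A = g ` A"
    proof -
      have "g (inv_into A f (f x)) = g x" if "x \<in> A" for x
        using assms[of "inv_into A f (f x)" x] that by (simp add: inv_into_into f_inv_into_f)
      thus ?thesis by (simp add: image_image cong: image_cong)
    qed
  qed
  thus ?thesis by (rule bij_betw_same_card)
qed

text \<open>The invariant of the successive additions, with exponents \<open>{1, a, b}\<close>.\<close>

definition good :: "triple list \<Rightarrow> nat \<Rightarrow> nat \<Rightarrow> bool" where
  "good L a b \<longleftrightarrow>
     (0, 0, 0) \<notin> set L \<and> (\<forall>s\<in>set L. \<forall>t\<in>set L. s \<noteq> t \<longrightarrow> icross s t \<noteq> (0, 0, 0)) \<and> distinct L \<and>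
     length L = a + b + 1 \<and> inductively_free UNIV (plane ` set L) \<and>
     (\<exists>f g. vbasis 3 (cf ` set L) [mvar, f, g] \<and> (\<forall>i<3. homogeneous a (f i)) \<and> (\<forall>i<3. homogeneous b (g i)))"

lemma good_swap: "good L a b \<Longrightarrow> good L b a"
  unfolding good_def using vbasis_swap by (auto simp: add.commute) blast

lemma cf_inj: "cf s = cf t \<Longrightarrow> s = t"
proof -
  assume H: "cf s = cf t"
  have "cf s 0 = cf t 0" "cf s 1 = cf t 1" "cf s 2 = cf t 2" by (simp_all add: H)
  thus ?thesis by (cases s; cases t) (simp add: cf_def)
qed

lemma plane_neq:
  assumes "icross s t \<noteq> (0, 0, 0)"
  shows "plane s \<noteq> plane t"
proof
  assume eq: "plane s = plane t"
  have "van3 (cf s) (form3 (cf t))"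
    unfolding van3_alt
  proof (intro allI impI)
    fix v assume "dot3 (cf s) v = 0"
    hence "vecof v \<in> plane s" by (simp add: plane_def dot3_co_vecof)
    hence "vecof v \<in> plane t" by (simp only: eq)
    thus "meval (form3 (cf t)) v = 0" by (simp add: plane_def dot3_co_vecof meval_form3 del: meval_lform)
  qed
  thus False using not_van3_cf[OF assms] by blast
qed

text \<open>One application of the addition theorem. The rule for adding a hyperplane requires in addition that the restriction is
  inductively free and that its exponents are contained in those of the previous lines; the restriction
  consists of lines in a plane.\<close>

lemma good_step:
  assumes G: "good L a b" and t: "t \<noteq> (0, 0, 0)" and ts: "\<forall>s\<in>set L. icross t s \<noteq> (0, 0, 0)"
    and R: "length (reps t L) = a + 1"
  shows "good (t # L) a (b + 1)"
proof -
  let ?C = "cf ` set L" and ?\<alpha> = "cf t"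
  note G' = G[unfolded good_def]
  have "\<exists>f g. vbasis 3 ?C [mvar, f, g] \<and> (\<forall>i<3. homogeneous a (f i)) \<and> (\<forall>i<3. homogeneous b (g i))"
    using G' by (elim conjE)
  then obtain f g where fg: "vbasis 3 ?C [mvar, f, g] \<and> (\<forall>i<3. homogeneous a (f i)) \<and> (\<forall>i<3. homogeneous b (g i))"
    by (elim exE)
  have bas: "vbasis 3 ?C [mvar, f, g]" using fg by (rule conjunct1)
  have hf: "homogeneous a (f i)" and hg: "homogeneous b (g i)" if "i < 3" for i using fg that by simp_all
  have L: "(0, 0, 0) \<notin> set L" "distinct L" "length L = a + b + 1" "inductively_free UNIV (plane ` set L)"
    using G' by simp_all
  have L2: "icross s s' \<noteq> (0, 0, 0)" if "s \<in> set L" "s' \<in> set L" "s \<noteq> s'" for s s'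
    using G' that by simp
  have indep1: "\<not> van3 ?\<alpha> (form3 c)" if "c \<in> ?C" for c using not_van3_cf ts that by blast
  have nz: "nonzero3 ?\<alpha>" using t by (simp add: nonzero3_cf)
  obtain p q \<sigma> \<rho> where par: "dot3 ?\<alpha> p = 0" "dot3 ?\<alpha> q = 0"
    "\<And>u i. dot3 ?\<alpha> u = 0 \<Longrightarrow> i < 3 \<Longrightarrow> u i = dot3 \<sigma> u * p i + dot3 \<rho> u * q i"
    "dot3 \<sigma> p = 1" "dot3 \<sigma> q = 0" "dot3 \<rho> p = 0" "dot3 \<rho> q = 1"
    "\<And>c. c \<in> ?C \<Longrightarrow> dot3 c q \<noteq> 0"
    using plane_parametrisation[OF nz _ indep1, of ?C] by blast
  interpret addition_step ?\<alpha> p q \<sigma> \<rho> ?C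
  proof
    show "nonzero3 c" if "c \<in> ?C" for c using that L(1) nonzero3_cf by blast
    show "\<not> van3 c (form3 d)" if "c \<in> ?C" "d \<in> ?C" "c \<noteq> d" for c d using that L2 not_van3_cf by blast
    show "\<not> van3 c (form3 ?\<alpha>)" if "c \<in> ?C" for c using that ts not_van3_cf icross_commute_nz by blast
  qed (use par nz indep1 in auto)
  \<comment> \<open>The intersection points on the new line correspond to the values of \<open>\<tau>\<close>, so the list \<open>reps\<close> counts them.\<close>
  define val where "val r = dot3 \<rho> (cf r) / dot3 \<sigma> (cf r)" for r
  have val: "val r = \<tau> (cf s) \<and> dot3 \<sigma> (cf r) \<noteq> 0"
    if s: "s \<in> set L" and r: "r \<noteq> (0, 0, 0)" "idot t r = 0" "idot s r = 0" for r s
  proof -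
    have ar: "dot3 ?\<alpha> (cf r) = 0" using r by (simp add: dot3_cf)
    have "dot3 (cf s) (cf r) = 0" using r by (simp add: dot3_cf)
    hence e: "dot3 \<rho> (cf r) = \<tau> (cf s) * dot3 \<sigma> (cf r)"
      using dot_on_plane_C[OF ar, of "cf s"] cq[of "cf s"] s by simp
    have "dot3 \<sigma> (cf r) \<noteq> 0"
    proof
      assume z: "dot3 \<sigma> (cf r) = 0"
      hence "cf r i = 0" if "i < 3" for i using rep[OF ar that] e by simp
      thus False using nonzero3_cf[of r] r(1) by (auto simp: nonzero3_def)
    qed
    thus ?thesis using e by (simp add: val_def)
  qed
  have reps: "(\<forall>r\<in>set (reps t L'). r \<noteq> (0, 0, 0) \<and> idot t r = 0 \<and> (\<exists>s\<in>set L'. idot s r = 0)) \<and>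
      (\<forall>s\<in>set L'. \<exists>r\<in>set (reps t L'). idot s r = 0) \<and> distinct (map val (reps t L'))" if "set L' \<subseteq> set L" for L'
    using that
  proof (induction L')
    case (Cons s L')
    hence IH: "\<forall>r\<in>set (reps t L'). r \<noteq> (0, 0, 0) \<and> idot t r = 0 \<and> (\<exists>s\<in>set L'. idot s r = 0)"
      "\<forall>s\<in>set L'. \<exists>r\<in>set (reps t L'). idot s r = 0" "distinct (map val (reps t L'))" by auto
    show ?case
    proof (cases "list_ex (\<lambda>r. idot s r = 0) (reps t L')")
      case True
      thus ?thesis using IH by (auto simp: Let_def list_ex_iff)
    next
      case False
      let ?r = "icross t s"
      have sL: "s \<in> set L" using Cons.prems by simp
      have r: "?r \<noteq> (0, 0, 0)" "idot t ?r = 0" "idot s ?r = 0" using ts sL by (simp_all add: idot_icross)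
      have "val ?r \<noteq> val r'" if r': "r' \<in> set (reps t L')" for r'
      proof
        assume eq: "val ?r = val r'"
        obtain s' where s': "s' \<in> set L'" "idot s' r' = 0" using IH(1) r' by blast
        have r'': "r' \<noteq> (0, 0, 0)" "idot t r' = 0" using IH(1) r' by auto
        have "val r' = \<tau> (cf s') \<and> dot3 \<sigma> (cf r') \<noteq> 0" by (rule val) (use s' r'' Cons.prems in auto)
        moreover have "val ?r = \<tau> (cf s)" using val[OF sL r] by simp
        ultimately have "\<tau> (cf s) = dot3 \<rho> (cf r') / dot3 \<sigma> (cf r')" "dot3 \<sigma> (cf r') \<noteq> 0" using eq by (auto simp: val_def)
        hence "dot3 (cf s) (cf r') = 0"
          using dot_on_plane_C[of "cf r'" "cf s"] r'' sL by (simp add: dot3_cf)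
        hence "idot s r' = 0" by (simp add: dot3_cf)
        thus False using False r' by (auto simp: list_ex_iff)
      qed
      thus ?thesis using IH r False by (auto simp: Let_def)
    qed
  qed simp
  note reps = reps[OF order_refl]
  have "\<tau> ` ?C = val ` set (reps t L)"
  proof (intro equalityI subsetI)
    fix x assume "x \<in> \<tau> ` ?C"
    then obtain s where s: "s \<in> set L" "x = \<tau> (cf s)" by auto
    then obtain r where r: "r \<in> set (reps t L)" "idot s r = 0" using reps by blast
    hence "val r = \<tau> (cf s)" using val[OF s(1)] reps by blast
    thus "x \<in> val ` set (reps t L)" using r s by (intro image_eqI[of _ _ r]) simp_all
  next
    fix x assume "x \<in> val ` set (reps t L)"
    then obtain r where r: "r \<in> set (reps t L)" "x = val r" by auto
    then obtain s where s: "s \<in> set L" "idot s r = 0" using reps by blast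
    hence "val r = \<tau> (cf s)" using val[OF s(1)] reps r by blast
    thus "x \<in> \<tau> ` ?C" using r s by (intro image_eqI[of _ _ "cf s"]) simp_all
  qed
  hence "card (\<tau> ` ?C) = card (set (map val (reps t L)))" by simp
  also have "\<dots> = a + 1" using reps R by (simp only: distinct_card length_map)
  finally have cardT: "card (\<tau> ` ?C) = a + 1" .
  have injcf: "inj_on cf (set L)" using cf_inj by (auto intro: inj_onI)
  have cardC: "card ?C = a + b + 1" using injcf L(2,3) by (simp add: card_image distinct_card)
  obtain f' g' where new: "vbasis 3 (insert ?\<alpha> ?C) [mvar, f', g']" "\<forall>i<3. homogeneous a (f' i)" "\<forall>i<3. homogeneous (b + 1) (g' i)"
    using addition[OF bas hf hg cardC cardT] by blast
  \<comment> \<open>The restriction to the new plane has rank at most two, and its exponents are \<open>{1, a}\<close>.\<close>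
  let ?H = "plane t" and ?B' = "plane ` set L"
  let ?B'' = "(\<lambda>K. ?H \<inter> K) ` ?B'"
  have mem: "v \<in> plane s \<longleftrightarrow> dot3 (cf s) (co v) = 0" for v s by (simp add: plane_def)
  have spanH: "?H = vec.span {vecof p, vecof q}"
  proof (intro equalityI subsetI)
    fix v assume "v \<in> ?H"
    hence a0: "dot3 ?\<alpha> (co v) = 0" by (simp add: mem)
    have "v = vecof (co v)" by simp
    also have "vecof (co v) = vecof (\<lambda>i. dot3 \<sigma> (co v) * p i + dot3 \<rho> (co v) * q i)"
      by (rule vecof_cong) (rule rep[OF a0])
    also have "\<dots> = dot3 \<sigma> (co v) *s vecof p + dot3 \<rho> (co v) *s vecof q" by (rule vecof_comb)
    also have "\<dots> \<in> vec.span {vecof p, vecof q}" by (intro vec.span_add vec.span_scale vec.span_base) auto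
    finally show "v \<in> vec.span {vecof p, vecof q}" .
  next
    fix v assume v: "v \<in> vec.span {vecof p, vecof q}"
    have "vec.span {vecof p, vecof q} \<subseteq> ?H"
      by (rule vec.span_minimal) (use subspace_plane \<alpha>p \<alpha>q in \<open>auto simp: mem dot3_co_vecof\<close>)
    thus "v \<in> ?H" using v by blast
  qed
  have vq: "vecof q \<notin> vec.span {vecof p}"
  proof
    assume "vecof q \<in> vec.span {vecof p}"
    then obtain k where "vecof q = k *s vecof p" by (auto simp: vec.span_singleton)
    hence "dot3 \<rho> (co (vecof q)) = k * dot3 \<rho> (co (vecof p))" by (simp add: dot3_co_scale)
    thus False using dual by (simp add: dot3_co_vecof)
  qed
  have vp: "vecof p \<noteq> 0"
  proof
    assume "vecof p = 0"
    hence "dot3 \<sigma> (co (vecof p)) = 0" by (simp only: dot3_co_zero)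
    thus False using dual by (simp add: dot3_co_vecof)
  qed
  have indH: "vec.independent {vecof q, vecof p}"
    using vq vp by (simp add: vec.independent_insert)
  have dimH: "vec.dim ?H = 2"
  proof -
    have "vecof q \<noteq> vecof p" using vq vec.span_base[of "vecof p" "{vecof p}"] by auto
    hence "card {vecof p, vecof q} = 2" by auto
    moreover have "vec.dim ?H = card {vecof p, vecof q}"
      unfolding spanH using vec.dim_span_eq_card_independent[of "{vecof p, vecof q}"] indH by (simp add: insert_commute)
    ultimately show ?thesis by simp
  qed
  have int: "?H \<inter> plane s = vec.span {vecof (pt (\<tau> (cf s)))}" if s: "s \<in> set L" for s
  proof (intro equalityI subsetI)
    fix v assume v: "v \<in> ?H \<inter> plane s"
    hence a0: "dot3 ?\<alpha> (co v) = 0" and "dot3 (cf s) (co v) = 0" by (auto simp: mem)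
    hence e: "dot3 \<rho> (co v) = \<tau> (cf s) * dot3 \<sigma> (co v)"
      using dot_on_plane_C[OF a0, of "cf s"] cq[of "cf s"] s by simp
    have "v = vecof (co v)" by simp
    also have "vecof (co v) = vecof (\<lambda>i. dot3 \<sigma> (co v) * pt (\<tau> (cf s)) i + 0 * q i)"
      by (rule vecof_cong) (use rep[OF a0] e in \<open>simp add: pt_def algebra_simps\<close>)
    also have "\<dots> = dot3 \<sigma> (co v) *s vecof (pt (\<tau> (cf s))) + 0 *s vecof q" by (rule vecof_comb)
    finally have "v = dot3 \<sigma> (co v) *s vecof (pt (\<tau> (cf s)))" by simp
    thus "v \<in> vec.span {vecof (pt (\<tau> (cf s)))}" unfolding vec.span_singleton by blast
  next
    fix v assume v: "v \<in> vec.span {vecof (pt (\<tau> (cf s)))}"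
    have "vecof (pt (\<tau> (cf s))) \<in> ?H" "vecof (pt (\<tau> (cf s))) \<in> plane s"
      using s by (auto simp: mem dot3_co_vecof dot_pt_C) (simp add: dot_pt \<alpha>p \<alpha>q)
    thus "v \<in> ?H \<inter> plane s"
      using v vec.span_minimal[of "{vecof (pt (\<tau> (cf s)))}" "?H \<inter> plane s"] vec.subspace_inter[OF subspace_plane subspace_plane]
      by blast
  qed
  have dimint: "vec.dim (?H \<inter> plane s) = 1" if s: "s \<in> set L" for s
  proof -
    have "vecof (pt (\<tau> (cf s))) \<noteq> 0"
    proof
      assume "vecof (pt (\<tau> (cf s))) = 0"
      hence "dot3 \<sigma> (co (vecof (pt (\<tau> (cf s))))) = 0" by (simp only: dot3_co_zero)
      thus False using dual by (simp add: dot3_co_vecof dot_pt)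
    qed
    thus ?thesis unfolding int[OF s] by (simp add: vec.dim_span_eq_card_independent)
  qed
  have dimplane: "vec.dim (plane s) = 2" if "s \<in> set (t # L)" for s
  proof (cases "s = t")
    case False
    hence s: "s \<in> set L" using that by simp
    have sub: "vec.subspace (plane s)" by (rule subspace_plane)
    have "vec.dim (plane s) \<noteq> 3"
    proof
      assume "vec.dim (plane s) = 3"
      hence "plane s = UNIV" using vec.subspace_dim_equal[OF sub vec.subspace_UNIV] dim_UNIV3 by auto
      moreover have "vecof q \<notin> plane s" using cq[of "cf s"] s by (simp add: mem dot3_co_vecof)
      ultimately show False by simp
    qed
    moreover have "vec.dim (plane s) \<le> 3" using vec.dim_subset[of "plane s" UNIV] dim_UNIV3 by simp
    moreover have "vec.dim (plane s) \<ge> 2"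
    proof -
      have eq: "(\<lambda>i. (cf t 0 * 0)) = (\<lambda>i. 0::complex)" by simp
      obtain x where x: "x \<in> plane s" "x \<notin> ?H"
      proof -
        have "\<not> van3 (cf s) (form3 ?\<alpha>)" using not_van3_cf[OF icross_commute_nz] ts s by blast
        then obtain u where "dot3 (cf s) u = 0" "dot3 ?\<alpha> u \<noteq> 0"
          by (auto simp: van3_alt meval_form3 simp del: meval_lform)
        thus ?thesis using that[of "vecof u"] by (simp add: mem dot3_co_vecof)
      qed
      have "?H \<inter> plane s \<noteq> plane s" using x by blast
      have "vec.dim (?H \<inter> plane s) \<noteq> vec.dim (plane s)"
        using vec.subspace_dim_equal[OF vec.subspace_inter[OF subspace_plane subspace_plane] sub, of t s] x by auto
      moreover have "vec.dim (?H \<inter> plane s) \<le> vec.dim (plane s)" by (rule vec.dim_subset) auto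
      ultimately show ?thesis using dimint[OF s] by simp
    qed
    ultimately show ?thesis by linarith
  qed (use dimH in simp)
  have arrU: "arrangement UNIV (plane ` set (t # L))"
    unfolding arrangement_def using dimplane dim_UNIV3 subspace_plane by auto
  have arrH: "arrangement ?H ?B''"
    unfolding arrangement_def
  proof (intro conjI ballI)
    fix Y assume "Y \<in> ?B''"
    then obtain s where s: "s \<in> set L" "Y = ?H \<inter> plane s" by blast
    show "vec.subspace Y" unfolding s(2) by (rule vec.subspace_inter[OF subspace_plane subspace_plane])
    show "Y \<subseteq> ?H" unfolding s(2) by blast
    show "vec.dim ?H = vec.dim Y + 1" unfolding s(2) dimint[OF s(1)] dimH by simp
  qed (simp_all add: subspace_plane)
  have tL: "?H \<notin> ?B'" using plane_neq ts by blast
  have Lne: "L \<noteq> []" using L(3) by auto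
  have "card ?B'' = card ((\<lambda>s. ?H \<inter> plane s) ` set L)" by (simp add: image_image)
  also have "\<dots> = card ((\<lambda>s. \<tau> (cf s)) ` set L)"
  proof (rule card_image_eq_if_same_kernel)
    fix s s' assume s: "s \<in> set L" "s' \<in> set L"
    show "?H \<inter> plane s = ?H \<inter> plane s' \<longleftrightarrow> \<tau> (cf s) = \<tau> (cf s')"
    proof
      assume eq: "?H \<inter> plane s = ?H \<inter> plane s'"
      let ?r = "icross t s"
      have r: "?r \<noteq> (0, 0, 0)" "idot t ?r = 0" "idot s ?r = 0" using ts s by (simp_all add: idot_icross)
      have "vecof (cf ?r) \<in> ?H \<inter> plane s" using r by (simp add: mem dot3_co_vecof dot3_cf)
      hence "vecof (cf ?r) \<in> plane s'" unfolding eq by blast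
      hence "idot s' ?r = 0" by (simp add: mem dot3_co_vecof dot3_cf)
      thus "\<tau> (cf s) = \<tau> (cf s')" using val[OF s(1) r] val[OF s(2) r(1,2)] by simp
    qed (simp add: int s)
  qed
  also have "\<dots> = a + 1" using cardT by (simp add: image_image)
  finally have cardB'': "card ?B'' = a + 1" .
  have ninj: "inj_on plane (set L)" using plane_neq L2 by (intro inj_onI) blast
  let ?c = "\<lambda>K. cf (inv_into (set L) plane K)"
  have cB: "?c ` ?B' = ?C" using ninj by (simp add: image_image cong: image_cong)
  have ex1: "has_exponents UNIV ?B' (mset [1, a, b])"
  proof (rule has_exponentsI[OF coordinates_bb _ dim_UNIV3[symmetric], where c="?c" and G="[mvar, f, g]"])
    fix K assume K: "K \<in> ?B'"
    then obtain s where s: "s \<in> set L" "K = plane s" by blast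
    have cK: "?c K = cf s" using s ninj by simp
    show "K = {\<Sum>i<3. u i *s bb i | u. (\<Sum>i<3. ?c K i * u i) = 0}"
      unfolding cK unfolding s(2) by (rule plane_eq)
    show "\<exists>k<3. ?c K k \<noteq> 0" unfolding cK using nonzero3_cf[of s] L(1) s by (auto simp: nonzero3_def)
  next
    show "vbasis 3 (?c ` ?B') [mvar, f, g]" unfolding cB by (rule bas)
    fix j i :: nat assume "j < length [mvar, f, g]" "i < 3"
    thus "homogeneous ([1, a, b] ! j) (([mvar, f, g] ! j) i)"
      using hf hg by (auto simp: less_Suc_eq numeral_2_eq_2)
  qed auto
  have ex2: "has_exponents ?H ?B'' {#1, card ?B'' - 1#}"
    by (rule has_exponents_dim2[OF subspace_plane dimH arrH]) (use Lne in simp)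
  have if2: "inductively_free ?H ?B''" by (rule inductively_free_dim2[OF subspace_plane dimH arrH])
  have sub: "{#1, card ?B'' - 1#} \<subseteq># mset [1, a, b]" unfolding cardB'' by simp
  have B': "?B' = plane ` set (t # L) - {?H}" using tL by auto
  have "inductively_free UNIV (plane ` set (t # L))"
    by (rule inductively_free.add_hyperplane[OF arrU _ B' refl L(4) if2 ex1 ex2 sub]) simp
  moreover have "t \<notin> set L"
  proof
    assume "t \<in> set L"
    thus False using tL by blast
  qed
  moreover have "icross s s' \<noteq> (0, 0, 0)" if "s \<in> set (t # L)" "s' \<in> set (t # L)" "s \<noteq> s'" for s s'
    using that L2 ts icross_commute_nz by (metis set_ConsD)
  ultimately show ?thesis
    unfolding good_def using t L new by auto
qed

text \<open>Adds the lines of the second list one after the other, checking that each of them meets the previous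
  ones in \<open>a + 1\<close> or \<open>b + 1\<close> points.\<close>

fun run :: "triple list \<Rightarrow> triple list \<Rightarrow> nat \<Rightarrow> nat \<Rightarrow> bool" where
  "run L [] a b \<longleftrightarrow> True"
| "run L (t # ts) a b \<longleftrightarrow> t \<noteq> (0, 0, 0) \<and> list_all (\<lambda>s. icross t s \<noteq> (0, 0, 0)) L \<and>
     (let n = length (reps t L) in
        if n = Suc a then run (t # L) ts a (Suc b)
        else if n = Suc b then run (t # L) ts (Suc a) b else False)"

lemma run_good:
  "good L a b \<Longrightarrow> run L ts a b \<Longrightarrow> \<exists>a b. good (rev ts @ L) a b"
proof (induction ts arbitrary: L a b)
  case (Cons t ts)
  have t: "t \<noteq> (0, 0, 0)" "\<forall>s\<in>set L. icross t s \<noteq> (0, 0, 0)"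
    using Cons.prems(2) by (simp_all add: list_all_iff)
  consider "length (reps t L) = Suc a" "run (t # L) ts a (Suc b)"
    | "length (reps t L) = Suc b" "run (t # L) ts (Suc a) b"
    using Cons.prems(2) by (auto simp: Let_def split: if_splits)
  thus ?case
  proof cases
    case 1
    have "good (t # L) a (b + 1)" by (rule good_step[OF Cons.prems(1) t]) (use 1 in simp)
    thus ?thesis using Cons.IH[of "t # L" a "Suc b"] 1 by simp
  next
    case 2
    have "good (t # L) b (a + 1)" by (rule good_step[OF good_swap[OF Cons.prems(1)] t]) (use 2 in simp)
    hence "good (t # L) (Suc a) b" using good_swap by simp
    thus ?thesis using Cons.IH[of "t # L" "Suc a" b] 2 by simp
  qed
qed auto

text \<open>For the single line \<open>z = 0\<close> the Euler field and the constant fields \<open>\<partial>/\<partial>X\<close>, \<open>\<partial>/\<partial>y\<close> form a basis.\<close>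

lemma good_single: "good [(0, 0, 1)] 0 0"
proof -
  let ?t = "(0, 0, 1) :: triple"
  let ?e = "\<lambda>i::nat. if i = 0 then 1 else 0 :: (nat, complex) mpoly"
  let ?f = "\<lambda>i::nat. if i = 1 then 1 else 0 :: (nat, complex) mpoly"
  have cf: "cf ?t = (\<lambda>i. if i = 0 then 0 else if i = 1 then 0 else 1)" by (auto simp: cf_def)
  have lin: "lin 3 (cf ?t) g = g 2" for g
    by (simp add: lin_def lessThan_three cf) (simp add: mconst_def)
  have f3: "form3 (cf ?t) = mvar 2" using lin[of mvar] by (simp add: lin_euler)
  have nz: "nonzero3 (cf ?t)" by (simp add: nonzero3_cf)
  have bas: "vbasis 3 {cf ?t} [mvar, ?e, ?f]"
  proof (rule vbasis3I)
    show "tangent 3 c mvar" for c :: "nat \<Rightarrow> complex" by (rule tangent_euler)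
    show "tangent 3 c ?e" "tangent 3 c ?f" if "c \<in> {cf ?t}" for c
      using that by (simp_all add: tangent_def lin vanishes_on_def)
    show "mvar \<in> vfields 3" "?e \<in> vfields 3" "?f \<in> vfields 3"
      by (auto simp: vfields_def intro: poly_ring_rules)
  next
    fix h :: "nat \<Rightarrow> (nat, complex) mpoly" assume h: "h \<in> vfields 3" "\<forall>c\<in>{cf ?t}. tangent 3 c h"
    have hR: "h i \<in> poly_ring 3" if "i < 3" for i using h(1) that by (auto simp: vfields_def)
    have "van3 (cf ?t) (h 2)" using h(2) by (simp add: tangent_def lin)
    then obtain r where r: "r \<in> poly_ring 3" "h 2 = mvar 2 * r"
      using van3_dvd[OF nz hR[of 2]] unfolding f3 by auto
    have "h i = r * mvar i + (h 0 - r * mvar 0) * ?e i + (h 1 - r * mvar 1) * ?f i" if "i < 3" for i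
      using that r(2) by (auto simp: less_Suc_eq numeral_3_eq_3 numeral_2_eq_2 mult.commute)
    moreover have "h 0 - r * mvar 0 \<in> poly_ring 3" "h 1 - r * mvar 1 \<in> poly_ring 3"
      using hR[of 0] hR[of 1] r(1) by (auto intro!: poly_ring_rules(2,3,12))
    ultimately show "\<exists>p\<in>poly_ring 3. \<exists>q\<in>poly_ring 3. \<exists>r\<in>poly_ring 3. \<forall>i<3. h i = p * mvar i + q * ?e i + r * ?f i"
      using r(1) by blast
  next
    fix p q r :: "(nat, complex) mpoly" assume eq: "\<forall>i<3. p * mvar i + q * ?e i + r * ?f i = 0"
    have "p * mvar 2 = 0" using eq[rule_format, of 2] by simp
    hence "p = 0" by simp
    thus "p = 0 \<and> q = 0 \<and> r = 0" using eq[rule_format, of 0] eq[rule_format, of 1] by simp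
  qed
  have dimH: "vec.dim (plane ?t) = 2"
  proof -
    have p: "plane ?t = vec.span {vecof (\<lambda>i. if i = 0 then 1 else 0), vecof (\<lambda>i. if i = 1 then 1 else 0)}" (is "_ = vec.span {?a, ?b}")
    proof (intro equalityI subsetI)
      fix v assume "v \<in> plane ?t"
      hence "v $ 3 = 0" by (simp add: plane_def dot3_alt cf co_def)
      hence "v = (v $ 1 / s3) *s ?a + (v $ 2) *s ?b" by (intro vec3_eqI) simp_all
      moreover have "(v $ 1 / s3) *s ?a + (v $ 2) *s ?b \<in> vec.span {?a, ?b}"
        by (intro vec.span_add vec.span_scale vec.span_base) auto
      ultimately show "v \<in> vec.span {?a, ?b}" by simp
    next
      fix v assume v: "v \<in> vec.span {?a, ?b}"
      have "vec.span {?a, ?b} \<subseteq> plane ?t"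
        by (rule vec.span_minimal[OF _ subspace_plane]) (auto simp: plane_def dot3_alt cf co_def)
      thus "v \<in> plane ?t" using v by blast
    qed
    have n: "?a \<notin> vec.span {?b}"
    proof
      assume "?a \<in> vec.span {?b}"
      then obtain k where "?a = k *s ?b" by (auto simp: vec.span_singleton)
      hence "?a $ 1 = (k *s ?b) $ 1" by (rule arg_cong)
      thus False by simp
    qed
    have b0: "?b \<noteq> 0"
    proof
      assume "?b = 0"
      hence "?b $ 2 = (0 :: complex^3) $ 2" by (rule arg_cong)
      thus False by simp
    qed
    have "?a \<noteq> ?b" using n vec.span_base[of ?b "{?b}"] by auto
    hence c: "card {?a, ?b} = 2" by simp
    have "vec.independent {?a, ?b}" using n b0 by (simp add: vec.independent_insert)
    hence "vec.dim (vec.span {?a, ?b}) = card {?a, ?b}" by (rule vec.dim_span_eq_card_independent)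
    thus ?thesis unfolding p c .
  qed
  have "inductively_free UNIV {plane ?t}"
  proof (rule inductively_free.add_hyperplane[where H="plane ?t", OF _ _ refl refl])
    show "arrangement UNIV {plane ?t}"
      unfolding arrangement_def using subspace_plane dimH dim_UNIV3 by simp
    show "inductively_free UNIV ({plane ?t} - {plane ?t} :: (complex^3) set set)"
      using inductively_free.empty[OF vec.subspace_UNIV] by simp
    show "inductively_free (plane ?t) ((\<lambda>K. plane ?t \<inter> K) ` ({plane ?t} - {plane ?t}))"
      using inductively_free.empty[OF subspace_plane] by simp
    show "has_exponents UNIV ({plane ?t} - {plane ?t}) (replicate_mset 3 0)"
      using has_exponents_empty[OF vec.subspace_UNIV, where 'a=complex and 'n=3] unfolding dim_UNIV3 by simp
    show "has_exponents (plane ?t) ((\<lambda>K. plane ?t \<inter> K) ` ({plane ?t} - {plane ?t})) (replicate_mset 2 0)"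
      using has_exponents_empty[OF subspace_plane[of ?t]] by (simp add: dimH)
  qed (simp_all add: numeral_3_eq_3 numeral_2_eq_2)
  moreover have "\<forall>i<3. homogeneous 0 (?e i)" "\<forall>i<3. homogeneous 0 (?f i)" by simp_all
  ultimately show ?thesis
    unfolding good_def using bas by (intro conjI exI[of _ ?e] exI[of _ ?f]) auto
qed

text \<open>The 31 lines in the coordinates \<open>X, y, z\<close>; factors \<open>\<surd>3\<close> are cancelled.\<close>

definition lines31 :: "triple list" where
  "lines31 = [(0,0,1), (1,0,0), (0,1,0), (3,1,0), (3,-1,0), (1,1,0), (1,-1,0), (2,0,-1), (2,0,1), (1,0,-1), (1,0,1),
    (1,1,1), (1,1,-1), (1,-1,1), (1,-1,-1), (1,1,2), (1,1,-2), (1,-1,2), (1,-1,-2),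
    (3,1,1), (3,1,-1), (3,-1,1), (3,-1,-1), (0,2,-1), (0,2,1), (4,0,1), (4,0,-1),
    (2,-2,1), (2,-2,-1), (2,2,-1), (2,2,1)]"

text \<open>An order in which each line meets the previous ones in a suitable number of points; the exponents at
  the end are \<open>{1, 13, 17}\<close>.\<close>

definition adding_order :: "triple list" where
  "adding_order = [(1,0,0), (0,1,0), (3,1,0), (3,-1,0), (1,1,0), (1,-1,0), (2,0,-1), (2,0,1), (1,0,-1), (1,0,1),
    (4,0,1), (1,1,1), (1,-1,1), (1,1,-1), (1,-1,-1), (1,1,2), (1,1,-2), (1,-1,2), (1,-1,-2),
    (3,1,1), (3,1,-1), (3,-1,1), (3,-1,-1), (0,2,-1), (0,2,1), (4,0,-1),
    (2,-2,1), (2,-2,-1), (2,2,-1), (2,2,1)]"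

lemma run_adding_order: "run [(0,0,1)] adding_order 0 0"
  by code_simp

lemma A_31_3_eq: "A_31_3 = plane ` set lines31"
proof -
  let ?S = "\<lambda>i. {v :: complex^3. forms_31_3 (v $ 1) (v $ 2) (v $ 3) ! i = 0}"
  let ?k = "[1, s3, 1, 1, 1, s3, s3, s3, s3, s3, s3, s3, s3, s3, s3, s3, s3, s3, s3, 1, 1, 1, 1, 1, 1, s3, s3, s3, s3, s3, s3]"
  have d: "y * 3 / s3 = s3 * y" for y using s3_sq by (simp add: field_simps)
  have val: "forms_31_3 (v $ 1) (v $ 2) (v $ 3) = map2 (\<lambda>k t. k * dot3 (cf t) (co v)) ?k lines31" for v :: "complex^3"
    unfolding forms_31_3_def Let_def s3_def[symmetric] lines31_def
    by (simp add: dot3_alt cf_def co_def d algebra_simps)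
  have "?S i = plane (lines31 ! i)" if i: "i < 31" for i
  proof -
    have l: "length lines31 = 31" "length ?k = 31" by (simp_all add: lines31_def)
    have "\<forall>x\<in>set ?k. x \<noteq> 0" by simp
    hence "?k ! i \<noteq> 0" using i l(2) nth_mem by metis
    thus ?thesis using i l by (simp add: val plane_def del: length_Cons)
  qed
  hence "?S ` {..<31} = plane ` (\<lambda>i. lines31 ! i) ` {..<31}"
    by (simp add: image_image)
  also have "(\<lambda>i. lines31 ! i) ` {..<31} = set lines31"
  proof -
    have "length lines31 = 31" by (simp add: lines31_def)
    thus ?thesis using nth_image[of 31 lines31] by (simp add: lessThan_atLeast0)
  qed
  finally have "?S ` {..<31} = plane ` set lines31" .
  moreover have "A_31_3 = ?S ` {..<31}" unfolding A_31_3_def by auto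
  ultimately show ?thesis by simp
qed

theorem inductively_free_A_31_3: "inductively_free UNIV A_31_3"
proof -
  obtain a b where "good (rev adding_order @ [(0,0,1)]) a b"
    using run_good[OF good_single run_adding_order] by blast
  hence "inductively_free UNIV (plane ` set (rev adding_order @ [(0,0,1)]))" by (simp add: good_def)
  moreover have "set (rev adding_order @ [(0,0,1)]) = set lines31" by (auto simp: adding_order_def lines31_def)
  ultimately show ?thesis by (simp only: A_31_3_eq)
qed

section \<open>Ternary forms with integer coefficients\<close>

definition mexp :: "nat \<Rightarrow> nat \<Rightarrow> nat \<Rightarrow> nat \<Rightarrow>\<^sub>0 nat" where
  "mexp i j k = Poly_Mapping.single 0 i + Poly_Mapping.single 1 j + Poly_Mapping.single 2 k"

definition mon :: "nat \<Rightarrow> nat \<Rightarrow> nat \<Rightarrow> (nat, complex) mpoly" where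
  "mon i j k = mvar 0 ^ i * mvar 1 ^ j * mvar 2 ^ k"

lemma meval_mon: "meval (mon i j k) u = u 0 ^ i * u 1 ^ j * u 2 ^ k"
  by (simp add: mon_def meval_simps)

lemma mon_single: "mon i j k = Poly_Mapping.single (mexp i j k) 1"
  by (rule mpoly_eqI) (simp add: meval_mon mexp_def mono_eval_add)

lemma mon_mult: "mon i j k * mon a b c = mon (i + a) (j + b) (k + c)"
  by (rule mpoly_eqI) (simp add: meval_mult meval_mon power_add mult_ac)

lemma lookup_mexp: "lk (mexp i j k) n = (if n = 0 then i else if n = 1 then j else if n = 2 then k else 0)"
  by (auto simp: mexp_def lookup_add lookup_single)

lemma mexp_eq_iff: "mexp i j k = mexp a b c \<longleftrightarrow> i = a \<and> j = b \<and> k = c"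
proof
  assume eq: "mexp i j k = mexp a b c"
  have "lk (mexp i j k) n = lk (mexp a b c) n" for n by (simp only: eq)
  from this[of 0] this[of 1] this[of 2] show "i = a \<and> j = b \<and> k = c" by (simp add: lookup_mexp)
qed auto

lemma mdeg_mexp: "mdeg (mexp i j k) = i + j + k"
  by (simp add: mexp_def)

lemma homogeneous_mon: "i + j + k = d \<Longrightarrow> homogeneous d (mon i j k)"
  unfolding mon_single by (rule homogeneous_single) (simp add: mdeg_mexp)

lemma mon_poly_ring: "mon i j k \<in> poly_ring 3"
  unfolding mon_def by (intro poly_ring_rules) auto

text \<open>The coefficient of \<open>X\<^sup>i Y\<^sup>j Z\<^sup>k\<close>.\<close>

definition cof :: "(nat, complex) mpoly \<Rightarrow> nat \<Rightarrow> nat \<Rightarrow> nat \<Rightarrow> complex" where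
  "cof p i j k = lk p (mexp i j k)"

lemma lookup_mconst_mult: "lk (mconst c * p) m = c * lk p m"
  for p :: "('x, 'a::comm_ring_1) mpoly"
  by (induction p rule: mpoly_induct)
     (simp_all add: mconst_def mult_single lookup_single when_def ring_distribs lookup_add)

lemma cof_mon: "cof (mon a b c) i j k = (if a = i \<and> b = j \<and> c = k then 1 else 0)"
  by (simp add: cof_def mon_single lookup_single when_def mexp_eq_iff)

lemma cof_add: "cof (p + q) i j k = cof p i j k + cof q i j k"
  and cof_scale: "cof (mconst c * p) i j k = c * cof p i j k"
  and cof_zero: "cof 0 i j k = 0"
  by (simp_all add: cof_def lookup_add lookup_mconst_mult)

lemma cof_sum: "cof (sum f T) i j k = (\<Sum>x\<in>T. cof (f x) i j k)"
  by (induction T rule: infinite_finite_induct) (simp_all add: cof_add cof_zero)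

lemma cof_homogeneous: "homogeneous d p \<Longrightarrow> i + j + k \<noteq> d \<Longrightarrow> cof p i j k = 0"
  unfolding cof_def homogeneous_alt by (metis in_keys_iff mdeg_mexp)

definition tdeg :: "nat \<Rightarrow> (nat \<times> nat) set" where
  "tdeg d = {(a, b). a + b \<le> d}"

lemma mem_tdeg: "(a, b) \<in> tdeg d \<longleftrightarrow> a + b \<le> d"
  by (simp add: tdeg_def)

lemma finite_tdeg [simp]: "finite (tdeg d)"
  by (rule finite_subset[of _ "{0..d} \<times> {0..d}"]) (auto simp: tdeg_def)

lemma form_expand:
  assumes "p \<in> poly_ring 3" "homogeneous d p"
  shows "p = (\<Sum>(a, b)\<in>tdeg d. mconst (cof p a b (d - a - b)) * mon a b (d - a - b))"
proof -
  let ?h = "\<lambda>(a, b). mexp a b (d - a - b)"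
  have inj: "inj_on ?h (tdeg d)" by (auto simp: inj_on_def mexp_eq_iff)
  have sub: "mkeys p \<subseteq> ?h ` tdeg d"
  proof
    fix m assume m: "m \<in> mkeys p"
    hence "mkeys m \<subseteq> {..<3}" using assms(1) by (auto simp: poly_ring_def)
    hence z: "lk m n = 0" if "n \<ge> 3" for n using that by (auto simp: in_keys_iff subset_iff)
    have eq: "m = mexp (lk m 0) (lk m 1) (lk m 2)"
    proof (rule poly_mapping_eqI)
      fix n :: nat
      consider "n = 0" | "n = 1" | "n = 2" | "n \<ge> 3" by linarith
      thus "lk m n = lk (mexp (lk m 0) (lk m 1) (lk m 2)) n"
        by cases (auto simp: lookup_mexp z)
    qed
    have "mdeg m = d" using assms(2) m by (simp add: homogeneous_alt)
    hence d: "lk m 0 + lk m 1 + lk m 2 = d" by (metis eq mdeg_mexp)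
    have "m = ?h (lk m 0, lk m 1)" using eq d by (metis add_diff_cancel_left' case_prod_conv diff_diff_left)
    thus "m \<in> ?h ` tdeg d" using d by (intro image_eqI[of _ _ "(lk m 0, lk m 1)"]) (auto simp: mem_tdeg)
  qed
  have "p = (\<Sum>m\<in>mkeys p. Poly_Mapping.single m (lk p m))" by (rule mpoly_expand)
  also have "\<dots> = (\<Sum>m\<in>?h ` tdeg d. Poly_Mapping.single m (lk p m))"
    by (rule sum.mono_neutral_left) (use sub in \<open>auto simp: in_keys_iff\<close>)
  also have "\<dots> = (\<Sum>x\<in>tdeg d. Poly_Mapping.single (?h x) (lk p (?h x)))"
    using inj by (simp add: sum.reindex)
  also have "\<dots> = (\<Sum>(a, b)\<in>tdeg d. mconst (cof p a b (d - a - b)) * mon a b (d - a - b))"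
    by (intro sum.cong refl) (auto simp: cof_def mon_single mconst_def mult_single)
  finally show ?thesis .
qed

subsection \<open>Coefficient tables\<close>

fun rowp :: "nat \<Rightarrow> nat \<Rightarrow> nat \<Rightarrow> int list \<Rightarrow> (nat, complex) mpoly" where
  "rowp a b d [] = 0"
| "rowp a b d (c # cs) = mconst (of_int c) * mon a b (d - a - b) + rowp a (b + 2) d cs"

text \<open>The form of degree \<open>d\<close> in which \<open>G ! i ! j\<close> is the coefficient of \<open>X\<^bsup>a+2i\<^esup> Y\<^bsup>b+2j\<^esup>\<close>, the exponent of \<open>Z\<close>
  being determined by \<open>d\<close>. One table thus stores one parity class of monomials.\<close>

fun polp :: "nat \<Rightarrow> nat \<Rightarrow> nat \<Rightarrow> int list list \<Rightarrow> (nat, complex) mpoly" where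
  "polp a b d [] = 0"
| "polp a b d (r # rs) = rowp a b d r + polp (a + 2) b d rs"

fun rowok :: "nat \<Rightarrow> nat \<Rightarrow> nat \<Rightarrow> int list \<Rightarrow> bool" where
  "rowok a b d [] \<longleftrightarrow> True"
| "rowok a b d (c # cs) \<longleftrightarrow> a + b \<le> d \<and> rowok a (b + 2) d cs"

fun polok :: "nat \<Rightarrow> nat \<Rightarrow> nat \<Rightarrow> int list list \<Rightarrow> bool" where
  "polok a b d [] \<longleftrightarrow> True"
| "polok a b d (r # rs) \<longleftrightarrow> rowok a b d r \<and> polok (a + 2) b d rs"

lemma rowp_poly_ring: "rowp a b d r \<in> poly_ring 3"
  by (induction r arbitrary: b) (auto intro!: poly_ring_rules mon_poly_ring)

lemma polp_poly_ring: "polp a b d G \<in> poly_ring 3"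
  by (induction G arbitrary: a) (auto intro!: poly_ring_rules rowp_poly_ring)

lemma homogeneous_rowp: "rowok a b d r \<Longrightarrow> homogeneous d (rowp a b d r)"
  by (induction r arbitrary: b) (auto intro!: homogeneous_add homogeneous_smult homogeneous_mon)

lemma homogeneous_polp: "polok a b d G \<Longrightarrow> homogeneous d (polp a b d G)"
  by (induction G arbitrary: a) (auto intro!: homogeneous_add homogeneous_rowp)

lemma mon_mult_rowp:
  "rowok a b d r \<Longrightarrow> mon i j k * rowp a b d r = rowp (a + i) (b + j) (d + i + j + k) r"
proof (induction r arbitrary: b)
  case (Cons c cs)
  have e: "k + (d - a - b) = d + i + j + k - (a + i) - (b + j)" using Cons.prems by simp
  have "mon i j k * (mconst (of_int c) * mon a b (d - a - b)) = mconst (of_int c) * mon (a + i) (b + j) (k + (d - a - b))"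
    by (simp add: mon_mult[symmetric] mult_ac) (simp add: mon_mult add.commute mult_ac)
  thus ?case using Cons by (simp add: ring_distribs e add.commute add.left_commute)
qed simp

lemma mon_mult_polp:
  "polok a b d G \<Longrightarrow> mon i j k * polp a b d G = polp (a + i) (b + j) (d + i + j + k) G"
proof (induction G arbitrary: a)
  case (Cons r rs)
  have "mon i j k * polp (a + 2) b d rs = polp (a + 2 + i) (b + j) (d + i + j + k) rs" using Cons by simp
  moreover have "a + 2 + i = a + i + 2" by simp
  ultimately show ?case using Cons mon_mult_rowp by (simp add: ring_distribs)
qed simp

lemma rowok_shift: "rowok a b d r \<Longrightarrow> rowok (a + i) (b + j) (d + i + j + k) r"
proof (induction r arbitrary: b)
  case (Cons c cs)
  show ?case using Cons.IH[of "b + 2"] Cons.prems by simp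
qed simp

lemma polok_shift: "polok a b d G \<Longrightarrow> polok (a + i) (b + j) (d + i + j + k) G"
proof (induction G arbitrary: a)
  case (Cons r rs)
  show ?case using Cons.IH[of "a + 2"] Cons.prems rowok_shift by simp
qed simp

definition ent :: "int list list \<Rightarrow> nat \<Rightarrow> nat \<Rightarrow> int" where
  "ent L x y = (if x < length L \<and> y < length (L ! x) then L ! x ! y else 0)"

definition icof :: "nat \<Rightarrow> nat \<Rightarrow> int list list \<Rightarrow> nat \<Rightarrow> nat \<Rightarrow> int" where
  "icof a b G i j = (if a \<le> i \<and> b \<le> j \<and> even (i - a) \<and> even (j - b) then ent G ((i - a) div 2) ((j - b) div 2) else 0)"

lemma ent_Cons: "ent (r # rs) x y = (if x = 0 then if y < length r then r ! y else 0 else ent rs (x - 1) y)"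
  by (cases x) (auto simp: ent_def)

lemma cof_rowp:
  "rowok a b d r \<Longrightarrow> cof (rowp a b d r) i j (d - i - j) =
     (if i = a \<and> b \<le> j \<and> even (j - b) \<and> (j - b) div 2 < length r then of_int (r ! ((j - b) div 2)) else 0)"
proof (induction r arbitrary: b)
  case (Cons c cs)
  show ?case
  proof (cases "i = a")
    case i: True
    consider "j < b" | "j = b" | "j = b + 1" | "j \<ge> b + 2" by linarith
    thus ?thesis
    proof cases
      case 4
      then obtain l where l: "j = b + 2 + l" by (metis le_add_diff_inverse)
      have "even (j - b) \<longleftrightarrow> even (j - (b + 2))" "(j - b) div 2 = Suc ((j - (b + 2)) div 2)" by (simp_all add: l)
      thus ?thesis using Cons 4 i by (simp add: cof_add cof_scale cof_mon)
    qed (use Cons i in \<open>auto simp: cof_add cof_scale cof_mon\<close>)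
  qed (use Cons in \<open>simp add: cof_add cof_scale cof_mon\<close>)
qed (simp add: cof_zero)

lemma cof_polp:
  "polok a b d G \<Longrightarrow> cof (polp a b d G) i j (d - i - j) = of_int (icof a b G i j)"
proof (induction G arbitrary: a)
  case (Cons r rs)
  have ok: "rowok a b d r" "polok (a + 2) b d rs" using Cons.prems by simp_all
  let ?r = "if i = a \<and> b \<le> j \<and> even (j - b) \<and> (j - b) div 2 < length r then r ! ((j - b) div 2) else 0"
  have "cof (polp a b d (r # rs)) i j (d - i - j) = cof (rowp a b d r) i j (d - i - j) + cof (polp (a + 2) b d rs) i j (d - i - j)"
    by (simp only: polp.simps cof_add)
  also have "\<dots> = of_int (?r + icof (a + 2) b rs i j)"
    unfolding cof_rowp[OF ok(1)] Cons.IH[OF ok(2)] by simp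
  also have "?r + icof (a + 2) b rs i j = icof a b (r # rs) i j"
  proof -
    consider "i < a" | "i = a" | "i = a + 1" | "i \<ge> a + 2" by linarith
    thus ?thesis
    proof cases
      case 4
      then obtain l where l: "i = a + 2 + l" by (metis le_add_diff_inverse)
      have "(i - a) div 2 = Suc ((i - (a + 2)) div 2)" by (simp add: l)
      thus ?thesis using 4 by (simp add: icof_def ent_Cons)
    qed (auto simp: icof_def ent_Cons)
  qed
  finally show ?case .
qed (simp add: cof_zero icof_def ent_def)

subsection \<open>A functional on forms of fixed degree\<close>

text \<open>The functional on forms of degree \<open>n\<close> whose value on \<open>X\<^bsup>2x\<^esup> Y\<^bsup>2y+1\<^esup> Z\<^sup>*\<close> is the entry \<open>(x, y)\<close> of
  the table, and which is zero on all other monomials.\<close>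

definition Lam :: "nat \<Rightarrow> int list list \<Rightarrow> (nat, complex) mpoly \<Rightarrow> complex" where
  "Lam n L p = (\<Sum>(x, y)\<in>{(x, y)\<in>tdeg n. 2 * x + 2 * y + 1 \<le> n}. of_int (ent L x y) * cof p (2 * x) (2 * y + 1) (n - 2 * x - (2 * y + 1)))"

lemma Lam_zero [simp]: "Lam n L 0 = 0"
  by (simp add: Lam_def cof_zero)

lemma Lam_add: "Lam n L (p + q) = Lam n L p + Lam n L q"
  by (simp add: Lam_def cof_add ring_distribs sum.distrib case_prod_unfold)

lemma Lam_scale: "Lam n L (mconst c * p) = c * Lam n L p"
  unfolding Lam_def cof_scale by (simp add: sum_distrib_left case_prod_unfold mult.left_commute)

lemma Lam_sum: "Lam n L (sum f T) = (\<Sum>x\<in>T. Lam n L (f x))"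
  by (induction T rule: infinite_finite_induct) (simp_all add: Lam_add)

lemma Lam_mon:
  assumes "a + b + c = n"
  shows "Lam n L (mon a b c) = (if even a \<and> odd b then of_int (ent L (a div 2) (b div 2)) else 0)"
proof -
  let ?S = "{(x, y)\<in>tdeg n. 2 * x + 2 * y + 1 \<le> n}"
  have fin: "finite ?S" by (rule finite_subset[OF _ finite_tdeg]) auto
  have "Lam n L (mon a b c) = (\<Sum>z\<in>?S. if z = (a div 2, b div 2) then (if even a \<and> odd b then of_int (ent L (a div 2) (b div 2)) else 0) else 0)"
    unfolding Lam_def
  proof (intro sum.cong refl)
    fix z assume z: "z \<in> ?S"
    obtain x y where xy: "z = (x, y)" by (cases z)
    have "a = 2 * x \<and> b = 2 * y + 1 \<and> c = n - 2 * x - (2 * y + 1) \<longleftrightarrow> x = a div 2 \<and> y = b div 2 \<and> even a \<and> odd b"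
    proof -
      have "a = 2 * x \<longleftrightarrow> x = a div 2 \<and> even a" "b = 2 * y + 1 \<longleftrightarrow> y = b div 2 \<and> odd b" by auto
      moreover have "c = n - 2 * x - (2 * y + 1)" if "a = 2 * x" "b = 2 * y + 1" using assms that by simp
      ultimately show ?thesis by blast
    qed
    thus "(case z of (x, y) \<Rightarrow> of_int (ent L x y) * cof (mon a b c) (2 * x) (2 * y + 1) (n - 2 * x - (2 * y + 1))) =
        (if z = (a div 2, b div 2) then (if even a \<and> odd b then of_int (ent L (a div 2) (b div 2)) else 0) else 0 :: complex)"
      by (auto simp: xy cof_mon)
  qed
  also have "\<dots> = (if even a \<and> odd b then of_int (ent L (a div 2) (b div 2)) else 0)"
  proof (cases "even a \<and> odd b")
    case True
    hence "(a div 2, b div 2) \<in> ?S" using assms by (auto simp: mem_tdeg elim!: evenE oddE)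
    thus ?thesis using fin by (simp add: sum.delta)
  qed auto
  finally show ?thesis .
qed

lemma Lam_degree: "homogeneous d p \<Longrightarrow> d \<noteq> n \<Longrightarrow> Lam n L p = 0"
  unfolding Lam_def by (intro sum.neutral) (auto intro!: cof_homogeneous)

fun dotrow :: "int list \<Rightarrow> int list \<Rightarrow> int" where
  "dotrow (c # cs) (l # ls) = c * l + dotrow cs ls"
| "dotrow _ _ = 0"

fun dot2 :: "int list list \<Rightarrow> int list list \<Rightarrow> int" where
  "dot2 (r # rs) (l # ls) = dotrow r l + dot2 rs ls"
| "dot2 _ _ = 0"

text \<open>The value of a functional with table \<open>L\<close> on a product of a form with table \<open>G\<close> and a monomial
  corresponding to the shift \<open>(x, y)\<close>: a correlation of the two tables.\<close>

definition cval :: "int list list \<Rightarrow> int list list \<Rightarrow> nat \<Rightarrow> nat \<Rightarrow> int" where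
  "cval G L x y = dot2 G (map (drop y) (drop x L))"

lemma dotrow_Nil2 [simp]: "dotrow cs [] = 0" by (cases cs) auto
lemma dot2_Nil2 [simp]: "dot2 cs [] = 0" by (cases cs) auto

lemma Lam_rowp:
  assumes "rowok a b d r" "d + (i + j + k) = n"
  shows "Lam n L (rowp a b d r * mon i j k) =
     (if even (a + i) \<and> odd (b + j)
      then of_int (dotrow r (drop ((b + j) div 2) (if (a + i) div 2 < length L then L ! ((a + i) div 2) else []))) else 0)"
  using assms(1)
proof (induction r arbitrary: b)
  case (Cons c cs)
  let ?x = "(a + i) div 2" and ?y = "(b + j) div 2"
  let ?R = "if ?x < length L then L ! ?x else []"
  have y2: "(b + 2 + j) div 2 = Suc ?y" "odd (b + 2 + j) \<longleftrightarrow> odd (b + j)" by auto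
  have "Lam n L (rowp a b d (c # cs) * mon i j k) =
      of_int c * Lam n L (mon (a + i) (b + j) (d - a - b + k)) + Lam n L (rowp a (b + 2) d cs * mon i j k)"
    by (simp add: ring_distribs Lam_add Lam_scale mult.assoc mon_mult)
  also have "Lam n L (mon (a + i) (b + j) (d - a - b + k)) = (if even (a + i) \<and> odd (b + j) then of_int (ent L ?x ?y) else 0)"
    by (rule Lam_mon) (use Cons.prems assms(2) in simp)
  also have "Lam n L (rowp a (b + 2) d cs * mon i j k) = (if even (a + i) \<and> odd (b + j) then of_int (dotrow cs (drop (Suc ?y) ?R)) else 0)"
    using Cons by (simp only: y2 rowok.simps) 
  finally have eq: "Lam n L (rowp a b d (c # cs) * mon i j k) =
      (if even (a + i) \<and> odd (b + j) then of_int (c * ent L ?x ?y + dotrow cs (drop (Suc ?y) ?R)) else 0)" by simp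
  have "c * ent L ?x ?y + dotrow cs (drop (Suc ?y) ?R) = dotrow (c # cs) (drop ?y ?R)"
  proof (cases "?y < length ?R")
    case True
    hence "drop ?y ?R = ?R ! ?y # drop (Suc ?y) ?R" by (rule Cons_nth_drop_Suc[symmetric])
    moreover have "ent L ?x ?y = ?R ! ?y" using True by (auto simp: ent_def split: if_splits)
    ultimately show ?thesis by (simp only: dotrow.simps)
  next
    case False
    hence "drop ?y ?R = []" "drop (Suc ?y) ?R = []" by (simp_all only: drop_all not_less le_SucI)
    moreover have "ent L ?x ?y = 0" using False by (auto simp: ent_def split: if_splits)
    ultimately show ?thesis by (simp only: dotrow_Nil2)
  qed
  thus ?case using eq by simp
qed simp

lemma Lam_polp:
  assumes "polok a b d G" "d + (i + j + k) = n"
  shows "Lam n L (polp a b d G * mon i j k) =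
     (if even (a + i) \<and> odd (b + j) then of_int (cval G L ((a + i) div 2) ((b + j) div 2)) else 0)"
  using assms(1)
proof (induction G arbitrary: a)
  case Nil
  show ?case by (simp add: cval_def)
next
  case (Cons r rs)
  let ?x = "(a + i) div 2" and ?y = "(b + j) div 2"
  have x2: "(a + 2 + i) div 2 = Suc ?x" "even (a + 2 + i) \<longleftrightarrow> even (a + i)" by auto
  have IH: "Lam n L (polp (a + 2) b d rs * mon i j k) = (if even (a + i) \<and> odd (b + j) then of_int (cval rs L (Suc ?x) ?y) else 0)"
    using Cons by (simp only: x2 polok.simps)
  have r: "Lam n L (rowp a b d r * mon i j k) = (if even (a + i) \<and> odd (b + j)
      then of_int (dotrow r (drop ?y (if ?x < length L then L ! ?x else []))) else 0)"
    by (rule Lam_rowp) (use Cons.prems assms(2) in auto)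
  have "dotrow r (drop ?y (if ?x < length L then L ! ?x else [])) + cval rs L (Suc ?x) ?y = cval (r # rs) L ?x ?y"
  proof (cases "?x < length L")
    case True
    hence "drop ?x L = L ! ?x # drop (Suc ?x) L" by (rule Cons_nth_drop_Suc[symmetric])
    thus ?thesis using True by (simp add: cval_def)
  next
    case False
    thus ?thesis by (simp add: cval_def)
  qed
  hence "of_int (dotrow r (drop ?y (if ?x < length L then L ! ?x else []))) + of_int (cval rs L (Suc ?x) ?y) = (of_int (cval (r # rs) L ?x ?y) :: complex)"
    by (simp only: of_int_add[symmetric])
  thus ?case using IH r by (simp add: ring_distribs Lam_add)
qed

definition convtab :: "int list list \<Rightarrow> int list list \<Rightarrow> nat \<Rightarrow> int list list" where
  "convtab E L m = map (\<lambda>x. map (\<lambda>y. cval E L x y) [0..<m - x]) [0..<m]"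

lemma ent_convtab: "x + y < m \<Longrightarrow> ent (convtab E L m) x y = cval E L x y"
  by (simp add: ent_def convtab_def)

text \<open>A functional applied to a multiple of a fixed even form \<open>E\<close> is a functional of the cofactor, whose table
  is the correlation of the two tables. Factors can thus be removed one at a time, without
  multiplying out their product.\<close>

lemma Lam_factor:
  assumes E: "polok 0 0 d E" and n: "n = d + e" "e + 1 = 2 * m" and p: "p \<in> poly_ring 3" "homogeneous e p"
  shows "Lam n L (polp 0 0 d E * p) = Lam e (convtab E L m) p"
proof -
  have m: "Lam n L (polp 0 0 d E * mon a b (e - a - b)) = Lam e (convtab E L m) (mon a b (e - a - b))" if ab: "a + b \<le> e" for a b
  proof -
    have 1: "d + (a + b + (e - a - b)) = n" "a + b + (e - a - b) = e" using n ab by auto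
    have "ent (convtab E L m) (a div 2) (b div 2) = cval E L (a div 2) (b div 2)" if "even a" "odd b"
      by (rule ent_convtab) (use that ab n in \<open>auto elim!: evenE oddE\<close>)
    thus ?thesis unfolding Lam_polp[OF E 1(1)] Lam_mon[OF 1(2)] by simp
  qed
  have ex: "p = (\<Sum>z\<in>tdeg e. mconst (cof p (fst z) (snd z) (e - fst z - snd z)) * mon (fst z) (snd z) (e - fst z - snd z))"
    using form_expand[OF p] by (simp add: case_prod_unfold)
  have "Lam n L (polp 0 0 d E * p) = (\<Sum>z\<in>tdeg e. cof p (fst z) (snd z) (e - fst z - snd z) * Lam n L (polp 0 0 d E * mon (fst z) (snd z) (e - fst z - snd z)))"
  proof -
    have "Lam n L (polp 0 0 d E * p) = Lam n L (polp 0 0 d E *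
        (\<Sum>z\<in>tdeg e. mconst (cof p (fst z) (snd z) (e - fst z - snd z)) * mon (fst z) (snd z) (e - fst z - snd z)))"
      by (rule arg_cong[OF arg_cong[OF ex]])
    thus ?thesis by (simp add: sum_distrib_left Lam_sum mult.left_commute[of "polp 0 0 d E"] Lam_scale)
  qed
  also have "\<dots> = (\<Sum>z\<in>tdeg e. cof p (fst z) (snd z) (e - fst z - snd z) * Lam e (convtab E L m) (mon (fst z) (snd z) (e - fst z - snd z)))"
    by (intro sum.cong refl arg_cong2[where f="(*)"] m) (auto simp: mem_tdeg)
  also have "\<dots> = Lam e (convtab E L m) p"
  proof -
    have "Lam e (convtab E L m) p = Lam e (convtab E L m)
        (\<Sum>z\<in>tdeg e. mconst (cof p (fst z) (snd z) (e - fst z - snd z)) * mon (fst z) (snd z) (e - fst z - snd z))"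
      by (rule arg_cong[OF ex])
    thus ?thesis by (simp add: Lam_sum Lam_scale)
  qed
  finally show ?thesis .
qed

subsection \<open>Values at integer points\<close>

text \<open>Recursive powers, values of monomials and values of forms, in a form suited to evaluation by rewriting.\<close>

fun ipow :: "int \<Rightarrow> nat \<Rightarrow> int" where
  "ipow a 0 = 1"
| "ipow a (Suc n) = a * ipow a n"

definition imon :: "triple \<Rightarrow> nat \<Rightarrow> nat \<Rightarrow> nat \<Rightarrow> int" where
  "imon t i j k = (case t of (a, b, c) \<Rightarrow> ipow a i * ipow b j * ipow c k)"

fun irow :: "nat \<Rightarrow> nat \<Rightarrow> nat \<Rightarrow> int list \<Rightarrow> triple \<Rightarrow> int" where
  "irow a b d [] t = 0"
| "irow a b d (c # cs) t = (if c = 0 then 0 else c * imon t a b (d - a - b)) + irow a (b + 2) d cs t"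

fun ival :: "nat \<Rightarrow> nat \<Rightarrow> nat \<Rightarrow> int list list \<Rightarrow> triple \<Rightarrow> int" where
  "ival a b d [] t = 0"
| "ival a b d (r # rs) t = irow a b d r t + ival (a + 2) b d rs t"

lemma ipow_eq: "ipow a n = a ^ n"
  by (induction n) simp_all

lemma meval_mon_cf: "meval (mon i j k) (cf t) = of_int (imon t i j k)"
  by (cases t) (simp add: meval_mon imon_def ipow_eq cf_def)

lemma meval_rowp: "meval (rowp a b d r) (cf t) = of_int (irow a b d r t)"
  by (induction r arbitrary: b) (simp_all add: meval_add meval_mult meval_mon_cf)

lemma meval_polp: "meval (polp a b d G) (cf t) = of_int (ival a b d G t)"
  by (induction G arbitrary: a) (simp_all add: meval_add meval_rowp)

text \<open>Sign changes of the first two coordinates. Together with the scalar \<open>-1\<close> they generate all sign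
  changes, and a form of one parity class is multiplied by a sign under each of them.\<close>

fun flip :: "int \<Rightarrow> int \<Rightarrow> triple \<Rightarrow> triple" where
  "flip s u (a, b, c) = (s * a, u * b, c)"

lemma imon_flip: "imon (flip s u t) i j k = s ^ i * u ^ j * imon t i j k"
  by (cases t) (simp add: imon_def ipow_eq power_mult_distrib)

lemma square_one_power: "(s::int) * s = 1 \<Longrightarrow> s ^ Suc (Suc a) = s ^ a"
  by (simp add: mult.assoc[symmetric])

lemma irow_flip: "u * u = 1 \<Longrightarrow> irow a b d r (flip s u t) = s ^ a * u ^ b * irow a b d r t"
  by (induction r arbitrary: b) (simp_all add: imon_flip square_one_power ring_distribs del: power_Suc)

lemma ival_flip: "s * s = 1 \<Longrightarrow> u * u = 1 \<Longrightarrow> ival a b d G (flip s u t) = s ^ a * u ^ b * ival a b d G t"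
  by (induction G arbitrary: a) (simp_all add: irow_flip square_one_power ring_distribs del: power_Suc)

subsection \<open>Forms vanishing at many collinear points\<close>

text \<open>Restricted to the line, the form becomes a polynomial of degree at most \<open>d\<close> in one parameter with more
  than \<open>d\<close> roots.\<close>

lemma form_eq_lines:
  assumes l: "l \<noteq> (0, 0, 0)" and on: "\<And>t. t \<in> set T \<Longrightarrow> t \<noteq> (0, 0, 0) \<and> idot l t = 0"
    and pair: "sorted_wrt (\<lambda>s t. icross s t \<noteq> (0, 0, 0)) T" and len: "d < length T"
    and p: "f \<in> poly_ring 3" "homogeneous d f" "\<And>t. t \<in> set T \<Longrightarrow> meval f (cf t) = 0"
  shows "van3 (cf l) f"
proof -
  let ?C = "(\<lambda>t. cf (icross t l)) ` set T"
  have tl: "\<not> van3 (cf l) (form3 (cf (icross t l)))" if t: "t \<in> set T" for t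
  proof (rule not_van3_cf)
    obtain a b c where l': "l = (a, b, c)" by (cases l)
    obtain x y z where t': "t = (x, y, z)" by (cases t)
    have d: "a * x + b * y + c * z = 0" using on[OF t] by (simp add: l' t')
    have e: "icross l (icross t l) = ((a*a+b*b+c*c) * x, (a*a+b*b+c*c) * y, (a*a+b*b+c*c) * z)"
    proof -
      have "b * (x * b - y * a) - c * (z * a - x * c) = (a*a+b*b+c*c) * x - a * (a * x + b * y + c * z)"
        "c * (y * c - z * b) - a * (x * b - y * a) = (a*a+b*b+c*c) * y - b * (a * x + b * y + c * z)"
        "a * (z * a - x * c) - b * (y * c - z * b) = (a*a+b*b+c*c) * z - c * (a * x + b * y + c * z)"
        by (simp_all add: algebra_simps)
      thus ?thesis unfolding d by (simp add: l' t')
    qed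
    have "a*a+b*b+c*c \<noteq> 0" using l by (auto simp: l' add_nonneg_eq_0_iff)
    thus "icross l (icross t l) \<noteq> (0, 0, 0)" unfolding e using on[OF t] by (auto simp: t')
  qed
  obtain p q \<sigma> \<rho> where par: "dot3 (cf l) p = 0" "dot3 (cf l) q = 0"
    "\<And>u i. dot3 (cf l) u = 0 \<Longrightarrow> i < 3 \<Longrightarrow> u i = dot3 \<sigma> u * p i + dot3 \<rho> u * q i"
    "dot3 \<sigma> p = 1" "dot3 \<sigma> q = 0" "dot3 \<rho> p = 0" "dot3 \<rho> q = 1"
    "\<And>c. c \<in> ?C \<Longrightarrow> dot3 c q \<noteq> 0"
  proof -
    have nz: "nonzero3 (cf l)" using l by (simp add: nonzero3_cf)
    have C: "\<not> van3 (cf l) (form3 c)" if "c \<in> ?C" for c using tl that by blast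
    have fin: "finite ?C" by simp
    show ?thesis using plane_parametrisation[OF nz fin C] that by blast
  qed
  interpret plane_param "cf l" p q \<sigma> \<rho>
    by standard (use par l in \<open>auto simp: nonzero3_cf\<close>)
  define \<tau> where "\<tau> t = dot3 \<rho> (cf t) / dot3 \<sigma> (cf t)" for t
  have \<sigma>0: "dot3 \<sigma> (cf t) \<noteq> 0" if t: "t \<in> set T" for t
  proof
    assume z: "dot3 \<sigma> (cf t) = 0"
    have a0: "dot3 (cf l) (cf t) = 0" using on[OF t] by (simp add: dot3_cf)
    have "dot3 (cf (icross t l)) (cf t) = 0"
      using idot_icross(1)[of t l] by (cases t; cases l) (simp add: dot3_cf algebra_simps)
    hence "dot3 \<rho> (cf t) * dot3 (cf (icross t l)) q = 0"
      using dot_on_plane[OF a0, of "cf (icross t l)"] z by simp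
    hence "dot3 \<rho> (cf t) = 0" using par(8) t by auto
    hence "cf t i = 0" if "i < 3" for i using rep[OF a0 that] z by simp
    thus False using nonzero3_cf[of t] on[OF t] by (auto simp: nonzero3_def)
  qed
  have cft: "cf t i = dot3 \<sigma> (cf t) * pt (\<tau> t) i" if t: "t \<in> set T" and i: "i < 3" for t i
  proof -
    have a0: "dot3 (cf l) (cf t) = 0" using on[OF t] by (simp add: dot3_cf)
    have "cf t i = dot3 \<sigma> (cf t) * p i + dot3 \<rho> (cf t) * q i" by (rule rep[OF a0 i])
    also have "\<dots> = dot3 \<sigma> (cf t) * pt (\<tau> t) i"
      using \<sigma>0[OF t] by (simp add: \<tau>_def pt_def distrib_left)
    finally show ?thesis .
  qed
  have root: "poly (restr f) (\<tau> t) = 0" if t: "t \<in> set T" for t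
  proof -
    have "meval f (cf t) = meval f (\<lambda>i. dot3 \<sigma> (cf t) * pt (\<tau> t) i)"
      by (rule meval_cong[of f "{..<3}"]) (use p(1) cft[OF t] in \<open>auto simp: poly_ring_eq\<close>)
    hence "dot3 \<sigma> (cf t) ^ d * meval f (pt (\<tau> t)) = 0"
      using p(3)[OF t] by (simp add: homogeneous_eval_scale[OF p(2)])
    thus ?thesis using \<sigma>0[OF t] by (simp add: poly_restr)
  qed
  have inj: "\<tau> s \<noteq> \<tau> t" if st: "s \<in> set T" "t \<in> set T" "icross s t \<noteq> (0, 0, 0)" for s t
  proof
    assume eq: "\<tau> s = \<tau> t"
    obtain a b c where s': "s = (a, b, c)" by (cases s)
    obtain x y z where t': "t = (x, y, z)" by (cases t)
    have m: "cf s i * cf t j = cf s j * cf t i" if "i < 3" "j < 3" for i j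
      using cft[OF st(1)] cft[OF st(2)] that eq by simp
    have "of_int (a * y) = (of_int (b * x) :: complex)" "of_int (b * z) = (of_int (c * y) :: complex)" "of_int (c * x) = (of_int (a * z) :: complex)"
      using m[of 0 1] m[of 1 2] m[of 2 0] by (simp_all add: s' t' cf_def)
    hence "icross s t = (0, 0, 0)" by (simp add: s' t' of_int_eq_iff del: of_int_mult)
    thus False using st by simp
  qed
  have "distinct (map \<tau> T')" if "sorted_wrt (\<lambda>s t. icross s t \<noteq> (0, 0, 0)) T'" "set T' \<subseteq> set T" for T'
    using that
  proof (induction T')
    case (Cons t T')
    have "\<tau> t \<noteq> \<tau> s" if "s \<in> set T'" for s
    proof (rule inj)
      show "t \<in> set T" using Cons.prems(2) by simp
      show "s \<in> set T" using Cons.prems(2) that by (meson set_subset_Cons subsetD)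
      show "icross t s \<noteq> (0, 0, 0)" using Cons.prems(1) that by simp
    qed
    hence "\<tau> t \<notin> \<tau> ` set T'" by blast
    thus ?case using Cons by simp
  qed simp
  from this[OF pair order_refl] have "distinct (map \<tau> T)" .
  hence c: "card (\<tau> ` set T) = length T" by (metis distinct_card length_map list.set_map)
  have "restr f = 0"
  proof (rule ccontr)
    assume nz: "restr f \<noteq> 0"
    have "length T \<le> card {x. poly (restr f) x = 0}"
      unfolding c[symmetric] using root by (intro card_mono poly_roots_finite nz) auto
    also have "\<dots> \<le> Polynomial.degree (restr f)" by (rule card_poly_roots_bound[OF nz])
    also have "\<dots> \<le> d" by (rule degree_lrestr[OF p(2)])
    finally show False using len by simp
  qed
  thus ?thesis by (rule van_if_restr_zero[OF p(1,2)])
qed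

text \<open>If a form of degree \<open>d\<close> vanishes at more than \<open>d\<close> points of the line \<open>l\<close>, then it is divisible by the
  equation of \<open>l\<close>, and the quotient of degree \<open>d - 1\<close> vanishes at the points off \<open>l\<close>. The procedure
  succeeds if this can be repeated until the degree is used up, so that the form must be zero.\<close>

fun peel :: "nat \<Rightarrow> triple list \<Rightarrow> triple list \<Rightarrow> bool" where
  "peel d [] T \<longleftrightarrow> False"
| "peel d (l # ls) T \<longleftrightarrow>
     (let on = filter (\<lambda>t. idot l t = 0) T in
      l \<noteq> (0, 0, 0) \<and> list_all (\<lambda>t. t \<noteq> (0, 0, 0)) on \<and> sorted_wrt (\<lambda>s t. icross s t \<noteq> (0, 0, 0)) on \<and> d < length on \<and>
      (case d of 0 \<Rightarrow> True | Suc e \<Rightarrow> peel e ls (filter (\<lambda>t. idot l t \<noteq> 0) T)))"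

lemma peel_zero:
  "peel d ls T \<Longrightarrow> f \<in> poly_ring 3 \<Longrightarrow> homogeneous d f \<Longrightarrow> (\<And>t. t \<in> set T \<Longrightarrow> meval f (cf t) = 0) \<Longrightarrow> f = 0"
proof (induction ls arbitrary: d T f)
  case (Cons l ls)
  let ?on = "filter (\<lambda>t. idot l t = 0) T"
  have H: "l \<noteq> (0, 0, 0)" "\<forall>t\<in>set ?on. t \<noteq> (0, 0, 0)" "sorted_wrt (\<lambda>s t. icross s t \<noteq> (0, 0, 0)) ?on" "d < length ?on"
    using Cons.prems(1) by (simp_all add: Let_def list_all_iff)
  have van: "van3 (cf l) f"
    by (rule form_eq_lines[OF H(1) _ H(3,4) Cons.prems(2,3)]) (use H(2) Cons.prems(4) in auto)
  have nz: "nonzero3 (cf l)" using H(1) by (simp add: nonzero3_cf)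
  obtain g where g: "g \<in> poly_ring 3" "f = form3 (cf l) * g" using van3_dvd[OF nz Cons.prems(2) van] by blast
  have fz: "form3 (cf l) \<noteq> 0" using nz lform_nonzero[of "{..<3}" _ "cf l"] by (auto simp: nonzero3_def)
  show ?case
  proof (cases d)
    case 0
    have "g = 0"
      by (rule homogeneous_cancel_zero[OF homogeneous_lform fz]) (use Cons.prems(3) g 0 in auto)
    thus ?thesis using g by simp
  next
    case (Suc e)
    have "homogeneous e g"
      by (rule homogeneous_cancel[OF homogeneous_lform fz]) (use Cons.prems(3) g Suc in simp)
    moreover have "meval g (cf t) = 0" if "t \<in> set (filter (\<lambda>t. idot l t \<noteq> 0) T)" for t
      using Cons.prems(4)[of t] that by (simp add: g(2) meval_mult meval_form3 dot3_cf del: meval_lform)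
    moreover have "peel e ls (filter (\<lambda>t. idot l t \<noteq> 0) T)" using Cons.prems(1) by (simp add: Let_def Suc)
    ultimately have "g = 0" using g(1) by (intro Cons.IH)
    thus ?thesis using g by simp
  qed
qed simp

subsection \<open>Dimension count\<close>

text \<open>Gaussian elimination: \<open>n + 1\<close> vectors with \<open>n\<close> coordinates are linearly dependent.\<close>

lemma nontrivial_relation:
  fixes a :: "nat \<Rightarrow> nat \<Rightarrow> 'a::field"
  shows "\<exists>c. (\<exists>k\<le>n. c k \<noteq> 0) \<and> (\<forall>i<n. (\<Sum>k\<le>n. c k * a k i) = 0)"
proof (induction n arbitrary: a)
  case 0
  show ?case by (intro exI[of _ "\<lambda>_. 1"]) auto
next
  case (Suc n)
  show ?case
  proof (cases "a (Suc n) n = 0")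
    case piv: False
    define e where "e k = a k n / a (Suc n) n" for k
    obtain c where c: "\<exists>k\<le>n. c k \<noteq> 0" "\<forall>i<n. (\<Sum>k\<le>n. c k * (a k i - e k * a (Suc n) i)) = 0"
      using Suc.IH[of "\<lambda>k i. a k i - e k * a (Suc n) i"] by blast
    define c' where "c' k = (if k = Suc n then - (\<Sum>k\<le>n. c k * e k) else c k)" for k
    have s: "(\<Sum>k\<le>Suc n. c' k * a k i) = (\<Sum>k\<le>n. c k * (a k i - e k * a (Suc n) i))" for i
      by (simp add: c'_def sum_distrib_right right_diff_distrib sum_subtractf mult.assoc)
    have "(\<Sum>k\<le>n. c k * (a k n - e k * a (Suc n) n)) = 0" using piv by (simp add: e_def)
    hence "\<forall>i<Suc n. (\<Sum>k\<le>Suc n. c' k * a k i) = 0" using c(2) unfolding s by (auto simp: less_Suc_eq)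
    moreover have "\<exists>k\<le>Suc n. c' k \<noteq> 0"
    proof -
      obtain k where "k \<le> n" "c k \<noteq> 0" using c(1) by blast
      thus ?thesis by (intro exI[of _ k]) (simp add: c'_def)
    qed
    ultimately show ?thesis by blast
  next
    case zero: True
    show ?thesis
    proof (cases "\<exists>j\<le>n. a j n \<noteq> 0")
      case False
      obtain c where c: "\<exists>k\<le>n. c k \<noteq> 0" "\<forall>i<n. (\<Sum>k\<le>n. c k * a k i) = 0" using Suc.IH[of a] by blast
      define c' where "c' k = (if k = Suc n then 0 else c k)" for k
      have s: "(\<Sum>k\<le>Suc n. c' k * a k i) = (\<Sum>k\<le>n. c k * a k i)" for i by (simp add: c'_def)
      have "(\<Sum>k\<le>n. c k * a k n) = 0" using False by simp
      hence "\<forall>i<Suc n. (\<Sum>k\<le>Suc n. c' k * a k i) = 0" using c(2) unfolding s by (auto simp: less_Suc_eq)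
      moreover have "\<exists>k\<le>Suc n. c' k \<noteq> 0"
      proof -
        obtain k where "k \<le> n" "c k \<noteq> 0" using c(1) by blast
        thus ?thesis by (intro exI[of _ k]) (simp add: c'_def)
      qed
      ultimately show ?thesis by blast
    next
      case True
      then obtain j where j: "j \<le> n" "a j n \<noteq> 0" by blast
      \<comment> \<open>exchange the vectors \<open>j\<close> and \<open>Suc n\<close>, so that the pivot is in the last place\<close>
      define b where "b k = (if k = j then a (Suc n) else a k)" for k
      define e where "e k = b k n / a j n" for k
      obtain c where c: "\<exists>k\<le>n. c k \<noteq> 0" "\<forall>i<n. (\<Sum>k\<le>n. c k * (b k i - e k * a j i)) = 0"
        using Suc.IH[of "\<lambda>k i. b k i - e k * a j i"] by blast
      define c' where "c' k = (if k = Suc n then c j else if k = j then - (\<Sum>k\<le>n. c k * e k) else c k)" for k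
      have s: "(\<Sum>k\<le>Suc n. c' k * a k i) = (\<Sum>k\<le>n. c k * (b k i - e k * a j i))" for i
      proof -
        have 1: "(\<Sum>k\<le>n. c k * b k i) = c j * a (Suc n) i + (\<Sum>k\<in>{..n}-{j}. c k * a k i)"
          using j(1) by (subst sum.remove[of _ j]) (auto simp: b_def intro!: sum.cong)
        have 2: "(\<Sum>k\<le>n. c' k * a k i) = - (\<Sum>k\<le>n. c k * e k) * a j i + (\<Sum>k\<in>{..n}-{j}. c k * a k i)"
          using j(1) by (subst sum.remove[of _ j]) (auto simp: c'_def intro!: sum.cong)
        have "(\<Sum>k\<le>Suc n. c' k * a k i) = (\<Sum>k\<le>n. c' k * a k i) + c j * a (Suc n) i" by (simp add: c'_def)
        also have "\<dots> = (\<Sum>k\<le>n. c k * b k i) - (\<Sum>k\<le>n. c k * e k) * a j i" unfolding 1 2 by (simp add: algebra_simps)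
        also have "\<dots> = (\<Sum>k\<le>n. c k * (b k i - e k * a j i))"
          by (simp add: sum_distrib_right right_diff_distrib sum_subtractf mult.assoc)
        finally show ?thesis .
      qed
      have "(\<Sum>k\<le>n. c k * (b k n - e k * a j n)) = 0" using j by (simp add: e_def)
      hence eqs: "\<forall>i<Suc n. (\<Sum>k\<le>Suc n. c' k * a k i) = 0" using c(2) unfolding s by (auto simp: less_Suc_eq)
      have "\<exists>k\<le>Suc n. c' k \<noteq> 0"
      proof (cases "c j = 0")
        case False
        thus ?thesis by (intro exI[of _ "Suc n"]) (simp add: c'_def)
      next
        case True
        obtain k where "k \<le> n" "c k \<noteq> 0" using c(1) by blast
        thus ?thesis using True by (intro exI[of _ k]) (auto simp: c'_def)
      qed
      thus ?thesis using eqs by blast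
    qed
  qed
qed

text \<open>If the points \<open>T\<close> together with \<open>n\<close> further points \<open>Q\<close> force a form of degree \<open>d\<close> to vanish, then the forms
  vanishing on \<open>T\<close> have dimension at most \<open>n\<close>, and any \<open>n\<close> independent ones span.\<close>

lemma span_by_dimension:
  fixes e :: "nat \<Rightarrow> (nat, complex) mpoly"
  assumes pl: "peel d ls (T @ Q)"
    and W: "\<And>k. k < length Q \<Longrightarrow> e k \<in> poly_ring 3 \<and> homogeneous d (e k) \<and> (\<forall>t\<in>set T. meval (e k) (cf t) = 0)"
    and ind: "\<And>c. (\<Sum>k<length Q. mconst (c k) * e k) = 0 \<Longrightarrow> \<forall>k<length Q. c k = 0"
    and p: "p \<in> poly_ring 3" "homogeneous d p" "\<And>t. t \<in> set T \<Longrightarrow> meval p (cf t) = 0"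
  obtains c where "p = (\<Sum>k<length Q. mconst (c k) * e k)"
proof -
  let ?n = "length Q"
  define v where "v k = (if k = ?n then p else e k)" for k
  obtain c where c: "\<exists>k\<le>?n. c k \<noteq> 0" "\<forall>i<?n. (\<Sum>k\<le>?n. c k * meval (v k) (cf (Q ! i))) = 0"
    using nontrivial_relation[of ?n "\<lambda>k i. meval (v k) (cf (Q ! i))"] by blast
  let ?f = "\<Sum>k\<le>?n. mconst (c k) * v k"
  have v: "v k \<in> poly_ring 3 \<and> homogeneous d (v k) \<and> (\<forall>t\<in>set T. meval (v k) (cf t) = 0)" if "k \<le> ?n" for k
    using W p that by (auto simp: v_def)
  have "?f = 0"
  proof (rule peel_zero[OF pl])
    show "?f \<in> poly_ring 3" using v by (intro poly_ring_rules) auto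
    show "homogeneous d ?f" using v by (intro homogeneous_sum homogeneous_smult) auto
    fix t assume "t \<in> set (T @ Q)"
    then consider "t \<in> set T" | i where "i < ?n" "t = Q ! i" by (auto simp: in_set_conv_nth)
    thus "meval ?f (cf t) = 0"
    proof cases
      case 1
      thus ?thesis using v by (simp add: meval_sum meval_mult)
    next
      case 2
      thus ?thesis using c(2) by (simp add: meval_sum meval_mult)
    qed
  qed
  hence rel: "mconst (c ?n) * p + (\<Sum>k<?n. mconst (c k) * e k) = 0"
    by (simp add: lessThan_Suc_atMost[symmetric] v_def add.commute)
  have cn: "c ?n \<noteq> 0"
  proof
    assume z: "c ?n = 0"
    hence "(\<Sum>k<?n. mconst (c k) * e k) = 0" using rel by (simp add: mconst_def)
    hence "\<forall>k<?n. c k = 0" by (rule ind)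
    thus False using z c(1) by (metis le_neq_implies_less)
  qed
  have "p = (\<Sum>k<?n. mconst (- (c k / c ?n)) * e k)"
  proof (rule mpoly_eqI)
    fix u
    have "c ?n * meval p u = - (\<Sum>k<?n. c k * meval (e k) u)"
      using arg_cong[OF rel, of "\<lambda>q. meval q u"] by (simp add: meval_simps eq_neg_iff_add_eq_0)
    hence "meval p u = - (\<Sum>k<?n. c k * meval (e k) u) / c ?n" using cn by (simp add: field_simps)
    thus "meval p u = meval (\<Sum>k<?n. mconst (- (c k / c ?n)) * e k) u"
      by (simp add: meval_simps sum_divide_distrib sum_negf)
  qed
  thus ?thesis by (rule that)
qed

section \<open>Forms of low degree through the points\<close>

text \<open>One point from each orbit of the 127 intersection points under sign changes.\<close>

definition zreps :: "triple list" where
  "zreps =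
    [(0,1,0), (1,0,0), (1,3,0), (1,1,0), (0,0,1), (0,1,1), (0,2,1), (0,1,2), (1,0,2), (1,0,1), (2,0,1), (1,0,3), (1,0,4), (1,3,2), (1,3,1), (1,3,4),
   (1,3,6), (1,3,8), (1,1,2), (1,1,1), (1,1,4), (1,5,2), (1,2,2), (1,2,1), (1,4,1), (2,1,2), (2,3,2), (3,1,2), (1,5,4), (3,1,4), (3,7,2), (3,5,4),
   (1,7,4), (5,1,2), (1,9,4), (5,3,4), (3,1,8), (1,5,8), (1,2,4)]"

text \<open>The tables of the generators: \<open>gA1\<close>, \<open>gA2\<close>, \<open>gA3\<close> span the forms of degree 14 through the points, and
  \<open>gB1\<close>, \<dots>, \<open>gB4\<close> complete their multiples in degree 15.\<close>

definition gA1 :: "int list list" where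
  "gA1 =
    [[24, - 234, 1001, - 2288, 2145, - 728, 80], [- 702, 0, 17160, - 26598, 12012, - 1872], [15015, - 61776, 12012, - 24024, 13728], [- 99528, 390390,
   48048, - 68640], [171171, - 720720, 144144], [- 60060, 240240], [0]]"

definition gA2 :: "int list list" where
  "gA2 =
    [[- 12, 117, 0, - 429, 0, 0, 0], [351, - 5005, 2431, 9009, 0, 0], [- 3003, 63921, - 51051, - 36036, 0], [7293, - 233805, 204204, 27456], [1287,
   212212, - 155584], [- 7644, - 37440], [1728]]"

definition gA3 :: "int list list" where
  "gA3 =
    [[0, 0, 1001, - 3146, 2145, - 728, 80], [0, - 10010, 22022, - 8580, 12012, - 1872], [9009, 66066, - 90090, - 96096, 13728], [- 84942, - 77220, 456456,
   - 13728], [173745, - 296296, - 167024], [- 75348, 165360], [3456]]"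

definition gB1 :: "int list list" where
  "gB1 =
    [[- 16, 216, - 1065, 2285, - 1980, 624, - 64, 0], [8, 1290, - 8242, 12783, - 3924, 208, 64], [911, - 1459, - 6513, - 9660, 3216, - 832], [- 3656,
   9669, 20076, - 1696, 2688], [3961, - 13956, - 6624, - 3712], [- 1352, 4816, 2368], [144, - 576], [0]]"

definition gB2 :: "int list list" where
  "gB2 =
    [[- 12, 163, - 812, 1777, - 1612, 560, - 64, 0], [- 63, 1869, - 10479, 18251, - 9156, 1296, 64], [903, 2403, - 31345, 31332, - 8304, - 1856], [- 1509,
   15425, - 45780, 28128, 19072], [945, 6300, - 20448, - 79488], [- 11928, 20496, 108864], [11664, - 46656], [0]]"

definition gB3 :: "int list list" where
  "gB3 =
    [[- 36, 497, - 2486, 5379, - 4697, 1499, - 156, 0], [- 121, 3989, - 21746, 33193, - 11411, 881, 156], [4381, - 12255, - 12154, - 7362, 3940, - 2380],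
   [- 20994, 67101, - 43554, - 1554, 12168], [29581, - 25233, 90648, - 29656], [- 16339, - 65815, - 10708], [4824, 31716], [- 1296]]"

definition gB4 :: "int list list" where
  "gB4 =
    [[12, - 137, 491, - 420, - 496, 64, 0, 0], [- 411, 3611, - 12203, 15428, 7920, - 1088, 0], [4818, - 25014, 60032, - 148512, 768, 1024], [- 24123,
   45188, 168768, 147840, - 8192], [52008, - 140576, - 266240, - 14336], [- 39216, 144576, 49152], [6912, - 27648], [0]]"

text \<open>The even form of degree 12 that, multiplied by 21 of the lines, is triple at all points.\<close>

definition gC :: "int list list" where
  "gC =
    [[4308, - 38677, 98608, - 93402, 31039, - 1396, - 480], [- 116031, 591648, - 604917, 327739, - 91472, 22336], [887472, - 2993256, 1631377, - 407768, -
   229952], [- 2286153, 3575857, - 235856, 1578496], [2379972, 281004, - 3432672], [- 974016, - 8256], [104448]]"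

text \<open>A solution of the linear equations expressing that the functional vanishes on \<open>J\<^sup>2\<close> in degree 33.\<close>

definition lamT :: "int list list" where
  "lamT =
    [[- 11919198946732663052142214661515825398997421103683276745516, 139705710836725681500956456529000184333257167444296041424041, -
   532697325068227533341599915822073894946817108977342228565818, 601066419964975636132715631979946766893497709047938553971144,
   256231820414749217179125346004552790915272014365874726584990, - 140038133900905030877353559060870234798728099353038670679500,
   43404856187343454911291044841417026861140163469108085519290, 323661101613866110589079816386164397142933911882568873458928,
   183388777841720754235030238372116143363356443678777318006902, - 433574035710703253345743623942904422323153395029764869195872, -
   986632689502538734418961795838175764598153265006851693954139, - 392638877551889041770660856218124907843938406157434640506115,
   1498292788858529778606635732629512136973107899634154358032217, - 624081905580164509743238383541695654187739464034638383411531,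
   76866056648235630342376516878968265869118494511089382240135, - 1035366104985496947510434536317008254156644371053576586640, 0],
   [94999588294982772706739539639801340153390150549101918235865, 21682728848177423885860361279631106293925510739518924244430, -
   1403481684053733328110750352323560168487828185771502121027989, - 801079206833498146096627632731785851008360062692974564943507, -
   163716627523151397045211497692080167098526595456496031961533, 266233851593165460802049625873143585051035394093614897220313,
   493908602957116259724907070981172113686160135391951679266015, 562803233925992387798277229327248282349685374835921772906165,
   518201121789057363582690721392071665512933652298503133967471, 404099846626537365489324604273608530523877526195223633495948,
   244037181626779586631121773804460992395927702153918373681606, - 58496812267010769367659934726346456525744528901588564231819, -
   739576390344553669540559652040383195262318315567205204466879, 168780703444320575306518587546213950475128754416456099631003, -
   40782241704823140703582806157852304979192435733453306603803, - 224409396261807046232894877054461004276330213749929533405], [-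
   180030851356244455226687975757285915454465339756005161816871, 667069389302302311140088400184067984377958092384417612350926,
   187208736980361039450292967606728308040661615848331932808811, 147923665226991348071565207199757452119676276391958251054445,
   168102046602591612906337370837390968679050534179144187748163, 173729500640551895261438272180103219827643022952385447826009,
   153093099420120908297224372161790157783121120956586107647743, 105223850001654669112207394052690113096218894496798284178121,
   32106741386988688940884408683501272950360984573152653230782, - 56435787222566773729938131993356431960339322568808071436150, -
   123992810549134900372820307808012733276556315587002991926884, - 43996277388474418280415671541263149877078294314978505643765,
   569732438864374612355431058845282551241117899171571594692486, 99186843958593240342672371001407073625264573867916868405660,
   2550868223614736412840675393033832208651703305660950476480], [- 60632049206841400684888309126860963254197479600807662506791,
   134569453084118764363421064940544537712226884789113175770574, 64490987162099568730314777512206483392577350734672179429995,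
   47487436209364491019246595721848574418541798079176148692589, 37063690183056799906370735237156609417660778640675568760003,
   21936384467425355731345244760614975137439836800130069990521, - 1979610733324339481409205858046070735178817609190708494637, -
   37681691269289355735270000843786727944644771691305394439200, - 87220319468178300369931379192915604588059557227337884177714, -
   147618680854917882020463256798553500839857818308415759330245, - 196726187115489843249031943266326910276331891240489440141362, -
   162957734103689272732018083261054316384444981999228068485940, - 195838600063175231784539448463190443179074530978363862521110, -
   10055908766694584955643709612750329539097879157332986273819], [49929549266710837696662726624362083694646784994404609486041,
   22103820872780286835119160498820025513988646045972984353230, 7719665517504004308284393249296459455799698327256586199915,
   1840923997429564384862773429936265905065299188805377827309, - 4649713965869984889592801549367959091682864284123295836445, -
   14059148752440392487683770628333603160122848719469919434227, - 27911983992269405770830017326832048719640397820557658471182, -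
   47569489025938398033231770616219798885370907996486609539470, - 73212232494083989234584556710364522477052790017385386718870, -
   99737085201834993968134056844443493992038046180605020824696, - 105450900267803714385978366404759990007128695372243708754853, -
   66094297402417363504912904688732032982926496850246611945711, 43453805816430031688029416896817732848839066071380734153122],
   [33560087313952169195046251951112383478400678703866858551513, - 2569232300229957340183132843018455064846342235080406676786, -
   5986566413198758192463457694337800609342660996467912874773, - 8193829864344674196472256194305017071116540289095289099251, -
   11571061557357257483166727077675605003593269519612533126601, - 16563584956790364832465260298766278859125683908445535049484, -
   23600902258825412871538513816041983810820563541746474762922, - 32739695910084090084894341873125916052676326355237649435775, -
   42260969271455847276548405945596765271225154128115027868905, - 44547882062404979053415688785607571688943157729453114467915, -
   20946550844717710524872206588888242915198754302243268263264, 34467009722102958942428701286595545337413084416278124113222],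
   [9154606905730530554079181803259895230232610281376823134681, - 8428909535940169505380073728017166577174567369479965070770, -
   8309958720778959940202323859061076721171294655969664872693, - 9057269845956905901048594098083149222271980978982584526047, -
   10737221821093579249412022646926466998249903101868782888154, - 13165173221593178469217012332914790103501119153657580372134, -
   16205084181793296257396299637424792959442274203323032359912, - 19099391658039898649202681539451681149942124992883838865943, -
   18909685493533982392517623522488665894203847552732818360296, - 7258633275417407823675000388358117626272821606515193701170,
   15905681534974139906684570859758570300234120325619443499287], [- 5386957867494799493737301554669113394719137782901165099175, -
   9545748556188420687102151429337214821472373172306761948050, - 8059350693627243153115678402400486490022431377725189237281, -
   8198585702279957778889744897078961521201072017027538777896, - 8994741380659383397962875295650264085832884315829264016994, -
   9996383233409999047004826772749369608113757900641828890105, - 10764869331012530027699871730023053919252042851741827936260, -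
   10076507509135843056457228412433954171354261163369658262162, - 4446843102564108000508808172982896397946751856194301851828, -
   461527226863996891060042652937608313377625886078832138856], [- 12498810974731191340975102925711292366607614553184365991559, -
   9163214370438674885534916690952009313369088783790496185086, - 7253775416854468986533182614839195225355225308091318124386, -
   7220854072080186521108069507649525299914514806033593044910, - 7606052447495029563557777164407102739416321630472387529562, -
   7847923155570869814804297106278982388696316857711093008674, - 7354505543240282384814223803948251565874439677786876494195, -
   4675575758113114456907263425494289292182199689881610971985, - 10488592098716735736475763309514467481611295697669565454477], [-
   15032496298715747899487727558602621032642526250300624294963, - 7978745822178723066726263334792310025052926968417983252855, -
   6210639296715175359897086061793220545843431528844957299222, - 6303840900807454258051512788928096921082194878718600144483, -
   6584769085284614208113355562710235472361972922587379635219, - 6469902614957575323432199671827300651463528074687342344329, -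
   5309524915173450584866116947015995146228717607779644978694, - 15760603210678177870285529571264422763482211916755055767576], [-
   14517828366038693131576949698984190002334529651887751897252, - 5995843940117442117728363649300756451828377775876284241065, -
   4824447944207878980616192803333761437687634076401668248552, - 5318075325526942166187281193794782948663013520871360002777, -
   5734878586010916857077701552603199176004709903446641362982, - 5531531397839984914183633153797642927288564071616768737544, -
   18228217979017873711057198264633783868039482550490001143927], [- 11716931792975920886738051691123941293541274029556332335044, -
   2974563955407666192836266349430578315217035848444487920128, - 2850714397421133598029971418068762867461429990618071328674, -
   4060661558011914970039764968523766016810261884627748957664, - 4852506145113691637470325752621312304923689816850547057754, -
   18930148800176169276040410758312263755597273271403821322061], [- 7259542506038727738991888797608843742337522733195041101456,
   1440240592607696817506997667118796625151887951058530197681, 56155976231195911681612054352770938539060884218505778211, -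
   2276107212244824158567889817051350620686668459519212317635, - 17888775266995826921213929459835212343363848811746182572220], [-
   2420759158077049436668543651826333082557074948351205463471, 7627368767375039940396362620421601792254848101839196418614,
   4364161591213008220363300762751166522435597944832351753600, - 13777775307701108660843798397368602142766407943938809044834], [-
   61750150098484052797981062738279317170300643592277333314, 15902237035393223111535221477915291014934764966812768907875, -
   3437460863762503978119966549083381550863791762475307837813], [- 2913163595480647544243892566901441485235243732621717599457,
   13017205521990501515213071451695749543605203380033964943811], [- 141151902243583418223192435146897476267030287332725383837]]"

text \<open>For each generator of degree 15, the weights with which the functional, applied to multiples of this
  generator, is a sum of point evaluations.\<close>

definition wB1 :: "(int \<times> triple) list" where
  "wB1 =
    [(- 452711662580963009740982364504226976571408530567458889662464000, (0,1,0)), (96789144015270269982937222832460279646419503456835993600000, (1,0,0)),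
   (3144471477506692647458928924046544372073381791177756250, (1,3,0)), (1549055044284576597692427939720689233152606455697183120000, (1,1,0)),
   (45430003376032977923434951509424402012333954043945680896000000, (0,0,1)), (62180882612739175441607582692404795548192249294671891660800000,
   (0,1,1)), (- 29961445128368015807017663879497167001006069863987911065600, (0,2,1)), (47041213131094152487175328717348576130010628757658271744000,
   (0,1,2)), (- 445232395378826223691382825582526303290660872678790922240, (1,0,2)), (- 23132323896370794313344023186829193465185802979911139328000,
   (1,0,1)), (- 30811693819311928473236628647011447905971349246443520, (2,0,1)), (- 7557927829758824022128868934658619531484393358606991360, (1,0,3)),
   (33625494522153995901206097065396381123056023078174720, (1,0,4)), (225515929585027526240002367423998666353682897784070000, (1,3,2)),
   (1096252377970885145863210607491474059209518352399597568, (1,3,1)), (9661269191604834176138936745233191589366702077364448, (1,3,4)),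
   (204988633404373469337542812196401100789007138801744, (1,3,6)), (- 1026039636620101335801380378078106093051288974700, (1,3,8)), (-
   98451508803365433020686222566881068707048794028720000000, (1,1,2)), (7519818657650550853923678676068122433807889288936606924800, (1,1,1)), (-
   30530028284505962419697117023922626744198327311000, (1,1,4)), (- 7441019361817735535653628470073051940526238581028160, (1,5,2)), (-
   50885563108388247516819615876458637226097096156774400, (1,2,2)), (1584509950824905190805180281615247294124150429748345962496, (1,2,1)),
   (123421318298130910522335433512262479112807656456192000, (1,4,1)), (- 147993981350300444407031284388173134076357979991441408, (2,1,2)), (-
   13392004847617437382572241815579654204892529924505600, (2,3,2)), (497220712869098808018515492723000570499298490156352, (3,1,2)), (-
   89325129362072652469423651532270458796057607840720, (1,5,4)), (29620149894289008674871090595092926090670702164400, (3,1,4)), (-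
   525390429209202631083909072346357493187063963000, (3,7,2)), (214339416253040103388534474432504930805688089190, (3,5,4)),
   (264920190467461139259806360825320166839996454742, (1,7,4)), (- 60573090800227574251195361995487773325825597400, (5,1,2)),
   (97601804218679188149953395975637650104186239250, (1,9,4)), (- 10207107329654964732975580646043858570375563550, (5,3,4)),
   (115696187551096936126868204583488701029073693134, (3,1,8)), (- 596441414165766896715068880861431696727538119570, (1,5,8)), (-
   48602905854459016717367794562183471514412688269639680, (1,2,4))]"

definition wB2 :: "(int \<times> triple) list" where
  "wB2 =
    [(- 270695883426127313713350056436281687040296656143732329938944000, (0,1,0)), (- 983689580098303802759407344369760960305572710227728793600000,
   (1,0,0)), (- 2198353778914663051851016717312218905519997556499550000, (1,3,0)), (- 3165622709062333398138277874462458049174562190172368032000,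
   (1,1,0)), (185752318494387813465603137022022709451843694219398060441600000, (0,0,1)),
   (48112020659241231584853424879269234143462848388445241344000000, (0,1,1)), (- 3113833781162036102357867059587861155181567920946680954880, (0,2,1)),
   (35745283176484379149220977054368004453716380666615562240000, (0,1,2)), (- 684901580627122696728309282072725029808165965795204005888, (1,0,2)), (-
   97180825144380299481428494843895762178606387512816959488000, (1,0,1)), (- 3643072989251069450156209785436045395231926646516744192, (2,0,1)), (-
   8071214515964882344021775953427172525627800314743619584, (1,0,3)), (27206391643130677469281799430602329475978658651832320, (1,0,4)),
   (484983857188289698367394832439187666616443329390856000, (1,3,2)), (38374982152348821579626051548309507923811565479919616, (1,3,1)),
   (9868950556622792190942809227854197279282166735076896, (1,3,4)), (178887288992702179979285681652455234591458282696128, (1,3,6)), (-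
   869317863740146736180721255631440235958355963840, (1,3,8)), (- 152850393627685854863471459091395322286214347816896000000, (1,1,2)), (-
   278461653877030531518383901949573501992680701717393283481600, (1,1,1)), (8564006704335297703388874234103949590661724052044000, (1,1,4)),
   (868481557248398854943060800353242016337554306782976, (1,5,2)), (2500004616171239334044097861399799523424509134236549120, (1,2,2)), (-
   2437176609166794725987179768129301863430100330951324205056, (1,2,1)), (11784173129792061898071321448085030009482773843148800, (1,4,1)), (-
   1304004848224687694255077500254001612243768937273098240, (2,1,2)), (54690431119266141114788550545590589178636090998784000, (2,3,2)), (-
   12685615114861174486006307987168639791935212656660224, (3,1,2)), (- 105331401789386443649434975500578293426904663578320, (1,5,4)),
   (83170198313579296648050877357891481184517394610480, (3,1,4)), (367032697281988690697240888180170278754201548000, (3,7,2)), (-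
   3751972412857261110009386078922687908894762419560, (3,5,4)), (1836193603267073394607958298534282533600709426840, (1,7,4)),
   (565235555291908268512525485589973293760067112800, (5,1,2)), (13311029425091353386147849355204959109452948600, (1,9,4)),
   (228832583765974777806651489257126684164374727800, (5,3,4)), (134002229648957825313616994865660422082872603184, (3,1,8)), (-
   485622239081082019895330969852364537450027512016, (1,5,8)), (- 51163501524123868844166115856427342277897245954146304, (1,2,4))]"

definition wB3 :: "(int \<times> triple) list" where
  "wB3 =
    [(- 1034874937775747063324347879935729929364555810587019559305216000, (0,1,0)), (1441100410895455819105752613877620209436555606747770163200000,
   (1,0,0)), (4757901257447382651219327601958705562393597058336265625, (1,3,0)), (3026097182553757516817459216220084354338338917195562548000,
   (1,1,0)), (639648784350791740949335967134600678511237781719202240921600000, (0,0,1)),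
   (147540451949139880580339204750230955810436149533271811686400000, (0,1,1)), (- 63891914901522325708037092931521499585184925261573788794880,
   (0,2,1)), (115531331899941390904272819855754557026822016520025382912000, (0,1,2)), (- 983953954537335059615797114125772130763240382222824112128,
   (1,0,2)), (8780817612314205124783108177910666592810505778370183168000, (1,0,1)), (3726688809844843528928146462305921447355452378335674368,
   (2,0,1)), (- 17478537723233731793026785225819556567894069327454797824, (1,0,3)), (67118699385234995058131344162675941009077725279354880, (1,0,4)),
   (837318921745422457524113706745665450228877228168843500, (1,3,2)), (2765515995573047401038864534101095625809768808762572800, (1,3,1)),
   (25329015595600871242538966870869449332101776579511620, (1,3,4)), (522551174071536343477984631871224400222801480513300, (1,3,6)), (-
   2674415325110078111014438592277413398703142429290, (1,3,8)), (- 176640436435436849873937111958658909581519116622788000000, (1,1,2)),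
   (26644292688051917694798074584939258503322781739800906956800, (1,1,1)), (28961384025101488934643213140191203913204869962301000, (1,1,4)), (-
   15509534540227471290866799712266033985449035394009264, (1,5,2)), (- 8787664540094595305267053253185266250414113825946337280, (1,2,2)),
   (3544012373997980853022531544606502372187389908528840835072, (1,2,1)), (274816662663264325642551473957265813647003260079308800, (1,4,1)), (-
   70229168677554261380387846699028146202219052538363904, (2,1,2)), (- 29780899725262713583292761299440373967620344896716800, (2,3,2)),
   (5621505403987556390384683279598972056445882290584432, (3,1,2)), (- 229937685572282663583805564500848400570734540975130, (1,5,4)),
   (44573274486125867071225934263208408712818170914630, (3,1,4)), (- 1082372563511524826294479432620926537692843521750, (3,7,2)),
   (1099932417900077899057953465788595969495763475160, (3,5,4)), (1210277546275800393491340768450463923346801051776, (1,7,4)), (-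
   507314833295612532195175871585927328749769555150, (5,1,2)), (210051719089325885558769197252465033196675686350, (1,9,4)), (-
   48630318578657859060465441725489938235373853850, (5,3,4)), (262780605098370024234046106749424127885939138891, (3,1,8)), (-
   1464174289814909008802264020841676040869226595541, (1,5,8)), (- 136190751029419562091851423106079179067640212461256704, (1,2,4))]"

definition wB4 :: "(int \<times> triple) list" where
  "wB4 =
    [(- 2900573212462723835162287689957011563348944059950293750, (1,3,0)), (4900422220759480373177707143463572492147957376787281488000, (1,1,0)),
   (826529724929898141562262603650548179437226676929034000, (1,3,2)), (2329799119314227038312411164372761002763487428254629888, (1,3,1)),
   (7020388821921851523700252329859306648657516462135488, (1,3,4)), (77350954165394767874358180112996356961565319929904, (1,3,6)), (-
   274178067948896609437504590822043385362109814060, (1,3,8)), (94866721764340880156011480502828489368324342569398400000, (1,1,2)),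
   (312418667338692197969717506816655375679041690809366531276800, (1,1,1)), (19303968302183453904276938333018892407095997075451000, (1,1,4)), (-
   3232153007809067041164511981368640885108763954203968, (1,5,2)), (- 26275669177476803734073634894512279093905002978166702080, (1,2,2)),
   (4508470030904497831935369416771080534991200423324409659392, (1,2,1)), (105150540189326972925572130866479964511685143271833600, (1,4,1)),
   (1414074080200835964839292422674459714301618636369952768, (2,1,2)), (- 73257813647803220065691500891887131959886025641164800, (2,3,2)),
   (20430601306852714166162106497249532818516358342495936, (3,1,2)), (- 55802534985757539452423356764504894176936123232000, (1,5,4)), (-
   44431188378030316588812127909995682200570144232320, (3,1,4)), (- 698600189440054518605787532955249777637609919800, (3,7,2)),
   (5806432784564144907986353262077330272837695364174, (3,5,4)), (412168257430829002074745814741287051167092045502, (1,7,4)), (-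
   1099717667579271792034025947210315560229182274200, (5,1,2)), (24787386644449899931729795545742641753260475750, (1,9,4)), (-
   304243768052390650304393296872826732786761244950, (5,3,4)), (6705345648457668560354529281013054729672144990, (3,1,8)), (-
   157139896364394076506354003231549956561894070654, (1,5,8)), (- 39435514862878433724596086099289545593905984481263616, (1,2,4))]"

text \<open>For the degrees 13 to 16: the lines to be removed (\<open>pl\<close>), additional points (\<open>ql\<close>) as many as the
  dimension of the space of forms, a basis of monomial multiples of the generators (\<open>es\<close>), and
  combinations of coefficients dual to this basis up to scalars (\<open>mu\<close>), which show that it is independent.\<close>

definition pl13 :: "triple list" where
  "pl13 =
    [(1,0,1), (-3,1,1), (2,-2,1), (-1,-1,2), (0,2,1), (-2,2,1), (-1,1,2), (1,-1,2), (-4,0,1), (-1,0,1), (4,0,1), (3,-1,1), (-3,1,0), (1,1,2)]"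

definition pl14 :: "triple list" where
  "pl14 =
    [(0,-2,1), (1,-1,2), (-2,-2,1), (2,-2,1), (-2,2,1), (-1,1,2), (-1,0,1), (3,1,1), (0,2,1), (2,2,1), (1,0,1), (4,0,1), (-4,0,1), (-3,1,0), (-3,-1,1)]"

definition ql14 :: "triple list" where
  "ql14 =
    [(-4,1,2), (-3,-1,1), (3,-2,2)]"

definition pl15 :: "triple list" where
  "pl15 =
    [(3,-1,1), (-3,-1,1), (-1,0,1), (-4,0,1), (1,0,1), (4,0,1), (2,-2,1), (1,-1,2), (-1,1,2), (-2,2,1), (-3,1,0), (-3,1,1), (-1,-1,2), (1,1,2), (-2,-2,1),
   (0,-2,1)]"

definition ql15 :: "triple list" where
  "ql15 =
    [(-2,-3,3), (-3,-4,5), (2,-3,3), (1,2,5), (3,-2,3), (3,-1,3), (1,-4,4), (1,4,4), (-3,-2,3), (-3,-2,2), (-3,-1,1), (3,1,1)]"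

definition pl16 :: "triple list" where
  "pl16 =
    [(1,0,1), (-3,1,1), (2,-2,1), (-1,-1,2), (0,2,1), (-2,2,1), (-1,1,2), (1,-1,2), (-4,0,1), (-1,0,1), (4,0,1), (3,-1,1), (-3,1,0), (1,1,2), (-6,2,5),
   (3,1,1), (6,-2,5)]"

definition ql16 :: "triple list" where
  "ql16 =
    [(-3,-2,3), (-3,-1,3), (-3,1,3), (2,3,3), (1,-2,5), (2,1,5), (-3,-2,2), (-4,-3,2), (3,4,2), (3,-1,1), (-2,4,1), (-4,-1,2), (-3,-2,4), (3,2,2),
   (-3,-4,2), (4,3,2), (3,1,1), (-2,-4,1), (-3,-1,1), (1,-4,4), (1,4,4), (3,-2,3), (3,-1,3), (-1,-4,4), (-2,-3,3), (-3,1,1), (0,-5,2)]"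

definition es14 :: "(nat \<times> nat \<times> nat \<times> nat) list" where
  "es14 =
    [(0,0,0,0), (1,0,0,0), (2,0,0,0)]"

definition mu14 :: "(int \<times> nat \<times> nat \<times> nat) list list" where
  "mu14 =
    [[(1,0,1,13)], [(- 1,1,0,13)], [(1,1,5,8)]]"

definition es15 :: "(nat \<times> nat \<times> nat \<times> nat) list" where
  "es15 =
    [(0,1,0,0), (0,0,1,0), (0,0,0,1), (1,1,0,0), (1,0,1,0), (1,0,0,1), (2,1,0,0), (2,0,1,0), (3,0,0,0), (4,0,0,0), (5,0,0,0), (6,0,0,0)]"

definition mu15 :: "(int \<times> nat \<times> nat \<times> nat) list list" where
  "mu15 =
    [[(1,1,5,9)], [(1,0,2,13)], [(- 5895,12,3,0), (- 220786,14,1,0), (902016,0,9,6), (35515746,2,13,0), (589437,4,11,0)], [(- 1,2,0,13)], [(- 1,3,3,9)],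
   [(12,1,4,10), (- 491,1,0,14)], [(9,12,3,0), (340,14,1,0), (- 5184,2,13,0), (- 405,4,11,0)], [(- 1,1,12,2)], [(- 2601,12,3,0), (134900,14,1,0),
   (5585436,2,13,0), (257985,4,11,0)], [(- 747,12,3,0), (10060,14,1,0), (- 1401948,2,13,0), (- 107325,4,11,0)], [(9,12,3,0), (- 530,14,1,0), (-
   5184,2,13,0), (- 405,4,11,0)], [(1,1,4,10)]]"

definition es16 :: "(nat \<times> nat \<times> nat \<times> nat) list" where
  "es16 =
    [(0,2,0,0), (0,1,1,0), (0,1,0,1), (0,0,2,0), (0,0,1,1), (0,0,0,2), (1,2,0,0), (1,1,1,0), (1,1,0,1), (1,0,2,0), (1,0,1,1), (1,0,0,2), (2,2,0,0),
   (2,1,1,0), (2,0,2,0), (3,1,0,0), (3,0,1,0), (3,0,0,1), (4,1,0,0), (4,0,1,0), (4,0,0,1), (5,1,0,0), (5,0,1,0), (5,0,0,1), (6,1,0,0), (6,0,1,0),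
   (6,0,0,1)]"

definition mu16 :: "(int \<times> nat \<times> nat \<times> nat) list list" where
  "mu16 =
    [[(213479,0,15,1), (125,14,1,1), (1938928,0,1,15), (79696,0,3,13), (18000,2,1,13), (35216,0,11,5), (129848,0,13,3)], [(- 1,3,12,1)], [(- 113,15,1,0),
   (356418,1,15,0), (8766,3,13,0), (11520,1,13,2), (- 297,5,11,0), (- 3,13,3,0), (- 27,7,9,0)], [(1,0,15,1)], [(- 164,0,12,4), (416,0,4,12), (-
   917,0,14,2), (2888,0,2,14)], [(- 16289,0,15,1), (11552,0,1,15), (1664,0,3,13), (- 656,0,11,5), (- 3668,0,13,3)], [(1,15,0,1)], [(322479,0,15,1),
   (125,14,1,1), (- 16272,0,1,15), (- 16704,0,3,13), (12816,0,11,5), (72648,0,13,3)], [(- 576,2,0,14), (1,14,0,2)], [(22,3,12,1), (8,5,10,1),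
   (1,7,8,1)], [(- 799493,15,1,0), (2410180434,1,15,0), (223828326,3,13,0), (17681463,5,11,0), (8397,13,3,0), (- 2211840,3,3,10), (1206873,7,9,0)],
   [(- 256,1,0,15), (22,3,12,1), (3,5,10,1)], [(113,15,1,0), (17982,1,15,0), (2754,3,13,0), (297,5,11,0), (3,13,3,0), (27,7,9,0)], [(57600,2,0,14),
   (125,14,2,0), (12816,0,12,4), (400,14,0,2), (- 16704,0,4,12), (72648,0,14,2), (- 16272,0,2,14)], [(1,1,15,0)], [(221393,15,1,0), (55888542,1,15,0),
   (- 2926206,3,13,0), (- 805383,5,11,0), (- 5517,13,3,0), (- 82053,7,9,0)], [(- 308,0,12,4), (452,0,4,12), (- 1649,0,14,2), (561,0,2,14)], [(-
   27533,0,15,1), (2244,0,1,15), (1808,0,3,13), (- 1232,0,11,5), (- 6596,0,13,3)], [(25591,15,1,0), (1020114,1,15,0), (926478,3,13,0),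
   (142479,5,11,0), (- 1179,13,3,0), (21789,7,9,0)], [(- 452,0,12,4), (488,0,4,12), (- 3131,0,14,2), (1484,0,2,14)], [(- 66077,0,15,1), (5936,0,1,15),
   (1952,0,3,13), (- 1808,0,11,5), (- 12524,0,13,3)], [(- 461,15,1,0), (53946,1,15,0), (8262,3,13,0), (891,5,11,0), (9,13,3,0), (81,7,9,0)],
   [(178,0,12,4), (- 232,0,4,12), (1009,0,14,2), (- 226,0,2,14)], [(35831,0,15,1), (- 1808,0,1,15), (- 1856,0,3,13), (1424,0,11,5), (8072,0,13,3)],
   [(144,2,0,14), (1,14,0,2)], [(2293,15,1,0), (8869014,1,15,0), (1133514,3,13,0), (109917,5,11,0), (63,13,3,0), (7047,7,9,0)], [(22,3,12,1),
   (3,5,10,1)]]"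

definition flips :: "triple \<Rightarrow> triple list" where
  "flips t = [t, flip (-1) 1 t, flip 1 (-1) t, flip (-1) (-1) t]"

definition zall :: "triple list" where
  "zall = concat (map flips zreps)"

text \<open>The 127 intersection points, one vector for each. In \<open>zall\<close> sign changes that
  give proportional vectors are repeated, which makes it symmetric.\<close>

definition zpts :: "triple list" where
  "zpts = concat (map (\<lambda>(a, b, c). [(a, b, c)] @ (if a \<noteq> 0 \<and> (b \<noteq> 0 \<or> c \<noteq> 0) then [(-a, b, c)] else [])
     @ (if b \<noteq> 0 \<and> c \<noteq> 0 then [(a, -b, c)] else []) @ (if a \<noteq> 0 \<and> b \<noteq> 0 \<and> c \<noteq> 0 then [(-a, -b, c)] else [])) zreps)"

definition gdat :: "(nat \<times> nat \<times> nat \<times> int list list) list" where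
  "gdat = [(0, 1, 14, gA1), (1, 0, 14, gA2), (1, 1, 14, gA3), (0, 1, 15, gB1), (0, 1, 15, gB2), (0, 1, 15, gB3), (1, 0, 15, gB4)]"

definition wsum :: "(int \<times> triple) list \<Rightarrow> nat \<Rightarrow> nat \<Rightarrow> nat \<Rightarrow> int" where
  "wsum W i j k = sum_list (map (\<lambda>(w, t). w * imon t i j k) W)"

definition index_pairs :: "nat \<Rightarrow> (nat \<times> nat) list" where
  "index_pairs n = concat (map (\<lambda>i. map (\<lambda>j. (i, j)) [0..<n - i]) [0..<n])"

text \<open>The functional vanishes on the products of the generator with all monomials of degree 19; only
  monomials of one parity class need to be tested.\<close>

definition checkA :: "int list list \<Rightarrow> nat \<Rightarrow> nat \<Rightarrow> bool" where
  "checkA G e1 n = list_all (\<lambda>(i, j). cval G lamT (i + e1) j = 0) (index_pairs n)"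

text \<open>On the products of the generator with the monomials of degree 18 in the relevant parity class, the functional
  agrees with the weighted sum of values at the points.\<close>

definition checkB :: "int list list \<Rightarrow> nat \<Rightarrow> nat \<Rightarrow> (int \<times> triple) list \<Rightarrow> bool" where
  "checkB G e1 n W = list_all (\<lambda>(i, j). cval G lamT (i + e1) j =
     wsum W (2 * i + e1) (2 * j + e1) (18 - (2 * i + e1) - (2 * j + e1))) (index_pairs n)"

fun muval :: "(int \<times> nat \<times> nat \<times> nat) list \<Rightarrow> nat \<times> nat \<times> nat \<times> nat \<Rightarrow> int" where
  "muval ws (k, m1, m2, m3) = (case gdat ! k of (a, b, d, G) \<Rightarrow>
     sum_list (map (\<lambda>(c, i, j, l). c * icof (a + m1) (b + m2) G i j) ws))"

text \<open>The matrix of the functionals \<open>mu\<close> on the forms \<open>es\<close> is diagonal with nonzero diagonal.\<close>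

definition mucheck :: "(nat \<times> nat \<times> nat \<times> nat) list \<Rightarrow> (int \<times> nat \<times> nat \<times> nat) list list \<Rightarrow> nat \<Rightarrow> bool" where
  "mucheck es mu n \<longleftrightarrow> list_all (\<lambda>k. list_all (\<lambda>l. (muval (mu ! k) (es ! l) = 0) = (l \<noteq> k)) [0..<n]) [0..<n]"

definition eok :: "nat \<Rightarrow> nat \<times> nat \<times> nat \<times> nat \<Rightarrow> bool" where
  "eok d e = (case e of (k, m1, m2, m3) \<Rightarrow> k < 7 \<and> (if k < 3 then 14 else 15) + m1 + m2 + m3 = d)"

lemma gdat_ok: "list_all (\<lambda>(a, b, d, G). polok a b d G) gdat" by code_simp
lemma cA1: "checkA gA1 0 10" by code_simp
lemma cA2: "checkA gA2 1 9" by code_simp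
lemma cA3: "checkA gA3 1 10" by code_simp
lemma cB1: "checkB gB1 0 10 wB1" by code_simp
lemma cB2: "checkB gB2 0 10 wB2" by code_simp
lemma cB3: "checkB gB3 0 10 wB3" by code_simp
lemma cB4: "checkB gB4 1 9 wB4" by code_simp
lemma vA1: "list_all (\<lambda>t. ival 0 1 14 gA1 t = 0) zreps" by code_simp
lemma vA2: "list_all (\<lambda>t. ival 1 0 14 gA2 t = 0) zreps" by code_simp
lemma vA3: "list_all (\<lambda>t. ival 1 1 14 gA3 t = 0) zreps" by code_simp
lemma vB1: "list_all (\<lambda>t. ival 0 1 15 gB1 t = 0) zreps" by code_simp
lemma vB2: "list_all (\<lambda>t. ival 0 1 15 gB2 t = 0) zreps" by code_simp
lemma vB3: "list_all (\<lambda>t. ival 0 1 15 gB3 t = 0) zreps" by code_simp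
lemma vB4: "list_all (\<lambda>t. ival 1 0 15 gB4 t = 0) zreps" by code_simp
lemma peel13: "peel 13 pl13 zpts" by code_simp
lemma peel14: "peel 14 pl14 (zpts @ ql14)" by code_simp
lemma peel15: "peel 15 pl15 (zpts @ ql15)" by code_simp
lemma peel16: "peel 16 pl16 (zpts @ ql16)" by code_simp
lemma mu14: "length es14 = 3 \<and> length ql14 = 3 \<and> list_all (eok 14) es14 \<and> mucheck es14 mu14 3" by code_simp
lemma mu15: "length es15 = 12 \<and> length ql15 = 12 \<and> list_all (eok 15) es15 \<and> mucheck es15 mu15 12" by code_simp
lemma mu16: "length es16 = 27 \<and> length ql16 = 27 \<and> list_all (eok 16) es16 \<and> mucheck es16 mu16 27" by code_simp
lemma weights_on_reps: "list_all (\<lambda>W. list_all (\<lambda>(w, t). t \<in> set zreps) W) [wB1, wB2, wB3, wB4]" by code_simp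

lemma zpts_zall: "set zpts \<subseteq> set zall"
proof -
  have "list_all (\<lambda>t. t \<in> set zall) zpts" by code_simp
  thus ?thesis by (simp only: list_all_iff) blast
qed

text \<open>Vanishing at all intersection points.\<close>

definition vanz :: "(nat, complex) mpoly \<Rightarrow> bool" where
  "vanz p \<longleftrightarrow> (\<forall>t\<in>set zall. meval p (cf t) = 0)"

definition gen :: "nat \<Rightarrow> (nat, complex) mpoly" where
  "gen k = (case gdat ! k of (a, b, d, G) \<Rightarrow> polp a b d G)"

definition gdeg :: "nat \<Rightarrow> nat" where "gdeg k = (if k < 3 then 14 else 15)"

lemma less_7_cases: "k < 7 \<Longrightarrow> k = 0 \<or> k = 1 \<or> k = 2 \<or> k = 3 \<or> k = 4 \<or> k = 5 \<or> k = (6::nat)"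
  by linarith

lemma gen_simps:
  "gen 0 = polp 0 1 14 gA1" "gen 1 = polp 1 0 14 gA2" "gen 2 = polp 1 1 14 gA3"
  "gen 3 = polp 0 1 15 gB1" "gen 4 = polp 0 1 15 gB2" "gen 5 = polp 0 1 15 gB3" "gen 6 = polp 1 0 15 gB4"
  by (simp_all add: gen_def gdat_def)

lemma polok_gens:
  "polok 0 1 14 gA1" "polok 1 0 14 gA2" "polok 1 1 14 gA3"
  "polok 0 1 15 gB1" "polok 0 1 15 gB2" "polok 0 1 15 gB3" "polok 1 0 15 gB4"
  using gdat_ok by (simp_all add: gdat_def)

lemma gen_form: "k < 7 \<Longrightarrow> gen k \<in> poly_ring 3 \<and> homogeneous (gdeg k) (gen k)"
  by (drule less_7_cases, elim disjE)
     (simp_all add: gen_simps gen_simps(2)[unfolded One_nat_def] gdeg_def polp_poly_ring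
       polok_gens[THEN homogeneous_polp, unfolded One_nat_def])

lemma vanz_polp:
  assumes "list_all (\<lambda>t. ival a b d G t = 0) zreps"
  shows "vanz (polp a b d G)"
proof -
  have f: "ival a b d G (flip s u t) = 0" if "t \<in> set zreps" "s * s = 1" "u * u = 1" for s u t
    using assms that by (simp add: ival_flip list_all_iff)
  have "ival a b d G t = 0" if "t \<in> set zall" for t
  proof -
    have "\<exists>t'\<in>set zreps. t \<in> set (flips t')" using that unfolding zall_def set_concat by simp
    then obtain t' where t': "t' \<in> set zreps" "t \<in> set (flips t')" by blast
    have "t' = flip 1 1 t'" by (cases t') simp
    thus ?thesis using t' f[of t' 1 1] f[of t' "-1" 1] f[of t' 1 "-1"] f[of t' "-1" "-1"]
      by (auto simp: flips_def)
  qed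
  thus ?thesis by (simp add: vanz_def meval_polp)
qed

lemma vanz_gen: "k < 7 \<Longrightarrow> vanz (gen k)"
  by (drule less_7_cases, elim disjE)
     (simp_all only: gen_simps vanz_polp[OF vA1] vanz_polp[OF vA2] vanz_polp[OF vA3]
       vanz_polp[OF vB1] vanz_polp[OF vB2] vanz_polp[OF vB3] vanz_polp[OF vB4])

lemma vanz_mult: "vanz p \<Longrightarrow> vanz (q * p)"
  by (simp add: vanz_def meval_mult)

section \<open>The functional vanishes on the square of the ideal\<close>

abbreviation Lam33 :: "(nat, complex) mpoly \<Rightarrow> complex" where "Lam33 \<equiv> Lam 33 lamT"

lemma Lam_expand:
  assumes "h \<in> poly_ring 3" "homogeneous e h"
  shows "Lam n L (g * h) = (\<Sum>(a, b)\<in>tdeg e. cof h a b (e - a - b) * Lam n L (g * mon a b (e - a - b)))"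
proof -
  have "Lam n L (g * h) = Lam n L (g * (\<Sum>(a, b)\<in>tdeg e. mconst (cof h a b (e - a - b)) * mon a b (e - a - b)))"
    by (rule arg_cong[OF arg_cong[OF form_expand[OF assms]]])
  thus ?thesis by (simp add: sum_distrib_left Lam_sum mult.left_commute[of g] Lam_scale case_prod_unfold)
qed

lemma mem_index_pairs: "i + j < n \<Longrightarrow> (i, j) \<in> set (index_pairs n)"
  by (auto simp: index_pairs_def image_iff)

lemma parity_index:
  assumes "even (e1 + a)" "odd (e2 + b)" "e1 \<le> 1" "e2 \<le> (1::nat)" "a + b \<le> D" "D + e2 \<le> 2 * n + e1"
  obtains i j where "i + j < n" "a = 2 * i + e1" "b + e2 = 2 * j + 1" "(e1 + a) div 2 = i + e1" "(e2 + b) div 2 = j"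
proof -
  obtain x where x: "e1 + a = 2 * x" using assms(1) by (rule evenE)
  obtain y where y: "e2 + b = 2 * y + 1" using assms(2) by (rule oddE)
  have "x \<ge> e1" using x assms(3) by (cases "e1 = 0") auto
  then obtain i where i: "x = i + e1" by (metis add.commute le_add_diff_inverse)
  have "i + y < n" using x y i assms(3-6) by linarith
  thus ?thesis using that[of i y] x y i by simp
qed

lemma Lam33_A:
  assumes G: "polok e1 e2 14 G" "checkA G e1 n" "e1 \<le> 1" "e2 \<le> 1" "19 + e2 \<le> 2 * n + e1"
    and h: "h \<in> poly_ring 3" "homogeneous 19 h"
  shows "Lam33 (polp e1 e2 14 G * h) = 0"
proof -
  have "Lam33 (polp e1 e2 14 G * mon a b (19 - a - b)) = 0" if ab: "a + b \<le> 19" for a b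
  proof (cases "even (e1 + a) \<and> odd (e2 + b)")
    case True
    obtain i j where "i + j < n" "(e1 + a) div 2 = i + e1" "(e2 + b) div 2 = j"
      by (rule parity_index[of e1 a e2 b 19 n]) (use True G(3-5) ab in auto)
    hence "cval G lamT ((e1 + a) div 2) ((e2 + b) div 2) = 0"
      using G(2) mem_index_pairs[of i j n] by (auto simp: checkA_def list_all_iff)
    thus ?thesis using Lam_polp[OF G(1), of a b "19 - a - b" 33 lamT] ab by simp
  next
    case False
    thus ?thesis using Lam_polp[OF G(1), of a b "19 - a - b" 33 lamT] ab by auto
  qed
  thus ?thesis unfolding Lam_expand[OF h] by (intro sum.neutral) (auto simp: mem_tdeg)
qed

text \<open>The weighted sum runs over one point of each orbit, and only the monomials of one parity class
  count. Averaging over the four sign changes with the appropriate characters projects \<open>h\<close> to this parity class,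
  and all four values of \<open>h\<close> are zero.\<close>

lemma Lam33_B:
  assumes G: "polok e1 e2 15 G" "checkB G e1 n W" "e1 \<le> 1" "e1 + e2 = 1" "18 + e2 \<le> 2 * n + e1"
    and W: "list_all (\<lambda>(w, t). t \<in> set zreps) W"
    and h: "h \<in> poly_ring 3" "homogeneous 18 h" "vanz h"
  shows "Lam33 (polp e1 e2 15 G * h) = 0"
proof -
  let ?P = "\<lambda>a b. even (e1 + a) \<and> even (e1 + b)"
  have e2: "odd (e2 + b) \<longleftrightarrow> even (e1 + b)" for b
  proof -
    have "e1 = 0 \<and> e2 = 1 \<or> e1 = 1 \<and> e2 = 0" using G(3,4) by linarith
    thus ?thesis by auto
  qed
  have val: "Lam33 (polp e1 e2 15 G * mon a b (18 - a - b)) = (if ?P a b then of_int (wsum W a b (18 - a - b)) else 0)"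
    if ab: "a + b \<le> 18" for a b
  proof (cases "even (e1 + a) \<and> odd (e2 + b)")
    case True
    obtain i j where ij: "i + j < n" "a = 2 * i + e1" "b + e2 = 2 * j + 1" "(e1 + a) div 2 = i + e1" "(e2 + b) div 2 = j"
      by (rule parity_index[of e1 a e2 b 18 n]) (use True G(3-5) ab in auto)
    have b: "b = 2 * j + e1" using ij(3) G(4) by linarith
    have "cval G lamT (i + e1) j = wsum W (2 * i + e1) (2 * j + e1) (18 - (2 * i + e1) - (2 * j + e1))"
      using G(2) mem_index_pairs[OF ij(1)] unfolding checkB_def list_all_iff by blast
    hence "cval G lamT ((e1 + a) div 2) ((e2 + b) div 2) = wsum W a b (18 - a - b)"
      by (simp only: ij(4,5)) (simp only: ij(2) b)
    thus ?thesis using Lam_polp[OF G(1), of a b "18 - a - b" 33 lamT] ab True e2[of b] by (simp del: even_add)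
  next
    case False
    thus ?thesis using Lam_polp[OF G(1), of a b "18 - a - b" 33 lamT] ab e2 by auto
  qed
  have zero: "(\<Sum>(a, b)\<in>tdeg 18. cof h a b (18 - a - b) * (if ?P a b then of_int (imon t a b (18 - a - b)) else 0)) = 0" (is "?S = 0")
    if t: "t \<in> set zreps" for t
  proof -
    have ev: "meval h (cf (flip s u t)) = (\<Sum>(a, b)\<in>tdeg 18. cof h a b (18 - a - b) * of_int (s ^ a * u ^ b * imon t a b (18 - a - b)))" for s u
      by (subst form_expand[OF h(1,2)]) (simp add: meval_sum meval_mult meval_mon_cf imon_flip case_prod_unfold)
    have z: "meval h (cf (flip s u t)) = 0" if "s = 1 \<or> s = -1" "u = 1 \<or> u = -1" for s u
    proof -
      have "flip s u t \<in> set (flips t)" using that by (cases t) (auto simp: flips_def)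
      thus ?thesis using h(3) t by (auto simp: vanz_def zall_def)
    qed
    have par: "(if ?P a b then 4 else 0) = 1 + (-1) ^ e1 * (-1) ^ a + (-1) ^ e1 * (-1) ^ b + (-1) ^ a * (-1 :: complex) ^ b" for a b
      using G(3) by (cases "e1 = 0"; cases "even a"; cases "even b") auto
    have "4 * ?S = (\<Sum>(a, b)\<in>tdeg 18. cof h a b (18 - a - b) * ((if ?P a b then 4 else 0) * of_int (imon t a b (18 - a - b))))"
      by (simp add: sum_distrib_left case_prod_unfold) (intro sum.cong refl, auto)
    also have "\<dots> = meval h (cf (flip 1 1 t)) + (-1) ^ e1 * meval h (cf (flip (-1) 1 t))
        + (-1) ^ e1 * meval h (cf (flip 1 (-1) t)) + meval h (cf (flip (-1) (-1) t))"
      unfolding ev par by (simp add: sum_distrib_left sum.distrib[symmetric] case_prod_unfold algebra_simps)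
    also have "\<dots> = 0" by (simp add: z)
    finally show ?thesis by simp
  qed
  have "Lam33 (polp e1 e2 15 G * h) = (\<Sum>(a, b)\<in>tdeg 18. cof h a b (18 - a - b) * (if ?P a b then of_int (wsum W a b (18 - a - b)) else 0))"
    unfolding Lam_expand[OF h(1,2)] by (rule sum.cong[OF refl], clarify, simp only: mem_tdeg val prod.case)
  also have "\<dots> = 0"
    using W
  proof (induction W)
    case Nil
    show ?case by (simp add: wsum_def case_prod_unfold cong: if_cong)
  next
    case (Cons x W)
    obtain w t where x: "x = (w, t)" by (cases x)
    have t: "t \<in> set zreps" using Cons.prems x by simp
    have "(\<Sum>(a, b)\<in>tdeg 18. cof h a b (18 - a - b) * (if ?P a b then of_int (wsum (x # W) a b (18 - a - b)) else 0))
       = (\<Sum>(a, b)\<in>tdeg 18. of_int w * (cof h a b (18 - a - b) * (if ?P a b then of_int (imon t a b (18 - a - b)) else 0))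
           + cof h a b (18 - a - b) * (if ?P a b then of_int (wsum W a b (18 - a - b)) else 0))"
      by (intro sum.cong refl) (auto simp: wsum_def x algebra_simps)
    also have "\<dots> = of_int w * (\<Sum>(a, b)\<in>tdeg 18. cof h a b (18 - a - b) * (if ?P a b then of_int (imon t a b (18 - a - b)) else 0))
         + (\<Sum>(a, b)\<in>tdeg 18. cof h a b (18 - a - b) * (if ?P a b then of_int (wsum W a b (18 - a - b)) else 0))"
      by (simp add: sum.distrib sum_distrib_left case_prod_unfold)
    also have "\<dots> = 0" using zero[OF t] Cons by simp
    finally show ?case .
  qed
  finally show ?thesis .
qed

lemma Lam33_gen:
  assumes k: "k < 7" and h: "h \<in> poly_ring 3" "homogeneous (33 - gdeg k) h" "vanz h"
  shows "Lam33 (gen k * h) = 0"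
proof -
  have W: "list_all (\<lambda>(w, t). t \<in> set zreps) W" if "W \<in> {wB1, wB2, wB3, wB4}" for W
    using weights_on_reps that by auto
  note A = Lam33_A[OF _ _ _ _ _ h(1)] and B = Lam33_B[OF _ _ _ _ _ W h(1) _ h(3)]
  from less_7_cases[OF k] show ?thesis
    using h(2)
  proof (elim disjE)
    assume "k = 0" thus ?thesis using A[OF polok_gens(1) cA1] h(2) by (simp add: gen_simps gdeg_def)
  next
    assume "k = 1" thus ?thesis using A[OF polok_gens(2) cA2] h(2) gen_simps(2) by (simp add: gdeg_def)
  next
    assume "k = 2" thus ?thesis using A[OF polok_gens(3) cA3] h(2) by (simp add: gen_simps gdeg_def)
  next
    assume "k = 3" thus ?thesis using B[OF polok_gens(4) cB1] h(2) by (simp add: gen_simps gdeg_def)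
  next
    assume "k = 4" thus ?thesis using B[OF polok_gens(5) cB2] h(2) by (simp add: gen_simps gdeg_def)
  next
    assume "k = 5" thus ?thesis using B[OF polok_gens(6) cB3] h(2) by (simp add: gen_simps gdeg_def)
  next
    assume "k = 6" thus ?thesis using B[OF polok_gens(7) cB4] h(2) by (simp add: gen_simps gdeg_def)
  qed
qed

text \<open>The basis elements: a monomial times the generator with index \<open>k\<close>.\<close>

definition epol :: "nat \<times> nat \<times> nat \<times> nat \<Rightarrow> (nat, complex) mpoly" where
  "epol e = (case e of (k, m1, m2, m3) \<Rightarrow> mon m1 m2 m3 * gen k)"

lemma Lam33_epol:
  assumes e: "eok d e" "d \<le> 33" and h: "h \<in> poly_ring 3" "homogeneous (33 - d) h" "vanz h"
  shows "Lam33 (epol e * h) = 0"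
proof -
  obtain k m1 m2 m3 where e': "e = (k, m1, m2, m3)" by (cases e)
  have k: "k < 7" and d: "gdeg k + m1 + m2 + m3 = d" using e(1) by (auto simp: eok_def e' gdeg_def)
  have "homogeneous (m1 + m2 + m3 + (33 - d)) (mon m1 m2 m3 * h)"
    by (rule homogeneous_mult[OF homogeneous_mon[OF refl] h(2)])
  moreover have "m1 + m2 + m3 + (33 - d) = 33 - gdeg k" using d e(2) by linarith
  ultimately have "Lam33 (gen k * (mon m1 m2 m3 * h)) = 0"
    using h by (intro Lam33_gen[OF k] poly_ring_rules mon_poly_ring vanz_mult) simp_all
  thus ?thesis by (simp add: epol_def e' mult_ac)
qed

lemma epol_form:
  assumes "eok d e"
  shows "epol e \<in> poly_ring 3" "homogeneous d (epol e)" "vanz (epol e)"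
proof -
  obtain k m1 m2 m3 where e': "e = (k, m1, m2, m3)" by (cases e)
  have k: "k < 7" and d: "gdeg k + m1 + m2 + m3 = d" using assms by (auto simp: eok_def e' gdeg_def)
  show "epol e \<in> poly_ring 3" using gen_form[OF k] by (auto simp: epol_def e' intro: poly_ring_rules mon_poly_ring)
  show "vanz (epol e)" by (simp add: epol_def e' vanz_mult vanz_gen[OF k])
  have "homogeneous (m1 + m2 + m3 + gdeg k) (mon m1 m2 m3 * gen k)"
    by (rule homogeneous_mult[OF homogeneous_mon[OF refl]]) (use gen_form[OF k] in blast)
  thus "homogeneous d (epol e)" using d by (simp add: epol_def e' add.commute add.left_commute)
qed

lemma cof_epol:
  assumes "eok d (k, m1, m2, m3)" "gdat ! k = (a, b, e, G)"
  shows "cof (epol (k, m1, m2, m3)) i j (d - i - j) = of_int (icof (a + m1) (b + m2) G i j)"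
proof -
  have k: "k < 7" using assms(1) by (simp add: eok_def)
  hence "gdat ! k \<in> set gdat" by (intro nth_mem) (simp add: gdat_def)
  hence ok: "polok a b e G" using gdat_ok assms(2) by (auto simp: list_all_iff)
  have "e = gdeg k" using less_7_cases[OF k] assms(2) by (elim disjE) (simp_all add: gdat_def gdeg_def)
  hence d: "e + m1 + m2 + m3 = d" using assms(1) by (simp add: eok_def gdeg_def)
  have "epol (k, m1, m2, m3) = polp (a + m1) (b + m2) d G"
    unfolding epol_def gen_def by (simp add: assms(2) mon_mult_polp[OF ok] d)
  moreover have "polok (a + m1) (b + m2) d G" using polok_shift[OF ok, of m1 m2 m3] d by simp
  ultimately show ?thesis by (simp only: cof_polp)
qed

text \<open>The forms listed in \<open>es\<close> are independent, since \<open>mu\<close> is dual to them up to scalars, and they are as many as the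
  dimension bound allows.\<close>

lemma epol_span:
  assumes es: "length es = n" "length Q = n" "list_all (eok d) es" "mucheck es mu n" and pl: "peel d ls (zpts @ Q)"
    and p: "p \<in> poly_ring 3" "homogeneous d p" "vanz p"
  obtains c where "p = (\<Sum>k<n. mconst (c k) * epol (es ! k))"
proof -
  have e: "eok d (es ! k)" if "k < n" for k using es(1,3) that by (simp add: list_all_length)
  have ind: "\<forall>k<n. c k = 0" if z: "(\<Sum>k<n. mconst (c k) * epol (es ! k)) = 0" for c
  proof (intro allI impI)
    fix k assume k: "k < n"
    have cofz: "(\<Sum>l<n. c l * cof (epol (es ! l)) i j (d - i - j)) = 0" for i j
      using arg_cong[OF z, of "\<lambda>q. cof q i j (d - i - j)"] by (simp add: cof_sum cof_scale cof_zero)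
    have mv: "of_int (muval ws (es ! l)) = sum_list (map (\<lambda>(a, i, j, m). of_int a * cof (epol (es ! l)) i j (d - i - j)) ws)"
      if l: "l < n" for l ws
    proof -
      obtain k' m1 m2 m3 where e': "es ! l = (k', m1, m2, m3)" by (cases "es ! l")
      obtain a b e'' G where g: "gdat ! k' = (a, b, e'', G)" by (cases "gdat ! k'")
      have "eok d (k', m1, m2, m3)" using e[OF l] e' by simp
      note cof_epol[OF this g]
      thus ?thesis unfolding e' by (induction ws) (auto simp: g)
    qed
    have "(\<Sum>l<n. c l * sum_list (map (\<lambda>(a, i, j, m). of_int a * cof (epol (es ! l)) i j (d - i - j)) ws)) = 0" for ws :: "(int \<times> nat \<times> nat \<times> nat) list"
    proof (induction ws)
      case (Cons x ws)
      obtain a i j m where x: "x = (a, i, j, m)" by (cases x)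
      have "(\<Sum>l<n. c l * sum_list (map (\<lambda>(a, i, j, m). of_int a * cof (epol (es ! l)) i j (d - i - j)) (x # ws)))
        = of_int a * (\<Sum>l<n. c l * cof (epol (es ! l)) i j (d - i - j))
          + (\<Sum>l<n. c l * sum_list (map (\<lambda>(a, i, j, m). of_int a * cof (epol (es ! l)) i j (d - i - j)) ws))"
        by (simp add: x sum_distrib_left sum.distrib[symmetric] algebra_simps)
      thus ?case using Cons cofz by simp
    qed simp
    from this[of "mu ! k"] have "(\<Sum>l<n. c l * of_int (muval (mu ! k) (es ! l))) = 0"
      by (simp add: mv)
    moreover have mc: "(muval (mu ! k) (es ! l) = 0) = (l \<noteq> k)" if "l < n" for l
      using es(4) k that by (simp add: mucheck_def list_all_iff)
    have "(\<Sum>l<n. c l * of_int (muval (mu ! k) (es ! l))) = (\<Sum>l<n. if l = k then c k * of_int (muval (mu ! k) (es ! k)) else 0)"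
      by (intro sum.cong refl) (use mc in auto)
    ultimately have "c k * of_int (muval (mu ! k) (es ! k)) = 0" using k by simp
    thus "c k = 0" using mc[OF k] by simp
  qed
  have vz: "meval q (cf t) = 0" if "vanz q" "t \<in> set zpts" for q t
    using that zpts_zall by (auto simp: vanz_def)
  have W: "epol (es ! k) \<in> poly_ring 3 \<and> homogeneous d (epol (es ! k)) \<and> (\<forall>t\<in>set zpts. meval (epol (es ! k)) (cf t) = 0)"
    if "k < length Q" for k
  proof -
    have "eok d (es ! k)" using e that es(2) by simp
    thus ?thesis using epol_form vz by blast
  qed
  obtain c where "p = (\<Sum>k<length Q. mconst (c k) * epol (es ! k))"
    by (rule span_by_dimension[OF pl W _ p(1,2) vz[OF p(3)]]) (use ind es(2) in \<open>blast | simp\<close>)+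
  thus ?thesis using that es(2) by simp
qed

text \<open>After multiplication by a power of \<open>Z\<close> the degree may be assumed to be 13.\<close>

lemma low_degree_zero:
  assumes "p \<in> poly_ring 3" "homogeneous d p" "vanz p" "d \<le> 13"
  shows "p = 0"
proof -
  have "mon 0 0 (13 - d) * p = 0"
  proof (rule peel_zero[OF peel13])
    show "mon 0 0 (13 - d) * p \<in> poly_ring 3" using assms(1) by (intro poly_ring_rules mon_poly_ring)
    show "homogeneous 13 (mon 0 0 (13 - d) * p)"
      using homogeneous_mult[OF homogeneous_mon[OF refl, of 0 0 "13 - d"] assms(2)] assms(4) by simp
    show "meval (mon 0 0 (13 - d) * p) (cf t) = 0" if "t \<in> set zpts" for t
      using assms(3) that zpts_zall by (auto simp: vanz_def meval_mult)
  qed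
  moreover have "mon 0 0 (13 - d) \<noteq> 0" by (simp add: mon_def)
  ultimately show ?thesis by simp
qed

lemma Lam33_forms_le16:
  assumes p: "p \<in> poly_ring 3" "homogeneous d p" "vanz p" "d \<le> 16"
    and h: "h \<in> poly_ring 3" "homogeneous (33 - d) h" "vanz h"
  shows "Lam33 (p * h) = 0"
proof -
  have *: ?thesis if es: "length es = n" "length Q = n" "list_all (eok d) es" "mucheck es mu n" "peel d ls (zpts @ Q)" for es n Q mu ls
  proof -
    obtain c where c: "p = (\<Sum>k<n. mconst (c k) * epol (es ! k))" by (rule epol_span[OF es p(1-3)])
    have "Lam33 (p * h) = (\<Sum>k<n. c k * Lam33 (epol (es ! k) * h))"
      by (simp add: c sum_distrib_right Lam_sum mult.assoc Lam_scale)
    also have "\<dots> = 0"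
      by (intro sum.neutral ballI) (use Lam33_epol[OF _ _ h] es(1,3) p(4) in \<open>auto simp: list_all_length\<close>)
    finally show ?thesis .
  qed
  consider "d \<le> 13" | "d = 14" | "d = 15" | "d = 16" using p(4) by linarith
  thus ?thesis
  proof cases
    case 1
    thus ?thesis using low_degree_zero[OF p(1-3)] by simp
  next
    case 2
    show ?thesis by (rule *[of es14 3 ql14 mu14 pl14]) (use mu14 peel14 2 in simp_all)
  next
    case 3
    show ?thesis by (rule *[of es15 12 ql15 mu15 pl15]) (use mu15 peel15 3 in simp_all)
  next
    case 4
    show ?thesis by (rule *[of es16 27 ql16 mu16 pl16]) (use mu16 peel16 4 in simp_all)
  qed
qed

text \<open>Of two homogeneous components with degrees adding up to 33 one has degree at most 16.\<close>

theorem Lam33_product: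
  assumes p: "p \<in> poly_ring 3" "\<And>d. vanz (hcomp d p)" and q: "q \<in> poly_ring 3" "\<And>d. vanz (hcomp d q)"
  shows "Lam33 (p * q) = 0"
proof -
  have R: "hcomp d p \<in> poly_ring 3" "hcomp d q \<in> poly_ring 3" for d
    using p(1) q(1) by (simp_all add: poly_ring_eq hcomp_polys_in)
  obtain M where M: "p = (\<Sum>i\<le>M. hcomp i p)" by (rule hcomp_expand)
  obtain N where N: "q = (\<Sum>j\<le>N. hcomp j q)" by (rule hcomp_expand)
  have "Lam33 (hcomp i p * hcomp j q) = 0" for i j
  proof (cases "i + j = 33")
    case False
    thus ?thesis by (intro Lam_degree[OF homogeneous_mult[OF homogeneous_hcomp homogeneous_hcomp]])
  next
    case True
    show ?thesis
    proof (cases "i \<le> 16")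
      case le: True
      have "33 - i = j" using True by simp
      thus ?thesis using le p(2) q(2) R by (intro Lam33_forms_le16[where d=i]) auto
    next
      case False
      have "j \<le> 16" "33 - j = i" using True False by simp_all
      hence "Lam33 (hcomp j q * hcomp i p) = 0" using p(2) q(2) R by (intro Lam33_forms_le16[where d=j]) auto
      thus ?thesis by (simp add: mult.commute)
    qed
  qed
  hence "Lam33 ((\<Sum>i\<le>M. hcomp i p) * (\<Sum>j\<le>N. hcomp j q)) = 0"
    by (simp add: sum_distrib_left sum_distrib_right Lam_sum)
  thus ?thesis by (simp add: M[symmetric] N[symmetric])
qed

section \<open>Substitution\<close>

text \<open>The homomorphism of polynomial rings that sends the variable \<open>i\<close> to \<open>\<sigma> i\<close>.\<close>

definition msubst :: "('x \<Rightarrow> ('y, 'a::comm_ring_1) mpoly) \<Rightarrow> ('x, 'a) mpoly \<Rightarrow> ('y, 'a) mpoly" where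
  "msubst \<sigma> p = (\<Sum>m\<in>mkeys p. mconst (lk p m) * (\<Prod>i\<in>mkeys m. \<sigma> i ^ lk m i))"

lemma meval_msubst: "meval (msubst \<sigma> p) v = meval p (\<lambda>i. meval (\<sigma> i) v)"
  by (simp add: msubst_def meval_simps meval_def[of p])

lemma msubst_add: "msubst \<sigma> (p + q) = msubst \<sigma> p + msubst \<sigma> q"
  and msubst_mult: "msubst \<sigma> (p * q) = msubst \<sigma> p * msubst \<sigma> q"
  and msubst_const: "msubst \<sigma> (mconst c) = mconst c"
  and msubst_var: "msubst \<sigma> (mvar i) = \<sigma> i"
  for p :: "('x, 'a::field_char_0) mpoly"
  by (rule mpoly_eqI; simp add: meval_msubst meval_simps)+

lemma msubst_zero [simp]: "msubst \<sigma> 0 = 0"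
  by (simp add: msubst_def)

lemma msubst_poly_ring: "(\<And>i. \<sigma> i \<in> poly_ring n) \<Longrightarrow> msubst \<sigma> p \<in> poly_ring n"
  unfolding msubst_def poly_ring_eq
  by (intro polys_in_sum polys_in_mult polys_in_const polys_in_prod polys_in_power) simp

section \<open>The ideal of a point\<close>

text \<open>The ideal of the point of projective space represented by \<open>w\<close>: all polynomials, homogeneous or not,
  vanishing on the punctured line spanned by \<open>w\<close>. It is prime because a polynomial in one variable \<open>c\<close> with roots at all
  \<open>c \<noteq> 0\<close> is zero.\<close>

definition point_ideal :: "('x \<Rightarrow> 'a::field_char_0) \<Rightarrow> ('x, 'a) mpoly set" where
  "point_ideal w = {p. \<forall>c. c \<noteq> 0 \<longrightarrow> meval p (\<lambda>i. c * w i) = 0}"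

lemma point_ideal_add: "p \<in> point_ideal w \<Longrightarrow> q \<in> point_ideal w \<Longrightarrow> p + q \<in> point_ideal w"
  and point_ideal_mult: "p \<in> point_ideal w \<Longrightarrow> q * p \<in> point_ideal w"
  and point_ideal_mult': "p \<in> point_ideal w \<Longrightarrow> p * q \<in> point_ideal w"
  and point_ideal_zero: "0 \<in> point_ideal w"
  by (simp_all add: point_ideal_def meval_simps)

lemma poly_zero_if_zero_off_0:
  fixes A :: "'a::field_char_0 poly"
  assumes "\<And>c. c \<noteq> 0 \<Longrightarrow> poly A c = 0"
  shows "A = 0"
proof (rule ccontr)
  assume "A \<noteq> 0"
  hence "finite (insert 0 {c. poly A c = 0})" by (simp add: poly_roots_finite)
  moreover have "insert 0 {c. poly A c = 0} = UNIV" using assms by auto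
  ultimately show False using infinite_UNIV_char_0[where 'a='a] by simp
qed

lemma point_ideal_prime:
  assumes "p * q \<in> point_ideal w"
  shows "p \<in> point_ideal w \<or> q \<in> point_ideal w"
proof -
  let ?r = "lrestr (\<lambda>_. 0) w"
  have ev: "poly (?r f) c = meval f (\<lambda>i. c * w i)" for f c by (simp add: poly_lrestr)
  have "?r p * ?r q = 0"
    by (rule poly_zero_if_zero_off_0) (use assms in \<open>simp add: ev point_ideal_def meval_mult\<close>)
  hence "?r p = 0 \<or> ?r q = 0" by simp
  thus ?thesis unfolding point_ideal_def ev[symmetric] by auto
qed

lemma homogeneous_in_point_ideal: "homogeneous d p \<Longrightarrow> meval p w = 0 \<Longrightarrow> p \<in> point_ideal w"
  by (simp add: point_ideal_def homogeneous_eval_scale)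

text \<open>On the line spanned by \<open>w\<close>, the components are the coefficients of a polynomial in the parameter.\<close>

lemma hcomp_vanishes:
  assumes "p \<in> point_ideal w"
  shows "meval (hcomp d p) w = 0"
proof -
  obtain N where N: "p = (\<Sum>i\<le>N. hcomp i p)" by (rule hcomp_expand)
  let ?A = "\<Sum>i\<le>N. Polynomial.monom (meval (hcomp i p) w) i"
  have "?A = 0"
  proof (rule poly_zero_if_zero_off_0)
    fix c :: 'b assume c: "c \<noteq> 0"
    have "poly ?A c = (\<Sum>i\<le>N. meval (hcomp i p) (\<lambda>j. c * w j))"
      by (simp add: poly_sum poly_monom homogeneous_eval_scale[OF homogeneous_hcomp] mult.commute)
    also have "\<dots> = meval p (\<lambda>j. c * w j)" by (subst (2) N) (simp add: meval_sum)
    also have "\<dots> = 0" using assms c by (simp add: point_ideal_def)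
    finally show "poly ?A c = 0" .
  qed
  hence z: "poly.coeff ?A d = 0" by simp
  show ?thesis
  proof (cases "d \<le> N")
    case True
    thus ?thesis using z by (simp add: coeff_sum)
  next
    case False
    have "hcomp d p = (\<Sum>i\<le>N. hcomp d (hcomp i p))" by (subst N) (simp add: hcomp_sum)
    also have "\<dots> = 0" using False by (intro sum.neutral) (auto simp: hcomp_homogeneous[OF homogeneous_hcomp])
    finally show ?thesis by simp
  qed
qed

text \<open>The additive closure of the triple products of elements of \<open>I\<close>; for an ideal \<open>I\<close> this is \<open>I\<^sup>3\<close>.\<close>

inductive_set cube :: "'r::comm_ring_1 set \<Rightarrow> 'r set" for I where
  prod: "p \<in> I \<Longrightarrow> q \<in> I \<Longrightarrow> r \<in> I \<Longrightarrow> p * q * r \<in> cube I"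
| sum: "p \<in> cube I \<Longrightarrow> q \<in> cube I \<Longrightarrow> p + q \<in> cube I"

text \<open>A form singular at the point \<open>P\<close> lies in the square of the ideal of \<open>P\<close>. Here \<open>a\<close> and \<open>b\<close> are the
  linear forms \<open>P\<^sub>2 x\<^sub>i - P\<^sub>i x\<^sub>2\<close>; by Euler's relation the third partial derivative vanishes at \<open>P\<close> as well.\<close>

lemma singular_form:
  fixes P :: "nat \<Rightarrow> complex"
  assumes P: "P 2 \<noteq> 0"
    and p: "p \<in> poly_ring 3" "homogeneous d p" "meval p P = 0" "meval (mpd 0 p) P = 0" "meval (mpd 1 p) P = 0"
  obtains a b u w :: "(nat, complex) mpoly" where "a \<in> point_ideal P" "b \<in> point_ideal P" "u \<in> point_ideal P" "w \<in> point_ideal P" "p = a * u + b * w"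
proof -
  let ?I = "point_ideal P"
  define a :: "(nat, complex) mpoly" where "a = mconst (P 2) * mvar 0 - mconst (P 0) * mvar 2"
  define b :: "(nat, complex) mpoly" where "b = mconst (P 2) * mvar 1 - mconst (P 1) * mvar 2"
  define K where "K = {a * u + b * w | u w. u \<in> ?I \<and> w \<in> ?I}"
  define \<sigma> :: "nat \<Rightarrow> (nat, complex) mpoly" where "\<sigma> i = mconst (P 2) * mvar i" for i
  define \<tau> :: "nat \<Rightarrow> (nat, complex) mpoly" where "\<tau> i = mconst (P i) * mvar 2" for i
  have ab: "a \<in> ?I" "b \<in> ?I" by (simp_all add: a_def b_def point_ideal_def meval_simps)
  have K0: "0 \<in> K" unfolding K_def by (rule CollectI, intro exI[of _ 0]) (simp add: point_ideal_zero)
  have Ka: "a * x + b * y \<in> K" if "x \<in> ?I" "y \<in> ?I" for x y using that unfolding K_def by blast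
  have Kadd: "x + y \<in> K" if xy: "x \<in> K" "y \<in> K" for x y
  proof -
    obtain u w u' w' where "u \<in> ?I" "w \<in> ?I" "u' \<in> ?I" "w' \<in> ?I" "x = a * u + b * w" "y = a * u' + b * w'"
      using xy unfolding K_def by blast
    thus ?thesis using Ka[of "u + u'" "w + w'"] by (simp add: point_ideal_add algebra_simps)
  qed
  have Kmult: "f * x \<in> K" if x: "x \<in> K" for f x
  proof -
    obtain u w where "u \<in> ?I" "w \<in> ?I" "x = a * u + b * w"
      using x unfolding K_def by blast
    thus ?thesis using Ka[of "f * u" "f * w"] by (simp add: point_ideal_mult algebra_simps)
  qed
  define D where "D q = a * msubst \<tau> (mpd 0 q) + b * msubst \<tau> (mpd 1 q)" for q
  have DI: "D q \<in> ?I" for q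
    unfolding D_def by (intro point_ideal_add point_ideal_mult' ab)
  have DK: "D q * D r \<in> K" for q r
  proof -
    have "D q * D r = a * (msubst \<tau> (mpd 0 q) * D r) + b * (msubst \<tau> (mpd 1 q) * D r)"
      by (simp add: D_def algebra_simps)
    thus ?thesis using Ka[OF point_ideal_mult[OF DI] point_ideal_mult[OF DI]] by simp
  qed
  \<comment> \<open>The substitutions \<open>\<sigma>\<close> and \<open>\<tau>\<close> differ by \<open>(a, b, 0)\<close>, so this is Taylor expansion modulo \<open>(a, b) I\<close>.\<close>
  have taylor: "\<exists>e\<in>K. msubst \<sigma> q = msubst \<tau> q + D q + e" if "q \<in> polys_in {..<3}" for q
    using that
  proof (induction q rule: polys_in_induct)
    case (const c)
    show ?case by (rule bexI[OF _ K0]) (simp add: msubst_const D_def)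
  next
    case (var i)
    hence "i = 0 \<or> i = 1 \<or> i = 2" by auto
    moreover have "msubst \<tau> 1 = 1" using msubst_const[of \<tau> 1] by (simp add: mconst_def)
    ultimately show ?case
      by (intro bexI[OF _ K0]) (auto simp: msubst_var D_def \<sigma>_def \<tau>_def a_def b_def)
  next
    case (add q r)
    then obtain e e' where "e \<in> K" "e' \<in> K" "msubst \<sigma> q = msubst \<tau> q + D q + e" "msubst \<sigma> r = msubst \<tau> r + D r + e'" by blast
    thus ?case by (intro bexI[OF _ Kadd[of e e']]) (simp_all add: msubst_add D_def mpd_add algebra_simps)
  next
    case (mult q r)
    then obtain e e' where e: "e \<in> K" "e' \<in> K" "msubst \<sigma> q = msubst \<tau> q + D q + e" "msubst \<sigma> r = msubst \<tau> r + D r + e'" by blast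
    have Dm: "D (q * r) = msubst \<tau> q * D r + msubst \<tau> r * D q"
      by (simp add: D_def mpd_mult msubst_add msubst_mult algebra_simps)
    let ?e = "D q * D r + ((msubst \<tau> r + D r + e') * e + (msubst \<tau> q + D q) * e')"
    have "?e \<in> K" by (intro Kadd Kmult DK e)
    moreover have "msubst \<sigma> (q * r) = msubst \<tau> (q * r) + D (q * r) + ?e"
      unfolding msubst_mult Dm e(3,4) by (simp add: algebra_simps)
    ultimately show ?case by blast
  qed
  then obtain e where e: "e \<in> K" "msubst \<sigma> p = msubst \<tau> p + D p + e" using p(1) by (auto simp: poly_ring_eq)
  have z: "msubst \<tau> f = 0" if "homogeneous k f" "meval f P = 0" for f k
  proof (rule mpoly_eqI)
    fix v
    have "meval (msubst \<tau> f) v = meval f (\<lambda>i. v 2 * P i)" by (simp add: meval_msubst \<tau>_def meval_simps mult.commute)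
    also have "\<dots> = 0" using that by (simp add: homogeneous_eval_scale)
    finally show "meval (msubst \<tau> f) v = meval 0 v" by simp
  qed
  have "msubst \<sigma> p = mconst (P 2 ^ d) * p"
    by (rule mpoly_eqI) (simp add: meval_msubst \<sigma>_def meval_simps homogeneous_eval_scale[OF p(2)])
  moreover have "msubst \<tau> p = 0" "D p = 0"
    using z[OF p(2,3)] z[OF homogeneous_mpd[OF p(2)] p(4)] z[OF homogeneous_mpd[OF p(2)] p(5)] by (simp_all add: D_def)
  ultimately have "mconst (P 2 ^ d) * p = e" using e(2) by simp
  hence "mconst (1 / P 2 ^ d) * e = p"
    by (intro mpoly_eqI) (use P in \<open>auto simp: meval_simps\<close>)
  hence "p \<in> K" using Kmult[OF e(1)] by metis
  thus ?thesis using that ab unfolding K_def by blast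
qed

section \<open>A form of degree 33 in the third symbolic power\<close>

text \<open>The lines of the arrangement that occur in the form of degree 33.\<close>

definition lines21 :: "triple list" where
  "lines21 = [(0,1,0), (3,1,0), (3,-1,0), (1,0,-1), (1,0,1), (0,2,-1), (0,2,1), (4,0,1), (4,0,-1),
    (1,1,2), (1,1,-2), (1,-1,2), (1,-1,-2), (3,1,1), (3,1,-1), (3,-1,1), (3,-1,-1),
    (2,-2,1), (2,-2,-1), (2,2,-1), (2,2,1)]"

definition F33 :: "(nat, complex) mpoly" where
  "F33 = prod_list (map (\<lambda>l. form3 (cf l)) lines21) * polp 0 0 12 gC"

text \<open>The values of the partial derivatives of a form given by a table are computed from the same table,
  by \<open>irow\<close> with shifted exponents for \<open>\<partial>/\<partial>X\<close> and by \<open>irowy\<close> for \<open>\<partial>/\<partial>Y\<close>.\<close>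

fun irowy :: "nat \<Rightarrow> nat \<Rightarrow> nat \<Rightarrow> int list \<Rightarrow> triple \<Rightarrow> int" where
  "irowy a b d [] t = 0"
| "irowy a b d (c # cs) t = c * int b * imon t a (b - 1) (d - a - b) + irowy a (b + 2) d cs t"

fun ivalx :: "nat \<Rightarrow> nat \<Rightarrow> nat \<Rightarrow> int list list \<Rightarrow> triple \<Rightarrow> int" where
  "ivalx a b d [] t = 0"
| "ivalx a b d (r # rs) t = int a * irow (a - 1) b (d - 1) r t + ivalx (a + 2) b d rs t"

fun ivaly :: "nat \<Rightarrow> nat \<Rightarrow> nat \<Rightarrow> int list list \<Rightarrow> triple \<Rightarrow> int" where
  "ivaly a b d [] t = 0"
| "ivaly a b d (r # rs) t = irowy a b d r t + ivaly (a + 2) b d rs t"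

lemma mpd_power: "mpd i (p ^ n) = of_nat n * p ^ (n - 1) * mpd i p"
proof (induction n)
  case 0
  show ?case using mpd_const[of i 1] by (simp add: mconst_def)
next
  case (Suc n)
  thus ?case by (cases n) (simp_all add: mpd_mult algebra_simps)
qed

lemma mpd_mon:
  "mpd 0 (mon i j k) = of_nat i * mon (i - 1) j k" "mpd 1 (mon i j k) = of_nat j * mon i (j - 1) k"
  by (simp_all add: mon_def mpd_mult mpd_power mult_ac)

lemma meval_mpd_rowp:
  "meval (mpd 0 (rowp a b d r)) (cf t) = of_int (int a * irow (a - 1) b (d - 1) r t)"
  "meval (mpd 1 (rowp a b d r)) (cf t) = of_int (irowy a b d r t)"
proof -
  have "meval (mpd 0 (rowp a b d r)) (cf t) = of_int (int a * irow (a - 1) b (d - 1) r t)" if "a > 0"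
    using that by (induction r arbitrary: b)
      (simp_all add: mpd_add mpd_smult mpd_mon meval_add meval_mult meval_of_nat meval_mon_cf algebra_simps)
  moreover have "meval (mpd 0 (rowp 0 b d r)) (cf t) = 0"
    by (induction r arbitrary: b) (simp_all add: mpd_add mpd_smult mpd_mon meval_add meval_mult)
  ultimately show "meval (mpd 0 (rowp a b d r)) (cf t) = of_int (int a * irow (a - 1) b (d - 1) r t)"
    by (cases "a = 0") simp_all
  show "meval (mpd 1 (rowp a b d r)) (cf t) = of_int (irowy a b d r t)"
    by (induction r arbitrary: b)
       (simp_all add: mpd_add mpd_smult mpd_mon[unfolded One_nat_def] meval_add meval_mult meval_of_nat meval_mon_cf)
qed

lemma meval_mpd_polp:
  "meval (mpd 0 (polp a b d G)) (cf t) = of_int (ivalx a b d G t)"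
  "meval (mpd 1 (polp a b d G)) (cf t) = of_int (ivaly a b d G t)"
  by (induction G arbitrary: a) (simp_all add: mpd_add meval_add meval_mpd_rowp meval_mpd_rowp[unfolded One_nat_def])

lemma polok_C: "polok 0 0 12 gC" by code_simp

text \<open>The three ways in which \<open>F33\<close> vanishes to order three at a point. The last coordinate must not be zero
  in the third case, since \<open>singular_form\<close> divides by it.\<close>

lemma multiplicities:
  "list_all (\<lambda>t. let k = length (filter (\<lambda>l. idot l t = 0) lines21) in
     3 \<le> k \<or> ival 0 0 12 gC t = 0 \<and>
       (k = 2 \<or> k = 1 \<and> ivalx 0 0 12 gC t = 0 \<and> ivaly 0 0 12 gC t = 0 \<and> snd (snd t) \<noteq> 0)) zpts"
  by code_simp

lemma form3_in_point_ideal: "idot l t = 0 \<Longrightarrow> form3 (cf l) \<in> point_ideal (cf t)"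
  by (rule homogeneous_in_point_ideal[OF homogeneous_lform]) (simp add: meval_form3 dot3_cf del: meval_lform)

lemma prod_list_filter_split:
  "prod_list (map f L) = prod_list (map f (filter P L)) * prod_list (map f (filter (\<lambda>x. \<not> P x) L))"
  for f :: "'b \<Rightarrow> 'a::comm_monoid_mult"
  by (induction L) (simp_all add: mult_ac)

theorem F33_in_cube:
  assumes "t \<in> set zpts"
  shows "F33 \<in> cube (point_ideal (cf t))"
proof -
  let ?I = "point_ideal (cf t)"
  let ?on = "filter (\<lambda>l. idot l t = 0) lines21"
  let ?C = "polp 0 0 12 gC"
  define \<phi> where "\<phi> l = form3 (cf l)" for l
  define rest where "rest = prod_list (map \<phi> (filter (\<lambda>l. idot l t \<noteq> 0) lines21))"
  have F: "F33 = prod_list (map \<phi> ?on) * rest * ?C"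
    unfolding F33_def rest_def \<phi>_def[symmetric] by (subst prod_list_filter_split[of _ _ "\<lambda>l. idot l t = 0"]) simp
  have on: "\<phi> l \<in> ?I" if "l \<in> set ?on" for l using that form3_in_point_ideal by (simp add: \<phi>_def)
  define k where "k = length ?on"
  have "3 \<le> k \<or> ival 0 0 12 gC t = 0 \<and> (k = 2 \<or> k = 1 \<and> ivalx 0 0 12 gC t = 0 \<and> ivaly 0 0 12 gC t = 0 \<and> snd (snd t) \<noteq> 0)"
    using multiplicities assms unfolding list_all_iff Let_def k_def by blast
  then consider "3 \<le> k" | "ival 0 0 12 gC t = 0" "k = 2"
    | "ival 0 0 12 gC t = 0" "k = 1" "ivalx 0 0 12 gC t = 0" "ivaly 0 0 12 gC t = 0" "snd (snd t) \<noteq> 0" by blast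
  thus ?thesis
  proof cases
    case 1
    then obtain l1 l2 l3 ls where ls: "?on = l1 # l2 # l3 # ls"
      unfolding k_def by (metis Suc_le_length_iff numeral_3_eq_3)
    have "\<phi> l1 \<in> ?I" "\<phi> l2 \<in> ?I" "\<phi> l3 \<in> ?I" by (rule on, simp only: ls, simp)+
    hence "\<phi> l1 * \<phi> l2 * (\<phi> l3 * (prod_list (map \<phi> ls) * rest * ?C)) \<in> cube ?I" by (intro cube.prod point_ideal_mult')
    thus ?thesis unfolding F ls by (simp add: mult_ac)
  next
    case 2
    then obtain l1 l2 where ls: "?on = [l1, l2]"
      unfolding k_def by (metis (no_types, lifting) length_0_conv length_Suc_conv numeral_2_eq_2)
    have "\<phi> l1 \<in> ?I" "\<phi> l2 \<in> ?I" by (rule on, simp only: ls, simp)+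
    moreover have "?C \<in> ?I"
      by (rule homogeneous_in_point_ideal[OF homogeneous_polp[OF polok_C]]) (simp add: meval_polp 2)
    ultimately have "\<phi> l1 * \<phi> l2 * (?C * rest) \<in> cube ?I" by (intro cube.prod point_ideal_mult')
    thus ?thesis unfolding F ls by (simp add: mult_ac)
  next
    case 3
    then obtain l1 where ls: "?on = [l1]"
      unfolding k_def by (metis (no_types, lifting) length_0_conv length_Suc_conv One_nat_def)
    have l: "\<phi> l1 \<in> ?I" by (rule on, simp only: ls, simp)
    have "cf t 2 \<noteq> 0" using 3(5) by (simp add: cf_def case_prod_unfold)
    moreover have "meval ?C (cf t) = 0" "meval (mpd 0 ?C) (cf t) = 0" "meval (mpd 1 ?C) (cf t) = 0"
      unfolding meval_mpd_polp meval_polp using 3 by simp_all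
    ultimately obtain a b u w where C: "a \<in> ?I" "b \<in> ?I" "u \<in> ?I" "w \<in> ?I" "?C = a * u + b * w"
      by (rule singular_form[OF _ polp_poly_ring homogeneous_polp[OF polok_C]])
    have "(\<phi> l1 * rest) * a * u + (\<phi> l1 * rest) * b * w \<in> cube ?I" by (intro cube.intros point_ideal_mult' l C)
    thus ?thesis unfolding F ls C(5) by (simp add: algebra_simps)
  qed
qed

text \<open>The lines other than \<open>Y = 0\<close> are grouped into orbits under sign changes. The product of an orbit is an even form.\<close>

definition q1 :: "int list list" where "q1 = [[0, -1], [9]]"
definition q2 :: "int list list" where "q2 = [[-1, 0], [1]]"
definition q3 :: "int list list" where "q3 = [[-1, 4], [0]]"
definition q4 :: "int list list" where "q4 = [[-1, 0], [16]]"
definition q5 :: "int list list" where "q5 = [[16, -8, 1], [-8, -2], [1]]"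
definition q6 :: "int list list" where "q6 = [[1, -2, 1], [-18, -18], [81]]"
definition q7 :: "int list list" where "q7 = [[1, -8, 16], [-8, -32], [16]]"

lemma meval_form3_cf: "meval (form3 (cf (a, b, c))) v = of_int a * v 0 + of_int b * v 1 + of_int c * v 2"
  by (simp add: meval_form3 dot3_alt cf_def del: meval_lform)

lemma line_products:
  "polp 0 0 2 q1 = form3 (cf (3, 1, 0)) * form3 (cf (3, -1, 0))"
  "polp 0 0 2 q2 = form3 (cf (1, 0, -1)) * form3 (cf (1, 0, 1))"
  "polp 0 0 2 q3 = form3 (cf (0, 2, -1)) * form3 (cf (0, 2, 1))"
  "polp 0 0 2 q4 = form3 (cf (4, 0, 1)) * form3 (cf (4, 0, -1))"
  "polp 0 0 4 q5 = form3 (cf (1, 1, 2)) * form3 (cf (1, 1, -2)) * form3 (cf (1, -1, 2)) * form3 (cf (1, -1, -2))"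
  "polp 0 0 4 q6 = form3 (cf (3, 1, 1)) * form3 (cf (3, 1, -1)) * form3 (cf (3, -1, 1)) * form3 (cf (3, -1, -1))"
  "polp 0 0 4 q7 = form3 (cf (2, -2, 1)) * form3 (cf (2, -2, -1)) * form3 (cf (2, 2, -1)) * form3 (cf (2, 2, 1))"
  by (rule mpoly_eqI, simp add: meval_mult meval_add meval_form3_cf meval_mon q1_def q2_def q3_def q4_def q5_def q6_def q7_def
        algebra_simps power2_eq_square power4_eq_xxxx del: meval_lform)+

lemma F33_eq: "F33 = polp 0 0 2 q1 * (polp 0 0 2 q2 * (polp 0 0 2 q3 * (polp 0 0 2 q4 *
    (polp 0 0 4 q5 * (polp 0 0 4 q6 * (polp 0 0 4 q7 * (polp 0 0 12 gC * mon 0 1 0)))))))"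
proof -
  have "mon 0 1 0 = form3 (cf (0, 1, 0))" by (rule mpoly_eqI) (simp add: meval_mon meval_form3_cf del: meval_lform)
  thus ?thesis unfolding F33_def line_products lines21_def list.map prod_list.Cons prod_list.Nil
    by (simp only: mult_ac mult_1_right mult_1_left)
qed

lemma Lam_F33_value:
  "ent (convtab gC (convtab q7 (convtab q6 (convtab q5 (convtab q4 (convtab q3 (convtab q2 (convtab q1 lamT
     16) 15) 14) 13) 11) 9) 7) 1) 0 0 \<noteq> 0"
  by code_simp

lemma poloks: "polok 0 0 2 q1" "polok 0 0 2 q2" "polok 0 0 2 q3" "polok 0 0 2 q4" "polok 0 0 4 q5" "polok 0 0 4 q6" "polok 0 0 4 q7"
  by code_simp+

text \<open>The even factors are removed from \<open>F33\<close> one at a time, until the monomial \<open>Y\<close> remains.\<close>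

theorem Lam33_F33: "Lam33 F33 \<noteq> 0"
proof -
  note ok = poloks polok_C
  have m: "mon 0 1 0 \<in> poly_ring 3" "homogeneous 1 (mon 0 1 0)" by (simp_all add: mon_poly_ring homogeneous_mon)
  note st = poly_ring_rules(3)[OF polp_poly_ring] homogeneous_mult[OF homogeneous_polp]
  have h8: "polp 0 0 12 gC * mon 0 1 0 \<in> poly_ring 3" (is "?p8 \<in> _") "homogeneous 13 (polp 0 0 12 gC * mon 0 1 0)"
    using st(1)[OF m(1)] st(2)[OF ok(8) m(2)] by simp_all
  have h7: "polp 0 0 4 q7 * ?p8 \<in> poly_ring 3" (is "?p7 \<in> _") "homogeneous 17 (polp 0 0 4 q7 * ?p8)"
    using st(1)[OF h8(1)] st(2)[OF ok(7) h8(2)] by simp_all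
  have h6: "polp 0 0 4 q6 * ?p7 \<in> poly_ring 3" (is "?p6 \<in> _") "homogeneous 21 (polp 0 0 4 q6 * ?p7)"
    using st(1)[OF h7(1)] st(2)[OF ok(6) h7(2)] by simp_all
  have h5: "polp 0 0 4 q5 * ?p6 \<in> poly_ring 3" (is "?p5 \<in> _") "homogeneous 25 (polp 0 0 4 q5 * ?p6)"
    using st(1)[OF h6(1)] st(2)[OF ok(5) h6(2)] by simp_all
  have h4: "polp 0 0 2 q4 * ?p5 \<in> poly_ring 3" (is "?p4 \<in> _") "homogeneous 27 (polp 0 0 2 q4 * ?p5)"
    using st(1)[OF h5(1)] st(2)[OF ok(4) h5(2)] by simp_all
  have h3: "polp 0 0 2 q3 * ?p4 \<in> poly_ring 3" (is "?p3 \<in> _") "homogeneous 29 (polp 0 0 2 q3 * ?p4)"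
    using st(1)[OF h4(1)] st(2)[OF ok(3) h4(2)] by simp_all
  have h2: "polp 0 0 2 q2 * ?p3 \<in> poly_ring 3" "homogeneous 31 (polp 0 0 2 q2 * ?p3)"
    using st(1)[OF h3(1)] st(2)[OF ok(2) h3(2)] by simp_all
  have "Lam33 F33 = Lam 1 (convtab gC (convtab q7 (convtab q6 (convtab q5 (convtab q4 (convtab q3 (convtab q2 (convtab q1 lamT
     16) 15) 14) 13) 11) 9) 7) 1) (mon 0 1 0)"
    unfolding F33_eq
    by (simp only: Lam_factor[OF ok(1) _ _ h2, of 33 16] Lam_factor[OF ok(2) _ _ h3, of 31 15] Lam_factor[OF ok(3) _ _ h4, of 29 14]
      Lam_factor[OF ok(4) _ _ h5, of 27 13] Lam_factor[OF ok(5) _ _ h6, of 25 11] Lam_factor[OF ok(6) _ _ h7, of 21 9]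
      Lam_factor[OF ok(7) _ _ h8, of 17 7] Lam_factor[OF ok(8) _ _ m, of 13 1] arith_simps mult_1_right one_add_one numeral_times_numeral)
  also have "\<dots> \<noteq> 0" using Lam_F33_value by (simp add: Lam_mon)
  finally show ?thesis .
qed

section \<open>The ideal of the singular points\<close>

text \<open>The integer point \<open>t\<close> in the original coordinates \<open>x, y, z\<close>.\<close>

definition ray :: "triple \<Rightarrow> 3 \<Rightarrow> complex" where
  "ray t j = vecof (cf t) $ j"

text \<open>The isomorphism between \<open>\<complex>[X, y, z]\<close> and \<open>\<complex>[x, y, z]\<close>, and its inverse.\<close>

definition to_S :: "(nat, complex) mpoly \<Rightarrow> (3, complex) mpoly" where
  "to_S = msubst (\<lambda>i. if i = 0 then mconst (1 / s3) * mvar 1 else if i = 1 then mvar 2 else mvar 3)"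

definition from_S :: "(3, complex) mpoly \<Rightarrow> (nat, complex) mpoly" where
  "from_S = msubst (\<lambda>j. if j = 1 then mconst s3 * mvar 0 else if j = 2 then mvar 1 else mvar 2)"

lemma from_S_to_S:
  assumes "p \<in> poly_ring 3"
  shows "from_S (to_S p) = p"
proof (rule mpoly_eqI)
  fix v
  have "meval (from_S (to_S p)) v = meval p (\<lambda>i. if i = 0 then v 0 else if i = 1 then v 1 else v 2)"
    unfolding from_S_def to_S_def meval_msubst
    by (rule arg_cong[of _ _ "meval p"]) (auto simp: meval_simps s3_nonzero fun_eq_iff)
  also have "\<dots> = meval p v"
    by (rule meval_cong[of _ "{..<3}"]) (use assms in \<open>auto simp: poly_ring_eq lessThan_three\<close>)
  finally show "meval (from_S (to_S p)) v = meval p v" .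
qed

lemma from_S_mult: "from_S (p * q) = from_S p * from_S q" and from_S_add: "from_S (p + q) = from_S p + from_S q"
  by (simp_all add: from_S_def msubst_mult msubst_add)

lemma from_S_poly_ring: "from_S p \<in> poly_ring 3"
  unfolding from_S_def poly_ring_eq by (rule msubst_poly_ring[unfolded poly_ring_eq]) (auto intro!: polys_in_mult polys_in_var)

lemma meval_from_S: "meval (from_S p) (\<lambda>i. c * cf t i) = meval p (\<lambda>j. c * ray t j)"
  unfolding from_S_def meval_msubst
  by (rule arg_cong[of _ _ "meval p"]) (auto simp: ray_def vecof_def meval_simps fun_eq_iff)

lemma from_S_point_ideal: "from_S p \<in> point_ideal (cf t) \<longleftrightarrow> p \<in> point_ideal (ray t)"
  by (simp add: point_ideal_def meval_from_S)

lemma meval_to_S: "meval (to_S p) (\<lambda>j. c * ray t j) = meval p (\<lambda>i. c * cf t i)"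
  unfolding to_S_def meval_msubst
  by (rule arg_cong[of _ _ "meval p"]) (auto simp: ray_def cf_def meval_simps s3_nonzero fun_eq_iff split: prod.split)

lemma to_S_point_ideal: "to_S p \<in> point_ideal (ray t) \<longleftrightarrow> p \<in> point_ideal (cf t)"
  by (simp add: point_ideal_def meval_to_S)

lemma to_S_mult: "to_S (p * q) = to_S p * to_S q" and to_S_add: "to_S (p + q) = to_S p + to_S q"
  by (simp_all add: to_S_def msubst_mult msubst_add)

text \<open>Any two lines of the list meet in a point of \<open>T\<close>. The points on the first line are selected once.\<close>

fun meet_in :: "triple list \<Rightarrow> triple list \<Rightarrow> bool" where
  "meet_in T [] \<longleftrightarrow> True"
| "meet_in T (l # L) \<longleftrightarrow> meet_in T L \<and> (let on = filter (\<lambda>t. t \<noteq> (0, 0, 0) \<and> idot l t = 0) T in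
     list_all (\<lambda>m. icross l m \<noteq> (0, 0, 0) \<and> list_ex (\<lambda>t. idot m t = 0) on) L)"

lemma meet_inD:
  "meet_in T L \<Longrightarrow> l \<in> set L \<Longrightarrow> m \<in> set L \<Longrightarrow> l \<noteq> m \<Longrightarrow>
     icross l m \<noteq> (0, 0, 0) \<and> (\<exists>t\<in>set T. t \<noteq> (0, 0, 0) \<and> idot l t = 0 \<and> idot m t = 0)"
proof (induction L)
  case (Cons k L)
  have k: "icross k j \<noteq> (0, 0, 0) \<and> (\<exists>t\<in>set T. t \<noteq> (0, 0, 0) \<and> idot k t = 0 \<and> idot j t = 0)" if "j \<in> set L" for j
    using Cons.prems(1) that unfolding meet_in.simps Let_def list_all_iff list_ex_iff set_filter by blast
  consider "l = k" "m \<in> set L" | "m = k" "l \<in> set L" | "l \<in> set L" "m \<in> set L" using Cons.prems by (metis set_ConsD)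
  thus ?case
  proof cases
    case 1
    thus ?thesis using k by blast
  next
    case 2
    thus ?thesis using k icross_commute_nz by blast
  next
    case 3
    thus ?thesis using Cons.IH[OF _ 3 Cons.prems(4)] Cons.prems(1) by (simp only: meet_in.simps) blast
  qed
qed simp

lemma lines31_meet: "meet_in zpts lines31" by code_simp

lemma distinct_lines31: "distinct lines31" by code_simp

lemma zall_double: "list_all (\<lambda>t. t \<noteq> (0, 0, 0) \<and> 2 \<le> length (filter (\<lambda>l. idot l t = 0) lines31)) zall"
  by code_simp

lemma lines_meet:
  assumes "l \<in> set lines31" "m \<in> set lines31" "l \<noteq> m"
  shows "icross l m \<noteq> (0, 0, 0)" "\<exists>t\<in>set zpts. t \<noteq> (0, 0, 0) \<and> idot l t = 0 \<and> idot m t = 0"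
  using meet_inD[OF lines31_meet assms] by blast+

lemma two_lines_through:
  assumes "t \<in> set zall"
  shows "\<exists>l\<in>set lines31. \<exists>m\<in>set lines31. l \<noteq> m \<and> idot l t = 0 \<and> idot m t = 0"
proof -
  let ?F = "filter (\<lambda>l. idot l t = 0) lines31"
  have F: "2 \<le> length ?F" using zall_double assms unfolding list_all_iff by blast
  hence "?F ! 0 \<in> set ?F" "?F ! 1 \<in> set ?F" by (intro nth_mem; linarith)+
  moreover have "0 < length ?F" "1 < length ?F" using F by linarith+
  from nth_eq_iff_index_eq[OF distinct_filter[OF distinct_lines31] this] have "?F ! 0 \<noteq> ?F ! 1" by simp
  ultimately show ?thesis unfolding set_filter by blast
qed

lemma zall_nonzero: "t \<in> set zall \<Longrightarrow> t \<noteq> (0, 0, 0)"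
  using zall_double unfolding list_all_iff by blast

lemma ray_in_plane: "idot l t = 0 \<Longrightarrow> (\<chi> j. c * ray t j) \<in> plane l"
proof -
  assume l: "idot l t = 0"
  have "(\<chi> j. c * ray t j) = c *s vecof (cf t)" by (simp add: vec_eq_iff ray_def)
  thus ?thesis using l by (simp add: plane_def dot3_co_scale dot3_co_vecof dot3_cf)
qed

lemma ray_nonzero:
  assumes "t \<noteq> (0, 0, 0)"
  obtains j where "ray t j \<noteq> 0"
proof -
  obtain a b c where t: "t = (a, b, c)" by (cases t)
  have "ray t 1 = s3 * of_int a" "ray t 2 = of_int b" "ray t 3 = of_int c" by (simp_all add: ray_def t cf_def)
  moreover have "a \<noteq> 0 \<or> b \<noteq> 0 \<or> c \<noteq> 0" using assms t by simp
  ultimately show ?thesis using that[of 1] that[of 2] that[of 3] s3_nonzero by fastforce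
qed

text \<open>Two different planes meet in the line spanned by the cross product of their coefficient vectors.\<close>

lemma common_point_of_planes:
  assumes lm: "icross l m \<noteq> (0, 0, 0)" and t: "t \<noteq> (0, 0, 0)" "idot l t = 0" "idot m t = 0"
    and v: "v \<in> plane l" "v \<in> plane m" "v \<noteq> 0"
  obtains c where "c \<noteq> 0" "\<forall>j. v $ j = c * ray t j"
proof -
  obtain a b c where l: "l = (a, b, c)" by (cases l)
  obtain d e f where m: "m = (d, e, f)" by (cases m)
  define n :: "nat \<Rightarrow> complex" where
    "n i = of_int (if i = 0 then b * f - c * e else if i = 1 then c * d - a * f else a * e - b * d)" for i
  have par: "u i * n j = u j * n i" if "dot3 (cf l) u = 0" "dot3 (cf m) u = 0" "i < 3" "j < 3" for u i j
  proof -
    let ?L = "of_int a * u 0 + of_int b * u 1 + of_int c * u 2" and ?M = "of_int d * u 0 + of_int e * u 1 + of_int f * u 2"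
    have 1: "?L = 0" "?M = 0"
      using that by (simp_all add: dot3_alt l m cf_def)
    have "u 0 * n 1 - u 1 * n 0 = of_int c * ?M - of_int f * ?L" "u 1 * n 2 - u 2 * n 1 = of_int a * ?M - of_int d * ?L"
      "u 2 * n 0 - u 0 * n 2 = of_int b * ?M - of_int e * ?L"
      by (simp_all add: n_def algebra_simps)
    hence "u 0 * n 1 = u 1 * n 0" "u 1 * n 2 = u 2 * n 1" "u 2 * n 0 = u 0 * n 2"
      unfolding 1 by simp_all
    thus ?thesis using that(3,4) by (auto simp: less_Suc_eq numeral_3_eq_3 numeral_2_eq_2)
  qed
  obtain k where k: "k < 3" "n k \<noteq> 0"
  proof -
    have "n 0 \<noteq> 0 \<or> n 1 \<noteq> 0 \<or> n 2 \<noteq> 0" using lm by (auto simp: l m n_def simp del: of_int_diff of_int_mult)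
    thus ?thesis using that[of 0] that[of 1] that[of 2] by fastforce
  qed
  have pt: "cf t i = cf t k / n k * n i" if "i < 3" for i
    using par[of "cf t" i k] that k t(2,3) by (simp add: dot3_cf field_simps)
  have pv: "co v i = co v k / n k * n i" if "i < 3" for i
    using par[of "co v" i k] that k v(1,2) by (simp add: plane_def field_simps)
  have tk: "cf t k \<noteq> 0"
  proof
    assume "cf t k = 0"
    hence "cf t i = 0" if "i < 3" for i using pt[OF that] by simp
    from this[of 0] this[of 1] this[of 2] have "t = (0, 0, 0)" by (cases t) (simp add: cf_def)
    thus False using t(1) by simp
  qed
  have vk: "co v k \<noteq> 0"
  proof
    assume "co v k = 0"
    hence "co v i = 0" if "i < 3" for i using pv[OF that] by simp
    hence "vecof (co v) = vecof (\<lambda>_. 0)" by (intro vecof_cong) simp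
    hence "v = vecof (\<lambda>_. 0)" by simp
    also have "\<dots> = 0" by (simp add: vec_eq_iff vecof_def)
    finally have "v = 0" .
    thus False using v(3) by simp
  qed
  let ?c = "co v k / cf t k"
  have "co v i = ?c * cf t i" if "i < 3" for i
    by (subst pt[OF that], subst pv[OF that]) (use tk in simp)
  hence "vecof (co v) = vecof (\<lambda>i. ?c * cf t i)" by (intro vecof_cong)
  hence v': "v = vecof (\<lambda>i. ?c * cf t i)" by simp
  have "v $ j = ?c * ray t j" for j by (subst v') (simp add: ray_def vecof_def)
  thus ?thesis using that[of ?c] tk vk by simp
qed

abbreviation (input) S_ring :: "(3, complex) mpoly ring" where "S_ring \<equiv> ring_of_type_algebra"

lemma S_ring_simps: "carrier ring_of_type_algebra = UNIV" "x \<otimes>\<^bsub>ring_of_type_algebra\<^esub> y = x * y"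
  "x \<oplus>\<^bsub>ring_of_type_algebra\<^esub> y = x + y" "\<one>\<^bsub>ring_of_type_algebra\<^esub> = 1" "\<zero>\<^bsub>ring_of_type_algebra\<^esub> = 0"
  by (simp_all add: ring_of_type_algebra_def)

lemma ideal_typeI:
  fixes I :: "'r::comm_ring_1 set"
  assumes "0 \<in> I" "\<And>x y. x \<in> I \<Longrightarrow> y \<in> I \<Longrightarrow> x + y \<in> I" "\<And>x y. x \<in> I \<Longrightarrow> y * x \<in> I"
  shows "ideal I ring_of_type_algebra"
proof -
  interpret R: cring "ring_of_type_algebra :: 'r ring" by (rule cring_from_type_algebra)
  have neg: "\<ominus>\<^bsub>ring_of_type_algebra\<^esub> x \<in> I" if "x \<in> I" for x
  proof -
    have "\<ominus>\<^bsub>ring_of_type_algebra\<^esub> x = - x" by (rule R.minus_equality) (simp_all add: S_ring_simps)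
    thus ?thesis using assms(3)[OF that, of "-1"] by simp
  qed
  show ?thesis
  proof (rule idealI)
    show "ring (ring_of_type_algebra :: 'r ring)" by (rule R.ring_axioms)
    show "subgroup I (add_monoid ring_of_type_algebra)"
      by (rule R.add.subgroupI) (use assms neg in \<open>auto simp: S_ring_simps a_inv_def[symmetric]\<close>)
  qed (use assms(3) in \<open>auto simp: S_ring_simps mult.commute\<close>)
qed

definition points_ideal :: "triple list \<Rightarrow> (3, complex) mpoly set" where
  "points_ideal T = (\<Inter>t\<in>set T. point_ideal (ray t))"

text \<open>Every listed point lies on two of the lines.\<close>

lemma J_subset: "J A_31_3 \<subseteq> points_ideal zall"
proof -
  interpret R: cring S_ring by (rule cring_from_type_algebra)
  have I: "ideal (points_ideal zall) S_ring"
    unfolding points_ideal_def by (rule ideal_typeI) (auto simp: point_ideal_zero point_ideal_add point_ideal_mult)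
  show ?thesis
    unfolding J_def
  proof (rule R.genideal_minimal[OF I], clarify)
    fix p :: "(3, complex) mpoly" and d
    assume van: "\<forall>v. v \<noteq> 0 \<and> (\<exists>H\<in>A_31_3. \<exists>K\<in>A_31_3. H \<noteq> K \<and> v \<in> H \<and> v \<in> K) \<longrightarrow> meval p (\<lambda>i. v $ i) = 0"
    have "p \<in> point_ideal (ray t)" if t: "t \<in> set zall" for t
      unfolding point_ideal_def
    proof (intro CollectI allI impI)
      fix c :: complex assume c: "c \<noteq> 0"
      let ?v = "(\<chi> j. c * ray t j) :: complex ^ 3"
      obtain l m where lm: "l \<in> set lines31" "m \<in> set lines31" "idot l t = 0" "idot m t = 0" "icross l m \<noteq> (0, 0, 0)"
        using two_lines_through[OF t] lines_meet(1) by blast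
      obtain j where "ray t j \<noteq> 0" by (rule ray_nonzero[OF zall_nonzero[OF t]])
      hence "?v $ j \<noteq> 0" using c by simp
      hence "?v \<noteq> 0" by (metis zero_index)
      moreover have "plane l \<in> A_31_3" "plane m \<in> A_31_3" using lm by (simp_all add: A_31_3_eq)
      ultimately have "meval p (\<lambda>i. ?v $ i) = 0"
        using van plane_neq[OF lm(5)] ray_in_plane[OF lm(3)] ray_in_plane[OF lm(4)] by blast
      thus "meval p (\<lambda>i. c * ray t i) = 0" by simp
    qed
    thus "p \<in> points_ideal zall" by (simp add: points_ideal_def)
  qed
qed

text \<open>The homogeneous components of a polynomial vanishing at all points vanish there as well, and any
  two of the lines meet in one of the points.\<close>

lemma subset_J: "points_ideal zpts \<subseteq> J A_31_3"
proof
  fix p assume p: "p \<in> points_ideal zpts"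
  interpret R: cring S_ring by (rule cring_from_type_algebra)
  let ?G = "{p. (\<exists>d. homogeneous d p) \<and>
         (\<forall>v. v \<noteq> 0 \<and> (\<exists>H\<in>A_31_3. \<exists>K\<in>A_31_3. H \<noteq> K \<and> v \<in> H \<and> v \<in> K) \<longrightarrow> meval p (\<lambda>i. v $ i) = 0)}"
  have J: "ideal (J A_31_3) S_ring" "?G \<subseteq> J A_31_3"
    unfolding J_def by (rule R.genideal_ideal R.genideal_self, simp add: S_ring_simps)+
  have comp: "hcomp d p \<in> J A_31_3" for d
  proof (rule subsetD[OF J(2)], intro CollectI conjI allI impI exI)
    show "homogeneous d (hcomp d p)" by simp
    fix v :: "complex ^ 3"
    assume "v \<noteq> 0 \<and> (\<exists>H\<in>A_31_3. \<exists>K\<in>A_31_3. H \<noteq> K \<and> v \<in> H \<and> v \<in> K)"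
    then obtain l m where v: "v \<noteq> 0" "l \<in> set lines31" "m \<in> set lines31" "plane l \<noteq> plane m" "v \<in> plane l" "v \<in> plane m"
      unfolding A_31_3_eq by blast
    hence ne: "l \<noteq> m" by blast
    obtain t where t: "t \<in> set zpts" "t \<noteq> (0, 0, 0)" "idot l t = 0" "idot m t = 0" and c: "icross l m \<noteq> (0, 0, 0)"
      using lines_meet[OF v(2,3) ne] by blast
    obtain c where c: "c \<noteq> 0" "\<forall>j. v $ j = c * ray t j"
      by (rule common_point_of_planes[OF c t(2-4) v(5,6,1)])
    have "p \<in> point_ideal (ray t)" using p t(1) by (simp add: points_ideal_def)
    hence "meval (hcomp d p) (ray t) = 0" by (rule hcomp_vanishes)
    thus "meval (hcomp d p) (\<lambda>i. v $ i) = 0" by (simp add: c(2) homogeneous_eval_scale[OF homogeneous_hcomp])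
  qed
  interpret I: ideal "J A_31_3" S_ring by (rule J(1))
  have "sum f T \<in> J A_31_3" if "\<And>x. x \<in> T \<Longrightarrow> f x \<in> J A_31_3" for f :: "nat \<Rightarrow> (3, complex) mpoly" and T
    using that
  proof (induction T rule: infinite_finite_induct)
    case (insert x T)
    thus ?case using I.a_closed[of "f x" "sum f T"] by (simp add: S_ring_simps)
  qed (use I.zero_closed in \<open>simp_all add: S_ring_simps\<close>)
  moreover obtain N where "p = (\<Sum>d\<le>N. hcomp d p)" by (rule hcomp_expand)
  ultimately show "p \<in> J A_31_3" using comp by metis
qed

lemma zpts_subset: "points_ideal zall \<subseteq> points_ideal zpts"
  using zpts_zall by (auto simp: points_ideal_def)

section \<open>Membership in the third symbolic power\<close>

lemma ideal_power_2: "ideal_power R I 2 = ideal_prod R (ideal_prod R (carrier R) I) I"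
  and ideal_power_3: "ideal_power R I 3 = ideal_prod R (ideal_prod R (ideal_prod R (carrier R) I) I) I"
  by (simp_all add: ideal_power_def nat_pow_def ideals_set_def numeral_2_eq_2 numeral_3_eq_3)

text \<open>A product of lines through all the points different from \<open>t0\<close>. The line \<open>t \<times> (t \<times> t0)\<close> passes through
  \<open>t\<close>, and its value at \<open>t0\<close> is \<open>-|t \<times> t0|\<^sup>2\<close>, which is not zero since the coordinates are real.\<close>

definition separator :: "triple \<Rightarrow> (nat, complex) mpoly" where
  "separator t0 = prod_list (map (\<lambda>t. form3 (cf (icross t (icross t t0)))) (filter (\<lambda>t. icross t t0 \<noteq> (0, 0, 0)) zpts))"

lemma separator_vanishes:
  assumes "t \<in> set zpts" "icross t t0 \<noteq> (0, 0, 0)"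
  shows "separator t0 \<in> point_ideal (cf t)"
proof -
  let ?f = "\<lambda>t. form3 (cf (icross t (icross t t0)))"
  have "prod_list (map ?f L) \<in> point_ideal (cf t)" if "t \<in> set L" for L
    using that
  proof (induction L)
    case (Cons s L)
    have "?f t \<in> point_ideal (cf t)"
      by (rule form3_in_point_ideal) (cases t; cases t0; simp add: algebra_simps)
    thus ?case using Cons by (auto intro: point_ideal_mult point_ideal_mult')
  qed simp
  thus ?thesis unfolding separator_def using assms by simp
qed

lemma separator_nonvanishing: "separator t0 \<notin> point_ideal (cf t0)"
proof
  assume "separator t0 \<in> point_ideal (cf t0)"
  hence z: "meval (separator t0) (cf t0) = 0" by (force simp: point_ideal_def dest: spec[of _ 1])
  have ne: "idot (icross t (icross t t0)) t0 \<noteq> 0" if "icross t t0 \<noteq> (0, 0, 0)" for t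
  proof -
    obtain a b c where n: "icross t t0 = (a, b, c)" by (cases "icross t t0")
    obtain x y z where t: "t = (x, y, z)" by (cases t)
    obtain x' y' z' where t0: "t0 = (x', y', z')" by (cases t0)
    have n': "a = y * z' - z * y'" "b = z * x' - x * z'" "c = x * y' - y * x'" using n by (simp_all add: t t0)
    have "idot (icross t (a, b, c)) t0 = - (a\<^sup>2 + b\<^sup>2 + c\<^sup>2)"
      unfolding t t0 icross.simps idot.simps n' by (simp add: power2_eq_square algebra_simps)
    moreover have "a\<^sup>2 + b\<^sup>2 + c\<^sup>2 \<noteq> 0" using that n by (simp add: add_nonneg_eq_0_iff)
    ultimately show ?thesis unfolding n by simp
  qed
  have "meval (prod_list (map (\<lambda>t. form3 (cf (icross t (icross t t0)))) L)) (cf t0) \<noteq> 0"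
    if "\<And>t. t \<in> set L \<Longrightarrow> icross t t0 \<noteq> (0, 0, 0)" for L
    using that
  proof (induction L)
    case (Cons t L)
    have "idot (icross t (icross t t0)) t0 \<noteq> 0" by (rule ne, rule Cons.prems) simp
    moreover have "meval (prod_list (map (\<lambda>t. form3 (cf (icross t (icross t t0)))) L)) (cf t0) \<noteq> 0"
      by (rule Cons.IH, rule Cons.prems) simp
    ultimately show ?case by (simp add: meval_mult meval_form3 dot3_cf del: meval_lform)
  qed simp
  from this[of "filter (\<lambda>t. icross t t0 \<noteq> (0, 0, 0)) zpts"] show False using z unfolding separator_def by simp
qed

lemma proportional_point_ideal:
  assumes "icross t t0 = (0, 0, 0)" "t \<noteq> (0, 0, 0)" "t0 \<noteq> (0, 0, 0)"
  shows "point_ideal (ray t0) \<subseteq> point_ideal (ray t)"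
proof -
  obtain a b c where t: "t = (a, b, c)" by (cases t)
  obtain x y z where t0: "t0 = (x, y, z)" by (cases t0)
  have e: "b * z = c * y" "c * x = a * z" "a * y = b * x" using assms(1) by (simp_all add: t t0)
  have "\<exists>m n. n \<noteq> 0 \<and> m \<noteq> 0 \<and> n * a = m * x \<and> n * b = m * y \<and> n * c = m * z"
  proof -
    consider "x \<noteq> 0" | "x = 0" "y \<noteq> 0" | "x = 0" "y = 0" "z \<noteq> 0" using assms(3) t0 by auto
    thus ?thesis
    proof cases
      case 1
      thus ?thesis using e assms(2) by (intro exI[of _ a] exI[of _ x]) (auto simp: t algebra_simps)
    next
      case 2
      thus ?thesis using e assms(2) by (intro exI[of _ b] exI[of _ y]) (auto simp: t algebra_simps)
    next
      case 3
      thus ?thesis using e assms(2) by (intro exI[of _ c] exI[of _ z]) (auto simp: t algebra_simps)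
    qed
  qed
  then obtain m n where mn: "n \<noteq> 0" "m \<noteq> 0" "n * a = m * x" "n * b = m * y" "n * c = m * z" by blast
  hence "of_int n * of_int a = (of_int m * of_int x :: complex)" "of_int n * of_int b = (of_int m * of_int y :: complex)"
    "of_int n * of_int c = (of_int m * of_int z :: complex)"
    by (simp_all flip: of_int_mult)
  hence "ray t j = of_int m / of_int n * ray t0 j" for j
    using mn(1) by (auto simp: ray_def vecof_def t t0 cf_def field_simps)
  hence r: "(\<lambda>j. k * ray t j) = (\<lambda>j. (k * of_int m / of_int n) * ray t0 j)" for k by (simp add: fun_eq_iff)
  show ?thesis
  proof
    fix p assume p: "p \<in> point_ideal (ray t0)"
    have "meval p (\<lambda>j. k * ray t j) = 0" if "k \<noteq> 0" for k
    proof -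
      have "k * of_int m / of_int n \<noteq> 0" using that mn by simp
      thus ?thesis using p unfolding r point_ideal_def by blast
    qed
    thus "p \<in> point_ideal (ray t)" unfolding point_ideal_def by blast
  qed
qed

text \<open>Let \<open>Q = (J : s)\<close> be an associated prime. Since \<open>s\<close> is not in \<open>J\<close>, it does not vanish at some
  point \<open>t0\<close>, and \<open>Q\<close> is contained in the ideal of \<open>t0\<close>. The separator is outside \<open>Q\<close>, and it multiplies the ideal of
  \<open>t0\<close> into \<open>J\<close>; so this ideal is contained in the localization of \<open>J\<close> at \<open>Q\<close>.\<close>

theorem F33_in_symbolic_power: "to_S F33 \<in> symbolic_power (J A_31_3) 3"
  unfolding symbolic_power_def
proof (intro CollectI ballI)
  fix Q assume "Q \<in> associated_primes (J A_31_3)"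
  then obtain s where Q: "primeideal Q S_ring" "Q = {r. r * s \<in> J A_31_3}" by (auto simp: associated_primes_def)
  interpret P: primeideal Q S_ring by (rule Q(1))
  have one: "1 \<notin> Q" using P.I_notcarr P.one_imp_carrier by (auto simp: S_ring_simps)
  hence "s \<notin> J A_31_3" by (simp add: Q(2))
  then obtain t0 where t0: "t0 \<in> set zpts" "s \<notin> point_ideal (ray t0)"
    using subset_J unfolding points_ideal_def by blast
  have QI: "Q \<subseteq> point_ideal (ray t0)"
  proof
    fix r assume "r \<in> Q"
    hence "r * s \<in> point_ideal (ray t0)" using Q(2) J_subset zpts_subset t0(1) by (fastforce simp: points_ideal_def)
    thus "r \<in> point_ideal (ray t0)" using point_ideal_prime t0(2) by blast
  qed
  have nz: "t \<noteq> (0, 0, 0)" if "t \<in> set zpts" for t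
    using zall_nonzero zpts_zall that by blast
  let ?s = "to_S (separator t0)"
  have s: "?s \<notin> Q"
    using QI separator_nonvanishing[of t0] by (auto simp: to_S_point_ideal)
  let ?L = "localize Q (J A_31_3)" and ?R = "localization_ring Q"
  have loc: "Fract x 1 \<in> ?L" if x: "x \<in> point_ideal (ray t0)" for x
  proof -
    have "x * ?s \<in> point_ideal (ray t)" if t: "t \<in> set zpts" for t
    proof (cases "icross t t0 = (0, 0, 0)")
      case True
      thus ?thesis using proportional_point_ideal[OF True nz[OF t] nz[OF t0(1)]] x by (intro point_ideal_mult') blast
    next
      case False
      thus ?thesis using t by (intro point_ideal_mult) (simp add: to_S_point_ideal separator_vanishes)
    qed
    hence "x * ?s \<in> J A_31_3" using subset_J by (auto simp: points_ideal_def)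
    moreover have "0 \<in> Q" using subset_J point_ideal_zero by (auto simp: Q(2) points_ideal_def)
    hence "?s \<noteq> 0" using s by metis
    hence "Fract x 1 = Fract (x * ?s) ?s" by (simp add: eq_fract)
    ultimately show ?thesis using s unfolding localize_def by blast
  qed
  have R: "a \<otimes>\<^bsub>?R\<^esub> b = a * b" "a \<oplus>\<^bsub>?R\<^esub> b = a + b" "carrier ?R = localize Q UNIV" for a b
    by (simp_all add: localization_ring_def ring_of_type_algebra_def)
  have one_loc: "Fract 1 1 \<in> carrier ?R" using one unfolding R localize_def by blast
  have cube: "Fract (to_S p) 1 \<in> ideal_power ?R ?L 3" if "p \<in> cube (point_ideal (cf t0))" for p
    using that
  proof (induction rule: cube.induct)
    case (prod p q r)
    have "Fract (to_S x) 1 \<in> ?L" if "x \<in> point_ideal (cf t0)" for x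
      using that by (intro loc) (simp add: to_S_point_ideal)
    hence "((Fract 1 1 \<otimes>\<^bsub>?R\<^esub> Fract (to_S p) 1) \<otimes>\<^bsub>?R\<^esub> Fract (to_S q) 1) \<otimes>\<^bsub>?R\<^esub> Fract (to_S r) 1 \<in> ideal_power ?R ?L 3"
      unfolding ideal_power_3 using prod one_loc by (intro ideal_prod.prod)
    thus ?case by (simp add: R to_S_mult)
  next
    case (sum p q)
    have "Fract (to_S p) 1 \<oplus>\<^bsub>?R\<^esub> Fract (to_S q) 1 \<in> ideal_power ?R ?L 3"
      using sum unfolding ideal_power_3 by (intro ideal_prod.sum)
    thus ?case by (simp add: R to_S_add)
  qed
  show "Fract (to_S F33) 1 \<in> ideal_power ?R ?L 3"
    by (rule cube[OF F33_in_cube[OF t0(1)]])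
qed

section \<open>The form is not in the square of the ideal\<close>

lemma prod_list_poly_ring: "(\<And>x. x \<in> set L \<Longrightarrow> f x \<in> poly_ring n) \<Longrightarrow> prod_list (map f L) \<in> poly_ring n"
  for f :: "'b \<Rightarrow> (nat, 'a::field_char_0) mpoly"
  by (induction L) (auto intro: poly_ring_rules)

lemma F33_poly_ring: "F33 \<in> poly_ring 3"
  unfolding F33_def by (intro poly_ring_rules polp_poly_ring prod_list_poly_ring)

text \<open>The functional vanishes on \<open>J\<^sup>2\<close>, which consists of sums of products of two elements of \<open>J\<close>.\<close>

theorem F33_not_in_square: "to_S F33 \<notin> ideal_power ring_of_type_algebra (J A_31_3) 2"
proof
  interpret R: cring S_ring by (rule cring_from_type_algebra)
  interpret I: ideal "J A_31_3" S_ring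
    unfolding J_def by (rule R.genideal_ideal) (simp add: S_ring_simps)
  have one_J: "p \<in> J A_31_3" if "p \<in> ideal_prod S_ring UNIV (J A_31_3)" for p
    using that
  proof (induction rule: ideal_prod.induct)
    case (prod i j)
    thus ?case using I.I_l_closed[of j i] by (simp add: S_ring_simps)
  next
    case (sum p q)
    thus ?case using I.a_closed by blast
  qed
  have van: "vanz (hcomp d (from_S p))" if "p \<in> J A_31_3" for p d
    unfolding vanz_def
  proof
    fix t assume "t \<in> set zall"
    hence "p \<in> point_ideal (ray t)" using J_subset that by (auto simp: points_ideal_def)
    thus "meval (hcomp d (from_S p)) (cf t) = 0" by (intro hcomp_vanishes) (simp add: from_S_point_ideal)
  qed
  have zero: "Lam33 (from_S p) = 0" if "p \<in> ideal_prod S_ring (ideal_prod S_ring UNIV (J A_31_3)) (J A_31_3)" for p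
    using that
  proof (induction rule: ideal_prod.induct)
    case (prod i j)
    hence "i \<in> J A_31_3" "j \<in> J A_31_3" using one_J by simp_all
    thus ?case unfolding S_ring_simps from_S_mult by (intro Lam33_product from_S_poly_ring van)
  next
    case (sum p q)
    thus ?case by (simp add: S_ring_simps from_S_add Lam_add)
  qed
  assume "to_S F33 \<in> ideal_power ring_of_type_algebra (J A_31_3) 2"
  hence "Lam33 (from_S (to_S F33)) = 0" unfolding ideal_power_2 S_ring_simps by (rule zero)
  thus False using Lam33_F33 by (simp add: from_S_to_S F33_poly_ring)
qed

theorem theorem4p3:
  shows "inductively_free UNIV A_31_3 \<and>
    \<not> symbolic_power (J A_31_3) 3 \<subseteq> ideal_power ring_of_type_algebra (J A_31_3) 2"
  using inductively_free_A_31_3 F33_in_symbolic_power F33_not_in_square by blast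

end
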